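(* Let $M>0$ be fixed and let $\theta_1,\dots,\theta_n$ be i.i.d. from $\pi_\star\in\mathcal P([-M,M])$. Let $$X_i=\theta_i+\frac1{J_i}\sum_{j=1}^{J_i}\varepsilon_{ij},$$ where $\mathbb E[\varepsilon_{ij}\mid\theta_i]=0$ and $\varepsilon_{i1},\dots,\varepsilon_{iJ_i}$ are jointly independent conditional on $\theta_i$, with the data for different $i$ independent. Suppose that $\operatorname{Var}[\varepsilon_{ij}\mid\theta_i]=\sigma_i^2J_i$, where $\sigma_1^2,\dots,\sigma_n^2$ are deterministic and there exist $0<k<K<\infty$ such that $k<\min_{1\le i\le n}\sigma_i\le\max_{1\le i\le n}\sigma_i<K$ for all $n\ge1$. Assume further that $\varepsilon_{ij}/\sqrt{J_i}$ conditioned on $\theta_i$ are uniformly sub-Gaussian. Then $$\mathbb E\left(\frac1n\sum_{i=1}^n\mathrm{Hel}^2\left(f_{\hat\pi_n,\sigma_i},f_{\pi_\star,\sigma_i}\right)\right)\lesssim\log^4 n\left(\frac1n+\frac1n\sum_{i=1}^n\frac1{J_i}\right),$$ and $$\left(\mathrm{Regret}_n^+\right)^2\lesssim\log^7 n\left(\frac1n+\frac1n\sum_{i=1}^n\frac1{J_i}\right).$$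
   Context: $\mathcal P([-M,M])$ is the set of probability measures on $[-M,M]$; $\phi(\cdot;\sigma)$ is the density of $N(0,\sigma^2)$; $f_{\pi,\sigma}(x):=\int\phi(x-\theta;\sigma)\,d\pi(\theta)$; $\mathrm{Hel}^2(p,q):=\frac12\int(\sqrt{p(x)}-\sqrt{q(x)})^2dx$; $a^+=\max(a,0)$. $a\lesssim b$ means $a\le Cb$ for a constant $C$ not depending on $n$ or the $J_i$. "Uniformly" means uniformly in $i,j,n$ and $\theta_i$. $\hat\pi_n\in\mathcal P([-M,M])$ is any estimator satisfying, for a fixed $q\ge0$, $$\frac1n\sum_{i=1}^n\log\int\phi(X_i-\theta;\sigma_i)\,d\hat\pi_n(\theta)\ \ge\ \frac1n\sum_{i=1}^n\log\int\phi(X_i-\theta;\sigma_i)\,d\pi_\star(\theta)-\frac{q\log n}{n}.$$ Put $\hat\theta_i:=\int\theta\,\phi(X_i-\theta;\sigma_i)\,d\hat\pi_n(\theta)\big/f_{\hat\pi_n,\sigma_i}(X_i)$ and let $Z_i\mid\theta_i\sim N(\theta_i,\sigma_i^2)$, $\theta_i\sim\pi_\star$, with posterior mean $\mathbb E_{\pi_\star}[\theta_i\mid Z_i]$. Then $$\mathrm{Regret}_n:=\sqrt{\frac1n\sum_{i=1}^n\mathbb E|\theta_i-\hat\theta_i|^2}-\sqrt{\frac1n\sum_{i=1}^n\mathbb E\bigl|\theta_i-\mathbb E_{\pi_\star}[\theta_i\mid Z_i]\bigr|^2}.$$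
   Formalization: The bounds are stated for n ≥ 2: at n = 1 the factors log^4 n and log^7 n vanish, and the Hellinger bound fails, for example for the maximum likelihood estimator (a point mass) when π⋆ is not a point mass. *)

theory Defs
  imports "HOL-Probability.Probability"
begin

section \<open>Gaussian location mixtures\<close>

text \<open>A probability measure on $[-M,M]$ is represented by a Borel probability measure on the real
  line that gives full mass to $[-M,M]$.\<close>

definition prob_measures_on :: "real \<Rightarrow> real measure set" where
  "prob_measures_on M = {\<pi> \<in> space (prob_algebra borel). measure \<pi> {-M..M} = 1}"

definition gauss_mixture :: "real measure \<Rightarrow> real \<Rightarrow> real \<Rightarrow> real" where
  "gauss_mixture \<pi> \<sigma> x = (\<integral>\<theta>. normal_density 0 \<sigma> (x - \<theta>) \<partial>\<pi>)"

definition hellinger_sq :: "(real \<Rightarrow> real) \<Rightarrow> (real \<Rightarrow> real) \<Rightarrow> real" where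
  "hellinger_sq p q = 1 / 2 * (\<integral>x. (sqrt (p x) - sqrt (q x))\<^sup>2 \<partial>lborel)"

definition plug_in_mean :: "real measure \<Rightarrow> real \<Rightarrow> real \<Rightarrow> real" where
  "plug_in_mean \<pi> \<sigma> x =
     (\<integral>\<theta>. \<theta> * normal_density 0 \<sigma> (x - \<theta>) \<partial>\<pi>) / gauss_mixture \<pi> \<sigma> x"

definition avg_loglik ::
    "nat \<Rightarrow> (nat \<Rightarrow> real) \<Rightarrow> (nat \<Rightarrow> real) \<Rightarrow> real measure \<Rightarrow> real" where
  "avg_loglik n \<sigma> x \<pi> = 1 / real n * (\<Sum>i = 1..n. ln (gauss_mixture \<pi> (\<sigma> i) (x i)))"


section \<open>The Gaussian experiment and its Bayes risk\<close>

text \<open>Joint law of $(\theta, Z)$ with $\theta \sim \pi$ and $Z \mid \theta \sim N(\theta,\sigma^2)$.\<close>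

definition gauss_joint :: "real measure \<Rightarrow> real \<Rightarrow> (real \<times> real) measure" where
  "gauss_joint \<pi> \<sigma> =
     density (\<pi> \<Otimes>\<^sub>M lborel) (\<lambda>(\<theta>, z). ennreal (normal_density 0 \<sigma> (z - \<theta>)))"

text \<open>The posterior mean is the conditional expectation of the first coordinate given the
  sigma-algebra generated by the second one.\<close>

definition bayes_risk :: "real measure \<Rightarrow> real \<Rightarrow> real" where
  "bayes_risk \<pi> \<sigma> =
     (let Q = gauss_joint \<pi> \<sigma>
      in \<integral>y. (fst y - real_cond_exp Q (vimage_algebra (space Q) snd borel) fst y)\<^sup>2 \<partial>Q)"


section \<open>Conditional variance and conditional independence\<close>

definition cond_variance :: "'a measure \<Rightarrow> 'a measure \<Rightarrow> ('a \<Rightarrow> real) \<Rightarrow> 'a \<Rightarrow> real" where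
  "cond_variance P F X = real_cond_exp P F (\<lambda>\<omega>. (X \<omega> - real_cond_exp P F X \<omega>)\<^sup>2)"

definition cond_indep_vars ::
    "'a measure \<Rightarrow> 'a measure \<Rightarrow> ('i \<Rightarrow> 'b measure) \<Rightarrow> ('i \<Rightarrow> 'a \<Rightarrow> 'b) \<Rightarrow> 'i set \<Rightarrow> bool" where
  "cond_indep_vars P F N X I \<longleftrightarrow>
     (\<forall>j\<in>I. X j \<in> measurable P (N j)) \<and>
     (\<forall>L A. L \<subseteq> I \<longrightarrow> finite L \<longrightarrow> (\<forall>j\<in>L. A j \<in> sets (N j)) \<longrightarrow>
        (AE \<omega> in P. real_cond_exp P F (indicator {\<omega> \<in> space P. \<forall>j\<in>L. X j \<omega> \<in> A j}) \<omega> =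
           (\<Prod>j\<in>L. real_cond_exp P F (indicator {\<omega> \<in> space P. X j \<omega> \<in> A j}) \<omega>)))"


section \<open>The sampling model\<close>

text \<open>For one sample size $n$; all parameters, including the probability space, may change with
  $n$. The constant $s$ is the uniform sub-Gaussian parameter: almost surely
  $E[\exp(t\,\varepsilon_{ij}/\sqrt{J_i}) \mid \theta_i] \le \exp(s^2t^2/2)$ for every real $t$. This
  conditional expectation is \<^const>\<open>nn_cond_exp\<close>, so that the bound also asserts finiteness;
  \<^const>\<open>real_cond_exp\<close> takes the value 0 where the conditional expectation is infinite.\<close>

locale eb_model = prob_space P
  for P :: "'a measure" +
  fixes M k K s :: real and pi_star :: "real measure" and n :: nat
    and \<sigma> :: "nat \<Rightarrow> real" and J :: "nat \<Rightarrow> nat"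
    and \<theta> :: "nat \<Rightarrow> 'a \<Rightarrow> real" and \<epsilon> :: "nat \<Rightarrow> nat \<Rightarrow> 'a \<Rightarrow> real"
  assumes prior: "pi_star \<in> prob_measures_on M"
    and sigma_bounds: "i \<in> {1..n} \<Longrightarrow> k < \<sigma> i \<and> \<sigma> i < K"
    and J_pos: "i \<in> {1..n} \<Longrightarrow> 1 \<le> J i"
    and theta_measurable: "i \<in> {1..n} \<Longrightarrow> \<theta> i \<in> borel_measurable P"
    and theta_law: "i \<in> {1..n} \<Longrightarrow> distr P borel (\<theta> i) = pi_star"
    and units_independent:
      "indep_vars (\<lambda>i. borel \<Otimes>\<^sub>M (\<Pi>\<^sub>M j\<in>{1..J i}. borel))
         (\<lambda>i \<omega>. (\<theta> i \<omega>, \<lambda>j\<in>{1..J i}. \<epsilon> i j \<omega>)) {1..n}"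
    and noise_measurable:
      "i \<in> {1..n} \<Longrightarrow> j \<in> {1..J i} \<Longrightarrow> \<epsilon> i j \<in> borel_measurable P"
    and noise_square_integrable:
      "i \<in> {1..n} \<Longrightarrow> j \<in> {1..J i} \<Longrightarrow> integrable P (\<lambda>\<omega>. (\<epsilon> i j \<omega>)\<^sup>2)"
    and noise_cond_indep:
      "i \<in> {1..n} \<Longrightarrow>
         cond_indep_vars P (vimage_algebra (space P) (\<theta> i) borel) (\<lambda>_. borel) (\<epsilon> i) {1..J i}"
    and noise_cond_mean:
      "i \<in> {1..n} \<Longrightarrow> j \<in> {1..J i} \<Longrightarrow>
         AE \<omega> in P. real_cond_exp P (vimage_algebra (space P) (\<theta> i) borel) (\<epsilon> i j) \<omega> = 0"
    and noise_cond_variance: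
      "i \<in> {1..n} \<Longrightarrow> j \<in> {1..J i} \<Longrightarrow>
         AE \<omega> in P. cond_variance P (vimage_algebra (space P) (\<theta> i) borel) (\<epsilon> i j) \<omega>
                      = (\<sigma> i)\<^sup>2 * real (J i)"
    and noise_cond_subgaussian:
      "i \<in> {1..n} \<Longrightarrow> j \<in> {1..J i} \<Longrightarrow>
         AE \<omega> in P. nn_cond_exp P (vimage_algebra (space P) (\<theta> i) borel)
                       (\<lambda>\<omega>. ennreal (exp (t * (\<epsilon> i j \<omega> / sqrt (real (J i)))))) \<omega>
                    \<le> ennreal (exp (s\<^sup>2 * t\<^sup>2 / 2))"

definition obs ::
    "(nat \<Rightarrow> nat) \<Rightarrow> (nat \<Rightarrow> 'a \<Rightarrow> real) \<Rightarrow> (nat \<Rightarrow> nat \<Rightarrow> 'a \<Rightarrow> real) \<Rightarrow> nat \<Rightarrow> 'a \<Rightarrow> real" where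
  "obs J \<theta> \<epsilon> i \<omega> = \<theta> i \<omega> + 1 / real (J i) * (\<Sum>j = 1..J i. \<epsilon> i j \<omega>)"

definition sample ::
    "nat \<Rightarrow> (nat \<Rightarrow> nat) \<Rightarrow> (nat \<Rightarrow> 'a \<Rightarrow> real) \<Rightarrow> (nat \<Rightarrow> nat \<Rightarrow> 'a \<Rightarrow> real) \<Rightarrow> 'a \<Rightarrow> nat \<Rightarrow> real" where
  "sample n J \<theta> \<epsilon> \<omega> = (\<lambda>i\<in>{1..n}. obs J \<theta> \<epsilon> i \<omega>)"


section \<open>Approximate maximum likelihood estimators and regret\<close>

text \<open>An estimator of the prior is a measurable function of the data $(X_1,\dots,X_n)$. The
  likelihood inequality is required almost surely.\<close>

definition prior_estimator :: "real \<Rightarrow> nat \<Rightarrow> ((nat \<Rightarrow> real) \<Rightarrow> real measure) \<Rightarrow> bool" where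
  "prior_estimator M n pihat \<longleftrightarrow>
     pihat \<in> measurable (\<Pi>\<^sub>M i\<in>{1..n}. borel) (prob_algebra borel) \<and>
     (\<forall>x \<in> space (\<Pi>\<^sub>M i\<in>{1..n}. (borel :: real measure)). pihat x \<in> prob_measures_on M)"

definition approx_npmle ::
    "'a measure \<Rightarrow> real \<Rightarrow> real measure \<Rightarrow> nat \<Rightarrow> (nat \<Rightarrow> real) \<Rightarrow> ('a \<Rightarrow> nat \<Rightarrow> real) \<Rightarrow>
     ((nat \<Rightarrow> real) \<Rightarrow> real measure) \<Rightarrow> bool" where
  "approx_npmle P q pi_star n \<sigma> X pihat \<longleftrightarrow>
     (AE \<omega> in P. avg_loglik n \<sigma> (X \<omega>) (pihat (X \<omega>)) \<ge>
                   avg_loglik n \<sigma> (X \<omega>) pi_star - q * ln (real n) / real n)"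

definition regret ::
    "'a measure \<Rightarrow> real measure \<Rightarrow> nat \<Rightarrow> (nat \<Rightarrow> real) \<Rightarrow> (nat \<Rightarrow> 'a \<Rightarrow> real) \<Rightarrow>
     ('a \<Rightarrow> nat \<Rightarrow> real) \<Rightarrow> ((nat \<Rightarrow> real) \<Rightarrow> real measure) \<Rightarrow> real" where
  "regret P pi_star n \<sigma> \<theta> X pihat =
     sqrt (1 / real n * (\<Sum>i = 1..n.
        \<integral>\<omega>. \<bar>\<theta> i \<omega> - plug_in_mean (pihat (X \<omega>)) (\<sigma> i) (X \<omega> i)\<bar>\<^sup>2 \<partial>P))
     - sqrt (1 / real n * (\<Sum>i = 1..n. bayes_risk pi_star (\<sigma> i)))"

end

theory Submission
  imports Defs
begin

text \<open>
Write \<open>f\<close> for the mixture density of a prior, \<open>f\<^sub>*\<close> for that of the true prior, \<open>X\<close> for the observation of a unit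
and \<open>Z\<close> for its Gaussian counterpart.

If the noise were Gaussian, the root likelihood ratio \<open>sqrt (f / f\<^sub>*)\<close> of a fixed prior would have mean
\<open>1 - Hel\<^sup>2\<close>, and the product over the units would be exponentially small in the sum of the squared Hellinger
distances. The likelihood inequality says that for the estimated prior the product is at least \<open>n\<close> to the power
\<open>- q / 2\<close>. Replacing the estimate by the nearest element of a finite net of priors, the sum of squared
distances is at most of the order of the log-cardinality of the net. Two points need work.

The noise is not Gaussian. It is replaced by Gaussian noise, one summand at a time (\<open>lindeberg\<close>). Two
conditional moments agree. The third-order terms are collected into a correction of size \<open>1 / sqrt J\<close>
times an average of third derivatives, everything else is of order \<open>1 / J\<close>. Integration by parts against
the Gaussian density (\<open>stein_third\<close>) and the Cauchy-Schwarz inequality give (\<open>edgeworth_bound\<close>)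
  \<open>\<bar>E h(\<theta>, X) - E h(\<theta>, Z)\<bar> \<le> c / sqrt J * sqrt (E h(\<theta>, Z)\<^sup>2) + c / J\<close>.
The norm on the right is what turns \<open>1 / sqrt J\<close> into \<open>1 / J\<close>. It is a multiple of the Hellinger distance for the
root likelihood ratio minus 1, and at most a multiple of the root of the mean for a bounded nonnegative
function. In each case the product with \<open>1 / sqrt J\<close> is absorbed by the main term at the price of \<open>1 / J\<close>
(\<open>root_ratio_expectation\<close>, \<open>post_diff_expectation\<close>, \<open>oracle_risk\<close>).

The net has to be small. On an interval of length of order \<open>ln n\<close>, the mixture density and the posterior mean are
determined up to a relative error \<open>1 / n\<close> by order \<open>ln n\<close> moments of the prior, each known to polynomial
precision (\<open>mixture_net\<close>). The log-cardinality is of order \<open>(ln n)\<^sup>2\<close>. As exponential weights of mean at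
most 1 are compared with their average over the net (\<open>ln_le_ln_card_plus_mean\<close>), the argument runs in
expectation, and \<open>hellinger_risk\<close> follows with the factor \<open>(ln n)\<^sup>2\<close>.

For the regret, the error of the plug-in rule is split at the posterior mean under the true prior. The
difference of two posterior means is controlled by the Hellinger distance with the factor \<open>(ln n) ^ 4\<close>
(\<open>post_diff_hellinger\<close>). To this end the differences of the \<open>j\<close>-th unnormalised posterior moments are given an
energy; integration by parts makes the energies log-convex in \<open>j\<close> up to a factor \<open>ln n\<close>, and a log-convex sequence
without exponential growth cannot start with a steep step. Exponential weights for the differences, once
more over the net, transfer the bound from fixed priors to the estimate (\<open>regret_bound\<close>), with the
factor \<open>(ln n) ^ 6\<close> in the squared regret. Since \<open>ln n\<close> is bounded below, the powers in the theorem dominate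
both factors.
\<close>

section \<open>Notation and elementary bounds\<close>

abbreviation "gpdf \<equiv> normal_density 0"

abbreviation "priors \<equiv> prob_measures_on"

abbreviation "hel_sq \<sigma> \<pi> \<rho> \<equiv> hellinger_sq (gauss_mixture \<pi> \<sigma>) (gauss_mixture \<rho> \<sigma>)"

lemma abs_mult_bound:
  fixes a b :: real
  assumes "\<bar>a\<bar> \<le> w" "\<bar>b\<bar> \<le> c"
  shows "\<bar>a * b\<bar> \<le> w * c"
proof -
  have "0 \<le> w" using assms(1) abs_ge_zero order_trans by blast
  then show ?thesis using assms by (simp add: abs_mult mult_mono)
qed

lemma abs_integral_diff_le:
  fixes f g h :: "'a \<Rightarrow> real"
  assumes "integrable M f" "integrable M g" "integrable M h" "AE x in M. \<bar>f x - g x\<bar> \<le> h x"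
  shows "\<bar>(\<integral>x. f x \<partial>M) - (\<integral>x. g x \<partial>M)\<bar> \<le> (\<integral>x. h x \<partial>M)"
proof -
  have "\<bar>\<integral>x. f x - g x \<partial>M\<bar> \<le> (\<integral>x. \<bar>f x - g x\<bar> \<partial>M)" by (rule integral_abs_bound)
  also have "... \<le> (\<integral>x. h x \<partial>M)" by (rule integral_mono_AE) (use assms in auto)
  finally show ?thesis using assms by simp
qed

section \<open>Gaussian measures and smoothing\<close>

definition gaussm :: "real \<Rightarrow> real measure" where
  "gaussm \<tau> = density lborel (\<lambda>z. ennreal (gpdf \<tau> z))"

lemma sets_gaussm [measurable_cong, simp]: "sets (gaussm \<tau>) = sets borel"
  and space_gaussm [simp]: "space (gaussm \<tau>) = UNIV"
  by (simp_all add: gaussm_def)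

lemma prob_space_gaussm: "0 < \<tau> \<Longrightarrow> prob_space (gaussm \<tau>)"
  unfolding gaussm_def by (rule prob_space_normal_density)

lemma integral_gaussm:
  fixes f :: "real \<Rightarrow> real"
  assumes "f \<in> borel_measurable borel"
  shows "(\<integral>z. f z \<partial>gaussm \<tau>) = (\<integral>z. gpdf \<tau> z * f z \<partial>lborel)"
  unfolding gaussm_def using assms by (subst integral_density) auto

lemma integrable_gaussm_iff:
  fixes f :: "real \<Rightarrow> real"
  assumes "f \<in> borel_measurable borel"
  shows "integrable (gaussm \<tau>) f \<longleftrightarrow> integrable lborel (\<lambda>z. gpdf \<tau> z * f z)"
  unfolding gaussm_def using assms by (subst integrable_density) auto

text \<open>Completing the square: an exponential tilt of a Gaussian density only moves its mean.\<close>

lemma normal_density_exp_shift: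
  assumes "0 < \<tau>"
  shows "gpdf \<tau> z * exp (t * z) = exp (t\<^sup>2 * \<tau>\<^sup>2 / 2) * normal_density (t * \<tau>\<^sup>2) \<tau> z"
proof -
  have "- (z - 0)\<^sup>2 / (2 * \<tau>\<^sup>2) + t * z = t\<^sup>2 * \<tau>\<^sup>2 / 2 + - (z - t * \<tau>\<^sup>2)\<^sup>2 / (2 * \<tau>\<^sup>2)"
    using assms by (simp add: field_simps power2_eq_square)
  then have "exp (- (z - 0)\<^sup>2 / (2 * \<tau>\<^sup>2)) * exp (t * z)
      = exp (t\<^sup>2 * \<tau>\<^sup>2 / 2) * exp (- (z - t * \<tau>\<^sup>2)\<^sup>2 / (2 * \<tau>\<^sup>2))"
    by (metis exp_add)
  then show ?thesis
    unfolding normal_density_def by (simp add: field_simps)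
qed

lemma gaussm_exp:
  assumes "0 < \<tau>"
  shows "integrable (gaussm \<tau>) (\<lambda>z. exp (t * z))"
    and "(\<integral>z. exp (t * z) \<partial>gaussm \<tau>) = exp (t\<^sup>2 * \<tau>\<^sup>2 / 2)"
  using assms
  by (simp_all add: integral_gaussm integrable_gaussm_iff normal_density_exp_shift)

lemma gaussm_exp_abs:
  assumes "0 < \<tau>"
  shows "integrable (gaussm \<tau>) (\<lambda>z. exp (t * \<bar>z\<bar>))"
    and "(\<integral>z. exp (t * \<bar>z\<bar>) \<partial>gaussm \<tau>) \<le> 2 * exp (t\<^sup>2 * \<tau>\<^sup>2 / 2)"
proof -
  have I: "integrable (gaussm \<tau>) (\<lambda>z. exp (t * z) + exp ((-t) * z))"
    using assms by (intro Bochner_Integration.integrable_add gaussm_exp)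
  have le: "exp (t * \<bar>z\<bar>) \<le> exp (t * z) + exp ((-t) * z)" for z
    by (cases "z \<ge> 0") auto
  show J: "integrable (gaussm \<tau>) (\<lambda>z. exp (t * \<bar>z\<bar>))"
    by (rule Bochner_Integration.integrable_bound[OF I]) (use le in \<open>auto simp: abs_of_nonneg add_nonneg_nonneg\<close>)
  have "(\<integral>z. exp (t * \<bar>z\<bar>) \<partial>gaussm \<tau>) \<le> (\<integral>z. exp (t * z) + exp ((-t) * z) \<partial>gaussm \<tau>)"
    by (rule integral_mono[OF J I]) (rule le)
  also have "... = exp (t\<^sup>2 * \<tau>\<^sup>2 / 2) + exp ((-t)\<^sup>2 * \<tau>\<^sup>2 / 2)"
    using assms by (subst Bochner_Integration.integral_add) (auto simp only: gaussm_exp)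
  finally show "(\<integral>z. exp (t * \<bar>z\<bar>) \<partial>gaussm \<tau>) \<le> 2 * exp (t\<^sup>2 * \<tau>\<^sup>2 / 2)" by simp
qed

lemma power_le_fact_exp:
  fixes y :: real
  assumes "0 \<le> y"
  shows "y ^ m \<le> fact m * exp y"
proof -
  have "(\<Sum>n\<in>{m}. y ^ n /\<^sub>R fact n) \<le> (\<Sum>n. y ^ n /\<^sub>R fact n)"
    by (rule sum_le_suminf[OF summable_exp_generic]) (use assms in auto)
  then have "y ^ m / fact m \<le> exp y"
    by (simp add: exp_def divide_inverse mult.commute)
  then show ?thesis
    by (simp add: pos_divide_le_eq mult.commute)
qed

lemma gaussm_integrable_exp_dominated:
  fixes f :: "real \<Rightarrow> real"
  assumes "0 < \<tau>" "f \<in> borel_measurable borel" "\<And>z. \<bar>f z\<bar> \<le> A * exp (c * \<bar>z\<bar>)"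
  shows "integrable (gaussm \<tau>) f"
proof (rule Bochner_Integration.integrable_bound)
  show "integrable (gaussm \<tau>) (\<lambda>z. A * exp (c * \<bar>z\<bar>))"
    using gaussm_exp_abs(1)[OF assms(1)] by simp
  show "AE z in gaussm \<tau>. norm (f z) \<le> norm (A * exp (c * \<bar>z\<bar>))"
    using assms(3) by (auto intro: order_trans[OF _ abs_ge_self])
qed (use assms(2) in simp)

lemma gaussm_moments:
  assumes "0 < \<tau>"
  shows "(\<integral>z. z \<partial>gaussm \<tau>) = 0" "(\<integral>z. z\<^sup>2 \<partial>gaussm \<tau>) = \<tau>\<^sup>2" "(\<integral>z. z ^ 3 \<partial>gaussm \<tau>) = 0"
    "(\<integral>z. z ^ 6 \<partial>gaussm \<tau>) = 15 * \<tau> ^ 6" "(\<integral>z. z ^ 4 \<partial>gaussm \<tau>) = 3 * \<tau> ^ 4"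
proof -
  have p: "\<And>k. (\<integral>z. z ^ k \<partial>gaussm \<tau>) = (\<integral>z. gpdf \<tau> z * (z - 0) ^ k \<partial>lborel)"
    by (subst integral_gaussm) auto
  show "(\<integral>z. z \<partial>gaussm \<tau>) = 0"
    using p[of 1] integral_normal_moment_odd[OF assms, of 0 0] by simp
  show "(\<integral>z. z ^ 3 \<partial>gaussm \<tau>) = 0"
    using p[of 3] integral_normal_moment_odd[OF assms, of 0 1] by (simp add: numeral_eq_Suc)
  show "(\<integral>z. z\<^sup>2 \<partial>gaussm \<tau>) = \<tau>\<^sup>2"
    using p[of 2] integral_normal_moment_even[OF assms, of 0 1] by (simp add: fact_numeral power2_eq_square field_simps)
  have f6: "fact 6 = (720::real)" "fact 4 = (24::real)" "fact 3 = (6::real)" by (simp_all add: fact_numeral)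
  show "(\<integral>z. z ^ 6 \<partial>gaussm \<tau>) = 15 * \<tau> ^ 6"
    using p[of 6] integral_normal_moment_even[OF assms, of 0 3] assms
    by (simp add: f6 field_simps)
  show "(\<integral>z. z ^ 4 \<partial>gaussm \<tau>) = 3 * \<tau> ^ 4"
    using p[of 4] integral_normal_moment_even[OF assms, of 0 2] assms
    by (simp add: f6 field_simps)
qed

text \<open>The factor \<open>\<tau> ^ 4\<close> is the point: \<open>\<tau>\<^sup>2\<close> will be \<open>\<sigma>\<^sup>2 / J\<close>, and a remainder of order \<open>J\<close> to the
  power -2 is needed. It comes from comparing \<open>z / \<tau>\<close>, not \<open>z\<close>, with its exponential.\<close>

lemma gaussm_fourth_exp:
  assumes "0 < \<tau>" "0 \<le> C"
  shows "integrable (gaussm \<tau>) (\<lambda>z. exp (C * \<bar>z\<bar>) * z ^ 4)"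
    and "(\<integral>z. exp (C * \<bar>z\<bar>) * z ^ 4 \<partial>gaussm \<tau>) \<le> 48 * \<tau> ^ 4 * exp ((1 + C * \<tau>)\<^sup>2 / 2)"
proof -
  have le: "exp (C * \<bar>z\<bar>) * z ^ 4 \<le> 24 * \<tau> ^ 4 * exp ((C + 1 / \<tau>) * \<bar>z\<bar>)" for z
  proof -
    have "(\<bar>z\<bar> / \<tau>) ^ 4 \<le> fact 4 * exp (\<bar>z\<bar> / \<tau>)" 
      using assms by (intro power_le_fact_exp) auto
    then have "z ^ 4 \<le> 24 * \<tau> ^ 4 * exp (\<bar>z\<bar> / \<tau>)"
      using assms by (simp add: fact_numeral field_simps power_divide power_even_abs)
    then have "exp (C * \<bar>z\<bar>) * z ^ 4 \<le> exp (C * \<bar>z\<bar>) * (24 * \<tau> ^ 4 * exp (\<bar>z\<bar> / \<tau>))"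
      by (intro mult_left_mono) auto
    also have "... = 24 * \<tau> ^ 4 * exp ((C + 1 / \<tau>) * \<bar>z\<bar>)"
      by (simp add: algebra_simps exp_add)
    finally show ?thesis .
  qed
  have I: "integrable (gaussm \<tau>) (\<lambda>z. 24 * \<tau> ^ 4 * exp ((C + 1 / \<tau>) * \<bar>z\<bar>))"
    using gaussm_exp_abs(1)[OF assms(1)] by simp
  show J: "integrable (gaussm \<tau>) (\<lambda>z. exp (C * \<bar>z\<bar>) * z ^ 4)"
    by (rule gaussm_integrable_exp_dominated[OF assms(1), of _ "24 * \<tau> ^ 4" "C + 1 / \<tau>"]) (use le in auto)
  have "(\<integral>z. exp (C * \<bar>z\<bar>) * z ^ 4 \<partial>gaussm \<tau>) \<le> 24 * \<tau> ^ 4 * (\<integral>z. exp ((C + 1 / \<tau>) * \<bar>z\<bar>) \<partial>gaussm \<tau>)"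
    using integral_mono[OF J I le] by simp
  also have "... \<le> 24 * \<tau> ^ 4 * (2 * exp ((C + 1 / \<tau>)\<^sup>2 * \<tau>\<^sup>2 / 2))"
    using assms by (intro mult_left_mono gaussm_exp_abs(2)) auto
  also have "(C + 1 / \<tau>)\<^sup>2 * \<tau>\<^sup>2 = (1 + C * \<tau>)\<^sup>2"
    using assms by (simp add: field_simps power2_eq_square)
  finally show "(\<integral>z. exp (C * \<bar>z\<bar>) * z ^ 4 \<partial>gaussm \<tau>) \<le> 48 * \<tau> ^ 4 * exp ((1 + C * \<tau>)\<^sup>2 / 2)"
    by simp
qed

text \<open>The heat semigroup at time \<open>\<tau>\<^sup>2\<close>.\<close>

definition smooth :: "real \<Rightarrow> (real \<Rightarrow> real) \<Rightarrow> real \<Rightarrow> real" where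
  "smooth \<tau> u x = (\<integral>z. u (x + z) \<partial>gaussm \<tau>)"

lemma cosh_add_le: "cosh (x + h) \<le> cosh x * exp \<bar>h\<bar>" for x h :: real
proof -
  have "exp x * exp h \<le> exp x * exp \<bar>h\<bar>" "exp (- x) * exp (- h) \<le> exp (- x) * exp \<bar>h\<bar>"
    by (auto intro!: mult_left_mono)
  then have "(exp x * exp h + exp (- x) * exp (- h)) / 2 \<le> (exp x * exp \<bar>h\<bar> + exp (- x) * exp \<bar>h\<bar>) / 2"
    by (intro divide_right_mono add_mono) auto
  moreover have "cosh (x + h) = (exp x * exp h + exp (- x) * exp (- h)) / 2"
    by (simp add: cosh_field_def exp_add[symmetric])
  moreover have "cosh x * exp \<bar>h\<bar> = (exp x * exp \<bar>h\<bar> + exp (- x) * exp \<bar>h\<bar>) / 2"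
    by (simp add: cosh_field_def distrib_right)
  ultimately show ?thesis by (simp only:)
qed

lemma cosh_mult_add_le:
  fixes x h C :: real
  assumes "0 \<le> C"
  shows "cosh (C * (x + h)) \<le> cosh (C * x) * exp (C * \<bar>h\<bar>)"
  using cosh_add_le[of "C * x" "C * h"] assms by (simp add: abs_mult distrib_left)

lemma smooth_integrable:
  assumes "0 < \<tau>" "0 \<le> C" "u \<in> borel_measurable borel" "\<And>x. \<bar>u x\<bar> \<le> B * cosh (C * x)"
  shows "integrable (gaussm \<tau>) (\<lambda>z. u (x + z))"
proof (rule gaussm_integrable_exp_dominated[OF assms(1)])
  have B: "0 \<le> B" using assms(4)[of 0] by simp
  show "\<bar>u (x + z)\<bar> \<le> (B * cosh (C * x)) * exp (C * \<bar>z\<bar>)" for z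
    using order_trans[OF assms(4)[of "x + z"] mult_left_mono[OF cosh_mult_add_le[OF assms(2)] B]]
    by (simp add: mult.assoc)
qed (use assms(3) in measurable)

lemma gaussm_cosh:
  assumes "0 < \<tau>"
  shows "integrable (gaussm \<tau>) (\<lambda>z. cosh (C * (x + z)))"
    and "(\<integral>z. cosh (C * (x + z)) \<partial>gaussm \<tau>) = exp (C\<^sup>2 * \<tau>\<^sup>2 / 2) * cosh (C * x)"
proof -
  have e: "(\<lambda>z. cosh (C * (x + z))) = (\<lambda>z. exp (C * x) / 2 * exp (C * z) + exp (- C * x) / 2 * exp ((- C) * z))"
    by (rule ext) (simp add: cosh_field_def exp_add[symmetric] distrib_left mult_exp_exp add_divide_distrib)
  have i: "integrable (gaussm \<tau>) (\<lambda>z. exp (C * x) / 2 * exp (C * z))"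
    "integrable (gaussm \<tau>) (\<lambda>z. exp (- C * x) / 2 * exp ((- C) * z))"
    using gaussm_exp(1)[OF assms] by (intro integrable_mult_right, blast)+
  show "integrable (gaussm \<tau>) (\<lambda>z. cosh (C * (x + z)))"
    unfolding e using i by (rule Bochner_Integration.integrable_add)
  have "(\<integral>z. cosh (C * (x + z)) \<partial>gaussm \<tau>)
    = exp (C * x) / 2 * exp (C\<^sup>2 * \<tau>\<^sup>2 / 2) + exp (- C * x) / 2 * exp ((- C)\<^sup>2 * \<tau>\<^sup>2 / 2)"
    unfolding e Bochner_Integration.integral_add[OF i] integral_mult_right_zero gaussm_exp(2)[OF assms] ..
  also have "... = exp (C\<^sup>2 * \<tau>\<^sup>2 / 2) * cosh (C * x)"
    by (simp add: cosh_field_def algebra_simps)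
  finally show "(\<integral>z. cosh (C * (x + z)) \<partial>gaussm \<tau>) = exp (C\<^sup>2 * \<tau>\<^sup>2 / 2) * cosh (C * x)" .
qed

lemma smooth_measurable [measurable]:
  assumes [measurable]: "u \<in> borel_measurable borel" and "0 < \<tau>"
  shows "smooth \<tau> u \<in> borel_measurable borel"
proof -
  interpret prob_space "gaussm \<tau>" by (rule prob_space_gaussm) fact
  have "(\<lambda>x. \<integral>z. u (x + z) \<partial>gaussm \<tau>) \<in> borel_measurable borel"
    by measurable
  then show ?thesis by (simp add: smooth_def[abs_def])
qed

lemma smooth_growth:
  assumes "0 < \<tau>" "0 \<le> C" "u \<in> borel_measurable borel" "\<And>x. \<bar>u x\<bar> \<le> B * cosh (C * x)"
  shows "\<bar>smooth \<tau> u x\<bar> \<le> B * exp (C\<^sup>2 * \<tau>\<^sup>2 / 2) * cosh (C * x)"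
proof -
  have "\<bar>smooth \<tau> u x\<bar> \<le> (\<integral>z. \<bar>u (x + z)\<bar> \<partial>gaussm \<tau>)"
    unfolding smooth_def by (rule integral_abs_bound)
  also have "... \<le> (\<integral>z. B * cosh (C * (x + z)) \<partial>gaussm \<tau>)"
    using smooth_integrable[OF assms] gaussm_cosh(1)[OF assms(1), of C x] assms(4)
    by (intro integral_mono) auto
  also have "... = B * exp (C\<^sup>2 * \<tau>\<^sup>2 / 2) * cosh (C * x)"
    using gaussm_cosh(2)[OF assms(1), of C x] by simp
  finally show ?thesis .
qed

lemma gaussm_convolution:
  assumes "0 < \<tau>" "0 < \<rho>"
  shows "gaussm \<tau> \<star> gaussm \<rho> = gaussm (sqrt (\<tau>\<^sup>2 + \<rho>\<^sup>2))"
proof -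
  have f: "finite_measure (gaussm \<tau>)" "finite_measure (gaussm \<rho>)"
    using prob_space_gaussm assms prob_space_def by blast+
  have "gaussm \<tau> \<star> gaussm \<rho> = density lborel (\<lambda>x. \<integral>\<^sup>+y. ennreal (gpdf \<tau> (x - y)) * ennreal (gpdf \<rho> y) \<partial>lborel)"
    unfolding gaussm_def by (rule convolution_density) (use f in \<open>auto simp: gaussm_def\<close>)
  also have "(\<lambda>x. \<integral>\<^sup>+y. ennreal (gpdf \<tau> (x - y)) * ennreal (gpdf \<rho> y) \<partial>lborel)
     = (\<lambda>x. ennreal (gpdf (sqrt (\<tau>\<^sup>2 + \<rho>\<^sup>2)) x))"
    using conv_normal_density_zero_mean[OF assms] by (simp add: ennreal_mult'' fun_eq_iff)
  finally show ?thesis by (simp add: gaussm_def)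
qed

lemma smooth_smooth:
  assumes "0 < \<tau>" "0 < \<rho>" "0 \<le> C" and [measurable]: "u \<in> borel_measurable borel"
    and u: "\<And>x. \<bar>u x\<bar> \<le> B * cosh (C * x)"
  shows "smooth \<tau> (smooth \<rho> u) = smooth (sqrt (\<tau>\<^sup>2 + \<rho>\<^sup>2)) u"
proof
  fix x
  interpret T: prob_space "gaussm \<tau>" by (rule prob_space_gaussm) fact
  interpret R: prob_space "gaussm \<rho>" by (rule prob_space_gaussm) fact
  interpret TR: pair_prob_space "gaussm \<tau>" "gaussm \<rho>" ..
  have pos: "0 < sqrt (\<tau>\<^sup>2 + \<rho>\<^sup>2)" using assms by (simp add: add_pos_pos)
  have "integrable (gaussm \<tau> \<star> gaussm \<rho>) (\<lambda>w. u (x + w))"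
    using smooth_integrable[OF pos assms(3-5), of x] assms by (simp add: gaussm_convolution)
  then have I: "integrable (gaussm \<tau> \<Otimes>\<^sub>M gaussm \<rho>) (\<lambda>p. u (x + (fst p + snd p)))"
    unfolding convolution_def by (subst (asm) integrable_distr_eq) (auto simp: case_prod_beta')
  have "smooth (sqrt (\<tau>\<^sup>2 + \<rho>\<^sup>2)) u x = (\<integral>w. u (x + w) \<partial>(gaussm \<tau> \<star> gaussm \<rho>))"
    using assms by (simp add: smooth_def gaussm_convolution)
  also have "... = (\<integral>p. u (x + (fst p + snd p)) \<partial>(gaussm \<tau> \<Otimes>\<^sub>M gaussm \<rho>))"
    unfolding convolution_def by (subst integral_distr) (auto simp: case_prod_beta')
  also have "... = (\<integral>a. (\<integral>b. u (x + (a + b)) \<partial>gaussm \<rho>) \<partial>gaussm \<tau>)"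
    using TR.integral_fst'[OF I] by simp
  also have "... = smooth \<tau> (smooth \<rho> u) x"
    by (simp add: smooth_def add.assoc)
  finally show "smooth \<tau> (smooth \<rho> u) x = smooth (sqrt (\<tau>\<^sup>2 + \<rho>\<^sup>2)) u x" ..
qed

text \<open>The semigroup law: \<open>J\<close> steps of variance \<open>\<sigma>\<^sup>2 / J\<close> compose to one step of variance \<open>\<sigma>\<^sup>2\<close>.\<close>

lemma smooth_funpow:
  assumes "0 < \<tau>" "0 \<le> C" and [measurable]: "u \<in> borel_measurable borel"
    and u: "\<And>x. \<bar>u x\<bar> \<le> B * cosh (C * x)"
  shows "(smooth \<tau> ^^ Suc m) u = smooth (\<tau> * sqrt (real (Suc m))) u"
proof (induction m)
  case (Suc m)
  have "(smooth \<tau> ^^ Suc (Suc m)) u = smooth \<tau> (smooth (\<tau> * sqrt (real (Suc m))) u)"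
    using Suc by simp
  also have "... = smooth (sqrt (\<tau>\<^sup>2 + (\<tau> * sqrt (real (Suc m)))\<^sup>2)) u"
    by (rule smooth_smooth[OF assms(1) _ assms(2-4)]) (use assms in auto)
  also have "sqrt (\<tau>\<^sup>2 + (\<tau> * sqrt (real (Suc m)))\<^sup>2) = \<tau> * sqrt (real (Suc (Suc m)))"
  proof -
    have "\<tau>\<^sup>2 + (\<tau> * sqrt (real (Suc m)))\<^sup>2 = \<tau>\<^sup>2 * real (Suc (Suc m))"
      by (simp add: power_mult_distrib algebra_simps)
    then show ?thesis using assms(1) by (simp add: real_sqrt_mult)
  qed
  finally show ?case .
qed simp

section \<open>Taylor jets of controlled growth\<close>

text \<open>\<open>U 1\<close>, \<open>U 2\<close> and \<open>U 3\<close> act as the derivatives of \<open>U 0\<close>, but only through the third-order Taylor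
  expansion with a fourth-order remainder. In this form the property passes through an integral without
  interchanging derivatives and integrals. Growth is measured by \<open>cosh (C * x)\<close> because smoothing
  multiplies this function by a constant.\<close>

definition jet :: "real \<Rightarrow> real \<Rightarrow> (nat \<Rightarrow> real \<Rightarrow> real) \<Rightarrow> bool" where
  "jet C B U \<longleftrightarrow> (\<forall>i. U i \<in> borel_measurable borel) \<and> (\<forall>i x. \<bar>U i x\<bar> \<le> B * cosh (C * x)) \<and>
     (\<forall>x h. \<bar>U 0 (x + h) - (\<Sum>i<4. U i x * h ^ i / fact i)\<bar> \<le> B * cosh (C * x) * (exp (C * \<bar>h\<bar>) * h ^ 4))"

lemma jetD:
  assumes "jet C B U"
  shows "U i \<in> borel_measurable borel" "\<bar>U i x\<bar> \<le> B * cosh (C * x)" "0 \<le> B"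
    "\<bar>U 0 (x + h) - (\<Sum>i<4. U i x * h ^ i / fact i)\<bar> \<le> B * cosh (C * x) * (exp (C * \<bar>h\<bar>) * h ^ 4)"
proof -
  have "\<bar>U 0 0\<bar> \<le> B * cosh (C * 0)" using assms unfolding jet_def by blast
  then show "0 \<le> B" by simp
qed (use assms in \<open>auto simp: jet_def\<close>)

lemma jet_smooth:
  assumes "0 < \<tau>" "0 \<le> C" "jet C B U"
  shows "jet C (B * exp (C\<^sup>2 * \<tau>\<^sup>2 / 2)) (\<lambda>i. smooth \<tau> (U i))"
  unfolding jet_def
proof (intro conjI allI)
  note U = jetD[OF assms(3)]
  note [measurable] = U(1)
  note int = smooth_integrable[OF assms(1,2) U(1) U(2)]
  fix i x h
  show "smooth \<tau> (U i) \<in> borel_measurable borel"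
    using assms(1) by measurable
  show "\<bar>smooth \<tau> (U i) x\<bar> \<le> B * exp (C\<^sup>2 * \<tau>\<^sup>2 / 2) * cosh (C * x)"
    by (rule smooth_growth[OF assms(1,2) U(1,2)])
  have i4: "integrable (gaussm \<tau>) (\<lambda>z. \<Sum>i<4. U i (x + z) * h ^ i / fact i)"
    using int by auto
  have "smooth \<tau> (U 0) (x + h) - (\<Sum>i<4. smooth \<tau> (U i) x * h ^ i / fact i)
      = (\<integral>z. U 0 (x + z + h) - (\<Sum>i<4. U i (x + z) * h ^ i / fact i) \<partial>gaussm \<tau>)"
  proof -
    have "(\<integral>z. (\<Sum>i<4. U i (x + z) * h ^ i / fact i) \<partial>gaussm \<tau>) = (\<Sum>i<4. smooth \<tau> (U i) x * h ^ i / fact i)"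
      unfolding smooth_def using int by (subst Bochner_Integration.integral_sum) auto
    moreover have "(\<integral>z. U 0 (x + z + h) \<partial>gaussm \<tau>) = smooth \<tau> (U 0) (x + h)"
      by (simp add: smooth_def algebra_simps)
    moreover have "integrable (gaussm \<tau>) (\<lambda>z. U 0 (x + z + h))"
      using int[of 0 "x + h"] by (simp add: algebra_simps)
    ultimately show ?thesis using i4 by (simp add: Bochner_Integration.integral_diff)
  qed
  also have "\<bar>...\<bar> \<le> (\<integral>z. \<bar>U 0 (x + z + h) - (\<Sum>i<4. U i (x + z) * h ^ i / fact i)\<bar> \<partial>gaussm \<tau>)"
    by (rule integral_abs_bound)
  also have "... \<le> (\<integral>z. B * cosh (C * (x + z)) * (exp (C * \<bar>h\<bar>) * h ^ 4) \<partial>gaussm \<tau>)"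
    using i4 int[of 0 "x + h"] gaussm_cosh(1)[OF assms(1), of C x]
    by (intro integral_mono U(4)) (auto simp: algebra_simps)
  also have "... = B * exp (C\<^sup>2 * \<tau>\<^sup>2 / 2) * cosh (C * x) * (exp (C * \<bar>h\<bar>) * h ^ 4)"
    using gaussm_cosh(2)[OF assms(1), of C x] by simp
  finally show "\<bar>smooth \<tau> (U 0) (x + h) - (\<Sum>i<4. smooth \<tau> (U i) x * h ^ i / fact i)\<bar>
    \<le> B * exp (C\<^sup>2 * \<tau>\<^sup>2 / 2) * cosh (C * x) * (exp (C * \<bar>h\<bar>) * h ^ 4)" .
qed

lemma jet_smooth_funpow:
  assumes "0 < \<tau>" "0 \<le> C" "jet C B U"
  shows "jet C (B * exp (C\<^sup>2 * \<tau>\<^sup>2 / 2 * real m)) (\<lambda>i. (smooth \<tau> ^^ m) (U i))"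
proof (induction m)
  case (Suc m)
  have "B * exp (C\<^sup>2 * \<tau>\<^sup>2 / 2 * real (Suc m)) = B * exp (C\<^sup>2 * \<tau>\<^sup>2 / 2 * real m) * exp (C\<^sup>2 * \<tau>\<^sup>2 / 2)"
    by (simp add: exp_add[symmetric] algebra_simps add_divide_distrib)
  with jet_smooth[OF assms(1,2) Suc] show ?case by (simp only: funpow.simps comp_def)
qed (use assms in simp)

text \<open>The first and third moments of the Gaussian vanish, so only the second-order term survives.\<close>

lemma smooth_jet_expansion:
  assumes "0 < \<tau>" "0 \<le> C" "jet C B U"
  shows "\<bar>smooth \<tau> (U 0) x - (U 0 x + U 2 x * \<tau>\<^sup>2 / 2)\<bar>
      \<le> B * cosh (C * x) * (48 * \<tau> ^ 4 * exp ((1 + C * \<tau>)\<^sup>2 / 2))"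
proof -
  note U = jetD[OF assms(3)]
  interpret prob_space "gaussm \<tau>" by (rule prob_space_gaussm) fact
  have pw: "integrable (gaussm \<tau>) (\<lambda>z. z ^ k)" for k :: nat
    using integrable_normal_moment[OF assms(1), of 0 k]
    by (subst integrable_gaussm_iff) auto
  have s4: "(\<Sum>i<4. U i x * z ^ i / fact i) = U 0 x + U 1 x * z + U 2 x / 2 * z\<^sup>2 + U 3 x / 6 * z ^ 3" for z
    by (simp add: numeral_eq_Suc)
  have i4: "integrable (gaussm \<tau>) (\<lambda>z. \<Sum>i<4. U i x * z ^ i / fact i)"
    unfolding s4 using pw[of 1] pw[of 2] pw[of 3] by auto
  have e4: "(\<integral>z. (\<Sum>i<4. U i x * z ^ i / fact i) \<partial>gaussm \<tau>) = U 0 x + U 2 x * \<tau>\<^sup>2 / 2"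
    unfolding s4 using pw[of 1] pw[of 2] pw[of 3]
    by (simp add: gaussm_moments[OF assms(1)] prob_space[simplified])
  have "\<bar>smooth \<tau> (U 0) x - (U 0 x + U 2 x * \<tau>\<^sup>2 / 2)\<bar>
      \<le> (\<integral>z. B * cosh (C * x) * (exp (C * \<bar>z\<bar>) * z ^ 4) \<partial>gaussm \<tau>)"
    unfolding e4[symmetric] smooth_def
    by (rule abs_integral_diff_le[OF smooth_integrable[OF assms(1,2) U(1) U(2)] i4])
      (use gaussm_fourth_exp(1)[OF assms(1,2)] U(4) in auto)
  also have "... = B * cosh (C * x) * (\<integral>z. exp (C * \<bar>z\<bar>) * z ^ 4 \<partial>gaussm \<tau>)" by simp
  also have "... \<le> B * cosh (C * x) * (48 * \<tau> ^ 4 * exp ((1 + C * \<tau>)\<^sup>2 / 2))"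
    using U(3) by (intro mult_left_mono gaussm_fourth_exp(2)[OF assms(1,2)]) auto
  finally show ?thesis .
qed

section \<open>Conditional independence of the noise\<close>

text \<open>Conditional independence is stated with real conditional expectations of indicators, sub-Gaussian tails
  with nonnegative ones; on indicators the two notions agree.\<close>

lemma (in finite_measure_subalgebra) nn_cond_exp_indicator:
  assumes [measurable]: "A \<in> sets M"
  shows "AE x in M. nn_cond_exp M F (indicator A) x = ennreal (real_cond_exp M F (indicator A) x)"
proof -
  have int: "integrable M (indicator A :: _ \<Rightarrow> real)"
    by (simp add: emeasure_finite less_top[symmetric])
  have pos: "AE x in M. 0 \<le> real_cond_exp M F (indicator A) x"
    by (rule real_cond_exp_pos) auto
  have intr: "integrable M (real_cond_exp M F (indicator A))"
    by (rule real_cond_exp_int(1)[OF int])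
  have "AE x in M. ennreal (real_cond_exp M F (indicator A) x) = nn_cond_exp M F (indicator A) x"
  proof (rule nn_cond_exp_charact)
    fix D assume DF: "D \<in> sets F"
    then have [measurable]: "D \<in> sets M" using subalg by (auto simp: subalgebra_def)
    have i1: "integrable M (\<lambda>x. indicator D x * real_cond_exp M F (indicator A) x)"
      using integrable_mult_indicator[OF \<open>D \<in> sets M\<close> intr] by simp
    have i2: "integrable M (\<lambda>x. indicator D x * indicator A x :: real)"
      using integrable_mult_indicator[OF \<open>D \<in> sets M\<close> int] by simp
    have "(\<integral>\<^sup>+x\<in>D. indicator A x \<partial>M) = (\<integral>\<^sup>+x. ennreal (indicator D x * indicator A x) \<partial>M)"
      by (rule nn_integral_cong) (auto simp: indicator_def)
    also have "... = ennreal (\<integral>x. indicator D x * indicator A x \<partial>M)"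
      by (rule nn_integral_eq_integral[OF i2]) auto
    also have "(\<integral>x. indicator D x * indicator A x \<partial>M) = (\<integral>x. indicator D x * real_cond_exp M F (indicator A) x \<partial>M)"
      using real_cond_exp_intg(2)[OF i2] DF by auto
    also have "ennreal ... = (\<integral>\<^sup>+x. ennreal (indicator D x * real_cond_exp M F (indicator A) x) \<partial>M)"
      by (rule nn_integral_eq_integral[OF i1, symmetric]) (use pos in auto)
    also have "... = (\<integral>\<^sup>+x\<in>D. ennreal (real_cond_exp M F (indicator A) x) \<partial>M)"
      by (rule nn_integral_cong) (auto simp: indicator_def)
    finally show "(\<integral>\<^sup>+x\<in>D. indicator A x \<partial>M) = (\<integral>\<^sup>+x\<in>D. ennreal (real_cond_exp M F (indicator A) x) \<partial>M)" .
  qed auto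
  then show ?thesis by (rule AE_symmetric)
qed

text \<open>A single unit of the sampling model. The conditional second moment stands for the conditional variance,
  the conditional mean being zero.\<close>

locale noisy_unit = prob_space P
  for P :: "'a measure" +
  fixes \<theta> :: "'a \<Rightarrow> real" and \<epsilon> :: "nat \<Rightarrow> 'a \<Rightarrow> real" and J :: nat and \<sigma> s M K :: real
  assumes theta_meas [measurable]: "\<theta> \<in> borel_measurable P"
    and theta_bounded: "AE \<omega> in P. \<bar>\<theta> \<omega>\<bar> \<le> M"
    and J_ge_1: "1 \<le> J"
    and sigma_pos: "0 < \<sigma>"
    and sigma_le: "\<sigma> \<le> K"
    and eps_meas: "j \<in> {1..J} \<Longrightarrow> \<epsilon> j \<in> borel_measurable P"
    and eps_cond_indep:
      "cond_indep_vars P (vimage_algebra (space P) \<theta> borel) (\<lambda>_. borel) \<epsilon> {1..J}"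
    and eps_cond_mean:
      "j \<in> {1..J} \<Longrightarrow> AE \<omega> in P. real_cond_exp P (vimage_algebra (space P) \<theta> borel) (\<epsilon> j) \<omega> = 0"
    and eps_cond_square:
      "j \<in> {1..J} \<Longrightarrow> AE \<omega> in P. real_cond_exp P (vimage_algebra (space P) \<theta> borel) (\<lambda>\<omega>. (\<epsilon> j \<omega>)\<^sup>2) \<omega>
                      = \<sigma>\<^sup>2 * real J"
    and eps_cond_subgaussian:
      "j \<in> {1..J} \<Longrightarrow> AE \<omega> in P. nn_cond_exp P (vimage_algebra (space P) \<theta> borel)
                       (\<lambda>\<omega>. ennreal (exp (t * (\<epsilon> j \<omega> / sqrt (real J))))) \<omega>
                    \<le> ennreal (exp (s\<^sup>2 * t\<^sup>2 / 2))"
begin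

abbreviation "F \<equiv> vimage_algebra (space P) \<theta> borel"

text \<open>Coordinate 0 holds \<open>\<theta>\<close>, so that the sigma-algebra \<open>G j\<close> generated by the past is that of \<open>\<theta>\<close> together
  with the noise variables before the \<open>j\<close>-th.\<close>

definition past :: "nat \<Rightarrow> 'a \<Rightarrow> nat \<Rightarrow> real" where
  "past j \<omega> = (\<lambda>i\<in>{0..<j}. if i = 0 then \<theta> \<omega> else \<epsilon> i \<omega>)"

abbreviation "G j \<equiv> vimage_algebra (space P) (past j) (\<Pi>\<^sub>M i\<in>{0..<j}. (borel :: real measure))"

lemma past_measurable:
  assumes "j \<in> {1..J}"
  shows "past j \<in> measurable P (\<Pi>\<^sub>M i\<in>{0..<j}. (borel :: real measure))"
proof -
  have "(\<lambda>\<omega>. if i = 0 then \<theta> \<omega> else \<epsilon> i \<omega>) \<in> borel_measurable P" if "i \<in> {0..<j}" for i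
    using eps_meas[of i] assms that by (cases "i = 0") auto
  then show ?thesis
    unfolding past_def by (intro measurable_restrict)
qed

lemma subalgebra_F: "subalgebra P F"
  using measurable_sets[OF theta_meas]
  by (auto simp: subalgebra_def sets_vimage_algebra2)

lemma subalgebra_G: 
  assumes "j \<in> {1..J}"
  shows "subalgebra P (G j)"
  using measurable_sets[OF past_measurable[OF assms]] measurable_space[OF past_measurable[OF assms]]
  by (auto simp: subalgebra_def sets_vimage_algebra2)

sublocale F: finite_measure_subalgebra P F
  by unfold_locales (rule subalgebra_F)

lemma finite_measure_subalgebra_G: "j \<in> {1..J} \<Longrightarrow> finite_measure_subalgebra P (G j)"
  by unfold_locales (rule subalgebra_G)

lemma theta_F: "\<theta> \<in> borel_measurable F"
  by (rule measurable_vimage_algebra1) auto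

lemma past_G: "j \<in> {1..J} \<Longrightarrow> past j \<in> measurable (G j) (\<Pi>\<^sub>M i\<in>{0..<j}. (borel :: real measure))"
  using measurable_space[OF past_measurable] by (intro measurable_vimage_algebra1) auto

lemma theta_G:
  assumes "j \<in> {1..J}"
  shows "\<theta> \<in> borel_measurable (G j)"
proof -
  have "(\<lambda>\<omega>. past j \<omega> 0) \<in> borel_measurable (G j)"
    by (rule measurable_compose[OF past_G[OF assms] measurable_component_singleton]) (use assms in auto)
  then show ?thesis using assms by (simp add: past_def)
qed

lemma eps_G:
  assumes "j \<in> {1..J}" "i \<in> {1..<j}"
  shows "\<epsilon> i \<in> borel_measurable (G j)"
proof -
  have "(\<lambda>\<omega>. past j \<omega> i) \<in> borel_measurable (G j)"
    by (rule measurable_compose[OF past_G[OF assms(1)] measurable_component_singleton]) (use assms in auto)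
  then show ?thesis using assms by (simp add: past_def)
qed

lemma F_G_measurable:
  fixes f :: "'a \<Rightarrow> 'b::topological_space"
  assumes "j \<in> {1..J}" "f \<in> borel_measurable F"
  shows "f \<in> borel_measurable (G j)"
proof (rule measurable_from_subalg[OF _ assms(2)])
  show "subalgebra (G j) F"
    using measurable_sets[OF theta_G[OF assms(1)]]
    by (auto simp: subalgebra_def sets_vimage_algebra2)
qed

lemma integrable_ind: "A \<in> sets P \<Longrightarrow> integrable P (indicator A :: _ \<Rightarrow> real)"
  by (simp add: emeasure_finite less_top[symmetric])

lemma rce_ind_bounds:
  assumes [measurable]: "A \<in> sets P"
  shows "AE \<omega> in P. 0 \<le> real_cond_exp P F (indicator A) \<omega>"
    "integrable P (real_cond_exp P F (indicator A))"
  using F.real_cond_exp_pos[of "indicator A"] F.real_cond_exp_int(1)[OF integrable_ind[OF assms]]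
  by auto

text \<open>For a product event of the past, conditional independence factorises the conditional probability, and
  the factor that belongs to \<open>\<epsilon> j\<close> can be pulled out.\<close>

lemma past_rectangle:
  assumes j: "j \<in> {1..J}" and B: "B \<in> sets borel" and A: "\<And>i. i \<in> {0..<j} \<Longrightarrow> A i \<in> sets borel"
  defines "Bj \<equiv> {\<omega> \<in> space P. \<epsilon> j \<omega> \<in> B}"
  defines "E \<equiv> {\<omega> \<in> space P. past j \<omega> \<in> Pi\<^sub>E {0..<j} A}"
  shows "(\<integral>\<omega>. indicator E \<omega> * indicator Bj \<omega> \<partial>P) = (\<integral>\<omega>. indicator E \<omega> * real_cond_exp P F (indicator Bj) \<omega> \<partial>P)"
proof -
  let ?R = "real_cond_exp P F"
  define L where "L = {1..<j}"
  define A' where "A' = A(j := B)"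
  define C where "C = \<theta> -` A 0 \<inter> space P"
  define EL where "EL = {\<omega> \<in> space P. \<forall>l\<in>L. \<epsilon> l \<omega> \<in> A' l}"
  define ELj where "ELj = {\<omega> \<in> space P. \<forall>l\<in>insert j L. \<epsilon> l \<omega> \<in> A' l}"
  have L: "L \<subseteq> {1..J}" "insert j L \<subseteq> {1..J}" "finite L" "j \<notin> L" using j by (auto simp: L_def)
  have A'm: "\<forall>l\<in>L. A' l \<in> sets borel" "\<forall>l\<in>insert j L. A' l \<in> sets borel"
    using A B j by (auto simp: A'_def L_def)
  have A0: "A 0 \<in> sets borel" using A j by auto
  have CF: "C \<in> sets F" unfolding C_def by (rule in_vimage_algebra[OF A0])
  have CP [measurable]: "C \<in> sets P" using CF subalgebra_F by (auto simp: subalgebra_def)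
  have epsL: "\<And>l. l \<in> insert j L \<Longrightarrow> \<epsilon> l \<in> borel_measurable P" using L eps_meas by auto
  have [measurable]: "Bj \<in> sets P" using eps_meas[OF j] B unfolding Bj_def by measurable
  have pm: "{\<omega> \<in> space P. \<epsilon> l \<omega> \<in> A' l} \<in> sets P" if "l \<in> insert j L" for l
    using measurable_sets[OF epsL[OF that], of "A' l"] A'm(2) that
    by (auto simp: vimage_def Int_def conj_commute)
  have [measurable]: "EL \<in> sets P" "ELj \<in> sets P"
    unfolding EL_def ELj_def
    by (rule sets.sets_Collect_finite_All; use pm L in auto)+
  have ci: "\<forall>L A. L \<subseteq> {1..J} \<longrightarrow> finite L \<longrightarrow> (\<forall>j\<in>L. A j \<in> sets borel) \<longrightarrow>
        (AE \<omega> in P. ?R (indicator {\<omega> \<in> space P. \<forall>j\<in>L. \<epsilon> j \<omega> \<in> A j}) \<omega> =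
           (\<Prod>j\<in>L. ?R (indicator {\<omega> \<in> space P. \<epsilon> j \<omega> \<in> A j}) \<omega>))"
    using eps_cond_indep unfolding cond_indep_vars_def by simp
  have AEL: "AE \<omega> in P. ?R (indicator EL) \<omega>
           = (\<Prod>l\<in>L. ?R (indicator {\<omega> \<in> space P. \<epsilon> l \<omega> \<in> A' l}) \<omega>)"
    using ci[rule_format, OF L(1) L(3), of A'] A'm unfolding EL_def by blast
  have AELj: "AE \<omega> in P. ?R (indicator ELj) \<omega>
           = (\<Prod>l\<in>insert j L. ?R (indicator {\<omega> \<in> space P. \<epsilon> l \<omega> \<in> A' l}) \<omega>)"
    using ci[rule_format, OF L(2), of A'] A'm L unfolding ELj_def by blast
  have Bj': "{\<omega> \<in> space P. \<epsilon> j \<omega> \<in> A' j} = Bj" by (simp add: A'_def Bj_def)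
  have AE1: "AE \<omega> in P. ?R (indicator ELj) \<omega>
      = ?R (indicator Bj) \<omega> * ?R (indicator EL) \<omega>"
    using AEL AELj by eventually_elim (use L in \<open>simp add: Bj'\<close>)
  have Eeq: "indicator E \<omega> = (indicator C \<omega> * indicator EL \<omega> :: real)" if "\<omega> \<in> space P" for \<omega>
  proof -
    have "\<omega> \<in> E \<longleftrightarrow> \<omega> \<in> C \<and> \<omega> \<in> EL"
      unfolding E_def C_def EL_def past_def PiE_def using that j
      by (auto simp: L_def A'_def Pi_iff split: if_splits)
        (metis One_nat_def atLeastLessThan_iff le0 neq0_conv not_less_eq_eq not_less less_imp_le Suc_leI)?
    then show ?thesis by (auto simp: indicator_def)
  qed
  have ELjeq: "indicator ELj \<omega> = (indicator EL \<omega> * indicator Bj \<omega> :: real)" if "\<omega> \<in> space P" for \<omega>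
    using that L by (auto simp: ELj_def EL_def Bj_def A'_def indicator_def)
  have CFm: "(indicator C :: _ \<Rightarrow> real) \<in> borel_measurable F" using CF by simp
  have i1: "integrable P (\<lambda>\<omega>. indicator C \<omega> * indicator ELj \<omega> :: real)"
    using integrable_mult_indicator[OF CP integrable_ind[of ELj]] by simp
  have i2: "integrable P (\<lambda>\<omega>. (indicator C \<omega> * ?R (indicator Bj) \<omega>) * indicator EL \<omega>)"
    using integrable_mult_indicator[OF \<open>EL \<in> sets P\<close> integrable_mult_indicator[OF CP rce_ind_bounds(2)[of Bj]]]
    by (simp add: mult.commute)
  have "(\<integral>\<omega>. indicator E \<omega> * indicator Bj \<omega> \<partial>P) = (\<integral>\<omega>. indicator C \<omega> * indicator ELj \<omega> \<partial>P :: real)"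
    by (rule Bochner_Integration.integral_cong) (auto simp: Eeq ELjeq)
  also have "... = (\<integral>\<omega>. indicator C \<omega> * ?R (indicator ELj) \<omega> \<partial>P)"
    using F.real_cond_exp_intg(2)[OF i1 CFm] by simp
  also have "... = (\<integral>\<omega>. (indicator C \<omega> * ?R (indicator Bj) \<omega>) * ?R (indicator EL) \<omega> \<partial>P)"
    by (rule integral_cong_AE) (use AE1 in \<open>auto simp: mult.assoc intro!: borel_measurable_times\<close>)
  also have "... = (\<integral>\<omega>. (indicator C \<omega> * ?R (indicator Bj) \<omega>) * indicator EL \<omega> \<partial>P)"
    by (rule F.real_cond_exp_intg(2)[OF i2]) (use CFm in auto)
  also have "... = (\<integral>\<omega>. indicator E \<omega> * ?R (indicator Bj) \<omega> \<partial>P)"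
    by (rule Bochner_Integration.integral_cong) (auto simp: Eeq mult_ac)
  finally show ?thesis .
qed

lemma nn_eq_integral_ind:
  assumes [measurable]: "A \<in> sets P" and f: "integrable P f" "AE \<omega> in P. 0 \<le> f \<omega>"
  shows "(\<integral>\<^sup>+\<omega>. indicator A \<omega> * ennreal (f \<omega>) \<partial>P) = ennreal (\<integral>\<omega>. indicator A \<omega> * f \<omega> \<partial>P)"
proof -
  have "(\<integral>\<^sup>+\<omega>. indicator A \<omega> * ennreal (f \<omega>) \<partial>P) = (\<integral>\<^sup>+\<omega>. ennreal (indicator A \<omega> * f \<omega>) \<partial>P)"
    by (rule nn_integral_cong) (auto simp: indicator_def)
  also have "... = ennreal (\<integral>\<omega>. indicator A \<omega> * f \<omega> \<partial>P)"
    using integrable_mult_indicator[OF assms(1) f(1)] f(2) by (intro nn_integral_eq_integral) auto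
  finally show ?thesis .
qed

text \<open>Both sides are finite measures in the event of the past. Rectangles generate \<open>G j\<close> and are closed under
  intersection, so the identity on rectangles extends to all of \<open>G j\<close>.\<close>

lemma past_event:
  assumes j: "j \<in> {1..J}" and B: "B \<in> sets borel" and A: "A \<in> sets (G j)"
  defines "Bj \<equiv> {\<omega> \<in> space P. \<epsilon> j \<omega> \<in> B}"
  shows "(\<integral>\<^sup>+\<omega>. indicator A \<omega> * indicator Bj \<omega> \<partial>P)
     = (\<integral>\<^sup>+\<omega>. indicator A \<omega> * ennreal (real_cond_exp P F (indicator Bj) \<omega>) \<partial>P)"
proof -
  let ?PM = "\<Pi>\<^sub>M i\<in>{0..<j}. (borel :: real measure)"
  note pm [measurable] = past_measurable[OF j]
  have Bjm [measurable]: "Bj \<in> sets P" using eps_meas[OF j] B unfolding Bj_def by measurable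
  note rb = rce_ind_bounds[OF Bjm]
  define q where "q = (\<lambda>\<omega>. ennreal (real_cond_exp P F (indicator Bj) \<omega>))"
  have [measurable]: "q \<in> borel_measurable P" unfolding q_def by simp
  define N1 where "N1 = distr (density P (indicator Bj)) ?PM (past j)"
  define N2 where "N2 = distr (density P q) ?PM (past j)"
  have e1: "emeasure N1 D = (\<integral>\<^sup>+\<omega>. indicator (past j -` D \<inter> space P) \<omega> * indicator Bj \<omega> \<partial>P)" if "D \<in> sets ?PM" for D
    unfolding N1_def using that
    by (subst emeasure_distr) (auto simp: emeasure_density mult.commute)
  have e2: "emeasure N2 D = (\<integral>\<^sup>+\<omega>. indicator (past j -` D \<inter> space P) \<omega> * q \<omega> \<partial>P)" if "D \<in> sets ?PM" for D
    unfolding N2_def using that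
    by (subst emeasure_distr) (auto simp: emeasure_density mult.commute)
  have "N1 = N2"
  proof (rule measure_eqI_PiM_finite[where I = "{0..<j}" and M = "\<lambda>_. borel" and A = "\<lambda>_. space ?PM"])
    show "sets N1 = sets ?PM" "sets N2 = sets ?PM" by (simp_all add: N1_def N2_def)
    fix A :: "nat \<Rightarrow> real set" assume A: "\<And>i. i \<in> {0..<j} \<Longrightarrow> A i \<in> sets borel"
    have D: "Pi\<^sub>E {0..<j} A \<in> sets ?PM" using A by (intro sets_PiM_I_finite) auto
    let ?E = "{\<omega> \<in> space P. past j \<omega> \<in> Pi\<^sub>E {0..<j} A}"
    have E: "past j -` (Pi\<^sub>E {0..<j} A) \<inter> space P = ?E" by auto
    have [measurable]: "?E \<in> sets P" using measurable_sets[OF pm D] unfolding E .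
    have "emeasure N1 (Pi\<^sub>E {0..<j} A) = (\<integral>\<^sup>+\<omega>. indicator ?E \<omega> * ennreal (indicator Bj \<omega>) \<partial>P)"
      unfolding e1[OF D] E by (simp add: ennreal_indicator)
    also have "... = ennreal (\<integral>\<omega>. indicator ?E \<omega> * indicator Bj \<omega> \<partial>P)"
      by (rule nn_eq_integral_ind) (auto intro: integrable_ind)
    also have "... = ennreal (\<integral>\<omega>. indicator ?E \<omega> * real_cond_exp P F (indicator Bj) \<omega> \<partial>P)"
      unfolding Bj_def by (subst past_rectangle[OF j B A]) auto
    also have "... = emeasure N2 (Pi\<^sub>E {0..<j} A)"
      unfolding e2[OF D] E q_def by (rule nn_eq_integral_ind[symmetric]) (use rb in auto)
    finally show "emeasure N1 (Pi\<^sub>E {0..<j} A) = emeasure N2 (Pi\<^sub>E {0..<j} A)" .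
  next
    show "range (\<lambda>_. space ?PM) \<subseteq> prod_algebra {0..<j} (\<lambda>_. borel)"
      using space_in_prod_algebra[of "{0..<j}" "\<lambda>_. borel :: real measure"] by (auto simp: space_PiM)
    fix i :: nat
    have "emeasure N1 (space ?PM) \<le> (\<integral>\<^sup>+\<omega>. 1 \<partial>P)"
      unfolding e1[OF sets.top] by (rule nn_integral_mono) (auto simp: indicator_def)
    then show "emeasure N1 (space ?PM) \<noteq> \<infinity>"
      using emeasure_space_1 by (auto simp: top_unique)
  qed auto
  moreover obtain D where D: "D \<in> sets ?PM" "A = past j -` D \<inter> space P"
    using A measurable_space[OF pm] by (auto simp: sets_vimage_algebra2)
  ultimately show ?thesis using e1[OF D(1)] e2[OF D(1)] by (simp add: q_def D(2))
qed

text \<open>For a fixed event of the past both sides are integrals of \<open>b\<close> against measures on the line, which agree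
  on Borel sets by the preceding identity.\<close>

lemma past_nn_integral:
  assumes j: "j \<in> {1..J}" and [measurable]: "b \<in> borel_measurable borel" and A: "A \<in> sets (G j)"
  shows "(\<integral>\<^sup>+\<omega>. indicator A \<omega> * b (\<epsilon> j \<omega>) \<partial>P)
     = (\<integral>\<^sup>+\<omega>. indicator A \<omega> * nn_cond_exp P F (\<lambda>\<omega>. b (\<epsilon> j \<omega>)) \<omega> \<partial>P)"
proof -
  note [measurable] = eps_meas[OF j]
  have AP [measurable]: "A \<in> sets P" using A subalgebra_G[OF j] by (auto simp: subalgebra_def)
  let ?N = "nn_cond_exp P F"
  define a where "a = ?N (indicator A)"
  have [measurable]: "a \<in> borel_measurable F" "a \<in> borel_measurable P" by (auto simp: a_def)
  note rA = rce_ind_bounds[OF AP]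
  have a_eq: "AE \<omega> in P. a \<omega> = ennreal (real_cond_exp P F (indicator A) \<omega>)"
    unfolding a_def by (rule F.nn_cond_exp_indicator[OF AP])
  have "distr (density P (indicator A)) borel (\<epsilon> j) = distr (density P a) borel (\<epsilon> j)"
  proof (rule measure_eqI)
    fix B assume "B \<in> sets (distr (density P (indicator A)) borel (\<epsilon> j))"
    then have B [measurable]: "B \<in> sets borel" by simp
    define Bj where "Bj = {\<omega> \<in> space P. \<epsilon> j \<omega> \<in> B}"
    have Bj: "\<epsilon> j -` B \<inter> space P = Bj" by (auto simp: Bj_def)
    have [measurable]: "Bj \<in> sets P" unfolding Bj_def by measurable
    note q = F.nn_cond_exp_indicator[OF \<open>Bj \<in> sets P\<close>]
    have "emeasure (distr (density P (indicator A)) borel (\<epsilon> j)) B = (\<integral>\<^sup>+\<omega>. indicator A \<omega> * indicator Bj \<omega> \<partial>P)"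
      by (subst emeasure_distr) (auto simp: emeasure_density Bj)
    also have "... = (\<integral>\<^sup>+\<omega>. indicator A \<omega> * ennreal (real_cond_exp P F (indicator Bj) \<omega>) \<partial>P)"
      unfolding Bj_def by (rule past_event[OF j B A])
    also have "... = (\<integral>\<^sup>+\<omega>. ?N (indicator Bj) \<omega> * indicator A \<omega> \<partial>P)"
      by (rule nn_integral_cong_AE) (use q in eventually_elim, simp add: mult.commute)
    also have "... = (\<integral>\<^sup>+\<omega>. ?N (indicator Bj) \<omega> * a \<omega> \<partial>P)"
      unfolding a_def by (rule F.nn_cond_exp_intg[symmetric]) auto
    also have "... = (\<integral>\<^sup>+\<omega>. a \<omega> * ?N (indicator Bj) \<omega> \<partial>P)"
      by (simp add: mult.commute)
    also have "... = (\<integral>\<^sup>+\<omega>. a \<omega> * indicator Bj \<omega> \<partial>P)"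
      by (rule F.nn_cond_exp_intg) auto
    also have "... = emeasure (distr (density P a) borel (\<epsilon> j)) B"
      by (subst emeasure_distr) (auto simp: emeasure_density Bj)
    finally show "emeasure (distr (density P (indicator A)) borel (\<epsilon> j)) B = emeasure (distr (density P a) borel (\<epsilon> j)) B" .
  qed simp
  then have "(\<integral>\<^sup>+x. b x \<partial>distr (density P (indicator A)) borel (\<epsilon> j)) = (\<integral>\<^sup>+x. b x \<partial>distr (density P a) borel (\<epsilon> j))"
    by simp
  then have "(\<integral>\<^sup>+\<omega>. indicator A \<omega> * b (\<epsilon> j \<omega>) \<partial>P) = (\<integral>\<^sup>+\<omega>. a \<omega> * b (\<epsilon> j \<omega>) \<partial>P)"
    by (simp add: nn_integral_distr nn_integral_density)
  also have "... = (\<integral>\<^sup>+\<omega>. a \<omega> * ?N (\<lambda>\<omega>. b (\<epsilon> j \<omega>)) \<omega> \<partial>P)"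
    by (rule F.nn_cond_exp_intg[symmetric]) auto
  also have "... = (\<integral>\<^sup>+\<omega>. ?N (\<lambda>\<omega>. b (\<epsilon> j \<omega>)) \<omega> * a \<omega> \<partial>P)"
    by (simp add: mult.commute)
  also have "... = (\<integral>\<^sup>+\<omega>. ?N (\<lambda>\<omega>. b (\<epsilon> j \<omega>)) \<omega> * indicator A \<omega> \<partial>P)"
    unfolding a_def by (rule F.nn_cond_exp_intg) auto
  finally show ?thesis by (simp add: mult.commute)
qed

text \<open>Once \<open>\<theta>\<close> is known, earlier noise variables carry no information about the next one.\<close>

lemma nn_cond_exp_past:
  assumes j: "j \<in> {1..J}" and [measurable]: "b \<in> borel_measurable borel"
  shows "AE \<omega> in P. nn_cond_exp P (G j) (\<lambda>\<omega>. b (\<epsilon> j \<omega>)) \<omega> = nn_cond_exp P F (\<lambda>\<omega>. b (\<epsilon> j \<omega>)) \<omega>"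
proof -
  interpret G: finite_measure_subalgebra P "G j" by (rule finite_measure_subalgebra_G[OF j])
  note [measurable] = eps_meas[OF j]
  have "AE \<omega> in P. nn_cond_exp P F (\<lambda>\<omega>. b (\<epsilon> j \<omega>)) \<omega> = nn_cond_exp P (G j) (\<lambda>\<omega>. b (\<epsilon> j \<omega>)) \<omega>"
  proof (rule G.nn_cond_exp_charact)
    fix A assume "A \<in> sets (G j)"
    from past_nn_integral[OF j assms(2) this]
    show "(\<integral>\<^sup>+\<omega>\<in>A. b (\<epsilon> j \<omega>) \<partial>P) = (\<integral>\<^sup>+\<omega>\<in>A. nn_cond_exp P F (\<lambda>\<omega>. b (\<epsilon> j \<omega>)) \<omega> \<partial>P)"
      by (simp add: mult.commute)
  qed (auto intro: F_G_measurable[OF j])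
  then show ?thesis by (rule AE_symmetric)
qed

lemma real_cond_exp_past:
  assumes j: "j \<in> {1..J}" and [measurable]: "b \<in> borel_measurable borel"
  shows "AE \<omega> in P. real_cond_exp P (G j) (\<lambda>\<omega>. b (\<epsilon> j \<omega>)) \<omega> = real_cond_exp P F (\<lambda>\<omega>. b (\<epsilon> j \<omega>)) \<omega>"
  using nn_cond_exp_past[OF j, of "\<lambda>x. ennreal (b x)"] nn_cond_exp_past[OF j, of "\<lambda>x. ennreal (- b x)"]
  by (auto simp: real_cond_exp_def)

lemma integral_past_times:
  assumes j: "j \<in> {1..J}" and [measurable]: "b \<in> borel_measurable borel"
    and \<Phi>: "\<Phi> \<in> borel_measurable (G j)" and int: "integrable P (\<lambda>\<omega>. \<Phi> \<omega> * b (\<epsilon> j \<omega>))"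
  shows "integrable P (\<lambda>\<omega>. \<Phi> \<omega> * real_cond_exp P F (\<lambda>\<omega>. b (\<epsilon> j \<omega>)) \<omega>)"
    and "(\<integral>\<omega>. \<Phi> \<omega> * b (\<epsilon> j \<omega>) \<partial>P) = (\<integral>\<omega>. \<Phi> \<omega> * real_cond_exp P F (\<lambda>\<omega>. b (\<epsilon> j \<omega>)) \<omega> \<partial>P)"
proof -
  interpret G: finite_measure_subalgebra P "G j" by (rule finite_measure_subalgebra_G[OF j])
  note [measurable] = eps_meas[OF j] measurable_from_subalg[OF subalgebra_G[OF j] \<Phi>]
  note r = G.real_cond_exp_intg[OF int \<Phi>]
  have AEeq: "AE \<omega> in P. \<Phi> \<omega> * real_cond_exp P (G j) (\<lambda>\<omega>. b (\<epsilon> j \<omega>)) \<omega> = \<Phi> \<omega> * real_cond_exp P F (\<lambda>\<omega>. b (\<epsilon> j \<omega>)) \<omega>"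
    using real_cond_exp_past[OF j assms(2)] by eventually_elim simp
  show "integrable P (\<lambda>\<omega>. \<Phi> \<omega> * real_cond_exp P F (\<lambda>\<omega>. b (\<epsilon> j \<omega>)) \<omega>)"
    using r(1) AEeq by (subst integrable_cong_AE[symmetric]) auto
  show "(\<integral>\<omega>. \<Phi> \<omega> * b (\<epsilon> j \<omega>) \<partial>P) = (\<integral>\<omega>. \<Phi> \<omega> * real_cond_exp P F (\<lambda>\<omega>. b (\<epsilon> j \<omega>)) \<omega> \<partial>P)"
    using r(2) integral_cong_AE[OF _ _ AEeq] by auto
qed

text \<open>The one-step bound of the exponential supermartingale that controls all partial sums.\<close>

lemma nn_integral_past_exp:
  assumes j: "j \<in> {1..J}" and \<Phi>: "\<Phi> \<in> borel_measurable (G j)"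
  shows "(\<integral>\<^sup>+\<omega>. \<Phi> \<omega> * ennreal (exp (t * (\<epsilon> j \<omega> / sqrt (real J)))) \<partial>P) 
    \<le> ennreal (exp (s\<^sup>2 * t\<^sup>2 / 2)) * (\<integral>\<^sup>+\<omega>. \<Phi> \<omega> \<partial>P)"
proof -
  interpret G: finite_measure_subalgebra P "G j" by (rule finite_measure_subalgebra_G[OF j])
  note [measurable] = eps_meas[OF j] measurable_from_subalg[OF subalgebra_G[OF j] \<Phi>]
  let ?b = "\<lambda>x. ennreal (exp (t * (x / sqrt (real J))))"
  have b: "?b \<in> borel_measurable borel" by measurable
  have "(\<integral>\<^sup>+\<omega>. \<Phi> \<omega> * ?b (\<epsilon> j \<omega>) \<partial>P) = (\<integral>\<^sup>+\<omega>. \<Phi> \<omega> * nn_cond_exp P (G j) (\<lambda>\<omega>. ?b (\<epsilon> j \<omega>)) \<omega> \<partial>P)"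
    by (rule G.nn_cond_exp_intg[OF \<Phi>, symmetric]) auto
  also have "... \<le> (\<integral>\<^sup>+\<omega>. ennreal (exp (s\<^sup>2 * t\<^sup>2 / 2)) * \<Phi> \<omega> \<partial>P)"
  proof (rule nn_integral_mono_AE)
    show "AE \<omega> in P. \<Phi> \<omega> * nn_cond_exp P (G j) (\<lambda>\<omega>. ?b (\<epsilon> j \<omega>)) \<omega> \<le> ennreal (exp (s\<^sup>2 * t\<^sup>2 / 2)) * \<Phi> \<omega>"
      using nn_cond_exp_past[OF j b] eps_cond_subgaussian[OF j, of t]
      by eventually_elim (auto simp: mult.commute intro!: mult_left_mono)
  qed
  also have "... = ennreal (exp (s\<^sup>2 * t\<^sup>2 / 2)) * (\<integral>\<^sup>+\<omega>. \<Phi> \<omega> \<partial>P)"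
    by (rule nn_integral_cmult) measurable
  finally show ?thesis .
qed

end

section \<open>Exponential moments of the partial sums\<close>

text \<open>The constants below are written out because they must depend on \<open>s\<close>, \<open>M\<close>, \<open>K\<close> and \<open>C\<close> alone. They bound, in
  turn, the exponential moments of the partial sums, the third conditional moments, the fourth-order
  remainders of a Gaussian step and of the replacement of one noise variable, and the total error.\<close>

definition growth_const :: "real \<Rightarrow> real \<Rightarrow> real \<Rightarrow> real" where
  "growth_const s M C = exp (C * M + s\<^sup>2 * C\<^sup>2 / 2)"

definition third_const :: "real \<Rightarrow> real" where
  "third_const s = 12 * exp (s\<^sup>2 / 2)"

definition gauss_rem_const :: "real \<Rightarrow> real \<Rightarrow> real" where
  "gauss_rem_const K C = 48 * K ^ 4 * exp ((1 + C * K)\<^sup>2 / 2)"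

definition step_const :: "real \<Rightarrow> real \<Rightarrow> real \<Rightarrow> real \<Rightarrow> real" where
  "step_const s M K C = growth_const s M C * (48 * exp (s\<^sup>2 * (C + 1)\<^sup>2 / 2) + gauss_rem_const K C)"

definition lindeberg_const :: "real \<Rightarrow> real \<Rightarrow> real \<Rightarrow> real \<Rightarrow> real" where
  "lindeberg_const s M K C = exp (C\<^sup>2 * K\<^sup>2 / 2) *
     (step_const s M K C + third_const s * (step_const s M K C + third_const s * growth_const s M C)
       + third_const s * growth_const s M C * (K\<^sup>2 + gauss_rem_const K C))"

lemma jet_mono:
  assumes "jet C B U" "B \<le> B'"
  shows "jet C B' U"
  unfolding jet_def
proof (intro conjI allI)
  fix i x h
  show "U i \<in> borel_measurable borel" using assms(1) by (rule jetD)
  have c: "B * cosh (C * x) \<le> B' * cosh (C * x)"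
    using assms(2) by (intro mult_right_mono) auto
  show "\<bar>U i x\<bar> \<le> B' * cosh (C * x)"
    by (rule order_trans[OF jetD(2)[OF assms(1)] c])
  show "\<bar>U 0 (x + h) - (\<Sum>i<4. U i x * h ^ i / fact i)\<bar> \<le> B' * cosh (C * x) * (exp (C * \<bar>h\<bar>) * h ^ 4)"
    by (rule order_trans[OF jetD(4)[OF assms(1)] mult_right_mono[OF c]]) auto
qed

context noisy_unit
begin

abbreviation "growth \<equiv> growth_const s M"

abbreviation "step \<equiv> step_const s M K"

abbreviation "lind \<equiv> lindeberg_const s M K"

definition partial :: "nat \<Rightarrow> 'a \<Rightarrow> real" where
  "partial l \<omega> = \<theta> \<omega> + (\<Sum>j\<in>{1..l}. \<epsilon> j \<omega> / real J)"

lemma partial_0 [simp]: "partial 0 = \<theta>"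
  by (simp add: partial_def fun_eq_iff)

lemma partial_Suc: "partial (Suc l) \<omega> = partial l \<omega> + \<epsilon> (Suc l) \<omega> / real J"
  by (simp add: partial_def)

lemma partial_measurable: "l \<le> J \<Longrightarrow> partial l \<in> borel_measurable P"
  unfolding partial_def[abs_def] using eps_meas theta_meas
  by (intro borel_measurable_add borel_measurable_sum borel_measurable_divide) auto

lemma partial_G: "l < J \<Longrightarrow> partial l \<in> borel_measurable (G (Suc l))"
  unfolding partial_def[abs_def] using eps_G[of "Suc l"] theta_G[of "Suc l"]
  by (intro borel_measurable_add borel_measurable_sum borel_measurable_divide) auto

definition scaled :: "nat \<Rightarrow> 'a \<Rightarrow> real" where
  "scaled j \<omega> = \<epsilon> j \<omega> / sqrt (real J)"

lemma scaled_measurable: "j \<in> {1..J} \<Longrightarrow> scaled j \<in> borel_measurable P"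
  unfolding scaled_def[abs_def] using eps_meas by auto

lemma incr_scaled: "\<epsilon> j \<omega> / real J = scaled j \<omega> / sqrt (real J)"
  using J_ge_1 by (simp add: scaled_def)

lemma sqrt_J_le: "sqrt (real J) \<le> real J"
  using J_ge_1 real_sqrt_le_mono[of "real J" "(real J)\<^sup>2"] by (simp add: power2_eq_square)

lemma incr_le_scaled: "\<bar>\<epsilon> j \<omega> / real J\<bar> \<le> \<bar>scaled j \<omega>\<bar>"
proof -
  have "1 \<le> sqrt (real J)" using J_ge_1 by simp
  then have "\<bar>scaled j \<omega>\<bar> \<le> \<bar>scaled j \<omega>\<bar> * sqrt (real J)"
    by (metis abs_ge_zero mult.right_neutral mult_left_mono)
  then show ?thesis
    unfolding incr_scaled abs_divide using J_ge_1 by (simp add: pos_divide_le_eq)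
qed

text \<open>Each summand adds \<open>s\<^sup>2 * t\<^sup>2 / (2 * J)\<close> to the exponent, so the total does not grow with \<open>J\<close>.\<close>

lemma exp_partial:
  "l \<le> J \<Longrightarrow> (\<integral>\<^sup>+\<omega>. ennreal (exp (t * partial l \<omega>)) \<partial>P) \<le> ennreal (exp (\<bar>t\<bar> * M + s\<^sup>2 * t\<^sup>2 / 2 * (real l / real J)))"
proof (induction l)
  case 0
  have "(\<integral>\<^sup>+\<omega>. ennreal (exp (t * partial 0 \<omega>)) \<partial>P) \<le> (\<integral>\<^sup>+\<omega>. ennreal (exp (\<bar>t\<bar> * M)) \<partial>P)"
  proof (rule nn_integral_mono_AE)
    show "AE \<omega> in P. ennreal (exp (t * partial 0 \<omega>)) \<le> ennreal (exp (\<bar>t\<bar> * M))"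
      using theta_bounded
    proof eventually_elim
      case (elim \<omega>)
      have "t * \<theta> \<omega> \<le> \<bar>t\<bar> * \<bar>\<theta> \<omega>\<bar>" by (metis abs_ge_self abs_mult)
      also have "... \<le> \<bar>t\<bar> * M" using elim by (intro mult_left_mono) auto
      finally show ?case by (simp add: ennreal_leI)
    qed
  qed
  then show ?case by (simp add: emeasure_space_1)
next
  case (Suc l)
  then have l: "l < J" and j: "Suc l \<in> {1..J}" by auto
  have e: "ennreal (exp (t * partial (Suc l) \<omega>))
     = ennreal (exp (t * partial l \<omega>)) * ennreal (exp ((t / sqrt (real J)) * (\<epsilon> (Suc l) \<omega> / sqrt (real J))))" for \<omega>
    using J_ge_1 by (simp add: partial_Suc distrib_left exp_add ennreal_mult')
  have m: "(\<lambda>\<omega>. ennreal (exp (t * partial l \<omega>))) \<in> borel_measurable (G (Suc l))"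
    using partial_G[OF l] by measurable
  have "(\<integral>\<^sup>+\<omega>. ennreal (exp (t * partial (Suc l) \<omega>)) \<partial>P)
    \<le> ennreal (exp (s\<^sup>2 * (t / sqrt (real J))\<^sup>2 / 2)) * (\<integral>\<^sup>+\<omega>. ennreal (exp (t * partial l \<omega>)) \<partial>P)"
    unfolding e by (rule nn_integral_past_exp[OF j m])
  also have "... \<le> ennreal (exp (s\<^sup>2 * (t / sqrt (real J))\<^sup>2 / 2)) * ennreal (exp (\<bar>t\<bar> * M + s\<^sup>2 * t\<^sup>2 / 2 * (real l / real J)))"
    using Suc by (intro mult_left_mono) auto
  also have "... = ennreal (exp (s\<^sup>2 * (t / sqrt (real J))\<^sup>2 / 2 + (\<bar>t\<bar> * M + s\<^sup>2 * t\<^sup>2 / 2 * (real l / real J))))"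
    by (simp add: ennreal_mult'[symmetric] exp_add)
  also have "s\<^sup>2 * (t / sqrt (real J))\<^sup>2 / 2 + (\<bar>t\<bar> * M + s\<^sup>2 * t\<^sup>2 / 2 * (real l / real J))
     = \<bar>t\<bar> * M + s\<^sup>2 * t\<^sup>2 / 2 * (real (Suc l) / real J)"
    using J_ge_1 by (simp add: power_divide field_simps)
  finally show ?case .
qed

lemma cosh_partial:
  assumes "l \<le> J" "0 \<le> C"
  shows "(\<integral>\<^sup>+\<omega>. ennreal (cosh (C * partial l \<omega>)) \<partial>P) \<le> ennreal (growth C)"
proof -
  note [measurable] = partial_measurable[OF assms(1)]
  have r: "real l / real J \<le> 1" using assms J_ge_1 by simp
  have b: "\<bar>t\<bar> * M + s\<^sup>2 * t\<^sup>2 / 2 * (real l / real J) \<le> C * M + s\<^sup>2 * C\<^sup>2 / 2" if "t = C \<or> t = - C" for t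
    using mult_left_mono[OF r, of "s\<^sup>2 * t\<^sup>2 / 2"] that assms by auto
  have e: "(\<integral>\<^sup>+\<omega>. ennreal (exp (t * partial l \<omega>)) \<partial>P) \<le> ennreal (growth C)" if "t = C \<or> t = - C" for t
    using order_trans[OF exp_partial[OF assms(1), of t]] b[OF that] by (auto simp: growth_const_def intro: ennreal_leI)
  define h :: real where "h = 1 / 2"
  then have h: "h = 1 / 2" "0 \<le> h" by simp_all
  have "(\<integral>\<^sup>+\<omega>. ennreal (cosh (C * partial l \<omega>)) \<partial>P)
     = (\<integral>\<^sup>+\<omega>. ennreal h * (ennreal (exp (C * partial l \<omega>)) + ennreal (exp ((- C) * partial l \<omega>))) \<partial>P)"
  proof (rule nn_integral_cong)
    fix \<omega>
    have "cosh (C * partial l \<omega>) = h * (exp (C * partial l \<omega>) + exp ((- C) * partial l \<omega>))"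
      by (simp add: cosh_field_def h(1))
    then show "ennreal (cosh (C * partial l \<omega>)) = ennreal h * (ennreal (exp (C * partial l \<omega>)) + ennreal (exp ((- C) * partial l \<omega>)))"
      using h(2) by (simp add: ennreal_plus[symmetric] ennreal_mult'[symmetric] del: ennreal_plus)
  qed
  also have "... = ennreal h * ((\<integral>\<^sup>+\<omega>. ennreal (exp (C * partial l \<omega>)) \<partial>P) + (\<integral>\<^sup>+\<omega>. ennreal (exp ((- C) * partial l \<omega>)) \<partial>P))"
    by (subst nn_integral_cmult) (simp_all add: nn_integral_add)
  also have "... \<le> ennreal h * (ennreal (growth C) + ennreal (growth C))"
    using e[of C] e[of "-C"] by (intro mult_left_mono add_mono) auto
  also have "... = ennreal (growth C)"
    using h(2) by (simp add: ennreal_plus[symmetric] ennreal_mult'[symmetric] growth_const_def del: ennreal_plus)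
      (simp add: h(1))
  finally show ?thesis .
qed

lemma cosh_exp_partial:
  assumes "l < J" "0 \<le> C" "0 \<le> c"
  shows "integrable P (\<lambda>\<omega>. cosh (C * partial l \<omega>) * exp (c * \<bar>scaled (Suc l) \<omega>\<bar>))"
    and "(\<integral>\<omega>. cosh (C * partial l \<omega>) * exp (c * \<bar>scaled (Suc l) \<omega>\<bar>) \<partial>P) \<le> 2 * exp (s\<^sup>2 * c\<^sup>2 / 2) * growth C"
proof -
  have j: "Suc l \<in> {1..J}" and l: "l \<le> J" using assms by auto
  note [measurable] = partial_measurable[OF l] scaled_measurable[OF j]
  have m: "(\<lambda>\<omega>. ennreal (cosh (C * partial l \<omega>))) \<in> borel_measurable (G (Suc l))"
    using partial_G[OF assms(1)] by (simp add: cosh_field_def)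
  let ?c = "\<lambda>\<omega>. cosh (C * partial l \<omega>)" and ?X = "scaled (Suc l)"
  let ?f = "\<lambda>\<omega>. ?c \<omega> * exp (c * \<bar>?X \<omega>\<bar>)"
  have [measurable]: "?f \<in> borel_measurable P" by (simp add: cosh_field_def)
  have mm [measurable]: "(\<lambda>\<omega>. ennreal (?c \<omega>)) \<in> borel_measurable P" by (simp add: cosh_field_def)
  have one: "(\<integral>\<^sup>+\<omega>. ennreal (?c \<omega>) * ennreal (exp (t * ?X \<omega>)) \<partial>P) \<le> ennreal (exp (s\<^sup>2 * c\<^sup>2 / 2) * growth C)"
    if "t = c \<or> t = - c" for t
  proof -
    have "(\<integral>\<^sup>+\<omega>. ennreal (?c \<omega>) * ennreal (exp (t * ?X \<omega>)) \<partial>P)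
      \<le> ennreal (exp (s\<^sup>2 * t\<^sup>2 / 2)) * (\<integral>\<^sup>+\<omega>. ennreal (?c \<omega>) \<partial>P)"
      unfolding scaled_def by (rule nn_integral_past_exp[OF j m])
    also have "... \<le> ennreal (exp (s\<^sup>2 * t\<^sup>2 / 2)) * ennreal (growth C)"
      by (intro mult_left_mono cosh_partial l assms) auto
    also have "... = ennreal (exp (s\<^sup>2 * c\<^sup>2 / 2) * growth C)"
      using that by (auto simp: ennreal_mult'[symmetric])
    finally show ?thesis .
  qed
  have "(\<integral>\<^sup>+\<omega>. ennreal (?f \<omega>) \<partial>P) \<le> (\<integral>\<^sup>+\<omega>. ennreal (?c \<omega>) * ennreal (exp (c * ?X \<omega>)) + ennreal (?c \<omega>) * ennreal (exp ((-c) * ?X \<omega>)) \<partial>P)"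
  proof (rule nn_integral_mono)
    fix \<omega>
    have "exp (c * \<bar>?X \<omega>\<bar>) \<le> exp (c * ?X \<omega>) + exp ((-c) * ?X \<omega>)"
      by (cases "?X \<omega> \<ge> 0") auto
    then have "?f \<omega> \<le> ?c \<omega> * (exp (c * ?X \<omega>) + exp ((-c) * ?X \<omega>))"
      by (intro mult_left_mono) auto
    then have "ennreal (?f \<omega>) \<le> ennreal (?c \<omega> * exp (c * ?X \<omega>) + ?c \<omega> * exp ((-c) * ?X \<omega>))"
      by (intro ennreal_leI) (simp add: distrib_left)
    then show "ennreal (?f \<omega>) \<le> ennreal (?c \<omega>) * ennreal (exp (c * ?X \<omega>)) + ennreal (?c \<omega>) * ennreal (exp ((-c) * ?X \<omega>))"
      by (simp add: ennreal_mult' ennreal_plus)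
  qed
  also have "... = (\<integral>\<^sup>+\<omega>. ennreal (?c \<omega>) * ennreal (exp (c * ?X \<omega>)) \<partial>P) + (\<integral>\<^sup>+\<omega>. ennreal (?c \<omega>) * ennreal (exp ((-c) * ?X \<omega>)) \<partial>P)"
    by (rule nn_integral_add) measurable
  also have "... \<le> ennreal (exp (s\<^sup>2 * c\<^sup>2 / 2) * growth C) + ennreal (exp (s\<^sup>2 * c\<^sup>2 / 2) * growth C)"
    by (intro add_mono one) auto
  also have "... = ennreal (2 * exp (s\<^sup>2 * c\<^sup>2 / 2) * growth C)"
    by (simp add: ennreal_plus[symmetric] growth_const_def del: ennreal_plus)
  finally have le: "(\<integral>\<^sup>+\<omega>. ennreal (?f \<omega>) \<partial>P) \<le> ennreal (2 * exp (s\<^sup>2 * c\<^sup>2 / 2) * growth C)" .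
  show I: "integrable P ?f"
    by (rule integrableI_nonneg) (use le in \<open>auto simp: less_top[symmetric] top_unique\<close>)
  have "ennreal (\<integral>\<omega>. ?f \<omega> \<partial>P) \<le> ennreal (2 * exp (s\<^sup>2 * c\<^sup>2 / 2) * growth C)"
    using le nn_integral_eq_integral[OF I] by simp
  then show "(\<integral>\<omega>. ?f \<omega> \<partial>P) \<le> 2 * exp (s\<^sup>2 * c\<^sup>2 / 2) * growth C"
    by (subst (asm) ennreal_le_iff) (auto simp: growth_const_def)
qed

lemma cosh_partial_integrable:
  assumes "l \<le> J" "0 \<le> C"
  shows "integrable P (\<lambda>\<omega>. cosh (C * partial l \<omega>))"
    and "(\<integral>\<omega>. cosh (C * partial l \<omega>) \<partial>P) \<le> growth C"
proof -
  note [measurable] = partial_measurable[OF assms(1)]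
  have [measurable]: "(\<lambda>\<omega>. cosh (C * partial l \<omega>)) \<in> borel_measurable P" by (simp add: cosh_field_def)
  note le = cosh_partial[OF assms]
  show I: "integrable P (\<lambda>\<omega>. cosh (C * partial l \<omega>))"
    by (rule integrableI_nonneg) (use le in \<open>auto simp: less_top[symmetric] top_unique\<close>)
  have "ennreal (\<integral>\<omega>. cosh (C * partial l \<omega>) \<partial>P) \<le> ennreal (growth C)"
    using le nn_integral_eq_integral[OF I] by simp
  then show "(\<integral>\<omega>. cosh (C * partial l \<omega>) \<partial>P) \<le> growth C"
    by (subst (asm) ennreal_le_iff) (auto simp: growth_const_def)
qed

text \<open>Gaussian increments match the noise in the first two conditional moments only. The conditional third
  moments are the source of the correction term in the comparison below.\<close>

definition third :: "nat \<Rightarrow> 'a \<Rightarrow> real" where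
  "third l = real_cond_exp P F (\<lambda>\<omega>. (\<epsilon> (Suc l) \<omega> / real J) ^ 3)"

lemma third_F [measurable]: "third l \<in> borel_measurable F" 
  by (simp add: third_def)

text \<open>The third moment of the increment is of order \<open>J\<close> to the power -3/2, so that the \<open>J\<close> of them add up to
  a correction of order \<open>1 / sqrt J\<close>.\<close>

lemma third_bounded:
  assumes "l < J"
  shows "AE \<omega> in P. \<bar>third l \<omega>\<bar> \<le> third_const s / (real J * sqrt (real J))"
proof -
  have j: "Suc l \<in> {1..J}" using assms by auto
  note [measurable] = eps_meas[OF j] scaled_measurable[OF j]
  let ?X = "scaled (Suc l)" and ?N = "nn_cond_exp P F"
  define q where "q = 6 / (real J * sqrt (real J))"
  have q: "0 \<le> q" using J_ge_1 by (simp add: q_def)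
  let ?e = "\<lambda>t \<omega>. ennreal (exp (t * (\<epsilon> (Suc l) \<omega> / sqrt (real J))))"
  have pt: "ennreal \<bar>(\<epsilon> (Suc l) \<omega> / real J) ^ 3\<bar> \<le> ennreal q * (?e 1 \<omega> + ?e (-1) \<omega>)" for \<omega>
  proof -
    have "\<bar>?X \<omega>\<bar> ^ 3 \<le> fact 3 * exp \<bar>?X \<omega>\<bar>"
      by (rule power_le_fact_exp) auto
    also have "... \<le> 6 * (exp (1 * ?X \<omega>) + exp ((-1) * ?X \<omega>))"
      by (cases "?X \<omega> \<ge> 0") (auto simp: fact_numeral)
    finally have "\<bar>?X \<omega>\<bar> ^ 3 / (real J * sqrt (real J)) \<le> q * (exp (1 * ?X \<omega>) + exp ((-1) * ?X \<omega>))"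
      using J_ge_1 by (simp add: q_def divide_right_mono)
    moreover have "\<bar>(\<epsilon> (Suc l) \<omega> / real J) ^ 3\<bar> = \<bar>?X \<omega>\<bar> ^ 3 / (real J * sqrt (real J))"
      unfolding incr_scaled power_abs abs_divide by (simp add: power_divide power3_eq_cube)
    ultimately have "\<bar>(\<epsilon> (Suc l) \<omega> / real J) ^ 3\<bar> \<le> q * (exp (1 * ?X \<omega>) + exp ((-1) * ?X \<omega>))"
      by simp
    then show ?thesis
      using q by (simp add: ennreal_plus[symmetric] ennreal_mult'[symmetric] scaled_def ennreal_leI del: ennreal_plus)
  qed
  have a1: "AE \<omega> in P. ennreal \<bar>third l \<omega>\<bar> \<le> ?N (\<lambda>\<omega>. ennreal \<bar>(\<epsilon> (Suc l) \<omega> / real J) ^ 3\<bar>) \<omega>"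
    unfolding third_def by (rule F.real_cond_exp_abs) auto
  have a2: "AE \<omega> in P. ?N (\<lambda>\<omega>. ennreal \<bar>(\<epsilon> (Suc l) \<omega> / real J) ^ 3\<bar>) \<omega>
     \<le> ?N (\<lambda>\<omega>. ennreal q * (?e 1 \<omega> + ?e (-1) \<omega>)) \<omega>"
    by (rule F.nn_cond_exp_mono) (use pt in auto)
  have a3: "AE \<omega> in P. ?N (\<lambda>\<omega>. ennreal q * (?e 1 \<omega> + ?e (-1) \<omega>)) \<omega> = ennreal q * ?N (\<lambda>\<omega>. ?e 1 \<omega> + ?e (-1) \<omega>) \<omega>"
    by (rule AE_symmetric, rule F.nn_cond_exp_prod) auto
  have a4: "AE \<omega> in P. ?N (?e 1) \<omega> + ?N (?e (-1)) \<omega> = ?N (\<lambda>\<omega>. ?e 1 \<omega> + ?e (-1) \<omega>) \<omega>"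
    by (rule F.nn_cond_exp_sum) auto
  show ?thesis
    using a1 a2 a3 a4 eps_cond_subgaussian[OF j, of 1] eps_cond_subgaussian[OF j, of "-1"]
  proof eventually_elim
    case (elim \<omega>)
    have "ennreal \<bar>third l \<omega>\<bar> \<le> ennreal q * (?N (?e 1) \<omega> + ?N (?e (-1)) \<omega>)"
      using elim by simp
    also have "... \<le> ennreal q * (ennreal (exp (s\<^sup>2 / 2)) + ennreal (exp (s\<^sup>2 / 2)))"
      using elim by (intro mult_left_mono add_mono) auto
    also have "... = ennreal (third_const s / (real J * sqrt (real J)))"
      using q by (simp add: ennreal_plus[symmetric] ennreal_mult'[symmetric] third_const_def q_def del: ennreal_plus)
    finally show ?case
      by (subst (asm) ennreal_le_iff) (use J_ge_1 in \<open>auto simp: third_const_def\<close>)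
  qed
qed

abbreviation "\<tau> \<equiv> \<sigma> / sqrt (real J)"

lemma tau_pos: "0 < \<tau>" using sigma_pos J_ge_1 by simp

lemma tau_le: "\<tau> \<le> K"
proof -
  have "1 \<le> sqrt (real J)" using J_ge_1 by simp
  then have "\<tau> \<le> \<sigma>" using sigma_pos by (simp add: pos_divide_le_eq)
  then show ?thesis using sigma_le by linarith
qed

lemma gauss_rem:
  assumes "0 \<le> C"
  shows "48 * \<tau> ^ 4 * exp ((1 + C * \<tau>)\<^sup>2 / 2) \<le> gauss_rem_const K C / (real J)\<^sup>2"
proof -
  have "C * \<tau> \<le> C * K" "0 \<le> C * \<tau>"
    using tau_le tau_pos assms by (auto intro: mult_left_mono simp del: times_divide_eq_right)
  then have "(1 + C * \<tau>)\<^sup>2 \<le> (1 + C * K)\<^sup>2"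
    by (intro power_mono) linarith+
  then have "exp ((1 + C * \<tau>)\<^sup>2 / 2) \<le> exp ((1 + C * K)\<^sup>2 / 2)"
    by (simp del: times_divide_eq_right)
  moreover have "\<tau> ^ 4 \<le> K ^ 4 / (real J)\<^sup>2"
  proof -
    have "\<tau> ^ 4 = \<sigma> ^ 4 / (real J)\<^sup>2"
      using J_ge_1 by (simp add: power_divide power4_eq_xxxx power2_eq_square[of "real J"])
    then show ?thesis using sigma_pos sigma_le by (auto intro!: divide_right_mono power_mono)
  qed
  ultimately have "48 * \<tau> ^ 4 * exp ((1 + C * \<tau>)\<^sup>2 / 2) \<le> 48 * (K ^ 4 / (real J)\<^sup>2) * exp ((1 + C * K)\<^sup>2 / 2)"
    using tau_pos by (intro mult_mono) auto
  then show ?thesis by (simp add: gauss_rem_const_def field_simps)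
qed

end

section \<open>Replacing the noise by Gaussian variables\<close>

context noisy_unit
begin

lemma integrable_cosh_exp_dominated:
  assumes "l < J" "0 \<le> C" "0 \<le> c" "f \<in> borel_measurable P"
    and "AE \<omega> in P. \<bar>f \<omega>\<bar> \<le> A * (cosh (C * partial l \<omega>) * exp (c * \<bar>scaled (Suc l) \<omega>\<bar>))"
  shows "integrable P f"
proof (rule Bochner_Integration.integrable_bound)
  show "integrable P (\<lambda>\<omega>. A * (cosh (C * partial l \<omega>) * exp (c * \<bar>scaled (Suc l) \<omega>\<bar>)))"
    using cosh_exp_partial(1)[OF assms(1-3)] by simp
  show "AE \<omega> in P. norm (f \<omega>) \<le> norm (A * (cosh (C * partial l \<omega>) * exp (c * \<bar>scaled (Suc l) \<omega>\<bar>)))"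
    using assms(5) by eventually_elim (auto intro: order_trans[OF _ abs_ge_self])
qed fact

lemma integrable_cosh_dominated:
  assumes "l \<le> J" "0 \<le> C" "f \<in> borel_measurable P"
    and "AE \<omega> in P. \<bar>f \<omega>\<bar> \<le> A * cosh (C * partial l \<omega>)"
  shows "integrable P f"
proof (rule Bochner_Integration.integrable_bound)
  show "integrable P (\<lambda>\<omega>. A * cosh (C * partial l \<omega>))"
    using cosh_partial_integrable(1)[OF assms(1-2)] by simp
  show "AE \<omega> in P. norm (f \<omega>) \<le> norm (A * cosh (C * partial l \<omega>))"
    using assms(4) by eventually_elim (auto intro: order_trans[OF _ abs_ge_self])
qed fact

lemma cosh_incr_remainder:
  assumes "l < J" "0 \<le> C"
  defines "f \<equiv> (\<lambda>\<omega>. cosh (C * partial l \<omega>) * (exp (C * \<bar>\<epsilon> (Suc l) \<omega> / real J\<bar>) * (\<epsilon> (Suc l) \<omega> / real J) ^ 4))"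
  shows "integrable P f"
    and "(\<integral>\<omega>. f \<omega> \<partial>P) \<le> growth C * (48 * exp (s\<^sup>2 * (C + 1)\<^sup>2 / 2)) / (real J)\<^sup>2"
proof -
  have j: "Suc l \<in> {1..J}" and l: "l \<le> J" using assms by auto
  note [measurable] = partial_measurable[OF l] scaled_measurable[OF j] eps_meas[OF j]
  let ?X = "\<lambda>\<omega>. scaled (Suc l) \<omega>"
  let ?g = "\<lambda>\<omega>. cosh (C * partial l \<omega>) * exp ((C + 1) * \<bar>?X \<omega>\<bar>)"
  have fm: "f \<in> borel_measurable P" unfolding f_def by (simp add: cosh_field_def)
  have pw: "\<bar>f \<omega>\<bar> \<le> 24 / (real J)\<^sup>2 * ?g \<omega>" for \<omega>
  proof -
    have a: "exp (C * \<bar>\<epsilon> (Suc l) \<omega> / real J\<bar>) \<le> exp (C * \<bar>?X \<omega>\<bar>)"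
      using mult_left_mono[OF incr_le_scaled[of "Suc l" \<omega>] assms(2)] by (simp del: abs_divide)
    have "\<bar>?X \<omega>\<bar> ^ 4 \<le> fact 4 * exp \<bar>?X \<omega>\<bar>" by (rule power_le_fact_exp) auto
    then have "?X \<omega> ^ 4 \<le> 24 * exp \<bar>?X \<omega>\<bar>" by (simp add: fact_numeral)
    moreover have "(\<epsilon> (Suc l) \<omega> / real J) ^ 4 = ?X \<omega> ^ 4 / (real J)\<^sup>2"
    proof -
      have "sqrt (real J) ^ 4 = (real J)\<^sup>2"
        by (simp add: power4_eq_xxxx power2_eq_square[of "real J"])
      then show ?thesis unfolding incr_scaled power_divide by simp
    qed
    ultimately have b: "(\<epsilon> (Suc l) \<omega> / real J) ^ 4 \<le> 24 / (real J)\<^sup>2 * exp \<bar>?X \<omega>\<bar>"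
      using divide_right_mono[of "?X \<omega> ^ 4" "24 * exp \<bar>?X \<omega>\<bar>" "(real J)\<^sup>2"] by simp
    have "\<bar>f \<omega>\<bar> = f \<omega>" unfolding f_def by (intro abs_of_nonneg mult_nonneg_nonneg) auto
    also have "f \<omega> \<le> cosh (C * partial l \<omega>) * (exp (C * \<bar>?X \<omega>\<bar>) * (24 / (real J)\<^sup>2 * exp \<bar>?X \<omega>\<bar>))"
      unfolding f_def by (intro mult_left_mono mult_mono a b) auto
    also have "... = 24 / (real J)\<^sup>2 * ?g \<omega>"
      by (simp add: algebra_simps exp_add)
    finally show ?thesis .
  qed
  show I: "integrable P f"
    by (rule integrable_cosh_exp_dominated[OF assms(1,2), of "C + 1" f "24 / (real J)\<^sup>2"]) (use assms(2) pw fm in auto)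
  have "(\<integral>\<omega>. f \<omega> \<partial>P) \<le> (\<integral>\<omega>. 24 / (real J)\<^sup>2 * ?g \<omega> \<partial>P)"
    using I cosh_exp_partial(1)[OF assms(1,2), of "C + 1"] assms(2) order_trans[OF abs_ge_self pw]
    by (intro integral_mono) auto
  also have "... = 24 / (real J)\<^sup>2 * (\<integral>\<omega>. ?g \<omega> \<partial>P)" by simp
  also have "... \<le> 24 / (real J)\<^sup>2 * (2 * exp (s\<^sup>2 * (C + 1)\<^sup>2 / 2) * growth C)"
    using assms(2) by (intro mult_left_mono cosh_exp_partial(2) assms(1,2)) auto
  finally show "(\<integral>\<omega>. f \<omega> \<partial>P) \<le> growth C * (48 * exp (s\<^sup>2 * (C + 1)\<^sup>2 / 2)) / (real J)\<^sup>2"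
    by (simp add: field_simps)
qed

lemma consts_nonneg: "0 \<le> growth C" "0 \<le> gauss_rem_const K C" "0 \<le> third_const s"
  by (auto simp: growth_const_def gauss_rem_const_def third_const_def)

lemma step_const_nonneg: "0 \<le> step C"
  unfolding step_const_def using consts_nonneg by (intro mult_nonneg_nonneg add_nonneg_nonneg) auto

lemma integrable_weighted_growth:
  assumes "l \<le> J" "0 \<le> C" "u \<in> borel_measurable borel" "\<And>x. \<bar>u x\<bar> \<le> B * cosh (C * x)"
    and W: "W \<in> borel_measurable P" "AE \<omega> in P. \<bar>W \<omega>\<bar> \<le> w" "0 \<le> w"
  shows "integrable P (\<lambda>\<omega>. W \<omega> * u (partial l \<omega>))"
    and "\<bar>\<integral>\<omega>. W \<omega> * u (partial l \<omega>) \<partial>P\<bar> \<le> w * B * growth C"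
proof -
  note [measurable] = assms(3) W(1) partial_measurable[OF assms(1)]
  have pw: "AE \<omega> in P. \<bar>W \<omega> * u (partial l \<omega>)\<bar> \<le> w * B * cosh (C * partial l \<omega>)"
    using W(2)
  proof eventually_elim
    case (elim \<omega>)
    show ?case using abs_mult_bound[OF elim assms(4)] by (simp add: mult.assoc)
  qed
  show I: "integrable P (\<lambda>\<omega>. W \<omega> * u (partial l \<omega>))"
    by (rule integrable_cosh_dominated[OF assms(1,2) _ pw]) measurable
  have B: "0 \<le> B" using assms(4)[of 0] by simp
  have "\<bar>\<integral>\<omega>. W \<omega> * u (partial l \<omega>) \<partial>P\<bar> \<le> (\<integral>\<omega>. \<bar>W \<omega> * u (partial l \<omega>)\<bar> \<partial>P)"
    by (rule integral_abs_bound)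
  also have "... \<le> (\<integral>\<omega>. w * B * cosh (C * partial l \<omega>) \<partial>P)"
    using I pw cosh_partial_integrable(1)[OF assms(1,2)] by (intro integral_mono_AE) auto
  also have "... = w * B * (\<integral>\<omega>. cosh (C * partial l \<omega>) \<partial>P)" by simp
  also have "... \<le> w * B * growth C"
    using W(3) B cosh_partial_integrable(2)[OF assms(1,2)] by (intro mult_left_mono) auto
  finally show "\<bar>\<integral>\<omega>. W \<omega> * u (partial l \<omega>) \<partial>P\<bar> \<le> w * B * growth C" .
qed

text \<open>Both sides are expanded at the partial sum: the first moments vanish, the second moments agree, the
  Gaussian third moment is zero. What remains is the third moment of the noise and two fourth-order
  remainders. The weight \<open>W\<close> may be any bounded function of \<open>\<theta>\<close>.\<close>

lemma swap_one:
  assumes l: "l < J" and C: "0 \<le> C" and V: "jet C B V"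
    and W: "W \<in> borel_measurable F" and Wb: "AE \<omega> in P. \<bar>W \<omega>\<bar> \<le> w" and w: "0 \<le> w"
  shows "\<bar>(\<integral>\<omega>. W \<omega> * V 0 (partial (Suc l) \<omega>) \<partial>P) - (\<integral>\<omega>. W \<omega> * smooth \<tau> (V 0) (partial l \<omega>) \<partial>P)
     - (\<integral>\<omega>. W \<omega> * third l \<omega> * V 3 (partial l \<omega>) \<partial>P) / 6\<bar> \<le> w * B * step C / (real J)\<^sup>2"
proof -
  have j: "Suc l \<in> {1..J}" and lJ: "l \<le> J" "Suc l \<le> J" using l by auto
  note V' = jetD[OF V]
  have WP [measurable]: "W \<in> borel_measurable P" by (rule measurable_from_subalg[OF subalgebra_F W])
  have th [measurable]: "third l \<in> borel_measurable P" by (rule measurable_from_subalg[OF subalgebra_F third_F])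
  note [measurable] = V'(1) partial_measurable[OF lJ(1)] partial_measurable[OF lJ(2)] scaled_measurable[OF j] eps_meas[OF j]
  define \<eta> where "\<eta> = (\<lambda>\<omega>. \<epsilon> (Suc l) \<omega> / real J)"
  have [measurable]: "\<eta> \<in> borel_measurable P" unfolding \<eta>_def by measurable
  have partial_eta: "partial (Suc l) \<omega> = partial l \<omega> + \<eta> \<omega>" for \<omega> by (simp add: partial_Suc \<eta>_def)
  let ?S = "partial l" and ?c = "\<lambda>\<omega>. cosh (C * partial l \<omega>)" and ?X = "scaled (Suc l)"
  have [measurable]: "?c \<in> borel_measurable P" by (simp add: cosh_field_def)
  have WG: "W \<in> borel_measurable (G (Suc l))" by (rule F_G_measurable[OF j W])
  have VG: "(\<lambda>\<omega>. V i (?S \<omega>)) \<in> borel_measurable (G (Suc l))" for i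
    by (rule measurable_compose[OF partial_G[OF l] V'(1)])
  have eta_pow: "\<bar>\<eta> \<omega> ^ i\<bar> \<le> fact i * exp (1 * \<bar>?X \<omega>\<bar>)" for i \<omega>
  proof -
    have "\<bar>\<eta> \<omega>\<bar> ^ i \<le> \<bar>?X \<omega>\<bar> ^ i" unfolding \<eta>_def by (intro power_mono incr_le_scaled) auto
    also have "... \<le> fact i * exp \<bar>?X \<omega>\<bar>" by (rule power_le_fact_exp) auto
    finally show ?thesis by (simp add: power_abs)
  qed
  have WVpw: "AE \<omega> in P. \<bar>W \<omega> * V i (?S \<omega>)\<bar> \<le> w * B * ?c \<omega>" for i
    using Wb
  proof eventually_elim
    case (elim \<omega>)
    show ?case using abs_mult_bound[OF elim V'(2)[of i "?S \<omega>"]] by (simp add: mult.assoc)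
  qed
  have WVint: "integrable P (\<lambda>\<omega>. W \<omega> * V i (?S \<omega>))" for i
    by (rule integrable_weighted_growth(1)[OF lJ(1) C V'(1,2) WP Wb w])
  have WVe: "integrable P (\<lambda>\<omega>. W \<omega> * V i (?S \<omega>) * \<eta> \<omega> ^ m)" for i m
  proof (rule integrable_cosh_exp_dominated[OF l C, of 1 _ "w * B * fact m"])
    show "AE \<omega> in P. \<bar>W \<omega> * V i (?S \<omega>) * \<eta> \<omega> ^ m\<bar> \<le> w * B * fact m * (?c \<omega> * exp (1 * \<bar>?X \<omega>\<bar>))"
      using WVpw[of i]
    proof eventually_elim
      case (elim \<omega>)
      show ?case using abs_mult_bound[OF elim eta_pow[of \<omega> m]] by (simp add: mult_ac)
    qed
  qed simp_all
  have m1: "(\<integral>\<omega>. W \<omega> * V 1 (?S \<omega>) * \<eta> \<omega> ^ 1 \<partial>P) = 0"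
  proof -
    define \<Phi> where "\<Phi> = (\<lambda>\<omega>. W \<omega> * V 1 (?S \<omega>) / real J)"
    have \<Phi>: "\<Phi> \<in> borel_measurable (G (Suc l))" unfolding \<Phi>_def using WG VG by measurable
    have e: "W \<omega> * V 1 (?S \<omega>) * \<eta> \<omega> ^ 1 = \<Phi> \<omega> * \<epsilon> (Suc l) \<omega>" for \<omega> by (simp add: \<Phi>_def \<eta>_def)
    have "(\<integral>\<omega>. \<Phi> \<omega> * \<epsilon> (Suc l) \<omega> \<partial>P) = (\<integral>\<omega>. \<Phi> \<omega> * real_cond_exp P F (\<epsilon> (Suc l)) \<omega> \<partial>P)"
      using integral_past_times(2)[OF j, of "\<lambda>x. x", OF _ \<Phi>] WVe[of 1 1] unfolding e by simp
    also have "... = (\<integral>\<omega>. 0 \<partial>P)"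
      using eps_cond_mean[OF j] measurable_from_subalg[OF subalgebra_G[OF j] \<Phi>]
      by (intro integral_cong_AE) auto
    finally show ?thesis unfolding e by simp
  qed
  have m2: "(\<integral>\<omega>. W \<omega> * V 2 (?S \<omega>) * \<eta> \<omega> ^ 2 \<partial>P) = (\<integral>\<omega>. W \<omega> * V 2 (?S \<omega>) \<partial>P) * \<tau>\<^sup>2"
  proof -
    define \<Phi> where "\<Phi> = (\<lambda>\<omega>. W \<omega> * V 2 (?S \<omega>) / (real J)\<^sup>2)"
    have \<Phi>: "\<Phi> \<in> borel_measurable (G (Suc l))" unfolding \<Phi>_def using WG VG by measurable
    have e: "W \<omega> * V 2 (?S \<omega>) * \<eta> \<omega> ^ 2 = \<Phi> \<omega> * (\<epsilon> (Suc l) \<omega>)\<^sup>2" for \<omega> by (simp add: \<Phi>_def \<eta>_def power_divide)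
    have "(\<integral>\<omega>. \<Phi> \<omega> * (\<epsilon> (Suc l) \<omega>)\<^sup>2 \<partial>P) = (\<integral>\<omega>. \<Phi> \<omega> * real_cond_exp P F (\<lambda>\<omega>. (\<epsilon> (Suc l) \<omega>)\<^sup>2) \<omega> \<partial>P)"
      using integral_past_times(2)[OF j, of "\<lambda>x. x\<^sup>2", OF _ \<Phi>] WVe[of 2 2] unfolding e by simp
    also have "... = (\<integral>\<omega>. \<Phi> \<omega> * (\<sigma>\<^sup>2 * real J) \<partial>P)"
      using eps_cond_square[OF j] measurable_from_subalg[OF subalgebra_G[OF j] \<Phi>]
      by (intro integral_cong_AE) auto
    also have "... = (\<integral>\<omega>. W \<omega> * V 2 (?S \<omega>) * \<tau>\<^sup>2 \<partial>P)"
      using J_ge_1 by (intro Bochner_Integration.integral_cong refl) (simp add: \<Phi>_def power_divide power2_eq_square field_simps)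
    finally show ?thesis unfolding e by simp
  qed
  have m3: "(\<integral>\<omega>. W \<omega> * V 3 (?S \<omega>) * \<eta> \<omega> ^ 3 \<partial>P) = (\<integral>\<omega>. W \<omega> * third l \<omega> * V 3 (?S \<omega>) \<partial>P)"
  proof -
    have \<Phi>: "(\<lambda>\<omega>. W \<omega> * V 3 (?S \<omega>)) \<in> borel_measurable (G (Suc l))" using WG VG by measurable
    have "(\<integral>\<omega>. W \<omega> * V 3 (?S \<omega>) * \<eta> \<omega> ^ 3 \<partial>P) = (\<integral>\<omega>. W \<omega> * V 3 (?S \<omega>) * third l \<omega> \<partial>P)"
      using integral_past_times(2)[OF j, of "\<lambda>x. (x / real J) ^ 3", OF _ \<Phi>] WVe[of 3 3] unfolding \<eta>_def third_def by simp
    then show ?thesis by (simp add: mult_ac)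
  qed
  define T where "T = (\<lambda>\<omega>. \<Sum>i<4. V i (?S \<omega>) * \<eta> \<omega> ^ i / fact i)"
  have s4: "W \<omega> * T \<omega> = W \<omega> * V 0 (?S \<omega>) + W \<omega> * V 1 (?S \<omega>) * \<eta> \<omega> ^ 1 + W \<omega> * V 2 (?S \<omega>) * \<eta> \<omega> ^ 2 / 2
      + W \<omega> * V 3 (?S \<omega>) * \<eta> \<omega> ^ 3 / 6" for \<omega>
    unfolding T_def by (simp add: numeral_eq_Suc algebra_simps)
  have Tint: "integrable P (\<lambda>\<omega>. W \<omega> * T \<omega>)"
    unfolding s4 using WVint[of 0] WVe[of 1 1] WVe[of 2 2] WVe[of 3 3] by auto
  have ET: "(\<integral>\<omega>. W \<omega> * T \<omega> \<partial>P) = (\<integral>\<omega>. W \<omega> * V 0 (?S \<omega>) \<partial>P) + (\<integral>\<omega>. W \<omega> * V 2 (?S \<omega>) \<partial>P) * \<tau>\<^sup>2 / 2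
     + (\<integral>\<omega>. W \<omega> * third l \<omega> * V 3 (?S \<omega>) \<partial>P) / 6"
    unfolding s4 using WVint[of 0] WVe[of 1 1] WVe[of 2 2] WVe[of 3 3] m1 m2 m3
    by (simp del: power_one_right times_divide_eq_left)
  have Sint: "integrable P (\<lambda>\<omega>. W \<omega> * V 0 (partial (Suc l) \<omega>))"
    by (rule integrable_weighted_growth(1)[OF lJ(2) C V'(1,2) WP Wb w])
  note Vs = jetD[OF jet_smooth[OF tau_pos C V]]
  have Gint: "integrable P (\<lambda>\<omega>. W \<omega> * smooth \<tau> (V 0) (?S \<omega>))"
    by (rule integrable_weighted_growth(1)[OF lJ(1) C Vs(1,2) WP Wb w])
  let ?f = "\<lambda>\<omega>. ?c \<omega> * (exp (C * \<bar>\<eta> \<omega>\<bar>) * \<eta> \<omega> ^ 4)"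
  have eta_pt: "\<epsilon> (Suc l) \<omega> / real J = \<eta> \<omega>" for \<omega> by (simp add: \<eta>_def)
  note rem = cosh_incr_remainder[OF l C, unfolded eta_pt]
  have "\<bar>(\<integral>\<omega>. W \<omega> * V 0 (partial (Suc l) \<omega>) \<partial>P) - (\<integral>\<omega>. W \<omega> * T \<omega> \<partial>P)\<bar> \<le> (\<integral>\<omega>. w * B * ?f \<omega> \<partial>P)"
  proof (rule abs_integral_diff_le[OF Sint Tint])
    show "AE \<omega> in P. \<bar>W \<omega> * V 0 (partial (Suc l) \<omega>) - W \<omega> * T \<omega>\<bar> \<le> w * B * ?f \<omega>"
      using Wb
    proof eventually_elim
      case (elim \<omega>)
      have "\<bar>V 0 (?S \<omega> + \<eta> \<omega>) - T \<omega>\<bar> \<le> B * ?c \<omega> * (exp (C * \<bar>\<eta> \<omega>\<bar>) * \<eta> \<omega> ^ 4)"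
        unfolding T_def by (rule V'(4))
      from abs_mult_bound[OF elim this] show ?case
        by (simp add: partial_eta right_diff_distrib mult.assoc)
    qed
  qed (use rem(1) in auto)
  also have "... = w * B * (\<integral>\<omega>. ?f \<omega> \<partial>P)" by simp
  also have "... \<le> w * B * (growth C * (48 * exp (s\<^sup>2 * (C + 1)\<^sup>2 / 2)) / (real J)\<^sup>2)"
    using rem(2) w V'(3) by (intro mult_left_mono) auto
  finally have d1: "\<bar>(\<integral>\<omega>. W \<omega> * V 0 (partial (Suc l) \<omega>) \<partial>P) - (\<integral>\<omega>. W \<omega> * T \<omega> \<partial>P)\<bar>
    \<le> w * B * (growth C * (48 * exp (s\<^sup>2 * (C + 1)\<^sup>2 / 2)) / (real J)\<^sup>2)" .
  let ?R = "\<lambda>\<omega>. W \<omega> * V 0 (?S \<omega>) + W \<omega> * V 2 (?S \<omega>) * (\<tau>\<^sup>2 / 2)"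
  have Rint: "integrable P ?R" using WVint[of 0] WVint[of 2] by auto
  have ER: "(\<integral>\<omega>. ?R \<omega> \<partial>P) = (\<integral>\<omega>. W \<omega> * V 0 (?S \<omega>) \<partial>P) + (\<integral>\<omega>. W \<omega> * V 2 (?S \<omega>) \<partial>P) * \<tau>\<^sup>2 / 2"
    using WVint[of 0] WVint[of 2] by simp
  have "\<bar>(\<integral>\<omega>. W \<omega> * smooth \<tau> (V 0) (?S \<omega>) \<partial>P) - (\<integral>\<omega>. ?R \<omega> \<partial>P)\<bar>
     \<le> (\<integral>\<omega>. w * B * (gauss_rem_const K C / (real J)\<^sup>2) * ?c \<omega> \<partial>P)"
  proof (rule abs_integral_diff_le[OF Gint Rint])
    show "AE \<omega> in P. \<bar>W \<omega> * smooth \<tau> (V 0) (?S \<omega>) - ?R \<omega>\<bar> \<le> w * B * (gauss_rem_const K C / (real J)\<^sup>2) * ?c \<omega>"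
      using Wb
    proof eventually_elim
      case (elim \<omega>)
      have "\<bar>smooth \<tau> (V 0) (?S \<omega>) - (V 0 (?S \<omega>) + V 2 (?S \<omega>) * \<tau>\<^sup>2 / 2)\<bar>
         \<le> B * ?c \<omega> * (48 * \<tau> ^ 4 * exp ((1 + C * \<tau>)\<^sup>2 / 2))"
        by (rule smooth_jet_expansion[OF tau_pos C V])
      also have "... \<le> B * ?c \<omega> * (gauss_rem_const K C / (real J)\<^sup>2)"
        using V'(3) by (intro mult_left_mono gauss_rem C) auto
      finally have "\<bar>smooth \<tau> (V 0) (?S \<omega>) - (V 0 (?S \<omega>) + V 2 (?S \<omega>) * \<tau>\<^sup>2 / 2)\<bar>
         \<le> B * ?c \<omega> * (gauss_rem_const K C / (real J)\<^sup>2)" .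
      from abs_mult_bound[OF elim this] show ?case
        by (simp add: algebra_simps)
    qed
  qed (use cosh_partial_integrable(1)[OF lJ(1) C] in auto)
  also have "... = w * B * (gauss_rem_const K C / (real J)\<^sup>2) * (\<integral>\<omega>. ?c \<omega> \<partial>P)" by simp
  also have "... \<le> w * B * (gauss_rem_const K C / (real J)\<^sup>2) * growth C"
    using cosh_partial_integrable(2)[OF lJ(1) C] w V'(3) consts_nonneg by (intro mult_left_mono) auto
  finally have d2: "\<bar>(\<integral>\<omega>. W \<omega> * smooth \<tau> (V 0) (?S \<omega>) \<partial>P) - (\<integral>\<omega>. ?R \<omega> \<partial>P)\<bar>
    \<le> w * B * (gauss_rem_const K C / (real J)\<^sup>2) * growth C" .
  have eqc: "w * B * step C / (real J)\<^sup>2 = w * B * (growth C * (48 * exp (s\<^sup>2 * (C + 1)\<^sup>2 / 2)) / (real J)\<^sup>2)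
     + w * B * (gauss_rem_const K C / (real J)\<^sup>2) * growth C"
    by (simp add: step_const_def add_divide_distrib algebra_simps)
  show ?thesis
    using d1 d2 unfolding ET ER eqc by linarith
qed

end

lemma telescope_bound:
  fixes a d :: "nat \<Rightarrow> real"
  assumes "\<And>l. l < n \<Longrightarrow> \<bar>a (Suc l) - a l - d l\<bar> \<le> e"
  shows "\<bar>a n - a 0 - (\<Sum>l<n. d l)\<bar> \<le> real n * e"
  using assms
proof (induction n)
  case (Suc n)
  have "\<bar>a n - a 0 - (\<Sum>l<n. d l)\<bar> \<le> real n * e" by (rule Suc.IH) (use Suc.prems in auto)
  moreover have "\<bar>a (Suc n) - a n - d n\<bar> \<le> e" by (rule Suc.prems) auto
  moreover have "real (Suc n) * e = real n * e + e" by (simp add: algebra_simps)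
  moreover have "(\<Sum>l<Suc n. d l) = (\<Sum>l<n. d l) + d n" by simp
  ultimately show ?case by linarith
qed simp

context noisy_unit
begin

lemma jet_iterates:
  assumes "0 \<le> C" "jet C B U" "m \<le> J"
  shows "jet C (B * exp (C\<^sup>2 * K\<^sup>2 / 2)) (\<lambda>i. (smooth \<tau> ^^ m) (U i))"
proof (rule jet_mono[OF jet_smooth_funpow[OF tau_pos assms(1,2)]])
  have "\<tau>\<^sup>2 * real m \<le> \<tau>\<^sup>2 * real J" using assms(3) by (intro mult_left_mono) auto
  also have "... = \<sigma>\<^sup>2" using J_ge_1 by (simp add: power_divide)
  also have "... \<le> K\<^sup>2" using sigma_pos sigma_le by (intro power_mono) auto
  finally have "C\<^sup>2 / 2 * (\<tau>\<^sup>2 * real m) \<le> C\<^sup>2 / 2 * K\<^sup>2" by (intro mult_left_mono) auto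
  then have "C\<^sup>2 * \<tau>\<^sup>2 / 2 * real m \<le> C\<^sup>2 * K\<^sup>2 / 2" by (simp add: algebra_simps)
  then show "B * exp (C\<^sup>2 * \<tau>\<^sup>2 / 2 * real m) \<le> B * exp (C\<^sup>2 * K\<^sup>2 / 2)"
    using jetD(3)[OF assms(2)] by (intro mult_left_mono) auto
qed

lemma smooth_tau_funpow_J:
  assumes "0 \<le> C" "jet C B U"
  shows "(smooth \<tau> ^^ J) (U i) = smooth \<sigma> (U i)"
proof -
  obtain m where m: "J = Suc m" using J_ge_1 by (cases J) auto
  have "(smooth \<tau> ^^ Suc m) (U i) = smooth (\<tau> * sqrt (real (Suc m))) (U i)"
    by (rule smooth_funpow[OF tau_pos assms(1) jetD(1,2)[OF assms(2)]])
  also have "\<tau> * sqrt (real (Suc m)) = \<sigma>" using m by simp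
  finally show ?thesis using m by simp
qed

text \<open>The correction terms of different replacements are evaluated at different partial sums. Moving the argument
  back to \<open>\<theta>\<close> is itself a chain of replacements, to be controlled only up to \<open>1 / sqrt J\<close>: the weights that
  multiply these terms are of order \<open>J\<close> to the power -3/2.\<close>

lemma weighted_drift:
  assumes l: "l < J" and C: "0 \<le> C" and U: "jet C B U"
    and W: "W \<in> borel_measurable F" and Wb: "AE \<omega> in P. \<bar>W \<omega>\<bar> \<le> w" and w: "0 \<le> w"
  defines "D \<equiv> exp (C\<^sup>2 * K\<^sup>2 / 2)"
  shows "\<bar>(\<integral>\<omega>. W \<omega> * (smooth \<tau> ^^ (J - Suc l)) (U 0) (partial l \<omega>) \<partial>P)
      - (\<integral>\<omega>. W \<omega> * smooth \<sigma> (U 0) (\<theta> \<omega>) \<partial>P)\<bar>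
    \<le> w * B * D * ((step C + third_const s * growth C) / sqrt (real J)
       + growth C * (K\<^sup>2 + gauss_rem_const K C) / real J)"
proof -
  define g3 where "g3 = third_const s / (real J * sqrt (real J))"
  have g3: "0 \<le> g3" using consts_nonneg J_ge_1 by (simp add: g3_def)
  have B: "0 \<le> B" by (rule jetD(3)[OF U])
  have D: "0 < D" by (simp add: D_def)
  have WP [measurable]: "W \<in> borel_measurable P" by (rule measurable_from_subalg[OF subalgebra_F W])
  have J1: "1 \<le> real J" "0 < real J" "1 \<le> sqrt (real J)" using J_ge_1 by auto
  have JJ: "real J * sqrt (real J) \<le> (real J)\<^sup>2"
  proof -
    have "sqrt (real J) \<le> real J" by (rule sqrt_J_le)
    then show ?thesis using J1 by (simp add: power2_eq_square)
  qed
  define e where "e i = (\<integral>\<omega>. W \<omega> * (smooth \<tau> ^^ (J - Suc i)) (U 0) (partial i \<omega>) \<partial>P)" for i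
  define \<delta> where "\<delta> = w * B * D * (step C + third_const s * growth C) / (real J * sqrt (real J))"
  have step: "\<bar>e (Suc i) - e i - 0\<bar> \<le> \<delta>" if i: "i < l" for i
  proof -
    define V where "V = (\<lambda>k. (smooth \<tau> ^^ (J - Suc (Suc i))) (U k))"
    have V: "jet C (B * D) V" unfolding V_def D_def by (rule jet_iterates[OF C U]) auto
    have iJ: "i < J" using i l by auto
    have ei: "e (Suc i) = (\<integral>\<omega>. W \<omega> * V 0 (partial (Suc i) \<omega>) \<partial>P)" by (simp add: e_def V_def)
    have "J - Suc i = Suc (J - Suc (Suc i))" using i l by auto
    then have eii: "e i = (\<integral>\<omega>. W \<omega> * smooth \<tau> (V 0) (partial i \<omega>) \<partial>P)"
      by (simp add: e_def V_def)
    have Wt: "AE \<omega> in P. \<bar>W \<omega> * third i \<omega>\<bar> \<le> w * g3"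
      using Wb third_bounded[OF iJ] by eventually_elim (unfold g3_def, rule abs_mult_bound)
    have tm: "(\<lambda>\<omega>. W \<omega> * third i \<omega>) \<in> borel_measurable P"
      using measurable_from_subalg[OF subalgebra_F third_F] by measurable
    have "\<bar>\<integral>\<omega>. W \<omega> * third i \<omega> * V 3 (partial i \<omega>) \<partial>P\<bar> \<le> w * g3 * (B * D) * growth C"
      by (rule integrable_weighted_growth(2)[OF _ C jetD(1,2)[OF V] tm Wt]) (use iJ w g3 in auto)
    moreover have "\<bar>e (Suc i) - e i - (\<integral>\<omega>. W \<omega> * third i \<omega> * V 3 (partial i \<omega>) \<partial>P) / 6\<bar> \<le> w * (B * D) * step C / (real J)\<^sup>2"
      unfolding ei eii by (rule swap_one[OF iJ C V W Wb w])
    ultimately have "\<bar>e (Suc i) - e i\<bar> \<le> w * (B * D) * step C / (real J)\<^sup>2 + w * g3 * (B * D) * growth C"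
      by linarith
    also have "... \<le> w * (B * D) * step C / (real J * sqrt (real J)) + w * g3 * (B * D) * growth C"
      using w B D step_const_nonneg JJ J1 by (intro add_right_mono divide_left_mono) auto
    also have "... = \<delta>"
      unfolding \<delta>_def g3_def by (simp add: add_divide_distrib distrib_left algebra_simps)
    finally show ?thesis by simp
  qed
  have "\<bar>e l - e 0\<bar> \<le> real l * \<delta>"
    using telescope_bound[of l e "\<lambda>_. 0" \<delta>, OF step] by simp
  also have "... \<le> real J * \<delta>"
    using l w B D step_const_nonneg consts_nonneg J1 unfolding \<delta>_def by (intro mult_right_mono) auto
  also have "... = w * B * D * ((step C + third_const s * growth C) / sqrt (real J))"
    using J1 by (simp add: \<delta>_def)
  finally have A1: "\<bar>e l - e 0\<bar> \<le> w * B * D * ((step C + third_const s * growth C) / sqrt (real J))" .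
  \<comment> \<open>The chain ends one Gaussian step short of variance \<open>\<sigma>\<^sup>2\<close>; that step changes the value by order \<open>1 / J\<close>.\<close>
  define V where "V = (\<lambda>k. (smooth \<tau> ^^ (J - Suc 0)) (U k))"
  have V: "jet C (B * D) V" unfolding V_def D_def by (rule jet_iterates[OF C U]) auto
  have e0: "e 0 = (\<integral>\<omega>. W \<omega> * V 0 (partial 0 \<omega>) \<partial>P)" by (simp add: e_def V_def)
  have "smooth \<tau> (V 0) = (smooth \<tau> ^^ Suc (J - Suc 0)) (U 0)" by (simp add: V_def)
  also have "Suc (J - Suc 0) = J" using J_ge_1 by auto
  finally have sV: "smooth \<tau> (V 0) = smooth \<sigma> (U 0)" using smooth_tau_funpow_J[OF C U] by simp
  have diff: "\<bar>V 0 x - smooth \<tau> (V 0) x\<bar> \<le> (B * D * (K\<^sup>2 + gauss_rem_const K C) / real J) * cosh (C * x)" for x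
  proof -
    have "\<bar>smooth \<tau> (V 0) x - (V 0 x + V 2 x * \<tau>\<^sup>2 / 2)\<bar> \<le> B * D * cosh (C * x) * (48 * \<tau> ^ 4 * exp ((1 + C * \<tau>)\<^sup>2 / 2))"
      by (rule smooth_jet_expansion[OF tau_pos C V])
    also have "... \<le> B * D * cosh (C * x) * (gauss_rem_const K C / (real J)\<^sup>2)"
      using B D by (intro mult_left_mono gauss_rem C) auto
    also have "... \<le> B * D * cosh (C * x) * (gauss_rem_const K C / real J)"
      using B D J1 consts_nonneg by (intro mult_left_mono divide_left_mono) (auto simp: power2_eq_square)
    finally have 1: "\<bar>smooth \<tau> (V 0) x - (V 0 x + V 2 x * \<tau>\<^sup>2 / 2)\<bar> \<le> B * D * cosh (C * x) * (gauss_rem_const K C / real J)" .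
    have t2: "\<tau>\<^sup>2 / 2 \<le> K\<^sup>2 / real J"
    proof -
      have "\<sigma>\<^sup>2 \<le> K\<^sup>2" using sigma_pos sigma_le by (intro power_mono) auto
      then have "\<sigma>\<^sup>2 / real J \<le> K\<^sup>2 / real J" by (intro divide_right_mono) auto
      moreover have "\<tau>\<^sup>2 = \<sigma>\<^sup>2 / real J" by (simp add: power_divide)
      moreover have "0 \<le> \<tau>\<^sup>2" by simp
      ultimately show ?thesis by linarith
    qed
    have "\<bar>V 2 x * (\<tau>\<^sup>2 / 2)\<bar> \<le> (B * D * cosh (C * x)) * (K\<^sup>2 / real J)"
      by (rule abs_mult_bound[OF jetD(2)[OF V]]) (use t2 in simp)
    with 1 have "\<bar>V 0 x - smooth \<tau> (V 0) x\<bar> \<le> B * D * cosh (C * x) * (gauss_rem_const K C / real J) + (B * D * cosh (C * x)) * (K\<^sup>2 / real J)"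
      by (simp only: times_divide_eq_right)
    then show ?thesis by (simp add: add_divide_distrib algebra_simps)
  qed
  note Vs = jetD[OF jet_smooth[OF tau_pos C V]]
  have i1: "integrable P (\<lambda>\<omega>. W \<omega> * V 0 (partial 0 \<omega>))"
    by (rule integrable_weighted_growth(1)[OF _ C jetD(1,2)[OF V] WP Wb w]) simp
  have i2: "integrable P (\<lambda>\<omega>. W \<omega> * smooth \<tau> (V 0) (partial 0 \<omega>))"
    by (rule integrable_weighted_growth(1)[OF _ C Vs(1,2) WP Wb w]) simp
  have "\<bar>\<integral>\<omega>. W \<omega> * (\<lambda>x. V 0 x - smooth \<tau> (V 0) x) (partial 0 \<omega>) \<partial>P\<bar> \<le> w * (B * D * (K\<^sup>2 + gauss_rem_const K C) / real J) * growth C"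
    by (rule integrable_weighted_growth(2)[OF _ C _ diff WP Wb w]) (use jetD(1)[OF V] Vs(1)[of 0] in auto)
  then have "\<bar>e 0 - (\<integral>\<omega>. W \<omega> * smooth \<sigma> (U 0) (\<theta> \<omega>) \<partial>P)\<bar> \<le> w * (B * D * (K\<^sup>2 + gauss_rem_const K C) / real J) * growth C"
    using i1 i2 unfolding e0 sV by (simp add: right_diff_distrib)
  with A1 have "\<bar>e l - (\<integral>\<omega>. W \<omega> * smooth \<sigma> (U 0) (\<theta> \<omega>) \<partial>P)\<bar> \<le>
     w * B * D * ((step C + third_const s * growth C) / sqrt (real J))
     + w * (B * D * (K\<^sup>2 + gauss_rem_const K C) / real J) * growth C"
    by linarith
  also have "... = w * B * D * ((step C + third_const s * growth C) / sqrt (real J)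
       + growth C * (K\<^sup>2 + gauss_rem_const K C) / real J)"
    by (simp add: algebra_simps)
  finally show ?thesis unfolding e_def .
qed

text \<open>Third moments of independent centred variables add, so this is a sixth of the conditional third moment of
  the averaged noise.\<close>

definition skew :: "'a \<Rightarrow> real" where
  "skew \<omega> = (\<Sum>l<J. third l \<omega>) / 6"

lemma skew_F: "skew \<in> borel_measurable F"
  unfolding skew_def[abs_def] by measurable

lemma skew_bounded: "AE \<omega> in P. \<bar>skew \<omega>\<bar> \<le> third_const s / sqrt (real J)"
proof -
  have "AE \<omega> in P. \<forall>l\<in>{..<J}. \<bar>third l \<omega>\<bar> \<le> third_const s / (real J * sqrt (real J))"
    by (rule AE_finite_allI) (use third_bounded in auto)
  then show ?thesis
  proof eventually_elim
    case (elim \<omega>)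
    have "\<bar>\<Sum>l<J. third l \<omega>\<bar> \<le> (\<Sum>l<J. \<bar>third l \<omega>\<bar>)" by (rule sum_abs)
    also have "... \<le> (\<Sum>l<J. third_const s / (real J * sqrt (real J)))"
      using elim by (intro sum_mono) auto
    also have "... = third_const s / sqrt (real J)" using J_ge_1 by simp
    finally have "\<bar>\<Sum>l<J. third l \<omega>\<bar> \<le> third_const s / sqrt (real J)" .
    moreover have "0 \<le> third_const s / sqrt (real J)" using consts_nonneg by simp
    moreover have "\<bar>(\<Sum>l<J. third l \<omega>) / 6\<bar> = \<bar>\<Sum>l<J. third l \<omega>\<bar> / 6" by simp
    ultimately have "\<bar>(\<Sum>l<J. third l \<omega>) / 6\<bar> \<le> third_const s / sqrt (real J)" by linarith
    then show ?case by (simp add: skew_def)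
  qed
qed

text \<open>The hybrids that use the noise for the first \<open>l\<close> summands and Gaussian variables for the other \<open>J - l\<close> are
  telescoped in \<open>l\<close>. The remainders of order \<open>J\<close> to the power -2 add up to \<open>1 / J\<close>; the third-order terms are
  not estimated but collected, since bounding them here would cost \<open>1 / sqrt J\<close>.\<close>

theorem lindeberg:
  assumes C: "0 \<le> C" and U: "jet C B U" and U3: "jet C B (\<lambda>i. U (i + 3))"
    and W: "W \<in> borel_measurable F" and Wb: "AE \<omega> in P. \<bar>W \<omega>\<bar> \<le> w" and w: "0 \<le> w"
  shows "\<bar>(\<integral>\<omega>. W \<omega> * U 0 (partial J \<omega>) \<partial>P) - (\<integral>\<omega>. W \<omega> * smooth \<sigma> (U 0) (\<theta> \<omega>) \<partial>P)
     - (\<integral>\<omega>. W \<omega> * skew \<omega> * smooth \<sigma> (U 3) (\<theta> \<omega>) \<partial>P)\<bar> \<le> w * B * lind C / real J"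
proof -
  define D where "D = exp (C\<^sup>2 * K\<^sup>2 / 2)"
  define g3 where "g3 = third_const s / (real J * sqrt (real J))"
  have g3: "0 \<le> g3" using consts_nonneg J_ge_1 by (simp add: g3_def)
  have J1: "1 \<le> real J" "0 < real J" "1 \<le> sqrt (real J)" using J_ge_1 by auto
  have B: "0 \<le> B" by (rule jetD(3)[OF U])
  have D: "0 < D" by (simp add: D_def)
  have WP [measurable]: "W \<in> borel_measurable P" by (rule measurable_from_subalg[OF subalgebra_F W])
  have tP [measurable]: "third l \<in> borel_measurable P" for l
    by (rule measurable_from_subalg[OF subalgebra_F third_F])
  note sU3' = jetD[OF jet_smooth[OF sigma_pos C U3]]
  have sU3: "smooth \<sigma> (U 3) \<in> borel_measurable borel"
    "\<And>x. \<bar>smooth \<sigma> (U 3) x\<bar> \<le> B * exp (C\<^sup>2 * \<sigma>\<^sup>2 / 2) * cosh (C * x)"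
    using sU3'(1)[of 0] sU3'(2)[of 0] by simp_all
  define a where "a l = (\<integral>\<omega>. W \<omega> * (smooth \<tau> ^^ (J - l)) (U 0) (partial l \<omega>) \<partial>P)" for l
  define d where "d l = (\<integral>\<omega>. W \<omega> * third l \<omega> * smooth \<sigma> (U 3) (\<theta> \<omega>) \<partial>P) / 6" for l
  define c where "c = step C"
  define c' where "c' = (step C + third_const s * growth C)"
  define c'' where "c'' = growth C * (K\<^sup>2 + gauss_rem_const K C)"
  have cn: "0 \<le> c" "0 \<le> c'" "0 \<le> c''" unfolding c_def c'_def c''_def using step_const_nonneg consts_nonneg by auto
  have Wt: "AE \<omega> in P. \<bar>W \<omega> * third l \<omega>\<bar> \<le> w * g3" if "l < J" for l
    using Wb third_bounded[OF that] by eventually_elim (unfold g3_def, rule abs_mult_bound)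
  have step: "\<bar>a (Suc l) - a l - d l\<bar> \<le> w * B * lind C / (real J)\<^sup>2" if l: "l < J" for l
  proof -
    define V where "V = (\<lambda>k. (smooth \<tau> ^^ (J - Suc l)) (U k))"
    have V: "jet C (B * D) V" unfolding V_def D_def by (rule jet_iterates[OF C U]) auto
    have al: "a (Suc l) = (\<integral>\<omega>. W \<omega> * V 0 (partial (Suc l) \<omega>) \<partial>P)" by (simp add: a_def V_def)
    have "J - l = Suc (J - Suc l)" using l by auto
    then have all: "a l = (\<integral>\<omega>. W \<omega> * smooth \<tau> (V 0) (partial l \<omega>) \<partial>P)"
      by (simp add: a_def V_def)
    have WF: "(\<lambda>\<omega>. W \<omega> * third l \<omega>) \<in> borel_measurable F" using W by measurable
    have 1: "\<bar>a (Suc l) - a l - (\<integral>\<omega>. W \<omega> * third l \<omega> * V 3 (partial l \<omega>) \<partial>P) / 6\<bar> \<le> w * (B * D) * c / (real J)\<^sup>2"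
      unfolding al all c_def by (rule swap_one[OF l C V W Wb w])
    have 2: "\<bar>(\<integral>\<omega>. W \<omega> * third l \<omega> * V 3 (partial l \<omega>) \<partial>P) - d l * 6\<bar> \<le> w * g3 * B * D * (c' / sqrt (real J) + c'' / real J)"
      using weighted_drift[OF l C U3 WF Wt[OF l]] w g3
      unfolding V_def d_def D_def c'_def c''_def by (simp add: mult.assoc)
    have 3: "w * g3 * B * D * (c' / sqrt (real J) + c'' / real J) \<le> w * B * D * third_const s * (c' + c'') / (real J)\<^sup>2"
    proof -
      have "c'' / real J \<le> c'' / sqrt (real J)"
      proof -
        have "sqrt (real J) \<le> real J" by (rule sqrt_J_le)
        then show ?thesis using cn J1 by (intro divide_left_mono) auto
      qed
      then have "c' / sqrt (real J) + c'' / real J \<le> (c' + c'') / sqrt (real J)" by (simp add: add_divide_distrib)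
      then have "w * g3 * B * D * (c' / sqrt (real J) + c'' / real J) \<le> w * g3 * B * D * ((c' + c'') / sqrt (real J))"
        using w g3 B D by (intro mult_left_mono) auto
      also have "... = w * B * D * third_const s * (c' + c'') / (real J)\<^sup>2"
        using J1 by (simp add: g3_def power2_eq_square mult.assoc)
      finally show ?thesis .
    qed
    have "\<bar>a (Suc l) - a l - d l\<bar> \<le> w * (B * D) * c / (real J)\<^sup>2 + w * B * D * third_const s * (c' + c'') / (real J)\<^sup>2"
      using 1 2 3 by linarith
    also have "... = w * B * lind C / (real J)\<^sup>2"
      unfolding lindeberg_const_def D_def[symmetric] c_def c'_def c''_def
      by (simp add: add_divide_distrib[symmetric] algebra_simps)
    finally show ?thesis .
  qed
  have "\<bar>a J - a 0 - (\<Sum>l<J. d l)\<bar> \<le> real J * (w * B * lind C / (real J)\<^sup>2)"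
    by (rule telescope_bound, rule step)
  also have "... = w * B * lind C / real J"
    using J1 by (simp add: power2_eq_square)
  finally have main: "\<bar>a J - a 0 - (\<Sum>l<J. d l)\<bar> \<le> w * B * lind C / real J" .
  have aJ: "a J = (\<integral>\<omega>. W \<omega> * U 0 (partial J \<omega>) \<partial>P)" by (simp add: a_def)
  have a0: "a 0 = (\<integral>\<omega>. W \<omega> * smooth \<sigma> (U 0) (\<theta> \<omega>) \<partial>P)"
    by (simp add: a_def smooth_tau_funpow_J[OF C U])
  have int: "integrable P (\<lambda>\<omega>. W \<omega> * third l \<omega> * smooth \<sigma> (U 3) (\<theta> \<omega>))" if "l < J" for l
    using integrable_weighted_growth(1)[OF _ C sU3 _ Wt[OF that], of 0] w g3 by simp
  have "(\<Sum>l<J. d l) = (\<integral>\<omega>. (\<Sum>l<J. W \<omega> * third l \<omega> * smooth \<sigma> (U 3) (\<theta> \<omega>)) / 6 \<partial>P)"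
    unfolding d_def using int by (subst Bochner_Integration.integral_divide_zero, subst Bochner_Integration.integral_sum) (auto simp: sum_divide_distrib)
  also have "... = (\<integral>\<omega>. W \<omega> * skew \<omega> * smooth \<sigma> (U 3) (\<theta> \<omega>) \<partial>P)"
    by (rule Bochner_Integration.integral_cong) (auto simp: skew_def sum_distrib_left sum_distrib_right sum_divide_distrib)
  finally show ?thesis using main unfolding aJ a0 by simp
qed

end

section \<open>Gaussian integration by parts\<close>

lemma integral_deriv_real_line:
  fixes F f :: "real \<Rightarrow> real"
  assumes "\<And>x. (F has_real_derivative f x) (at x)" "\<And>x. isCont f x" "integrable lborel f"
    and "(F \<longlongrightarrow> 0) at_bot" "(F \<longlongrightarrow> 0) at_top"
  shows "(\<integral>x. f x \<partial>lborel) = 0"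
proof -
  have "(LBINT x=-\<infinity>..\<infinity>. f x) = 0 - 0"
    by (rule interval_integral_FTC_integrable[of _ _ F])
      (use assms in \<open>auto simp: ereal_tendsto_simps1 has_real_derivative_iff_has_vector_derivative[symmetric] set_integrable_def\<close>)
  then show ?thesis
    by (simp add: interval_lebesgue_integral_def set_lebesgue_integral_def)
qed

text \<open>A quadratic bound on the first-order remainder is preserved when it is integrated over a mixing measure,
  which replaces differentiation under the integral sign.\<close>

lemma has_real_derivative_quadratic:
  fixes f :: "real \<Rightarrow> real" and x D C :: real
  assumes "\<And>h :: real. \<bar>f (x + h) - f x - h * D\<bar> \<le> C * h\<^sup>2"
  shows "(f has_real_derivative D) (at x)"
  unfolding DERIV_def
proof (rule LIM_I)
  fix r :: real assume r: "0 < r"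
  have C: "0 \<le> C" using assms[of 1] by simp
  show "\<exists>s>0. \<forall>h. h \<noteq> 0 \<and> norm (h - 0) < s \<longrightarrow> norm ((f (x + h) - f x) / h - D) < r"
  proof (intro exI[of _ "r / (C + 1)"] conjI allI impI)
    show "0 < r / (C + 1)" using r C by simp
    fix h :: real assume h: "h \<noteq> 0 \<and> norm (h - 0) < r / (C + 1)"
    have "(f (x + h) - f x) / h - D = (f (x + h) - f x - h * D) / h"
      using h by (simp add: field_simps)
    also have "\<bar>...\<bar> \<le> C * h\<^sup>2 / \<bar>h\<bar>"
      unfolding abs_divide by (intro divide_right_mono assms) auto
    also have "... = C * \<bar>h\<bar>" using h by (simp add: power2_eq_square abs_if)
    also have "... \<le> (C + 1) * \<bar>h\<bar>" by (simp add: algebra_simps)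
    also have "... < r" using h C by (simp add: pos_less_divide_eq mult.commute)
    finally show "norm ((f (x + h) - f x) / h - D) < r" by simp
  qed
qed

lemma normal_density_deriv:
  assumes "0 < \<sigma>"
  shows "(gpdf \<sigma> has_real_derivative (- y / \<sigma>\<^sup>2 * gpdf \<sigma> y)) (at y)"
  unfolding normal_density_def
  by (rule derivative_eq_intros refl | use assms in \<open>force simp: field_simps\<close>)+

lemma normal_density_deriv':
  assumes "0 < \<sigma>"
  shows "((\<lambda>y. - y / \<sigma>\<^sup>2 * gpdf \<sigma> y) has_real_derivative
     ((y\<^sup>2 / \<sigma> ^ 4 - 1 / \<sigma>\<^sup>2) * gpdf \<sigma> y)) (at y)"
proof -
  have "((\<lambda>y. - y / \<sigma>\<^sup>2 * gpdf \<sigma> y) has_real_derivative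
     (- 1 / \<sigma>\<^sup>2 * gpdf \<sigma> y + - y / \<sigma>\<^sup>2 * (- y / \<sigma>\<^sup>2 * gpdf \<sigma> y))) (at y)"
    by (rule derivative_eq_intros normal_density_deriv assms refl | use assms in \<open>simp add: field_simps\<close>)+
  moreover have "(- 1 / \<sigma>\<^sup>2 * gpdf \<sigma> y + - y / \<sigma>\<^sup>2 * (- y / \<sigma>\<^sup>2 * gpdf \<sigma> y))
    = (y\<^sup>2 / \<sigma> ^ 4 - 1 / \<sigma>\<^sup>2) * gpdf \<sigma> y"
    using assms by (simp add: field_simps power2_eq_square power4_eq_xxxx)
  ultimately show ?thesis by simp
qed

lemma normal_density_deriv'':
  assumes "0 < \<sigma>"
  shows "((\<lambda>y. (y\<^sup>2 / \<sigma> ^ 4 - 1 / \<sigma>\<^sup>2) * gpdf \<sigma> y) has_real_derivative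
     (- (y ^ 3 - 3 * \<sigma>\<^sup>2 * y) / \<sigma> ^ 6 * gpdf \<sigma> y)) (at y)"
proof -
  have "((\<lambda>y. (y\<^sup>2 / \<sigma> ^ 4 - 1 / \<sigma>\<^sup>2) * gpdf \<sigma> y) has_real_derivative
     (2 * y / \<sigma> ^ 4 * gpdf \<sigma> y + (y\<^sup>2 / \<sigma> ^ 4 - 1 / \<sigma>\<^sup>2) * (- y / \<sigma>\<^sup>2 * gpdf \<sigma> y))) (at y)"
    by (rule derivative_eq_intros normal_density_deriv assms refl | use assms in \<open>simp add: field_simps\<close>)+
  moreover have "(2 * y / \<sigma> ^ 4 * gpdf \<sigma> y + (y\<^sup>2 / \<sigma> ^ 4 - 1 / \<sigma>\<^sup>2) * (- y / \<sigma>\<^sup>2 * gpdf \<sigma> y))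
    = - (y ^ 3 - 3 * \<sigma>\<^sup>2 * y) / \<sigma> ^ 6 * gpdf \<sigma> y"
    using assms by (simp add: field_simps eval_nat_numeral)
  ultimately show ?thesis by simp
qed

lemma normal_density_le:
  "gpdf \<sigma> y \<le> 1 / sqrt (2 * pi * \<sigma>\<^sup>2)"
  unfolding normal_density_def by (simp add: divide_right_mono)

lemma normal_density_second_bound:
  assumes "0 < \<sigma>"
  shows "\<bar>(y\<^sup>2 / \<sigma> ^ 4 - 1 / \<sigma>\<^sup>2) * gpdf \<sigma> y\<bar> \<le> 3 / \<sigma>\<^sup>2 / sqrt (2 * pi * \<sigma>\<^sup>2)"
proof -
  define t where "t = y\<^sup>2 / (2 * \<sigma>\<^sup>2)"
  have t: "0 \<le> t" by (simp add: t_def)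
  have e: "gpdf \<sigma> y = 1 / sqrt (2 * pi * \<sigma>\<^sup>2) * exp (- t)"
    by (simp add: normal_density_def t_def)
  have te: "t * exp (- t) \<le> 1" using power_le_fact_exp[OF t, of 1] by (simp add: exp_minus field_simps)
  have e1: "exp (- t) \<le> 1" using t by simp
  have "y\<^sup>2 / \<sigma> ^ 4 - 1 / \<sigma>\<^sup>2 = (2 * t - 1) / \<sigma>\<^sup>2"
    using assms by (simp add: t_def diff_divide_distrib power2_eq_square power4_eq_xxxx)
  then have "\<bar>y\<^sup>2 / \<sigma> ^ 4 - 1 / \<sigma>\<^sup>2\<bar> = \<bar>2 * t - 1\<bar> / \<sigma>\<^sup>2"
    by (simp add: abs_divide)
  also have "... \<le> (2 * t + 1) / \<sigma>\<^sup>2" using t by (intro divide_right_mono) auto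
  finally have "\<bar>y\<^sup>2 / \<sigma> ^ 4 - 1 / \<sigma>\<^sup>2\<bar> * exp (- t) \<le> (2 * t + 1) / \<sigma>\<^sup>2 * exp (- t)"
    by (rule mult_right_mono) simp
  also have "... = (2 * (t * exp (- t)) + exp (- t)) / \<sigma>\<^sup>2" by (simp add: algebra_simps add_divide_distrib)
  also have "... \<le> 3 / \<sigma>\<^sup>2" 
  proof (intro divide_right_mono)
    show "2 * (t * exp (- t)) + exp (- t) \<le> 3" using te e1 by linarith
  qed simp
  finally have "\<bar>y\<^sup>2 / \<sigma> ^ 4 - 1 / \<sigma>\<^sup>2\<bar> * exp (- t) / sqrt (2 * pi * \<sigma>\<^sup>2) \<le> 3 / \<sigma>\<^sup>2 / sqrt (2 * pi * \<sigma>\<^sup>2)"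
    by (rule divide_right_mono) simp
  then show ?thesis unfolding e abs_mult by simp
qed

lemma normal_density_taylor:
  assumes "0 < \<sigma>"
  shows "\<bar>gpdf \<sigma> (y + h) - gpdf \<sigma> y - h * (- y / \<sigma>\<^sup>2 * gpdf \<sigma> y)\<bar>
     \<le> 3 / \<sigma>\<^sup>2 / sqrt (2 * pi * \<sigma>\<^sup>2) * h\<^sup>2"
proof -
  define d where "d = (\<lambda>m::nat. if m = 0 then (\<lambda>h. gpdf \<sigma> (y + h)) else
     if m = 1 then (\<lambda>h. - (y + h) / \<sigma>\<^sup>2 * gpdf \<sigma> (y + h)) else
      (\<lambda>h. ((y + h)\<^sup>2 / \<sigma> ^ 4 - 1 / \<sigma>\<^sup>2) * gpdf \<sigma> (y + h)))"
  have "\<exists>t. \<bar>t\<bar> \<le> \<bar>h\<bar> \<and> gpdf \<sigma> (y + h) = (\<Sum>m<2. d m 0 / fact m * h ^ m) + d 2 t / fact 2 * h ^ 2"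
  proof (rule Maclaurin_bi_le)
    show "d 0 = (\<lambda>h. gpdf \<sigma> (y + h))" by (simp add: d_def)
    show "\<forall>m t. m < 2 \<and> \<bar>t\<bar> \<le> \<bar>h\<bar> \<longrightarrow> DERIV (d m) t :> d (Suc m) t"
    proof (intro allI impI)
      fix m :: nat and t assume "m < 2 \<and> \<bar>t\<bar> \<le> \<bar>h\<bar>"
      then consider "m = 0" | "m = 1" by linarith
      then show "DERIV (d m) t :> d (Suc m) t"
      proof cases
        case 1
        show ?thesis using DERIV_shift[of "gpdf \<sigma>" _ t y] normal_density_deriv[OF assms, of "t + y"]
          by (simp add: 1 d_def add.commute)
      next
        case 2
        show ?thesis using DERIV_shift[of "\<lambda>y. - y / \<sigma>\<^sup>2 * gpdf \<sigma> y" _ t y] normal_density_deriv'[OF assms, of "t + y"]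
          by (simp add: 2 d_def add.commute)
      qed
    qed
  qed
  then obtain t where t: "gpdf \<sigma> (y + h) = (\<Sum>m<2. d m 0 / fact m * h ^ m) + d 2 t / fact 2 * h ^ 2"
    by blast
  have "gpdf \<sigma> (y + h) - gpdf \<sigma> y - h * (- y / \<sigma>\<^sup>2 * gpdf \<sigma> y)
     = ((y + t)\<^sup>2 / \<sigma> ^ 4 - 1 / \<sigma>\<^sup>2) * gpdf \<sigma> (y + t) / 2 * h\<^sup>2"
    unfolding t by (simp add: d_def numeral_2_eq_2)
  also have "\<bar>...\<bar> \<le> 3 / \<sigma>\<^sup>2 / sqrt (2 * pi * \<sigma>\<^sup>2) * h\<^sup>2"
  proof -
    have "\<bar>((y + t)\<^sup>2 / \<sigma> ^ 4 - 1 / \<sigma>\<^sup>2) * gpdf \<sigma> (y + t) / 2\<bar> \<le> 3 / \<sigma>\<^sup>2 / sqrt (2 * pi * \<sigma>\<^sup>2)"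
    proof -
      have half: "\<bar>a / 2\<bar> \<le> b" if "\<bar>a\<bar> \<le> b" for a b :: real using that by linarith
      show ?thesis by (rule half[OF normal_density_second_bound[OF assms]])
    qed
    then show ?thesis unfolding abs_mult[of _ "h\<^sup>2"] by (intro mult_mono) auto
  qed
  finally show ?thesis .
qed

lemma normal_density_exp_decay:
  assumes "0 < \<sigma>"
  shows "gpdf \<sigma> z * exp (c * \<bar>z\<bar>) \<le> exp ((c + 1)\<^sup>2 * \<sigma>\<^sup>2 / 2) / sqrt (2 * pi * \<sigma>\<^sup>2) * exp (- \<bar>z\<bar>)"
proof -
  have "0 \<le> (\<bar>z\<bar> - (c + 1) * \<sigma>\<^sup>2)\<^sup>2 / (2 * \<sigma>\<^sup>2)" by simp
  also have "... = z\<^sup>2 / (2 * \<sigma>\<^sup>2) - (c + 1) * \<bar>z\<bar> + (c + 1)\<^sup>2 * \<sigma>\<^sup>2 / 2"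
    using assms by (simp add: power2_diff field_simps power2_eq_square)
  finally have "- (z - 0)\<^sup>2 / (2 * \<sigma>\<^sup>2) + c * \<bar>z\<bar> \<le> (c + 1)\<^sup>2 * \<sigma>\<^sup>2 / 2 + - \<bar>z\<bar>"
    by (simp add: algebra_simps)
  then have "exp (- (z - 0)\<^sup>2 / (2 * \<sigma>\<^sup>2)) * exp (c * \<bar>z\<bar>) \<le> exp ((c + 1)\<^sup>2 * \<sigma>\<^sup>2 / 2) * exp (- \<bar>z\<bar>)"
    by (simp only: exp_add[symmetric] exp_le_cancel_iff)
  then have "exp (- (z - 0)\<^sup>2 / (2 * \<sigma>\<^sup>2)) * exp (c * \<bar>z\<bar>) / sqrt (2 * pi * \<sigma>\<^sup>2) \<le> exp ((c + 1)\<^sup>2 * \<sigma>\<^sup>2 / 2) * exp (- \<bar>z\<bar>) / sqrt (2 * pi * \<sigma>\<^sup>2)"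
    by (intro divide_right_mono) auto
  then show ?thesis by (simp add: normal_density_def)
qed

lemma exp_minus_abs_tendsto:
  "((\<lambda>z::real. A * exp (- \<bar>z\<bar>)) \<longlongrightarrow> 0) at_top" "((\<lambda>z::real. A * exp (- \<bar>z\<bar>)) \<longlongrightarrow> 0) at_bot"
proof -
  have 1: "((\<lambda>z::real. exp (- \<bar>z\<bar>)) \<longlongrightarrow> 0) at_top"
    by (rule filterlim_compose[OF exp_at_bot])
      (simp add: filterlim_uminus_at_bot filterlim_abs_real)
  have 2: "((\<lambda>z::real. exp (- \<bar>z\<bar>)) \<longlongrightarrow> 0) at_bot"
    unfolding filterlim_at_bot_mirror using 1 by simp
  show "((\<lambda>z::real. A * exp (- \<bar>z\<bar>)) \<longlongrightarrow> 0) at_top" using tendsto_mult_left[OF 1, of A] by simp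
  show "((\<lambda>z::real. A * exp (- \<bar>z\<bar>)) \<longlongrightarrow> 0) at_bot" using tendsto_mult_left[OF 2, of A] by simp
qed

lemma gauss_dominated_tendsto:
  fixes F :: "real \<Rightarrow> real"
  assumes "0 < \<sigma>" "\<And>z. \<bar>F z\<bar> \<le> A * exp (c * \<bar>z\<bar>) * gpdf \<sigma> z"
  shows "(F \<longlongrightarrow> 0) at_top" "(F \<longlongrightarrow> 0) at_bot"
proof -
  have A: "0 \<le> A"
  proof -
    have "0 \<le> A * gpdf \<sigma> 0" using assms(2)[of 0] by simp
    then show ?thesis using normal_density_pos[OF assms(1), of 0 0] by (simp add: zero_le_mult_iff)
  qed
  define A' where "A' = A * (exp ((c + 1)\<^sup>2 * \<sigma>\<^sup>2 / 2) / sqrt (2 * pi * \<sigma>\<^sup>2))"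
  have b: "\<bar>F z\<bar> \<le> A' * exp (- \<bar>z\<bar>)" for z
  proof -
    have "\<bar>F z\<bar> \<le> A * (gpdf \<sigma> z * exp (c * \<bar>z\<bar>))" using assms(2)[of z] by (simp add: mult_ac)
    also have "... \<le> A * (exp ((c + 1)\<^sup>2 * \<sigma>\<^sup>2 / 2) / sqrt (2 * pi * \<sigma>\<^sup>2) * exp (- \<bar>z\<bar>))"
      by (intro mult_left_mono normal_density_exp_decay assms A)
    finally show ?thesis by (simp add: A'_def)
  qed
  show "(F \<longlongrightarrow> 0) at_top" "(F \<longlongrightarrow> 0) at_bot"
    by (rule Lim_null_comparison[OF _ exp_minus_abs_tendsto(1)[of A']] Lim_null_comparison[OF _ exp_minus_abs_tendsto(2)[of A']];
        use b in auto)+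
qed

section \<open>Functions with controlled derivatives\<close>

text \<open>Existence and size of the derivatives are put into one recursion; products then follow by induction on
  the order, without a formula for higher derivatives.\<close>

fun deriv_bounded :: "nat \<Rightarrow> (real \<Rightarrow> real) \<Rightarrow> real \<Rightarrow> (real \<Rightarrow> real) \<Rightarrow> bool" where
  "deriv_bounded 0 w B f \<longleftrightarrow> (\<forall>x. \<bar>f x\<bar> \<le> B * w x)"
| "deriv_bounded (Suc n) w B f \<longleftrightarrow> (\<forall>x. \<bar>f x\<bar> \<le> B * w x) \<and>
     (\<exists>f'. (\<forall>x. (f has_real_derivative f' x) (at x)) \<and> deriv_bounded n w B f')"

abbreviation "smooth8 C \<equiv> deriv_bounded 8 (\<lambda>x. cosh (C * x))"

lemma deriv_bounded_le: "deriv_bounded n w B f \<Longrightarrow> \<bar>f x\<bar> \<le> B * w x"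
  by (cases n) auto

lemma deriv_bounded_mono:
  assumes "deriv_bounded n w B f" "\<And>x. B * w x \<le> B' * w' x"
  shows "deriv_bounded n w' B' f"
  using assms(1)
proof (induction n arbitrary: f)
  case 0
  then show ?case using assms(2) by (auto intro: order_trans)
next
  case (Suc n)
  then show ?case using assms(2) by (auto intro: order_trans)
qed

lemma deriv_bounded_Suc_D: "deriv_bounded (Suc n) w B f \<Longrightarrow> deriv_bounded n w B f"
  by (induction n arbitrary: f) auto

lemma deriv_bounded_add:
  "deriv_bounded n w B f \<Longrightarrow> deriv_bounded n w B' g \<Longrightarrow> deriv_bounded n w (B + B') (\<lambda>x. f x + g x)"
proof (induction n arbitrary: f g)
  case 0
  show ?case
  proof (simp, intro allI)
    fix x show "\<bar>f x + g x\<bar> \<le> (B + B') * w x"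
      using 0 abs_triangle_ineq[of "f x" "g x"] by (simp add: distrib_right) (smt (verit))
  qed
next
  case (Suc n)
  obtain f' g' where d: "\<forall>x. (f has_real_derivative f' x) (at x)" "deriv_bounded n w B f'"
     "\<forall>x. (g has_real_derivative g' x) (at x)" "deriv_bounded n w B' g'"
    using Suc.prems by auto
  have "\<bar>f x + g x\<bar> \<le> (B + B') * w x" for x
    using deriv_bounded_le[OF Suc.prems(1), of x] deriv_bounded_le[OF Suc.prems(2), of x] abs_triangle_ineq[of "f x" "g x"]
    by (simp add: distrib_right)
  moreover have "deriv_bounded n w (B + B') (\<lambda>x. f' x + g' x)" by (rule Suc.IH[OF d(2,4)])
  moreover have "\<forall>x. ((\<lambda>x. f x + g x) has_real_derivative (f' x + g' x)) (at x)"
    using d by (auto intro: DERIV_add)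
  ultimately show ?case by auto
qed

lemma deriv_bounded_cmult:
  "deriv_bounded n w B f \<Longrightarrow> deriv_bounded n w (\<bar>c\<bar> * B) (\<lambda>x. c * f x)"
proof (induction n arbitrary: f)
  case 0
  then show ?case by (auto simp: abs_mult mult.assoc intro: mult_left_mono)
next
  case (Suc n)
  obtain f' where d: "\<forall>x. (f has_real_derivative f' x) (at x)" "deriv_bounded n w B f'"
    using Suc.prems by auto
  have "\<bar>c * f x\<bar> \<le> \<bar>c\<bar> * B * w x" for x
    using deriv_bounded_le[OF Suc.prems, of x] by (simp add: abs_mult mult.assoc mult_left_mono)
  moreover have "deriv_bounded n w (\<bar>c\<bar> * B) (\<lambda>x. c * f' x)" by (rule Suc.IH[OF d(2)])
  moreover have "\<forall>x. ((\<lambda>x. c * f x) has_real_derivative (c * f' x)) (at x)"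
    using d by (auto intro: DERIV_cmult)
  ultimately show ?case by auto
qed

lemma deriv_bounded_const: "\<bar>c\<bar> \<le> B \<Longrightarrow> deriv_bounded n (\<lambda>_. 1) B (\<lambda>_. c)"
proof (induction n arbitrary: c)
  case (Suc n)
  have "deriv_bounded n (\<lambda>_. 1) B (\<lambda>_. 0)" by (rule Suc.IH) (use Suc.prems in auto)
  moreover have "\<forall>x. ((\<lambda>_. c) has_real_derivative 0) (at x)" by auto
  ultimately show ?case using Suc.prems by (auto intro!: exI[of _ "\<lambda>_. 0"])
qed simp

lemma deriv_bounded_mult:
  "deriv_bounded n w B f \<Longrightarrow> deriv_bounded n (\<lambda>_. 1) B' g \<Longrightarrow> (\<And>x. 0 \<le> w x) \<Longrightarrow> 0 \<le> B \<Longrightarrow> 0 \<le> B'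
    \<Longrightarrow> deriv_bounded n w (2 ^ n * (B * B')) (\<lambda>x. f x * g x)"
proof (induction n arbitrary: f g)
  case 0
  have "\<bar>f x * g x\<bar> \<le> (B * w x) * B'" for x
    using 0 unfolding abs_mult by (intro mult_mono) auto
  then show ?case by (simp add: mult_ac)
next
  case (Suc n)
  obtain f' g' where d: "\<forall>x. (f has_real_derivative f' x) (at x)" "deriv_bounded n w B f'"
     "\<forall>x. (g has_real_derivative g' x) (at x)" "deriv_bounded n (\<lambda>_. 1) B' g'"
    using Suc.prems by auto
  have "\<bar>f x * g x\<bar> \<le> (B * w x) * B'" for x
    using deriv_bounded_le[OF Suc.prems(1), of x] deriv_bounded_le[OF Suc.prems(2), of x] Suc.prems
    unfolding abs_mult by (intro mult_mono) auto
  moreover have "(B * w x) * B' \<le> 2 ^ Suc n * (B * B') * w x" for x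
  proof -
    have "1 * (B * B' * w x) \<le> 2 ^ Suc n * (B * B' * w x)"
      using Suc.prems by (intro mult_right_mono) (auto simp del: power_Suc)
    then show ?thesis by (simp add: mult_ac)
  qed
  ultimately have b: "\<bar>f x * g x\<bar> \<le> 2 ^ Suc n * (B * B') * w x" for x by (rule order_trans)
  have "deriv_bounded n w (2 ^ n * (B * B') + 2 ^ n * (B * B')) (\<lambda>x. f x * g' x + f' x * g x)"
    by (rule deriv_bounded_add; rule Suc.IH)
      (use d Suc.prems deriv_bounded_Suc_D[OF Suc.prems(1)] deriv_bounded_Suc_D[OF Suc.prems(2)] in auto)
  moreover have "\<forall>x. ((\<lambda>x. f x * g x) has_real_derivative (f x * g' x + f' x * g x)) (at x)"
    using d by (intro allI DERIV_mult') auto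
  ultimately show ?case using b by (auto simp: algebra_simps)
qed

lemma deriv_bounded_sequence:
  "deriv_bounded n w B f \<Longrightarrow> \<exists>U. U 0 = f \<and> (\<forall>i<n. \<forall>x. (U i has_real_derivative U (Suc i) x) (at x)) \<and>
     (\<forall>i\<le>n. \<forall>x. \<bar>U i x\<bar> \<le> B * w x)"
proof (induction n arbitrary: f)
  case 0
  then show ?case by (intro exI[of _ "\<lambda>_. f"]) auto
next
  case (Suc n)
  obtain f' where d: "\<forall>x. (f has_real_derivative f' x) (at x)" "deriv_bounded n w B f'"
    using Suc.prems by auto
  obtain U where U: "U 0 = f'" "\<forall>i<n. \<forall>x. (U i has_real_derivative U (Suc i) x) (at x)"
     "\<forall>i\<le>n. \<forall>x. \<bar>U i x\<bar> \<le> B * w x"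
    using Suc.IH[OF d(2)] by blast
  let ?V = "\<lambda>i. case i of 0 \<Rightarrow> f | Suc j \<Rightarrow> U j"
  have "\<forall>i<Suc n. \<forall>x. (?V i has_real_derivative ?V (Suc i) x) (at x)"
    using U d by (auto split: nat.splits)
  moreover have "\<forall>i\<le>Suc n. \<forall>x. \<bar>?V i x\<bar> \<le> B * w x"
    using U deriv_bounded_le[OF Suc.prems] by (auto split: nat.splits)
  ultimately show ?case by (intro exI[of _ ?V]) simp
qed

lemma differentiable_measurable:
  fixes f :: "real \<Rightarrow> real"
  assumes "\<And>x. (f has_real_derivative f' x) (at x)"
  shows "f \<in> borel_measurable borel"
  by (rule borel_measurable_continuous_onI)
    (use assms in \<open>auto intro!: continuous_at_imp_continuous_on DERIV_isCont\<close>)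

lemma jet_of_derivatives:
  assumes C: "0 \<le> C" and meas: "\<And>i. U i \<in> borel_measurable borel"
    and bd: "\<And>i x. \<bar>U i x\<bar> \<le> B * cosh (C * x)"
    and der: "\<And>i x. i < 4 \<Longrightarrow> (U i has_real_derivative U (Suc i) x) (at x)"
  shows "jet C B U"
  unfolding jet_def
proof (intro conjI allI)
  fix x h
  have B: "0 \<le> B" using bd[of 0 0] by simp
  have "\<exists>t. \<bar>t\<bar> \<le> \<bar>h\<bar> \<and> U 0 (x + h) = (\<Sum>m<4. U m (x + 0) / fact m * h ^ m) + U 4 (x + t) / fact 4 * h ^ 4"
  proof (rule Maclaurin_bi_le[where f = "\<lambda>h. U 0 (x + h)" and diff = "\<lambda>m h. U m (x + h)"])
    show "\<forall>m t. m < 4 \<and> \<bar>t\<bar> \<le> \<bar>h\<bar> \<longrightarrow> DERIV (\<lambda>h. U m (x + h)) t :> U (Suc m) (x + t)"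
    proof (intro allI impI)
      fix m :: nat and t assume "m < 4 \<and> \<bar>t\<bar> \<le> \<bar>h\<bar>"
      then show "DERIV (\<lambda>h. U m (x + h)) t :> U (Suc m) (x + t)"
        using der[of m "t + x"] DERIV_shift[of "U m" _ t x] by (simp add: add.commute)
    qed
  qed simp
  then obtain t where t: "\<bar>t\<bar> \<le> \<bar>h\<bar>" "U 0 (x + h) = (\<Sum>m<4. U m (x + 0) / fact m * h ^ m) + U 4 (x + t) / fact 4 * h ^ 4"
    by blast
  have "U 0 (x + h) - (\<Sum>i<4. U i x * h ^ i / fact i) = U 4 (x + t) / fact 4 * h ^ 4"
    unfolding t(2) by simp
  also have "\<bar>...\<bar> = \<bar>U 4 (x + t)\<bar> / fact 4 * h ^ 4" by (simp add: abs_mult)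
  also have "... \<le> \<bar>U 4 (x + t)\<bar> * h ^ 4" 
    by (intro mult_right_mono) (auto simp: fact_numeral)
  also have "... \<le> (B * cosh (C * x) * exp (C * \<bar>h\<bar>)) * h ^ 4"
  proof (rule mult_right_mono)
    have "\<bar>U 4 (x + t)\<bar> \<le> B * cosh (C * (x + t))" by (rule bd)
    also have "... \<le> B * (cosh (C * x) * exp (C * \<bar>t\<bar>))" by (intro mult_left_mono cosh_mult_add_le C B)
    also have "... \<le> B * (cosh (C * x) * exp (C * \<bar>h\<bar>))" using t C B by (intro mult_left_mono) (auto intro: mult_left_mono)
    finally show "\<bar>U 4 (x + t)\<bar> \<le> B * cosh (C * x) * exp (C * \<bar>h\<bar>)" by simp
  qed auto
  finally show "\<bar>U 0 (x + h) - (\<Sum>i<4. U i x * h ^ i / fact i)\<bar> \<le> B * cosh (C * x) * (exp (C * \<bar>h\<bar>) * h ^ 4)"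
    by (simp add: mult.assoc)
qed (use meas bd in auto)

text \<open>Order 8 leaves room for a fourth-order expansion of the third derivative.\<close>

lemma deriv_bounded_jets:
  assumes C: "0 \<le> C" and f: "smooth8 C B f"
  obtains U where "U 0 = f" "jet C B U" "jet C B (\<lambda>i. U (i + 3))"
    "\<And>i x. i < 4 \<Longrightarrow> (U i has_real_derivative U (Suc i) x) (at x)"
proof -
  obtain V where V: "V 0 = f" "\<forall>i<8. \<forall>x. (V i has_real_derivative V (Suc i) x) (at x)"
     "\<forall>i\<le>8. \<forall>x. \<bar>V i x\<bar> \<le> B * cosh (C * x)"
    using deriv_bounded_sequence[OF f] by blast
  define U where "U i = (if i < 8 then V i else (\<lambda>_. 0))" for i
  have B: "0 \<le> B" using V(3)[rule_format, of 0 0] by simp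
  have m: "U i \<in> borel_measurable borel" for i
    using V(2) differentiable_measurable[of "V i" "V (Suc i)"] by (auto simp: U_def)
  have b: "\<bar>U i x\<bar> \<le> B * cosh (C * x)" for i x using V(3) B by (auto simp: U_def)
  have d: "(U i has_real_derivative U (Suc i) x) (at x)" if "i < 7" for i x
    using V(2) that by (auto simp: U_def)
  show ?thesis
  proof (rule that[of U])
    show "U 0 = f" using V(1) by (simp add: U_def)
    show "jet C B U" by (rule jet_of_derivatives[OF C]) (use m b d in auto)
    show "jet C B (\<lambda>i. U (i + 3))"
      by (rule jet_of_derivatives[OF C]) (use m b d[of "_ + 3"] in auto)
    show "\<And>i x. i < 4 \<Longrightarrow> (U i has_real_derivative U (Suc i) x) (at x)" using d by auto
  qed
qed

text \<open>Three integrations by parts at once: with \<open>\<phi>\<close> the Gaussian density and \<open>u = U 0\<close>, the function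
  \<open>u'' \<phi> - u' \<phi>' + u \<phi>''\<close> vanishes at infinity and has derivative \<open>u''' \<phi> + u \<phi>'''\<close>.\<close>

lemma stein_third:
  assumes \<sigma>: "0 < \<sigma>" and C: "0 \<le> C" and U: "jet C B U"
    and der: "\<And>i x. i < 4 \<Longrightarrow> (U i has_real_derivative U (Suc i) x) (at x)"
  shows "smooth \<sigma> (U 3) x = (\<integral>z. U 0 (x + z) * ((z ^ 3 - 3 * \<sigma>\<^sup>2 * z) / \<sigma> ^ 6) \<partial>gaussm \<sigma>)"
proof -
  note U' = jetD[OF U]
  note [measurable] = U'(1)
  let ?\<phi> = "gpdf \<sigma>"
  let ?f1 = "\<lambda>z. - z / \<sigma>\<^sup>2 * ?\<phi> z" and ?f2 = "\<lambda>z. (z\<^sup>2 / \<sigma> ^ 4 - 1 / \<sigma>\<^sup>2) * ?\<phi> z"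
    and ?f3 = "\<lambda>z. - (z ^ 3 - 3 * \<sigma>\<^sup>2 * z) / \<sigma> ^ 6 * ?\<phi> z"
  \<comment> \<open>The primitive is bounded by an exponential times \<open>\<phi>\<close>, so it has no boundary terms.\<close>
  define F where "F z = U 2 (x + z) * ?\<phi> z - U 1 (x + z) * ?f1 z + U 0 (x + z) * ?f2 z" for z
  define f where "f z = U 3 (x + z) * ?\<phi> z + U 0 (x + z) * ?f3 z" for z
  have dU: "((\<lambda>z. U i (x + z)) has_real_derivative U (Suc i) (x + z)) (at z)" if "i < 4" for i z
    using der[OF that, of "z + x"] DERIV_shift[of "U i" _ z x] by (simp add: add.commute)
  have dF: "(F has_real_derivative f z) (at z)" for z
  proof -
    have u: "((\<lambda>z. U 2 (x + z)) has_real_derivative U 3 (x + z)) (at z)"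
      "((\<lambda>z. U 1 (x + z)) has_real_derivative U 2 (x + z)) (at z)"
      "((\<lambda>z. U 0 (x + z)) has_real_derivative U 1 (x + z)) (at z)"
      using dU[of 2 z] dU[of 1 z] dU[of 0 z] by (simp_all add: numeral_2_eq_2 numeral_3_eq_3)
    have "(F has_real_derivative
       (U 2 (x + z) * ?f1 z + U 3 (x + z) * ?\<phi> z) - (U 1 (x + z) * ?f2 z + U 2 (x + z) * ?f1 z)
        + (U 0 (x + z) * ?f3 z + U 1 (x + z) * ?f2 z)) (at z)"
      unfolding F_def
      by (rule DERIV_add DERIV_diff DERIV_mult' u normal_density_deriv[OF \<sigma>] normal_density_deriv'[OF \<sigma>] normal_density_deriv''[OF \<sigma>])+
    then show ?thesis by (simp add: f_def)
  qed
  have cf: "isCont f z" for z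
  proof -
    have "isCont (\<lambda>z. U 3 (x + z)) z" "isCont (\<lambda>z. U 0 (x + z)) z"
      using DERIV_isCont[OF dU[of 3 z]] DERIV_isCont[OF dU[of 0 z]] by auto
    moreover have "isCont ?\<phi> z" by (rule DERIV_isCont[OF normal_density_deriv[OF \<sigma>]])
    ultimately show ?thesis unfolding f_def using \<sigma> by (intro continuous_intros) auto
  qed
  define B' where "B' = B * cosh (C * x)"
  have B': "0 \<le> B'" using U'(3) by (simp add: B'_def)
  have Ub: "\<bar>U i (x + z)\<bar> \<le> B' * exp (C * \<bar>z\<bar>)" for i z
    using order_trans[OF U'(2)[of i "x + z"] mult_left_mono[OF cosh_mult_add_le[OF C] U'(3)]]
    by (simp add: B'_def mult.assoc)
  define q where "q = 1 + 1 / \<sigma>\<^sup>2 + (2 / \<sigma> ^ 4 + 1 / \<sigma>\<^sup>2) + (6 / \<sigma> ^ 6 + 3 * \<sigma>\<^sup>2 / \<sigma> ^ 6)"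
  have qparts: "0 \<le> 1 / \<sigma>\<^sup>2" "0 \<le> 2 / \<sigma> ^ 4" "0 \<le> 6 / \<sigma> ^ 6" "0 \<le> 3 * \<sigma>\<^sup>2 / \<sigma> ^ 6" using \<sigma> by auto
  have q1: "1 / \<sigma>\<^sup>2 \<le> q" "0 \<le> q" "2 / \<sigma> ^ 4 + 1 / \<sigma>\<^sup>2 \<le> q" "6 / \<sigma> ^ 6 + 3 * \<sigma>\<^sup>2 / \<sigma> ^ 6 \<le> q" unfolding q_def using qparts by linarith+
  have e1: "1 \<le> exp \<bar>z\<bar>" for z :: real by simp
  have p1: "\<bar>z\<bar> \<le> exp \<bar>z\<bar>" for z :: real using power_le_fact_exp[of "\<bar>z\<bar>" 1] by simp
  have p2: "z\<^sup>2 \<le> 2 * exp \<bar>z\<bar>" for z :: real using power_le_fact_exp[of "\<bar>z\<bar>" 2] by simp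
  have p3: "\<bar>z ^ 3\<bar> \<le> 6 * exp \<bar>z\<bar>" for z :: real using power_le_fact_exp[of "\<bar>z\<bar>" 3] by (simp add: power_abs fact_numeral)
  have k0: "\<bar>1\<bar> \<le> q * exp \<bar>z\<bar>" for z :: real
  proof -
    have "1 * 1 \<le> q * exp \<bar>z\<bar>" using e1[of z] qparts by (intro mult_mono) (auto simp: q_def)
    then show ?thesis by simp
  qed
  have k1: "\<bar>- z / \<sigma>\<^sup>2\<bar> \<le> q * exp \<bar>z\<bar>" for z
  proof -
    have "\<bar>- z / \<sigma>\<^sup>2\<bar> = 1 / \<sigma>\<^sup>2 * \<bar>z\<bar>" by simp
    also have "... \<le> q * exp \<bar>z\<bar>" using p1[of z] q1 by (intro mult_mono) auto
    finally show ?thesis .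
  qed
  have k2: "\<bar>z\<^sup>2 / \<sigma> ^ 4 - 1 / \<sigma>\<^sup>2\<bar> \<le> q * exp \<bar>z\<bar>" for z
  proof -
    have "\<bar>z\<^sup>2 / \<sigma> ^ 4 - 1 / \<sigma>\<^sup>2\<bar> \<le> z\<^sup>2 / \<sigma> ^ 4 + 1 / \<sigma>\<^sup>2"
      using abs_triangle_ineq4[of "z\<^sup>2 / \<sigma> ^ 4" "1 / \<sigma>\<^sup>2"] by simp
    also have "... \<le> (2 * exp \<bar>z\<bar>) / \<sigma> ^ 4 + exp \<bar>z\<bar> / \<sigma>\<^sup>2"
      using \<sigma> by (intro add_mono divide_right_mono p2 e1) auto
    also have "... = (2 / \<sigma> ^ 4 + 1 / \<sigma>\<^sup>2) * exp \<bar>z\<bar>" by (simp add: algebra_simps)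
    also have "... \<le> q * exp \<bar>z\<bar>" using q1 by (intro mult_right_mono) auto
    finally show ?thesis .
  qed
  have k3: "\<bar>- (z ^ 3 - 3 * \<sigma>\<^sup>2 * z) / \<sigma> ^ 6\<bar> \<le> q * exp \<bar>z\<bar>" for z
  proof -
    have "\<bar>- (z ^ 3 - 3 * \<sigma>\<^sup>2 * z) / \<sigma> ^ 6\<bar> = \<bar>z ^ 3 - 3 * \<sigma>\<^sup>2 * z\<bar> / \<sigma> ^ 6" using \<sigma> by (simp add: abs_divide power_abs)
    also have "... \<le> (\<bar>z ^ 3\<bar> + 3 * \<sigma>\<^sup>2 * \<bar>z\<bar>) / \<sigma> ^ 6"
      using abs_triangle_ineq4[of "z ^ 3" "3 * \<sigma>\<^sup>2 * z"] \<sigma> by (intro divide_right_mono) (auto simp: abs_mult)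
    also have "... \<le> (6 * exp \<bar>z\<bar> + 3 * \<sigma>\<^sup>2 * exp \<bar>z\<bar>) / \<sigma> ^ 6"
      using \<sigma> p3[of z] p1[of z] by (intro divide_right_mono add_mono mult_left_mono) auto
    also have "... = (6 / \<sigma> ^ 6 + 3 * \<sigma>\<^sup>2 / \<sigma> ^ 6) * exp \<bar>z\<bar>" by (simp add: algebra_simps add_divide_distrib)
    also have "... \<le> q * exp \<bar>z\<bar>" using q1 by (intro mult_right_mono) auto
    finally show ?thesis .
  qed
  have dom_term: "\<bar>U i (x + z) * (r * ?\<phi> z)\<bar> \<le> B' * q * exp ((C + 1) * \<bar>z\<bar>) * ?\<phi> z" if "\<bar>r\<bar> \<le> q * exp \<bar>z\<bar>" for i z r
  proof -
    have "\<bar>U i (x + z) * (r * ?\<phi> z)\<bar> \<le> (B' * exp (C * \<bar>z\<bar>)) * ((q * exp \<bar>z\<bar>) * ?\<phi> z)"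
      by (rule abs_mult_bound[OF Ub]) (use that in \<open>simp add: abs_mult mult_right_mono\<close>) 
    then show ?thesis by (simp add: algebra_simps exp_add)
  qed
  have Fb: "\<bar>F z\<bar> \<le> (3 * (B' * q)) * exp ((C + 1) * \<bar>z\<bar>) * ?\<phi> z" for z
  proof -
    have tri: "\<bar>a - b + c\<bar> \<le> 3 * D" if "\<bar>a\<bar> \<le> D" "\<bar>b\<bar> \<le> D" "\<bar>c\<bar> \<le> D" for a b c D :: real
      using that by linarith
    have "\<bar>U 2 (x + z) * (1 * ?\<phi> z) - U 1 (x + z) * ?f1 z + U 0 (x + z) * ?f2 z\<bar> \<le> 3 * (B' * q * exp ((C + 1) * \<bar>z\<bar>) * ?\<phi> z)"
      by (rule tri; rule dom_term; rule k0 k1 k2)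
    then show ?thesis unfolding F_def by (simp only: mult_1_left mult.assoc)
  qed
  have fb3: "\<bar>U 3 (x + z) * ?\<phi> z\<bar> \<le> B' * q * exp ((C + 1) * \<bar>z\<bar>) * ?\<phi> z" for z
    using dom_term[OF k0, of 3 z] by simp
  have dom: "integrable lborel (\<lambda>z. B' * q * exp ((C + 1) * \<bar>z\<bar>) * ?\<phi> z)"
  proof -
    have "integrable (gaussm \<sigma>) (\<lambda>z. B' * q * exp ((C + 1) * \<bar>z\<bar>))"
      using gaussm_exp_abs(1)[OF \<sigma>, of "C + 1"] by simp
    then show ?thesis by (subst (asm) integrable_gaussm_iff) (simp_all add: mult_ac)
  qed
  have i3: "integrable lborel (\<lambda>z. U 3 (x + z) * ?\<phi> z)"
    by (rule Bochner_Integration.integrable_bound[OF dom]) (use fb3 in \<open>auto intro: order_trans[OF _ abs_ge_self]\<close>)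
  have i0: "integrable lborel (\<lambda>z. U 0 (x + z) * ?f3 z)"
    by (rule Bochner_Integration.integrable_bound[OF dom])
      (use dom_term[OF k3, of 0] in \<open>auto intro: order_trans[OF _ abs_ge_self] simp del: minus_diff_eq\<close>)
  have "(\<integral>z. f z \<partial>lborel) = 0"
    by (rule integral_deriv_real_line[OF dF cf])
      (use i3 i0 gauss_dominated_tendsto[OF \<sigma> Fb] in \<open>auto simp: f_def[abs_def]\<close>)
  then have "(\<integral>z. U 3 (x + z) * ?\<phi> z \<partial>lborel) = (\<integral>z. - (U 0 (x + z) * ?f3 z) \<partial>lborel)"
    unfolding f_def using i3 i0 by simp
  also have "... = (\<integral>z. ?\<phi> z * (U 0 (x + z) * ((z ^ 3 - 3 * \<sigma>\<^sup>2 * z) / \<sigma> ^ 6)) \<partial>lborel)"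
    by (rule Bochner_Integration.integral_cong) (simp_all add: mult_ac del: minus_diff_eq)
  finally show ?thesis
    unfolding smooth_def by (subst (1 2) integral_gaussm) (simp_all add: mult.commute)
qed

section \<open>Posterior moments\<close>

text \<open>\<open>mom \<pi> \<sigma> 0\<close> is the mixture density and \<open>post \<pi> \<sigma> i\<close> the \<open>i\<close>-th posterior moment of the location.\<close>

definition mom :: "real measure \<Rightarrow> real \<Rightarrow> nat \<Rightarrow> real \<Rightarrow> real" where
  "mom \<pi> \<sigma> i x = (\<integral>\<theta>. \<theta> ^ i * gpdf \<sigma> (x - \<theta>) \<partial>\<pi>)"

definition post :: "real measure \<Rightarrow> real \<Rightarrow> nat \<Rightarrow> real \<Rightarrow> real" where
  "post \<pi> \<sigma> i x = mom \<pi> \<sigma> i x / mom \<pi> \<sigma> 0 x"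

lemma gauss_mixture_mom: "gauss_mixture \<pi> \<sigma> = mom \<pi> \<sigma> 0"
  by (simp add: gauss_mixture_def mom_def fun_eq_iff)

lemma plug_in_mean_post: "plug_in_mean \<pi> \<sigma> = post \<pi> \<sigma> 1"
  by (simp add: plug_in_mean_def post_def mom_def gauss_mixture_def fun_eq_iff)

lemma normal_density_antimono:
  assumes "0 < \<sigma>" "\<bar>y\<bar> \<le> z"
  shows "gpdf \<sigma> z \<le> gpdf \<sigma> y"
proof -
  have "y\<^sup>2 \<le> z\<^sup>2" using assms(2) by (metis abs_ge_zero power2_abs power_mono)
  then have "- z\<^sup>2 / (2 * \<sigma>\<^sup>2) \<le> - y\<^sup>2 / (2 * \<sigma>\<^sup>2)" by (intro divide_right_mono) auto
  then show ?thesis unfolding normal_density_def by (intro mult_left_mono) auto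
qed

lemma normal_density_ratio:
  assumes "0 < \<sigma>" "\<bar>a\<bar> \<le> M" "\<bar>b\<bar> \<le> M"
  shows "gpdf \<sigma> (x - a) \<le> exp (2 * M * (\<bar>x\<bar> + M) / \<sigma>\<^sup>2) * gpdf \<sigma> (x - b)"
proof -
  have M: "0 \<le> M" using assms by linarith
  have "(x - b)\<^sup>2 - (x - a)\<^sup>2 = (a - b) * (2 * x - a - b)" by (simp add: power2_eq_square algebra_simps)
  also have "... \<le> \<bar>a - b\<bar> * \<bar>2 * x - a - b\<bar>" by (metis abs_ge_self abs_mult)
  also have "... \<le> (2 * M) * (2 * (\<bar>x\<bar> + M))" using assms by (intro mult_mono) auto
  finally have "((x - b)\<^sup>2 - (x - a)\<^sup>2) / (2 * \<sigma>\<^sup>2) \<le> (2 * M) * (2 * (\<bar>x\<bar> + M)) / (2 * \<sigma>\<^sup>2)"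
    by (intro divide_right_mono) auto
  also have "... = 2 * M * (\<bar>x\<bar> + M) / \<sigma>\<^sup>2" by simp
  finally have "- (x - a - 0)\<^sup>2 / (2 * \<sigma>\<^sup>2) \<le> 2 * M * (\<bar>x\<bar> + M) / \<sigma>\<^sup>2 + - (x - b - 0)\<^sup>2 / (2 * \<sigma>\<^sup>2)"
    by (simp add: diff_divide_distrib)
  then have "exp (- (x - a - 0)\<^sup>2 / (2 * \<sigma>\<^sup>2)) \<le> exp (2 * M * (\<bar>x\<bar> + M) / \<sigma>\<^sup>2) * exp (- (x - b - 0)\<^sup>2 / (2 * \<sigma>\<^sup>2))"
    by (simp only: exp_add[symmetric] exp_le_cancel_iff)
  then have "1 / sqrt (2 * pi * \<sigma>\<^sup>2) * exp (- (x - a - 0)\<^sup>2 / (2 * \<sigma>\<^sup>2)) \<le> 1 / sqrt (2 * pi * \<sigma>\<^sup>2) * (exp (2 * M * (\<bar>x\<bar> + M) / \<sigma>\<^sup>2) * exp (- (x - b - 0)\<^sup>2 / (2 * \<sigma>\<^sup>2)))"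
    by (intro mult_left_mono) auto
  then show ?thesis unfolding normal_density_def by (simp add: mult_ac)
qed

locale mixture = prob_space \<pi> for M \<sigma> :: real and \<pi> :: "real measure" +
  assumes M_pos: "0 < M" and sg: "0 < \<sigma>" and prior: "\<pi> \<in> priors M"

lemma prob_measures_onD:
  assumes "\<pi> \<in> priors M"
  shows "prob_space \<pi>" "sets \<pi> = sets borel" "AE \<theta> in \<pi>. \<bar>\<theta>\<bar> \<le> M"
proof -
  have s: "\<pi> \<in> space (prob_algebra borel)" "measure \<pi> {-M..M} = 1" using assms by (auto simp: prob_measures_on_def)
  then show p: "prob_space \<pi>" and e: "sets \<pi> = sets borel" by (auto simp: space_prob_algebra)
  interpret prob_space \<pi> by fact
  have "AE \<theta> in \<pi>. \<theta> \<in> {-M..M}" using s(2) e by (subst prob_eq_1[symmetric]) auto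
  then show "AE \<theta> in \<pi>. \<bar>\<theta>\<bar> \<le> M" by eventually_elim auto
qed

lemma mixtureI: "0 < M \<Longrightarrow> 0 < \<sigma> \<Longrightarrow> \<pi> \<in> priors M \<Longrightarrow> mixture M \<sigma> \<pi>"
  using prob_measures_onD(1) by (auto simp: mixture_def mixture_axioms_def)

context mixture
begin

lemma sets_pi [measurable_cong, simp]: "sets \<pi> = sets borel" and AE_bound: "AE \<theta> in \<pi>. \<bar>\<theta>\<bar> \<le> M"
  using prob_measures_onD[OF prior] by auto

lemma space_pi [simp]: "space \<pi> = UNIV" using sets_eq_imp_space_eq[OF sets_pi] by simp

lemma mom_integrable: "integrable \<pi> (\<lambda>\<theta>. \<theta> ^ i * gpdf \<sigma> (x - \<theta>))"
proof (rule integrable_const_bound)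
  show "AE \<theta> in \<pi>. norm (\<theta> ^ i * gpdf \<sigma> (x - \<theta>)) \<le> M ^ i * (1 / sqrt (2 * pi * \<sigma>\<^sup>2))"
    using AE_bound
  proof eventually_elim
    case (elim \<theta>)
    show ?case unfolding norm_mult using elim normal_density_le[of \<sigma> "x - \<theta>"]
      by (intro mult_mono) (auto simp: power_abs M_pos less_imp_le intro!: power_mono)
  qed
qed measurable

lemma nd_integrable: "integrable \<pi> (\<lambda>\<theta>. gpdf \<sigma> (x - \<theta>))"
  using mom_integrable[of 0 x] by simp

lemma mom0: "mom \<pi> \<sigma> 0 x = (\<integral>\<theta>. gpdf \<sigma> (x - \<theta>) \<partial>\<pi>)"
  by (simp add: mom_def)

lemma mom0_lower: "gpdf \<sigma> (\<bar>x\<bar> + M) \<le> mom \<pi> \<sigma> 0 x"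
proof -
  have "(\<integral>\<theta>. gpdf \<sigma> (\<bar>x\<bar> + M) \<partial>\<pi>) \<le> (\<integral>\<theta>. gpdf \<sigma> (x - \<theta>) \<partial>\<pi>)"
  proof (rule integral_mono_AE)
    show "AE \<theta> in \<pi>. gpdf \<sigma> (\<bar>x\<bar> + M) \<le> gpdf \<sigma> (x - \<theta>)"
      using AE_bound by eventually_elim (rule normal_density_antimono[OF sg], linarith)
  qed (use nd_integrable in auto)
  then show ?thesis using prob_space by (simp add: mom0)
qed

lemma mom0_pos: "0 < mom \<pi> \<sigma> 0 x"
  using mom0_lower[of x] normal_density_pos[OF sg, of 0 "\<bar>x\<bar> + M"] by linarith

lemma mom_bound: "\<bar>mom \<pi> \<sigma> i x\<bar> \<le> M ^ i * mom \<pi> \<sigma> 0 x"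
proof -
  have "\<bar>mom \<pi> \<sigma> i x\<bar> \<le> (\<integral>\<theta>. \<bar>\<theta> ^ i * gpdf \<sigma> (x - \<theta>)\<bar> \<partial>\<pi>)"
    unfolding mom_def by (rule integral_abs_bound)
  also have "... \<le> (\<integral>\<theta>. M ^ i * gpdf \<sigma> (x - \<theta>) \<partial>\<pi>)"
  proof (rule integral_mono_AE)
    show "AE \<theta> in \<pi>. \<bar>\<theta> ^ i * gpdf \<sigma> (x - \<theta>)\<bar> \<le> M ^ i * gpdf \<sigma> (x - \<theta>)"
      using AE_bound by eventually_elim (auto simp: abs_mult power_abs intro!: mult_right_mono power_mono)
  qed (use nd_integrable mom_integrable in auto)
  finally show ?thesis by (simp add: mom0)
qed

lemma mom_deriv: "(mom \<pi> \<sigma> i has_real_derivative (mom \<pi> \<sigma> (Suc i) x - x * mom \<pi> \<sigma> i x) / \<sigma>\<^sup>2) (at x)"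
proof (rule has_real_derivative_quadratic)
  fix h :: real
  let ?c = "3 / \<sigma>\<^sup>2 / sqrt (2 * pi * \<sigma>\<^sup>2)"
  let ?n = "gpdf \<sigma>"
  have e: "h * ((mom \<pi> \<sigma> (Suc i) x - x * mom \<pi> \<sigma> i x) / \<sigma>\<^sup>2)
     = (\<integral>\<theta>. \<theta> ^ i * (h * (- (x - \<theta>) / \<sigma>\<^sup>2 * ?n (x - \<theta>))) \<partial>\<pi>)"
  proof -
    have "(\<integral>\<theta>. \<theta> ^ i * (h * (- (x - \<theta>) / \<sigma>\<^sup>2 * ?n (x - \<theta>))) \<partial>\<pi>)
       = (\<integral>\<theta>. h / \<sigma>\<^sup>2 * (\<theta> ^ Suc i * ?n (x - \<theta>)) - h * x / \<sigma>\<^sup>2 * (\<theta> ^ i * ?n (x - \<theta>)) \<partial>\<pi>)"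
      by (rule Bochner_Integration.integral_cong) (use sg in \<open>auto simp: field_simps\<close>)
    also have "... = h / \<sigma>\<^sup>2 * mom \<pi> \<sigma> (Suc i) x - h * x / \<sigma>\<^sup>2 * mom \<pi> \<sigma> i x"
      unfolding mom_def using mom_integrable[of "Suc i" x] mom_integrable[of i x]
      by (subst Bochner_Integration.integral_diff) (auto simp del: power_Suc)
    finally have I: "(\<integral>\<theta>. \<theta> ^ i * (h * (- (x - \<theta>) / \<sigma>\<^sup>2 * ?n (x - \<theta>))) \<partial>\<pi>)
       = h / \<sigma>\<^sup>2 * mom \<pi> \<sigma> (Suc i) x - h * x / \<sigma>\<^sup>2 * mom \<pi> \<sigma> i x" .
    show ?thesis unfolding I by (simp add: right_diff_distrib diff_divide_distrib mult_ac)
  qed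
  have ie: "integrable \<pi> (\<lambda>\<theta>. \<theta> ^ i * (h * (- (x - \<theta>) / \<sigma>\<^sup>2 * ?n (x - \<theta>))))"
  proof -
    have "integrable \<pi> (\<lambda>\<theta>. h / \<sigma>\<^sup>2 * (\<theta> ^ Suc i * ?n (x - \<theta>)) - h * x / \<sigma>\<^sup>2 * (\<theta> ^ i * ?n (x - \<theta>)))"
      using mom_integrable[of "Suc i" x] mom_integrable[of i x] by (auto simp del: power_Suc)
    also have "?this \<longleftrightarrow> ?thesis"
      by (rule Bochner_Integration.integrable_cong) (use sg in \<open>auto simp: field_simps\<close>)
    finally show ?thesis .
  qed
  note i1 = mom_integrable[of i "x + h"] and i2 = mom_integrable[of i x]
  let ?L = "mom \<pi> \<sigma> i (x + h) - mom \<pi> \<sigma> i x - h * ((mom \<pi> \<sigma> (Suc i) x - x * mom \<pi> \<sigma> i x) / \<sigma>\<^sup>2)"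
  define g where "g = (\<lambda>\<theta>. (\<theta> ^ i * ?n (x + h - \<theta>) - \<theta> ^ i * ?n (x - \<theta>)) - \<theta> ^ i * (h * (- (x - \<theta>) / \<sigma>\<^sup>2 * ?n (x - \<theta>))))"
  have gi: "integrable \<pi> g"
    unfolding g_def by (rule Bochner_Integration.integrable_diff[OF Bochner_Integration.integrable_diff[OF i1 i2] ie])
  have L: "?L = (\<integral>\<theta>. g \<theta> \<partial>\<pi>)"
    unfolding e g_def
    by (subst Bochner_Integration.integral_diff[OF Bochner_Integration.integrable_diff[OF i1 i2] ie],
        subst Bochner_Integration.integral_diff[OF i1 i2]) (simp add: mom_def)
  have gb: "AE \<theta> in \<pi>. \<bar>g \<theta>\<bar> \<le> M ^ i * ?c * h\<^sup>2"
    using AE_bound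
  proof eventually_elim
    case (elim \<theta>)
    have t: "\<bar>\<theta> ^ i\<bar> \<le> M ^ i" unfolding power_abs using elim by (intro power_mono) auto
    have "g \<theta> = \<theta> ^ i * (?n (x - \<theta> + h) - ?n (x - \<theta>) - h * (- (x - \<theta>) / \<sigma>\<^sup>2 * ?n (x - \<theta>)))"
    proof -
      have "x + h - \<theta> = x - \<theta> + h" by simp
      then show ?thesis unfolding g_def by (simp only: right_diff_distrib)
    qed
    then show ?case
      using abs_mult_bound[OF t normal_density_taylor[OF sg, of "x - \<theta>" h]] by (simp only: mult.assoc)
  qed
  have "\<bar>\<integral>\<theta>. g \<theta> \<partial>\<pi>\<bar> \<le> (\<integral>\<theta>. \<bar>g \<theta>\<bar> \<partial>\<pi>)" by (rule integral_abs_bound)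
  also have "... \<le> (\<integral>\<theta>. M ^ i * ?c * h\<^sup>2 \<partial>\<pi>)"
    by (rule integral_mono_AE[OF _ _ gb]) (use gi in auto)
  also have "... = M ^ i * ?c * h\<^sup>2" using prob_space by simp
  finally show "\<bar>?L\<bar> \<le> M ^ i * ?c * h\<^sup>2" unfolding L .
qed

lemma mom_measurable [measurable]: "mom \<pi> \<sigma> i \<in> borel_measurable borel"
  by (rule differentiable_measurable[OF mom_deriv])

lemma post_measurable [measurable]: "post \<pi> \<sigma> i \<in> borel_measurable borel"
  unfolding post_def[abs_def] by measurable

lemma post_bound: "\<bar>post \<pi> \<sigma> i x\<bar> \<le> M ^ i"
  unfolding post_def abs_divide using mom_bound[of i x] mom0_pos[of x]
  by (simp add: pos_divide_le_eq)

lemma post_deriv: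
  "(post \<pi> \<sigma> i has_real_derivative (post \<pi> \<sigma> (Suc i) x - post \<pi> \<sigma> i x * post \<pi> \<sigma> 1 x) / \<sigma>\<^sup>2) (at x)"
proof -
  have n: "mom \<pi> \<sigma> 0 x \<noteq> 0" using mom0_pos[of x] by simp
  have "(post \<pi> \<sigma> i has_real_derivative
    (((mom \<pi> \<sigma> (Suc i) x - x * mom \<pi> \<sigma> i x) / \<sigma>\<^sup>2) * mom \<pi> \<sigma> 0 x - mom \<pi> \<sigma> i x * ((mom \<pi> \<sigma> (Suc 0) x - x * mom \<pi> \<sigma> 0 x) / \<sigma>\<^sup>2))
     / (mom \<pi> \<sigma> 0 x * mom \<pi> \<sigma> 0 x)) (at x)"
    unfolding post_def[abs_def] by (rule DERIV_divide[OF mom_deriv mom_deriv n])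
  moreover have "(((mom \<pi> \<sigma> (Suc i) x - x * mom \<pi> \<sigma> i x) / \<sigma>\<^sup>2) * mom \<pi> \<sigma> 0 x - mom \<pi> \<sigma> i x * ((mom \<pi> \<sigma> (Suc 0) x - x * mom \<pi> \<sigma> 0 x) / \<sigma>\<^sup>2))
     / (mom \<pi> \<sigma> 0 x * mom \<pi> \<sigma> 0 x) = (post \<pi> \<sigma> (Suc i) x - post \<pi> \<sigma> i x * post \<pi> \<sigma> 1 x) / \<sigma>\<^sup>2"
    unfolding post_def using n sg by (simp add: field_simps)
  ultimately show ?thesis by simp
qed

end

text \<open>Both densities are averages of Gaussian densities whose centres differ by at most \<open>2 * M\<close>.\<close>

lemma mom0_ratio:
  assumes "mixture M \<sigma> \<pi>" "mixture M \<sigma> \<rho>"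
  shows "mom \<pi> \<sigma> 0 x \<le> exp (2 * M * (\<bar>x\<bar> + M) / \<sigma>\<^sup>2) * mom \<rho> \<sigma> 0 x"
proof -
  interpret A: mixture M \<sigma> \<pi> by fact
  interpret B: mixture M \<sigma> \<rho> by fact
  let ?E = "exp (2 * M * (\<bar>x\<bar> + M) / \<sigma>\<^sup>2)"
  have one: "gpdf \<sigma> (x - a) \<le> ?E * mom \<rho> \<sigma> 0 x" if a: "\<bar>a\<bar> \<le> M" for a
  proof -
    have "(\<integral>\<theta>. gpdf \<sigma> (x - a) \<partial>\<rho>) \<le> (\<integral>\<theta>. ?E * gpdf \<sigma> (x - \<theta>) \<partial>\<rho>)"
    proof (rule integral_mono_AE)
      show "AE \<theta> in \<rho>. gpdf \<sigma> (x - a) \<le> ?E * gpdf \<sigma> (x - \<theta>)"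
        using B.AE_bound by eventually_elim (rule normal_density_ratio[OF A.sg a])
    qed (use B.nd_integrable in auto)
    then show ?thesis using B.prob_space by (simp add: B.mom0)
  qed
  have "(\<integral>\<theta>. gpdf \<sigma> (x - \<theta>) \<partial>\<pi>) \<le> (\<integral>\<theta>. ?E * mom \<rho> \<sigma> 0 x \<partial>\<pi>)"
  proof (rule integral_mono_AE)
    show "AE \<theta> in \<pi>. gpdf \<sigma> (x - \<theta>) \<le> ?E * mom \<rho> \<sigma> 0 x"
      using A.AE_bound by eventually_elim (rule one)
  qed (use A.nd_integrable in auto)
  then show ?thesis using A.prob_space by (simp add: A.mom0)
qed

text \<open>The derivative of a posterior moment is a posterior covariance divided by \<open>\<sigma>\<^sup>2\<close>, hence a polynomial in
  posterior moments, and these are bounded by powers of \<open>M\<close>.\<close>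

lemma post_deriv_bounded:
  assumes "0 < M" "0 < k"
  shows "\<exists>B\<ge>0. \<forall>\<pi> \<sigma>. \<pi> \<in> priors M \<longrightarrow> k < \<sigma> \<longrightarrow> deriv_bounded n (\<lambda>_. 1) B (post \<pi> \<sigma> i)"
proof (induction n arbitrary: i)
  case 0
  have "\<bar>post \<pi> \<sigma> i x\<bar> \<le> M ^ i" if "\<pi> \<in> priors M" "k < \<sigma>" for \<pi> \<sigma> x
    using mixture.post_bound[OF mixtureI[OF assms(1) _ that(1)]] that(2) assms(2) by auto
  then show ?case using assms by (intro exI[of _ "M ^ i"]) auto
next
  case (Suc n)
  obtain B1 where B1: "0 \<le> B1" "\<And>\<pi> \<sigma>. \<pi> \<in> priors M \<Longrightarrow> k < \<sigma> \<Longrightarrow> deriv_bounded n (\<lambda>_. 1) B1 (post \<pi> \<sigma> (Suc i))"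
    using Suc[of "Suc i"] by blast
  obtain B2 where B2: "0 \<le> B2" "\<And>\<pi> \<sigma>. \<pi> \<in> priors M \<Longrightarrow> k < \<sigma> \<Longrightarrow> deriv_bounded n (\<lambda>_. 1) B2 (post \<pi> \<sigma> i)"
    using Suc[of "i"] by blast
  obtain B3 where B3: "0 \<le> B3" "\<And>\<pi> \<sigma>. \<pi> \<in> priors M \<Longrightarrow> k < \<sigma> \<Longrightarrow> deriv_bounded n (\<lambda>_. 1) B3 (post \<pi> \<sigma> 1)"
    using Suc[of 1] by blast
  define B where "B = (B1 + 2 ^ n * (B2 * B3)) / k\<^sup>2 + M ^ i"
  have nn: "0 \<le> (B1 + 2 ^ n * (B2 * B3)) / k\<^sup>2" "0 \<le> M ^ i" using B1 B2 B3 assms by auto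
  show ?case
  proof (intro exI[of _ B] conjI allI impI)
    show "0 \<le> B" using nn by (simp add: B_def)
    fix \<pi> \<sigma> assume p: "\<pi> \<in> priors M" and \<sigma>: "k < \<sigma>"
    have s0: "0 < \<sigma>" using \<sigma> assms by linarith
    interpret mixture M \<sigma> \<pi> by (rule mixtureI[OF assms(1) s0 p])
    let ?f = "\<lambda>x. 1 / \<sigma>\<^sup>2 * (post \<pi> \<sigma> (Suc i) x + (- 1) * (post \<pi> \<sigma> i x * post \<pi> \<sigma> 1 x))"
    have d: "(post \<pi> \<sigma> i has_real_derivative ?f x) (at x)" for x
      using post_deriv[of i x] by simp
    have s2: "\<bar>1 / \<sigma>\<^sup>2\<bar> \<le> 1 / k\<^sup>2" using \<sigma> assms by (auto intro!: frac_le power_mono)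
    have f: "deriv_bounded n (\<lambda>_. 1) (\<bar>1 / \<sigma>\<^sup>2\<bar> * (B1 + \<bar>-1\<bar> * (2 ^ n * (B2 * B3)))) ?f"
      by (intro deriv_bounded_cmult deriv_bounded_add deriv_bounded_mult B1(2) B2(2) B3(2) p \<sigma>) (use B1 B2 B3 in auto)
    have "\<bar>1 / \<sigma>\<^sup>2\<bar> * (B1 + \<bar>-1\<bar> * (2 ^ n * (B2 * B3))) \<le> 1 / k\<^sup>2 * (B1 + \<bar>-1\<bar> * (2 ^ n * (B2 * B3)))"
      using B1 B2 B3 by (intro mult_right_mono s2) auto
    then have le: "\<bar>1 / \<sigma>\<^sup>2\<bar> * (B1 + \<bar>-1\<bar> * (2 ^ n * (B2 * B3))) \<le> B"
      using nn by (simp add: B_def)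
    have "deriv_bounded n (\<lambda>_. 1) B ?f" by (rule deriv_bounded_mono[OF f]) (use le in simp)
    moreover have "\<bar>post \<pi> \<sigma> i x\<bar> \<le> B" for x using post_bound[of i x] nn by (simp add: B_def)
    ultimately show "deriv_bounded (Suc n) (\<lambda>_. 1) B (post \<pi> \<sigma> i)"
      unfolding deriv_bounded.simps mult_1_right
      by (intro conjI allI exI[of _ ?f] d)
  qed
qed

definition root_ratio :: "real measure \<Rightarrow> real measure \<Rightarrow> real \<Rightarrow> real \<Rightarrow> real" where
  "root_ratio \<pi> \<rho> \<sigma> x = sqrt (mom \<pi> \<sigma> 0 x / mom \<rho> \<sigma> 0 x)"

lemma root_ratio_deriv:
  assumes "mixture M \<sigma> \<pi>" "mixture M \<sigma> \<rho>"
  shows "(root_ratio \<pi> \<rho> \<sigma> has_real_derivative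
     root_ratio \<pi> \<rho> \<sigma> x * (1 / (2 * \<sigma>\<^sup>2) * (post \<pi> \<sigma> 1 x + (- 1) * post \<rho> \<sigma> 1 x))) (at x)"
proof -
  interpret A: mixture M \<sigma> \<pi> by fact
  interpret B: mixture M \<sigma> \<rho> by fact
  define a b where "a = mom \<pi> \<sigma> 0 x" and "b = mom \<rho> \<sigma> 0 x"
  have ab: "0 < a" "0 < b" using A.mom0_pos B.mom0_pos by (auto simp: a_def b_def)
  define a1 b1 where "a1 = mom \<pi> \<sigma> 1 x" and "b1 = mom \<rho> \<sigma> 1 x"
  have q: "((\<lambda>x. mom \<pi> \<sigma> 0 x / mom \<rho> \<sigma> 0 x) has_real_derivative
     (((a1 - x * a) / \<sigma>\<^sup>2) * b - a * ((b1 - x * b) / \<sigma>\<^sup>2)) / (b * b)) (at x)"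
    using DERIV_divide[OF A.mom_deriv[of 0 x] B.mom_deriv[of 0 x]] ab by (simp add: a_def b_def a1_def b1_def)
  have "(root_ratio \<pi> \<rho> \<sigma> has_real_derivative
     inverse (sqrt (a / b)) / 2 * ((((a1 - x * a) / \<sigma>\<^sup>2) * b - a * ((b1 - x * b) / \<sigma>\<^sup>2)) / (b * b))) (at x)"
    unfolding root_ratio_def[abs_def]
    by (rule DERIV_chain2[OF DERIV_real_sqrt q, folded a_def b_def]) (use ab in auto)
  moreover have "inverse (sqrt (a / b)) / 2 * ((((a1 - x * a) / \<sigma>\<^sup>2) * b - a * ((b1 - x * b) / \<sigma>\<^sup>2)) / (b * b))
     = sqrt (a / b) * (1 / (2 * \<sigma>\<^sup>2) * (a1 / a + (- 1) * (b1 / b)))"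
  proof -
    have i: "inverse (sqrt (a / b)) = sqrt (a / b) * (b / a)"
      using ab by (simp add: field_simps real_sqrt_divide)
    show ?thesis unfolding i using ab A.sg by (simp add: field_simps)
  qed
  ultimately show ?thesis by (simp add: root_ratio_def post_def a_def b_def a1_def b1_def)
qed

lemma root_ratio_growth:
  assumes "mixture M \<sigma> \<pi>" "mixture M \<sigma> \<rho>" "k < \<sigma>" "0 < k"
  shows "\<bar>root_ratio \<pi> \<rho> \<sigma> x\<bar> \<le> (2 * exp (M\<^sup>2 / k\<^sup>2)) * cosh (M / k\<^sup>2 * x)"
proof -
  interpret A: mixture M \<sigma> \<pi> by fact
  interpret B: mixture M \<sigma> \<rho> by fact
  have "root_ratio \<pi> \<rho> \<sigma> x \<le> sqrt (exp (2 * M * (\<bar>x\<bar> + M) / \<sigma>\<^sup>2))"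
    unfolding root_ratio_def using mom0_ratio[OF assms(1,2), of x] B.mom0_pos[of x]
    by (intro real_sqrt_le_mono) (simp add: pos_divide_le_eq)
  also have "sqrt (exp (2 * M * (\<bar>x\<bar> + M) / \<sigma>\<^sup>2)) = exp (M * (\<bar>x\<bar> + M) / \<sigma>\<^sup>2)"
  proof (rule real_sqrt_unique)
    show "(exp (M * (\<bar>x\<bar> + M) / \<sigma>\<^sup>2))\<^sup>2 = exp (2 * M * (\<bar>x\<bar> + M) / \<sigma>\<^sup>2)"
      by (simp add: exp_double[symmetric] mult.assoc)
  qed simp
  also have "... \<le> exp (M * (\<bar>x\<bar> + M) / k\<^sup>2)"
    using assms A.M_pos by (auto intro!: divide_left_mono power_mono mult_pos_pos)
  also have "... = exp (M\<^sup>2 / k\<^sup>2) * exp (M / k\<^sup>2 * \<bar>x\<bar>)"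
    by (simp add: exp_add[symmetric] power2_eq_square algebra_simps add_divide_distrib)
  also have "exp (M / k\<^sup>2 * \<bar>x\<bar>) \<le> 2 * cosh (M / k\<^sup>2 * x)"
    by (cases "0 \<le> x") (simp_all add: cosh_field_def)
  finally have "root_ratio \<pi> \<rho> \<sigma> x \<le> exp (M\<^sup>2 / k\<^sup>2) * (2 * cosh (M / k\<^sup>2 * x))" by simp
  moreover have "0 \<le> root_ratio \<pi> \<rho> \<sigma> x" using A.mom0_pos[of x] B.mom0_pos[of x] by (simp add: root_ratio_def)
  ultimately show ?thesis by (simp add: mult_ac)
qed

text \<open>The logarithmic derivative of the root likelihood ratio is a multiple of the difference of two posterior
  means, so each derivative is the ratio times a function all of whose derivatives are bounded.\<close>

lemma root_ratio_deriv_bounded: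
  assumes "0 < M" "0 < k"
  shows "\<exists>B\<ge>0. \<forall>\<pi> \<rho> \<sigma>. \<pi> \<in> priors M \<longrightarrow> \<rho> \<in> priors M \<longrightarrow> k < \<sigma> \<longrightarrow>
     deriv_bounded n (\<lambda>x. cosh (M / k\<^sup>2 * x)) B (root_ratio \<pi> \<rho> \<sigma>)"
proof (induction n)
  case 0
  have "\<bar>root_ratio \<pi> \<rho> \<sigma> x\<bar> \<le> (2 * exp (M\<^sup>2 / k\<^sup>2)) * cosh (M / k\<^sup>2 * x)"
    if "\<pi> \<in> priors M" "\<rho> \<in> priors M" "k < \<sigma>" for \<pi> \<rho> \<sigma> x
    by (rule root_ratio_growth) (use that assms in \<open>auto intro: mixtureI\<close>)
  then show ?case by (intro exI[of _ "2 * exp (M\<^sup>2 / k\<^sup>2)"]) auto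
next
  case (Suc n)
  then obtain B1 where B1: "0 \<le> B1" "\<And>\<pi> \<rho> \<sigma>. \<pi> \<in> priors M \<Longrightarrow> \<rho> \<in> priors M \<Longrightarrow> k < \<sigma>
      \<Longrightarrow> deriv_bounded n (\<lambda>x. cosh (M / k\<^sup>2 * x)) B1 (root_ratio \<pi> \<rho> \<sigma>)" by blast
  obtain B3 where B3: "0 \<le> B3" "\<And>\<pi> \<sigma>. \<pi> \<in> priors M \<Longrightarrow> k < \<sigma> \<Longrightarrow> deriv_bounded n (\<lambda>_. 1) B3 (post \<pi> \<sigma> 1)"
    using post_deriv_bounded[OF assms, of n 1] by blast
  define B where "B = 2 ^ n * (B1 * (1 / (2 * k\<^sup>2) * (B3 + B3))) + 2 * exp (M\<^sup>2 / k\<^sup>2)"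
  have nn: "0 \<le> 2 ^ n * (B1 * (1 / (2 * k\<^sup>2) * (B3 + B3)))" "0 \<le> 2 * exp (M\<^sup>2 / k\<^sup>2)" using B1 B3 by auto
  show ?case
  proof (intro exI[of _ B] conjI allI impI)
    show "0 \<le> B" using nn unfolding B_def by linarith
    fix \<pi> \<rho> \<sigma> assume p: "\<pi> \<in> priors M" "\<rho> \<in> priors M" and \<sigma>: "k < \<sigma>"
    have s0: "0 < \<sigma>" using \<sigma> assms by linarith
    note mx = mixtureI[OF assms(1) s0 p(1)] mixtureI[OF assms(1) s0 p(2)]
    let ?a = "\<lambda>x. 1 / (2 * \<sigma>\<^sup>2) * (post \<pi> \<sigma> 1 x + (- 1) * post \<rho> \<sigma> 1 x)"
    have s2: "\<bar>1 / (2 * \<sigma>\<^sup>2)\<bar> \<le> 1 / (2 * k\<^sup>2)" using \<sigma> assms by (auto intro!: frac_le power_mono)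
    have a: "deriv_bounded n (\<lambda>_. 1) (\<bar>1 / (2 * \<sigma>\<^sup>2)\<bar> * (B3 + \<bar>-1\<bar> * B3)) ?a"
      by (intro deriv_bounded_cmult deriv_bounded_add B3(2) p \<sigma>)
    have a': "deriv_bounded n (\<lambda>_. 1) (1 / (2 * k\<^sup>2) * (B3 + B3)) ?a"
      by (rule deriv_bounded_mono[OF a]) (use mult_right_mono[OF s2, of "B3 + B3"] B3(1) in simp)
    have f: "deriv_bounded n (\<lambda>x. cosh (M / k\<^sup>2 * x)) (2 ^ n * (B1 * (1 / (2 * k\<^sup>2) * (B3 + B3)))) (\<lambda>x. root_ratio \<pi> \<rho> \<sigma> x * ?a x)"
      by (rule deriv_bounded_mult[OF B1(2)[OF p \<sigma>] a']) (use B1 B3 in auto)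
    have "deriv_bounded n (\<lambda>x. cosh (M / k\<^sup>2 * x)) B (\<lambda>x. root_ratio \<pi> \<rho> \<sigma> x * ?a x)"
    proof (rule deriv_bounded_mono[OF f])
      fix x show "2 ^ n * (B1 * (1 / (2 * k\<^sup>2) * (B3 + B3))) * cosh (M / k\<^sup>2 * x) \<le> B * cosh (M / k\<^sup>2 * x)"
      proof (rule mult_right_mono)
        show "2 ^ n * (B1 * (1 / (2 * k\<^sup>2) * (B3 + B3))) \<le> B" unfolding B_def using nn by linarith
      qed simp
    qed
    moreover have "\<bar>root_ratio \<pi> \<rho> \<sigma> x\<bar> \<le> B * cosh (M / k\<^sup>2 * x)" for x
    proof -
      have "(2 * exp (M\<^sup>2 / k\<^sup>2)) * cosh (M / k\<^sup>2 * x) \<le> B * cosh (M / k\<^sup>2 * x)"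
        using nn by (intro mult_right_mono) (auto simp: B_def)
      then show ?thesis using root_ratio_growth[OF mx \<sigma> assms(2), of x] by linarith
    qed
    ultimately show "deriv_bounded (Suc n) (\<lambda>x. cosh (M / k\<^sup>2 * x)) B (root_ratio \<pi> \<rho> \<sigma>)"
      unfolding deriv_bounded.simps
      by (intro conjI allI exI[of _ "\<lambda>x. root_ratio \<pi> \<rho> \<sigma> x * ?a x"] root_ratio_deriv[OF mx])
  qed
qed

section \<open>The Gaussian experiment\<close>

lemma integral_abs_mult_le:
  fixes f g :: "'a \<Rightarrow> real"
  assumes [measurable]: "f \<in> borel_measurable M" "g \<in> borel_measurable M"
    and f: "integrable M (\<lambda>x. (f x)\<^sup>2)" and g: "integrable M (\<lambda>x. (g x)\<^sup>2)"
  shows "integrable M (\<lambda>x. f x * g x)"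
    and "(\<integral>x. \<bar>f x * g x\<bar> \<partial>M) \<le> sqrt (\<integral>x. (f x)\<^sup>2 \<partial>M) * sqrt (\<integral>x. (g x)\<^sup>2 \<partial>M)"
proof -
  have am: "2 * \<bar>a * b\<bar> \<le> t * a\<^sup>2 + b\<^sup>2 / t" if "0 < t" for a b t :: real
  proof -
    have "0 \<le> (t * \<bar>a\<bar> - \<bar>b\<bar>)\<^sup>2 / t" using that by simp
    also have "... = t * a\<^sup>2 + b\<^sup>2 / t - 2 * \<bar>a * b\<bar>"
      using that by (simp add: power2_diff field_simps abs_mult power2_eq_square)
    finally show ?thesis by simp
  qed
  show I: "integrable M (\<lambda>x. f x * g x)"
  proof (rule Bochner_Integration.integrable_bound[OF Bochner_Integration.integrable_add[OF f g]])
    have "\<bar>f x * g x\<bar> \<le> (f x)\<^sup>2 + (g x)\<^sup>2" for x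
    proof -
      have "2 * \<bar>f x * g x\<bar> \<le> (f x)\<^sup>2 + (g x)\<^sup>2" using am[of 1 "f x" "g x"] by simp
      then show ?thesis using abs_ge_zero[of "f x * g x"] by linarith
    qed
    then show "AE x in M. norm (f x * g x) \<le> norm ((f x)\<^sup>2 + (g x)\<^sup>2)" by auto
  qed measurable
  define a b where "a = (\<integral>x. (f x)\<^sup>2 \<partial>M)" and "b = (\<integral>x. (g x)\<^sup>2 \<partial>M)"
  have ab: "0 \<le> a" "0 \<le> b" by (auto simp: a_def b_def)
  define c where "c = (\<integral>x. \<bar>f x * g x\<bar> \<partial>M)"
  have key: "2 * c \<le> t * a + b / t" if t: "0 < t" for t
  proof -
    have "2 * c = (\<integral>x. 2 * \<bar>f x * g x\<bar> \<partial>M)" by (simp add: c_def)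
    also have "... \<le> (\<integral>x. t * (f x)\<^sup>2 + (g x)\<^sup>2 / t \<partial>M)"
      by (rule integral_mono) (use I f g am[OF t] in auto)
    also have "... = t * a + b / t" using f g by (simp add: a_def b_def)
    finally show ?thesis .
  qed
  have "c \<le> sqrt a * sqrt b"
  proof (rule field_le_epsilon)
    fix e :: real assume e: "0 < e"
    define \<delta> where "\<delta> = e / (sqrt a + sqrt b + e + 1)"
    have den: "0 < sqrt a + sqrt b + e + 1" using ab e by (simp add: add_nonneg_pos)
    have d: "0 < \<delta>" "\<delta> \<le> 1" using den e ab by (auto simp: \<delta>_def)
    define A B where "A = sqrt a + \<delta>" and "B = sqrt b + \<delta>"
    have AB: "0 < A" "0 < B" "a \<le> A\<^sup>2" "b \<le> B\<^sup>2"
    proof -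
      show "0 < A" "0 < B" using ab d by (auto simp: A_def B_def add_nonneg_pos)
      have "(sqrt a)\<^sup>2 \<le> A\<^sup>2" by (rule power_mono) (use d ab in \<open>auto simp: A_def\<close>)
      moreover have "(sqrt b)\<^sup>2 \<le> B\<^sup>2" by (rule power_mono) (use d ab in \<open>auto simp: B_def\<close>)
      ultimately show "a \<le> A\<^sup>2" "b \<le> B\<^sup>2" using ab by auto
    qed
    have "2 * c \<le> B / A * a + b / (B / A)" using AB by (intro key) simp
    also have "... \<le> B / A * A\<^sup>2 + B\<^sup>2 / (B / A)"
      using AB by (intro add_mono mult_left_mono divide_right_mono) auto
    also have "... = 2 * (A * B)" using AB by (simp add: power2_eq_square)
    finally have "c \<le> A * B" by simp
    also have "... = sqrt a * sqrt b + \<delta> * (sqrt a + sqrt b + \<delta>)" by (simp add: A_def B_def algebra_simps)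
    also have "\<delta> * (sqrt a + sqrt b + \<delta>) \<le> \<delta> * (sqrt a + sqrt b + e + 1)"
      using d e by (intro mult_left_mono) auto
    also have "... = e" using den by (simp add: \<delta>_def)
    finally show "c \<le> sqrt a * sqrt b + e" by simp
  qed
  then show "(\<integral>x. \<bar>f x * g x\<bar> \<partial>M) \<le> sqrt (\<integral>x. (f x)\<^sup>2 \<partial>M) * sqrt (\<integral>x. (g x)\<^sup>2 \<partial>M)"
    by (simp add: a_def b_def c_def)
qed

context mixture
begin

abbreviation "Q \<equiv> gauss_joint \<pi> \<sigma>"

lemma sets_Q [measurable_cong, simp]: "sets Q = sets (borel \<Otimes>\<^sub>M borel)"
  unfolding gauss_joint_def by (simp cong: sets_pair_measure_cong)

lemma space_Q [simp]: "space Q = UNIV"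
  by (simp add: gauss_joint_def space_pair_measure)

lemma Q_density_measurable [measurable]: "(\<lambda>(\<theta>, z). ennreal (gpdf \<sigma> (z - \<theta>))) \<in> borel_measurable (\<pi> \<Otimes>\<^sub>M lborel)"
  by measurable

lemma Q_nn_integral:
  assumes [measurable]: "f \<in> borel_measurable (borel \<Otimes>\<^sub>M borel)"
  shows "(\<integral>\<^sup>+p. f p \<partial>Q) = (\<integral>\<^sup>+\<theta>. \<integral>\<^sup>+y. f (\<theta>, \<theta> + y) \<partial>gaussm \<sigma> \<partial>\<pi>)"
proof -
  interpret pair_sigma_finite \<pi> lborel ..
  have fm [measurable]: "f \<in> borel_measurable (\<pi> \<Otimes>\<^sub>M lborel)" using assms by measurable
  have "(\<integral>\<^sup>+p. f p \<partial>Q) = (\<integral>\<^sup>+p. (case p of (\<theta>, z) \<Rightarrow> ennreal (gpdf \<sigma> (z - \<theta>))) * f p \<partial>(\<pi> \<Otimes>\<^sub>M lborel))"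
    unfolding gauss_joint_def by (rule nn_integral_density) measurable
  also have "... = (\<integral>\<^sup>+\<theta>. \<integral>\<^sup>+z. ennreal (gpdf \<sigma> (z - \<theta>)) * f (\<theta>, z) \<partial>lborel \<partial>\<pi>)"
    by (subst lborel.nn_integral_fst[symmetric]) auto
  also have "... = (\<integral>\<^sup>+\<theta>. \<integral>\<^sup>+y. f (\<theta>, \<theta> + y) \<partial>gaussm \<sigma> \<partial>\<pi>)"
  proof (rule nn_integral_cong)
    fix \<theta>
    have "(\<integral>\<^sup>+z. ennreal (gpdf \<sigma> (z - \<theta>)) * f (\<theta>, z) \<partial>lborel)
       = (\<integral>\<^sup>+y. ennreal (gpdf \<sigma> y) * f (\<theta>, \<theta> + y) \<partial>lborel)"
      using nn_integral_real_affine[of "\<lambda>z. ennreal (gpdf \<sigma> (z - \<theta>)) * f (\<theta>, z)" 1 \<theta>] by simp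
    also have "... = (\<integral>\<^sup>+y. f (\<theta>, \<theta> + y) \<partial>gaussm \<sigma>)"
      unfolding gaussm_def by (rule nn_integral_density[symmetric]) measurable
    finally show "(\<integral>\<^sup>+z. ennreal (gpdf \<sigma> (z - \<theta>)) * f (\<theta>, z) \<partial>lborel) = (\<integral>\<^sup>+y. f (\<theta>, \<theta> + y) \<partial>gaussm \<sigma>)" .
  qed
  finally show ?thesis .
qed

lemma prob_space_Q: "prob_space Q"
proof
  interpret g: prob_space "gaussm \<sigma>" by (rule prob_space_gaussm[OF sg])
  have "emeasure Q (space Q) = (\<integral>\<^sup>+p. 1 \<partial>Q)" by simp
  also have "... = 1"
    by (subst Q_nn_integral) (simp_all add: g.emeasure_space_1[simplified] emeasure_space_1[simplified])
  finally show "emeasure Q (space Q) = 1" .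
qed

lemma Q_distr: "Q = distr (\<pi> \<Otimes>\<^sub>M gaussm \<sigma>) (borel \<Otimes>\<^sub>M borel) (\<lambda>(\<theta>, y). (\<theta>, \<theta> + y))"
proof (rule measure_eqI)
  interpret g: prob_space "gaussm \<sigma>" by (rule prob_space_gaussm[OF sg])
  fix A assume "A \<in> sets Q"
  then have A [measurable]: "A \<in> sets (borel \<Otimes>\<^sub>M borel)" by simp
  have m [measurable]: "(\<lambda>(\<theta>, y). (\<theta>, \<theta> + y)) \<in> measurable (\<pi> \<Otimes>\<^sub>M gaussm \<sigma>) (borel \<Otimes>\<^sub>M (borel :: real measure))"
    by measurable
  have "emeasure Q A = (\<integral>\<^sup>+p. indicator A p \<partial>Q)" using \<open>A \<in> sets Q\<close> by simp
  also have "... = (\<integral>\<^sup>+\<theta>. \<integral>\<^sup>+y. indicator A (\<theta>, \<theta> + y) \<partial>gaussm \<sigma> \<partial>\<pi>)"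
    by (rule Q_nn_integral) measurable
  also have "... = (\<integral>\<^sup>+p. indicator A (case p of (\<theta>, y) \<Rightarrow> (\<theta>, \<theta> + y)) \<partial>(\<pi> \<Otimes>\<^sub>M gaussm \<sigma>))"
    by (subst g.nn_integral_fst[symmetric]) auto
  also have "... = (\<integral>\<^sup>+p. indicator A p \<partial>distr (\<pi> \<Otimes>\<^sub>M gaussm \<sigma>) (borel \<Otimes>\<^sub>M borel) (\<lambda>(\<theta>, y). (\<theta>, \<theta> + y)))"
    by (subst nn_integral_distr) (auto intro: m)
  finally show "emeasure Q A = emeasure (distr (\<pi> \<Otimes>\<^sub>M gaussm \<sigma>) (borel \<Otimes>\<^sub>M borel) (\<lambda>(\<theta>, y). (\<theta>, \<theta> + y))) A"
    by simp
qed simp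

lemma Q_integral_iterated:
  fixes h :: "real \<times> real \<Rightarrow> real"
  assumes [measurable]: "h \<in> borel_measurable (borel \<Otimes>\<^sub>M borel)" and int: "integrable Q h"
  shows "(\<integral>p. h p \<partial>Q) = (\<integral>\<theta>. (\<integral>y. h (\<theta>, \<theta> + y) \<partial>gaussm \<sigma>) \<partial>\<pi>)"
    and "integrable \<pi> (\<lambda>\<theta>. \<integral>y. h (\<theta>, \<theta> + y) \<partial>gaussm \<sigma>)"
proof -
  interpret g: prob_space "gaussm \<sigma>" by (rule prob_space_gaussm[OF sg])
  interpret PG: pair_prob_space \<pi> "gaussm \<sigma>" ..
  have m [measurable]: "(\<lambda>(\<theta>, y). (\<theta>, \<theta> + y)) \<in> measurable (\<pi> \<Otimes>\<^sub>M gaussm \<sigma>) (borel \<Otimes>\<^sub>M (borel :: real measure))"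
    by measurable
  have I: "integrable (\<pi> \<Otimes>\<^sub>M gaussm \<sigma>) (\<lambda>p. h (case p of (\<theta>, y) \<Rightarrow> (\<theta>, \<theta> + y)))"
    using int unfolding Q_distr by (subst (asm) integrable_distr_eq) auto
  show "(\<integral>p. h p \<partial>Q) = (\<integral>\<theta>. (\<integral>y. h (\<theta>, \<theta> + y) \<partial>gaussm \<sigma>) \<partial>\<pi>)"
    unfolding Q_distr using PG.integral_fst'[OF I] by (subst integral_distr) auto
  show "integrable \<pi> (\<lambda>\<theta>. \<integral>y. h (\<theta>, \<theta> + y) \<partial>gaussm \<sigma>)"
    using PG.integrable_fst'[OF I] by simp
qed

lemma Q_integral_swap:
  fixes h :: "real \<times> real \<Rightarrow> real"
  assumes [measurable]: "h \<in> borel_measurable (borel \<Otimes>\<^sub>M borel)" and int: "integrable Q h"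
  shows "(\<integral>p. h p \<partial>Q) = (\<integral>z. (\<integral>\<theta>. h (\<theta>, z) * gpdf \<sigma> (z - \<theta>) \<partial>\<pi>) \<partial>lborel)"
proof -
  interpret pair_sigma_finite \<pi> lborel ..
  have m [measurable]: "h \<in> borel_measurable (\<pi> \<Otimes>\<^sub>M lborel)" using assms(1) by measurable
  have n: "AE p in \<pi> \<Otimes>\<^sub>M lborel. 0 \<le> (case p of (\<theta>, z) \<Rightarrow> gpdf \<sigma> (z - \<theta>))" by auto
  have dm: "(\<lambda>p. case p of (\<theta>, z) \<Rightarrow> gpdf \<sigma> (z - \<theta>)) \<in> borel_measurable (\<pi> \<Otimes>\<^sub>M lborel)" by measurable
  have Qe: "Q = density (\<pi> \<Otimes>\<^sub>M lborel) (\<lambda>p. ennreal (case p of (\<theta>, z) \<Rightarrow> gpdf \<sigma> (z - \<theta>)))"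
    unfolding gauss_joint_def by (rule arg_cong[where f = "density _"]) auto
  have I: "integrable (\<pi> \<Otimes>\<^sub>M lborel) (\<lambda>(\<theta>, z). h (\<theta>, z) * gpdf \<sigma> (z - \<theta>))"
    using int unfolding Qe by (subst (asm) integrable_density[OF m dm n]) (simp add: case_prod_beta' mult.commute)
  have "(\<integral>p. h p \<partial>Q) = (\<integral>p. (case p of (\<theta>, z) \<Rightarrow> h (\<theta>, z) * gpdf \<sigma> (z - \<theta>)) \<partial>(\<pi> \<Otimes>\<^sub>M lborel))"
    unfolding Qe by (subst integral_density[OF m dm n]) (simp add: case_prod_beta' mult.commute)
  also have "... = (\<integral>z. (\<integral>\<theta>. h (\<theta>, z) * gpdf \<sigma> (z - \<theta>) \<partial>\<pi>) \<partial>lborel)"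
    by (rule integral_snd[OF I, symmetric])
  finally show ?thesis .
qed

lemma Q_integral_snd:
  fixes u :: "real \<Rightarrow> real"
  assumes [measurable]: "u \<in> borel_measurable borel" and int: "integrable Q (\<lambda>p. u (snd p))"
  shows "(\<integral>p. u (snd p) \<partial>Q) = (\<integral>z. u z * mom \<pi> \<sigma> 0 z \<partial>lborel)"
  using Q_integral_swap[OF _ int] by (simp add: mom0)

lemma Q_nn_integral_snd:
  assumes [measurable]: "u \<in> borel_measurable borel"
  shows "(\<integral>\<^sup>+p. u (snd p) \<partial>Q) = (\<integral>\<^sup>+z. u z * ennreal (mom \<pi> \<sigma> 0 z) \<partial>lborel)"
proof -
  interpret pair_sigma_finite \<pi> lborel ..
  have "(\<integral>\<^sup>+p. u (snd p) \<partial>Q) = (\<integral>\<^sup>+p. (case p of (\<theta>, z) \<Rightarrow> ennreal (gpdf \<sigma> (z - \<theta>))) * u (snd p) \<partial>(\<pi> \<Otimes>\<^sub>M lborel))"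
    unfolding gauss_joint_def by (rule nn_integral_density) measurable
  also have "... = (\<integral>\<^sup>+z. \<integral>\<^sup>+\<theta>. ennreal (gpdf \<sigma> (z - \<theta>)) * u z \<partial>\<pi> \<partial>lborel)"
    by (subst nn_integral_snd[symmetric]) auto
  also have "... = (\<integral>\<^sup>+z. u z * ennreal (mom \<pi> \<sigma> 0 z) \<partial>lborel)"
  proof (rule nn_integral_cong)
    fix z
    have "(\<integral>\<^sup>+\<theta>. ennreal (gpdf \<sigma> (z - \<theta>)) * u z \<partial>\<pi>) = (\<integral>\<^sup>+\<theta>. ennreal (gpdf \<sigma> (z - \<theta>)) \<partial>\<pi>) * u z"
      by (rule nn_integral_multc) measurable
    also have "(\<integral>\<^sup>+\<theta>. ennreal (gpdf \<sigma> (z - \<theta>)) \<partial>\<pi>) = ennreal (mom \<pi> \<sigma> 0 z)"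
      unfolding mom0 by (rule nn_integral_eq_integral[OF nd_integrable]) auto
    finally show "(\<integral>\<^sup>+\<theta>. ennreal (gpdf \<sigma> (z - \<theta>)) * u z \<partial>\<pi>) = u z * ennreal (mom \<pi> \<sigma> 0 z)"
      by (simp add: mult.commute)
  qed
  finally show ?thesis .
qed

lemma Q_fst_bounded: "AE p in Q. \<bar>fst p\<bar> \<le> M"
proof -
  have "AE p in \<pi> \<Otimes>\<^sub>M gaussm \<sigma>. \<bar>fst p\<bar> \<le> M"
  proof -
    interpret g: prob_space "gaussm \<sigma>" by (rule prob_space_gaussm[OF sg])
    interpret PG: pair_prob_space \<pi> "gaussm \<sigma>" ..
    have "AE \<theta> in \<pi>. AE y in gaussm \<sigma>. \<bar>fst (\<theta>, y)\<bar> \<le> M" using AE_bound by eventually_elim auto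
    then show ?thesis by (rule PG.AE_pair_measure[rotated]) measurable
  qed
  then show ?thesis unfolding Q_distr
    by (subst AE_distr_iff) (auto simp: case_prod_beta')
qed

lemma Q_cosh_integrable: "integrable Q (\<lambda>p. cosh (C * snd p))"
proof (rule integrableI_nonneg)
  have [measurable]: "(\<lambda>p. cosh (C * snd p)) \<in> borel_measurable (borel \<Otimes>\<^sub>M borel :: (real \<times> real) measure)"
    by (simp add: cosh_field_def)
  then show "(\<lambda>p. cosh (C * snd p)) \<in> borel_measurable Q" by measurable
  let ?b = "exp (C\<^sup>2 * \<sigma>\<^sup>2 / 2) * cosh (\<bar>C\<bar> * M)"
  have "(\<integral>\<^sup>+p. ennreal (cosh (C * snd p)) \<partial>Q) = (\<integral>\<^sup>+\<theta>. \<integral>\<^sup>+y. ennreal (cosh (C * (\<theta> + y))) \<partial>gaussm \<sigma> \<partial>\<pi>)"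
    by (subst Q_nn_integral) auto
  also have "... \<le> (\<integral>\<^sup>+\<theta>. ennreal ?b \<partial>\<pi>)"
  proof (rule nn_integral_mono_AE)
    show "AE \<theta> in \<pi>. (\<integral>\<^sup>+y. ennreal (cosh (C * (\<theta> + y))) \<partial>gaussm \<sigma>) \<le> ennreal ?b"
      using AE_bound
    proof eventually_elim
      case (elim \<theta>)
      have "(\<integral>\<^sup>+y. ennreal (cosh (C * (\<theta> + y))) \<partial>gaussm \<sigma>) = ennreal (exp (C\<^sup>2 * \<sigma>\<^sup>2 / 2) * cosh (C * \<theta>))"
        using nn_integral_eq_integral[OF gaussm_cosh(1)[OF sg, of C \<theta>]] gaussm_cosh(2)[OF sg, of C \<theta>] by simp
      moreover have "cosh (C * \<theta>) \<le> cosh (\<bar>C\<bar> * M)"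
      proof -
        have "\<bar>C * \<theta>\<bar> \<le> \<bar>C\<bar> * M" unfolding abs_mult using elim by (intro mult_left_mono) auto
        then have "cosh \<bar>C * \<theta>\<bar> \<le> cosh (\<bar>C\<bar> * M)" by (subst cosh_real_nonneg_le_iff) auto
        then show ?thesis by (simp add: cosh_real_abs)
      qed
      ultimately show ?case by (auto intro!: ennreal_leI mult_left_mono)
    qed
  qed
  also have "... = ennreal ?b" using emeasure_space_1 by simp
  also have "... < \<infinity>" by simp
  finally show "(\<integral>\<^sup>+p. ennreal (cosh (C * snd p)) \<partial>Q) < \<infinity>" .
qed auto

lemma Q_integrable_cosh_dominated:
  fixes h :: "real \<times> real \<Rightarrow> real"
  assumes [measurable]: "h \<in> borel_measurable (borel \<Otimes>\<^sub>M borel)" and "AE p in Q. \<bar>h p\<bar> \<le> A * cosh (C * snd p)"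
  shows "integrable Q h"
proof (rule Bochner_Integration.integrable_bound)
  show "integrable Q (\<lambda>p. A * cosh (C * snd p))" using Q_cosh_integrable by simp
  show "AE p in Q. norm (h p) \<le> norm (A * cosh (C * snd p))"
    using assms(2) by eventually_elim (auto intro: order_trans[OF _ abs_ge_self])
qed measurable

lemma mom0_integrable: "integrable lborel (mom \<pi> \<sigma> 0)" and mom0_integral: "(\<integral>z. mom \<pi> \<sigma> 0 z \<partial>lborel) = 1"
proof -
  have e: "(\<integral>\<^sup>+z. ennreal (mom \<pi> \<sigma> 0 z) \<partial>lborel) = 1"
    using Q_nn_integral_snd[of "\<lambda>_. 1"] prob_space.emeasure_space_1[OF prob_space_Q] by simp
  show i: "integrable lborel (mom \<pi> \<sigma> 0)"
    by (rule integrableI_nonneg) (use e mom0_pos in \<open>auto simp: less_imp_le\<close>)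
  have "ennreal (\<integral>z. mom \<pi> \<sigma> 0 z \<partial>lborel) = ennreal 1"
    using nn_integral_eq_integral[OF i] e mom0_pos by (simp add: less_imp_le)
  then show "(\<integral>z. mom \<pi> \<sigma> 0 z \<partial>lborel) = 1"
    by (subst (asm) ennreal_inj) (auto intro!: integral_nonneg_AE simp: mom0_pos less_imp_le)
qed

text \<open>The conditional expectation is identified on events of the second coordinate, where exchanging the two
  integrals turns the inner one into the first posterior moment.\<close>

lemma bayes_risk_post:
  "bayes_risk \<pi> \<sigma> = (\<integral>p. (fst p - post \<pi> \<sigma> 1 (snd p))\<^sup>2 \<partial>Q)"
proof -
  interpret Q: prob_space Q by (rule prob_space_Q)
  let ?F = "vimage_algebra (space Q) snd (borel :: real measure)"
  have sm: "snd \<in> borel_measurable Q" by measurable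
  have sub: "subalgebra Q ?F"
    using measurable_sets[OF sm] by (auto simp: subalgebra_def sets_vimage_algebra2)
  interpret F: finite_measure_subalgebra Q ?F by unfold_locales (rule sub)
  have sF: "snd \<in> borel_measurable ?F" by (rule measurable_vimage_algebra1) auto
  have pm: "(\<lambda>p. post \<pi> \<sigma> 1 (snd p)) \<in> borel_measurable ?F"
    by (rule measurable_compose[OF sF post_measurable])
  have i1: "integrable Q fst" by (rule Q.integrable_const_bound[OF _ ]) (use Q_fst_bounded in auto)
  have i2: "integrable Q (\<lambda>p. post \<pi> \<sigma> 1 (snd p))"
    by (rule Q.integrable_const_bound[of _ M]) (use post_bound[of 1] in auto)
  have "AE p in Q. real_cond_exp Q ?F fst p = post \<pi> \<sigma> 1 (snd p)"
  proof (rule F.real_cond_exp_charact[OF _ i1 i2 pm])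
    fix A assume "A \<in> sets ?F"
    then obtain B where B [measurable]: "B \<in> sets borel" and A: "A = snd -` B" by (auto simp: sets_vimage_algebra2)
    have [measurable]: "A \<in> sets Q" using measurable_sets[OF sm B] A by simp
    have ind: "indicator A p = (indicator B (snd p) :: real)" for p by (simp add: A indicator_def)
    have j1: "integrable Q (\<lambda>p. indicator B (snd p) * fst p)"
      using integrable_mult_indicator[OF \<open>A \<in> sets Q\<close> i1] by (simp add: ind)
    have j2: "integrable Q (\<lambda>p. indicator B (snd p) * post \<pi> \<sigma> 1 (snd p))"
      using integrable_mult_indicator[OF \<open>A \<in> sets Q\<close> i2] by (simp add: ind)
    have "(LINT p:A|Q. fst p) = (\<integral>p. indicator B (snd p) * fst p \<partial>Q)" by (simp add: set_lebesgue_integral_def ind)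
    also have "... = (\<integral>z. (\<integral>\<theta>. indicator B z * \<theta> * gpdf \<sigma> (z - \<theta>) \<partial>\<pi>) \<partial>lborel)"
      by (subst Q_integral_swap[OF _ j1]) auto
    also have "... = (\<integral>z. indicator B z * mom \<pi> \<sigma> 1 z \<partial>lborel)"
      by (simp add: mom_def mult.assoc)
    also have "... = (\<integral>z. (indicator B z * post \<pi> \<sigma> 1 z) * mom \<pi> \<sigma> 0 z \<partial>lborel)"
      using mom0_pos by (intro Bochner_Integration.integral_cong) (auto simp: post_def less_imp_neq[symmetric])
    also have "... = (\<integral>p. indicator B (snd p) * post \<pi> \<sigma> 1 (snd p) \<partial>Q)"
      by (rule Q_integral_snd[OF _ j2, symmetric]) measurable
    also have "... = (LINT p:A|Q. post \<pi> \<sigma> 1 (snd p))" by (simp add: set_lebesgue_integral_def ind)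
    finally show "(LINT p:A|Q. fst p) = (LINT p:A|Q. post \<pi> \<sigma> 1 (snd p))" .
  qed
  then show ?thesis
    unfolding bayes_risk_def Let_def by (intro integral_cong_AE) auto
qed

end

lemma sqrt_diff_sq: "0 \<le> p \<Longrightarrow> 0 \<le> q \<Longrightarrow> (sqrt p - sqrt q)\<^sup>2 = p + q - 2 * sqrt (p * q)" for p q :: real
  by (simp add: power2_diff real_sqrt_mult)

text \<open>Under the law with density \<open>mom \<rho> \<sigma> 0\<close>, the deficit of the mean of the root likelihood ratio from 1 and
  its squared distance from 1 are multiples of the same number \<open>H\<close>. An error proportional to that
  distance can therefore be absorbed by the deficit.\<close>

lemma hellinger_mixture:
  assumes "mixture M \<sigma> \<pi>" "mixture M \<sigma> \<rho>"
  defines "H \<equiv> hel_sq \<sigma> \<pi> \<rho>"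
  shows "0 \<le> H" "H \<le> 1"
    and "integrable lborel (\<lambda>x. (sqrt (mom \<pi> \<sigma> 0 x) - sqrt (mom \<rho> \<sigma> 0 x))\<^sup>2)"
    and "(\<integral>x. (root_ratio \<pi> \<rho> \<sigma> x - 1) * mom \<rho> \<sigma> 0 x \<partial>lborel) = - H"
    and "(\<integral>x. (root_ratio \<pi> \<rho> \<sigma> x - 1)\<^sup>2 * mom \<rho> \<sigma> 0 x \<partial>lborel) = 2 * H"
proof -
  interpret A: mixture M \<sigma> \<pi> by fact
  interpret B: mixture M \<sigma> \<rho> by fact
  let ?p = "mom \<pi> \<sigma> 0" and ?q = "mom \<rho> \<sigma> 0"
  have pos: "0 \<le> ?p x" "0 \<le> ?q x" "0 < ?q x" for x using A.mom0_pos[of x] B.mom0_pos[of x] by auto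
  have e: "(sqrt (?p x) - sqrt (?q x))\<^sup>2 = ?p x + ?q x - 2 * sqrt (?p x * ?q x)" for x
    by (rule sqrt_diff_sq) (use pos in auto)
  have si: "integrable lborel (\<lambda>x. sqrt (?p x * ?q x))"
  proof (rule Bochner_Integration.integrable_bound[OF Bochner_Integration.integrable_add[OF A.mom0_integrable B.mom0_integrable]])
    have "2 * sqrt (?p x * ?q x) \<le> ?p x + ?q x" for x using e[of x] zero_le_power2[of "sqrt (?p x) - sqrt (?q x)"] by linarith
    then have "sqrt (?p x * ?q x) \<le> ?p x + ?q x" for x using pos[of x]
      by (smt (verit) mult_nonneg_nonneg real_sqrt_ge_zero)
    then show "AE x in lborel. norm (sqrt (?p x * ?q x)) \<le> norm (?p x + ?q x)" using pos by (auto simp: abs_mult)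
  qed measurable
  show I: "integrable lborel (\<lambda>x. (sqrt (?p x) - sqrt (?q x))\<^sup>2)"
    unfolding e using si A.mom0_integrable B.mom0_integrable by auto
  have H: "H = 1 / 2 * (\<integral>x. (sqrt (?p x) - sqrt (?q x))\<^sup>2 \<partial>lborel)"
    by (simp add: H_def hellinger_sq_def gauss_mixture_mom)
  have H2: "H = 1 - (\<integral>x. sqrt (?p x * ?q x) \<partial>lborel)"
    unfolding H e using si A.mom0_integrable B.mom0_integrable by (simp add: A.mom0_integral B.mom0_integral)
  have s0: "0 \<le> (\<integral>x. sqrt (?p x * ?q x) \<partial>lborel)" by (rule integral_nonneg_AE) (use pos in auto)
  show "0 \<le> H" unfolding H by simp
  show "H \<le> 1" using H2 s0 by simp
  have r: "root_ratio \<pi> \<rho> \<sigma> x * ?q x = sqrt (?p x * ?q x)" for x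
  proof -
    define t where "t = sqrt (?q x)"
    have t: "0 < t" "?q x = t * t" using pos[of x] by (auto simp: t_def)
    have "sqrt (?p x / ?q x) * ?q x = sqrt (?p x) / t * (t * t)" by (simp add: real_sqrt_divide t_def[symmetric] t(2)[symmetric])
    also have "... = sqrt (?p x) * sqrt (?q x)" using t(1) by (simp add: t_def[symmetric])
    finally show ?thesis by (simp add: root_ratio_def real_sqrt_mult)
  qed
  show "(\<integral>x. (root_ratio \<pi> \<rho> \<sigma> x - 1) * ?q x \<partial>lborel) = - H"
    unfolding H2 left_diff_distrib r using si B.mom0_integrable by (simp add: B.mom0_integral)
  have "(root_ratio \<pi> \<rho> \<sigma> x - 1)\<^sup>2 * ?q x = (sqrt (?p x) - sqrt (?q x))\<^sup>2" for x
  proof -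
    have "(root_ratio \<pi> \<rho> \<sigma> x - 1)\<^sup>2 * ?q x = ((root_ratio \<pi> \<rho> \<sigma> x - 1) * sqrt (?q x))\<^sup>2"
      using pos[of x] by (simp add: power_mult_distrib)
    also have "(root_ratio \<pi> \<rho> \<sigma> x - 1) * sqrt (?q x) = sqrt (?p x) - sqrt (?q x)"
      using pos[of x] by (simp add: root_ratio_def left_diff_distrib real_sqrt_divide)
    finally show ?thesis .
  qed
  then show "(\<integral>x. (root_ratio \<pi> \<rho> \<sigma> x - 1)\<^sup>2 * ?q x \<partial>lborel) = 2 * H" by (simp add: H)
qed

section \<open>Comparison with the Gaussian experiment\<close>

definition skew_const :: "real \<Rightarrow> real \<Rightarrow> real" where
  "skew_const s k = third_const s * (sqrt 6 / k ^ 3)"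

lemma skew_const_nonneg: "0 < k \<Longrightarrow> 0 \<le> skew_const s k"
  by (simp add: skew_const_def third_const_def)

text \<open>The norm of the third Hermite polynomial produced by the integration by parts.\<close>

lemma gaussm_hermite_sq:
  assumes "0 < \<sigma>"
  shows "integrable (gaussm \<sigma>) (\<lambda>z. ((z ^ 3 - 3 * \<sigma>\<^sup>2 * z) / \<sigma> ^ 6)\<^sup>2)"
    and "(\<integral>z. ((z ^ 3 - 3 * \<sigma>\<^sup>2 * z) / \<sigma> ^ 6)\<^sup>2 \<partial>gaussm \<sigma>) = 6 / \<sigma> ^ 6"
proof -
  have pw: "integrable (gaussm \<sigma>) (\<lambda>z. z ^ m)" for m :: nat
    using integrable_normal_moment[OF assms, of 0 m] by (subst integrable_gaussm_iff) auto
  have e: "((z ^ 3 - 3 * \<sigma>\<^sup>2 * z) / \<sigma> ^ 6)\<^sup>2 = (z ^ 6 - 6 * \<sigma>\<^sup>2 * z ^ 4 + 9 * \<sigma> ^ 4 * z\<^sup>2) / \<sigma> ^ 12" for z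
    by (simp add: power_divide eval_nat_numeral algebra_simps)
  show "integrable (gaussm \<sigma>) (\<lambda>z. ((z ^ 3 - 3 * \<sigma>\<^sup>2 * z) / \<sigma> ^ 6)\<^sup>2)"
    unfolding e using pw[of 6] pw[of 4] pw[of 2] by auto
  have "(\<integral>z. ((z ^ 3 - 3 * \<sigma>\<^sup>2 * z) / \<sigma> ^ 6)\<^sup>2 \<partial>gaussm \<sigma>) = (15 * \<sigma> ^ 6 - 6 * \<sigma>\<^sup>2 * (3 * \<sigma> ^ 4) + 9 * \<sigma> ^ 4 * \<sigma>\<^sup>2) / \<sigma> ^ 12"
    unfolding e using pw[of 6] pw[of 4] pw[of 2] by (simp add: gaussm_moments[OF assms])
  also have "... = 6 / \<sigma> ^ 6"
    using assms by (simp add: eval_nat_numeral)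
  finally show "(\<integral>z. ((z ^ 3 - 3 * \<sigma>\<^sup>2 * z) / \<sigma> ^ 6)\<^sup>2 \<partial>gaussm \<sigma>) = 6 / \<sigma> ^ 6" .
qed

locale noisy_prior = noisy_unit P \<theta> \<epsilon> J \<sigma> s M K + prior: mixture M \<sigma> \<pi>
  for P :: "'a measure" and \<theta> \<epsilon> J \<sigma> s M K \<pi> +
  fixes k :: real
  assumes theta_law: "distr P borel \<theta> = \<pi>" and k_pos: "0 < k" and k_le: "k \<le> \<sigma>"
begin

abbreviation "obsv \<equiv> partial J"

lemma obsv_measurable [measurable]: "obsv \<in> borel_measurable P"
  by (rule partial_measurable) simp

lemma theta_integral:
  fixes H :: "real \<Rightarrow> real"
  assumes [measurable]: "H \<in> borel_measurable borel"
  shows "(\<integral>\<omega>. H (\<theta> \<omega>) \<partial>P) = (\<integral>t. H t \<partial>\<pi>)" "integrable P (\<lambda>\<omega>. H (\<theta> \<omega>)) \<longleftrightarrow> integrable \<pi> H"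
  unfolding theta_law[symmetric] by (simp_all add: integral_distr integrable_distr_eq)

text \<open>Sums of products cover the expanded square \<open>(\<theta> - r x)\<^sup>2\<close>. In the correction term
  the derivatives are moved onto the Gaussian density, and the Cauchy-Schwarz inequality bounds it by
  the norm of \<open>h\<close> in the Gaussian experiment. No power of \<open>J\<close> better than \<open>1 / sqrt J\<close> is available for
  it, but for the functions of interest this norm is small.\<close>

lemma edgeworth_bound:
  fixes W u :: "nat \<Rightarrow> real \<Rightarrow> real" and m :: nat
  assumes C: "0 \<le> C" and Wm [measurable]: "\<And>a. W a \<in> borel_measurable borel"
    and Wb: "\<And>a t. \<bar>t\<bar> \<le> M \<Longrightarrow> \<bar>W a t\<bar> \<le> w" and w: "0 \<le> w" and B: "0 \<le> B"
    and u: "\<And>a. smooth8 C B (u a)"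
  defines "h \<equiv> (\<lambda>p. \<Sum>a<m. W a (fst p) * u a (snd p))"
  shows "\<bar>(\<integral>\<omega>. h (\<theta> \<omega>, obsv \<omega>) \<partial>P) - (\<integral>p. h p \<partial>prior.Q)\<bar>
     \<le> skew_const s k / sqrt (real J) * sqrt (\<integral>p. (h p)\<^sup>2 \<partial>prior.Q) + real m * w * B * lind C / real J"
    and "integrable P (\<lambda>\<omega>. h (\<theta> \<omega>, obsv \<omega>))" "integrable prior.Q h" "integrable prior.Q (\<lambda>p. (h p)\<^sup>2)"
    "h \<in> borel_measurable (borel \<Otimes>\<^sub>M borel)"
proof -
  let ?N = "\<integral>p. (h p)\<^sup>2 \<partial>prior.Q"
  note sg = prior.sg
  interpret g: prob_space "gaussm \<sigma>" by (rule prob_space_gaussm[OF sg])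
  define D where "D = (\<lambda>a U. U 0 = u a \<and> jet C B U \<and> jet C B (\<lambda>i. U (i + 3)) \<and>
     (\<forall>i x. i < 4 \<longrightarrow> (U i has_real_derivative U (Suc i) x) (at x)))"
  have "\<exists>U. D a U" for a using deriv_bounded_jets[OF C u[of a]] unfolding D_def by metis
  then obtain U where DU: "\<And>a. D a (U a)" by metis
  have U0: "U a 0 = u a" and U: "jet C B (U a)" and U3: "jet C B (\<lambda>i. U a (i + 3))"
    and der: "\<And>i x. i < 4 \<Longrightarrow> (U a i has_real_derivative U a (Suc i) x) (at x)" for a
    using DU[of a] unfolding D_def by auto
  have um [measurable]: "u a \<in> borel_measurable borel" for a using jetD(1)[OF U[of a], of 0] by (simp add: U0)
  have ub: "\<bar>u a x\<bar> \<le> B * cosh (C * x)" for a x using jetD(2)[OF U[of a], of 0] by (simp add: U0)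
  show hm [measurable]: "h \<in> borel_measurable (borel \<Otimes>\<^sub>M borel)" unfolding h_def by measurable
  have termb: "\<bar>W a t * u a x\<bar> \<le> w * B * cosh (C * x)" if "\<bar>t\<bar> \<le> M" for a t x
    using abs_mult_bound[OF Wb[OF that] ub] by (simp add: mult.assoc)
  have hb: "\<bar>h (t, x)\<bar> \<le> real m * (w * B) * cosh (C * x)" if "\<bar>t\<bar> \<le> M" for t x
  proof -
    have "\<bar>h (t, x)\<bar> \<le> (\<Sum>a<m. \<bar>W a t * u a x\<bar>)" by (simp add: h_def sum_abs)
    also have "... \<le> (\<Sum>a<m. w * B * cosh (C * x))" by (intro sum_mono termb that)
    finally show ?thesis by simp
  qed
  have AEb: "AE p in prior.Q. \<bar>h p\<bar> \<le> real m * (w * B) * cosh (C * snd p)"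
    using prior.Q_fst_bounded by eventually_elim (metis hb prod.collapse)
  show Qh: "integrable prior.Q h" by (rule prior.Q_integrable_cosh_dominated[OF hm AEb])
  show Qh2: "integrable prior.Q (\<lambda>p. (h p)\<^sup>2)"
  proof (rule prior.Q_integrable_cosh_dominated[where C = "2 * C"])
    show "AE p in prior.Q. \<bar>(h p)\<^sup>2\<bar> \<le> (real m * (w * B))\<^sup>2 * cosh (2 * C * snd p)"
      using AEb
    proof eventually_elim
      case (elim p)
      have "\<bar>(h p)\<^sup>2\<bar> = \<bar>h p\<bar>\<^sup>2" by simp
      also have "... \<le> (real m * (w * B) * cosh (C * snd p))\<^sup>2" using elim by (intro power_mono) auto
      also have "... = (real m * (w * B))\<^sup>2 * (cosh (C * snd p))\<^sup>2" by (simp add: power_mult_distrib)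
      also have "... \<le> (real m * (w * B))\<^sup>2 * cosh (2 * C * snd p)"
      proof (rule mult_left_mono)
        have "cosh (2 * (C * snd p)) = 2 * (cosh (C * snd p))\<^sup>2 - 1" by (rule cosh_double_cosh)
        moreover have "1 \<le> (cosh (C * snd p))\<^sup>2" using cosh_real_ge_1[of "C * snd p"] by (simp add: one_le_power)
        ultimately have "(cosh (C * snd p))\<^sup>2 \<le> cosh (2 * (C * snd p))" by linarith
        then show "(cosh (C * snd p))\<^sup>2 \<le> cosh (2 * C * snd p)" by (simp add: mult.assoc)
      qed simp
      finally show ?case .
    qed
  qed measurable
  have WF: "(\<lambda>\<omega>. W a (\<theta> \<omega>)) \<in> borel_measurable F" for a
    by (rule measurable_compose[OF theta_F Wm])
  have WAE: "AE \<omega> in P. \<bar>W a (\<theta> \<omega>)\<bar> \<le> w" for a using theta_bounded by eventually_elim (rule Wb)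
  have WP [measurable]: "(\<lambda>\<omega>. W a (\<theta> \<omega>)) \<in> borel_measurable P" for a by measurable
  have i1: "integrable P (\<lambda>\<omega>. W a (\<theta> \<omega>) * u a (obsv \<omega>))" for a
    by (rule integrable_weighted_growth(1)[OF _ C um ub WP WAE w]) simp
  show "integrable P (\<lambda>\<omega>. h (\<theta> \<omega>, obsv \<omega>))" unfolding h_def using i1 by simp
  have e1: "(\<integral>\<omega>. h (\<theta> \<omega>, obsv \<omega>) \<partial>P) = (\<Sum>a<m. \<integral>\<omega>. W a (\<theta> \<omega>) * u a (obsv \<omega>) \<partial>P)"
    unfolding h_def using i1 by simp
  note skP [measurable] = measurable_from_subalg[OF subalgebra_F skew_F]
  have L: "\<bar>(\<integral>\<omega>. W a (\<theta> \<omega>) * u a (obsv \<omega>) \<partial>P) - (\<integral>\<omega>. W a (\<theta> \<omega>) * smooth \<sigma> (u a) (\<theta> \<omega>) \<partial>P)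
     - (\<integral>\<omega>. W a (\<theta> \<omega>) * skew \<omega> * smooth \<sigma> (U a 3) (\<theta> \<omega>) \<partial>P)\<bar> \<le> w * B * lind C / real J" for a
    using lindeberg[OF C U[of a] U3[of a] WF[of a] WAE[of a] w] by (simp add: U0)
  \<comment> \<open>The main term of the comparison is the integral of \<open>h\<close> in the Gaussian experiment.\<close>
  have uint: "integrable (gaussm \<sigma>) (\<lambda>z. u a (t + z))" for a t by (rule smooth_integrable[OF sg C um ub])
  have sm [measurable]: "smooth \<sigma> (u a) \<in> borel_measurable borel" for a using sg by measurable
  have hsum: "(\<integral>y. h (t, t + y) \<partial>gaussm \<sigma>) = (\<Sum>a<m. W a t * smooth \<sigma> (u a) t)" for t
    unfolding h_def smooth_def using uint by simp
  have Wi: "integrable P (\<lambda>\<omega>. W a (\<theta> \<omega>) * smooth \<sigma> (u a) (\<theta> \<omega>))" for a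
    using integrable_weighted_growth(1)[OF _ C sm smooth_growth[OF sg C um ub] WP WAE w, of 0 a] by simp
  have e2: "(\<integral>p. h p \<partial>prior.Q) = (\<Sum>a<m. \<integral>\<omega>. W a (\<theta> \<omega>) * smooth \<sigma> (u a) (\<theta> \<omega>) \<partial>P)"
  proof -
    have "(\<integral>p. h p \<partial>prior.Q) = (\<integral>t. (\<Sum>a<m. W a t * smooth \<sigma> (u a) t) \<partial>\<pi>)"
      unfolding prior.Q_integral_iterated(1)[OF hm Qh] hsum ..
    also have "... = (\<integral>\<omega>. (\<Sum>a<m. W a (\<theta> \<omega>) * smooth \<sigma> (u a) (\<theta> \<omega>)) \<partial>P)"
      by (rule theta_integral(1)[symmetric]) measurable
    also have "... = (\<Sum>a<m. \<integral>\<omega>. W a (\<theta> \<omega>) * smooth \<sigma> (u a) (\<theta> \<omega>) \<partial>P)"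
      using Wi by (rule Bochner_Integration.integral_sum)
    finally show ?thesis .
  qed
  \<comment> \<open>The correction term becomes an integral of \<open>h\<close> times the Hermite factor \<open>q\<close> in the same experiment.\<close>
  define q where "q z = (z ^ 3 - 3 * \<sigma>\<^sup>2 * z) / \<sigma> ^ 6" for z
  have qm [measurable]: "q \<in> borel_measurable borel" unfolding q_def by measurable
  have s3: "smooth \<sigma> (U a 3) t = (\<integral>z. u a (t + z) * q z \<partial>gaussm \<sigma>)" for a t
    using stein_third[OF sg C U[of a] der[of _ a], of t] by (simp add: U0 q_def)
  have s3m [measurable]: "smooth \<sigma> (U a 3) \<in> borel_measurable borel" for a
    using jetD(1)[OF U[of a], of 3] sg by (rule smooth_measurable)
  have s3b: "\<bar>smooth \<sigma> (U a 3) t\<bar> \<le> B * exp (C\<^sup>2 * \<sigma>\<^sup>2 / 2) * cosh (C * t)" for a t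
    by (rule smooth_growth[OF sg C jetD(1,2)[OF U[of a]]])
  define k3 where "k3 = third_const s / sqrt (real J)"
  have k3: "0 \<le> k3" using consts_nonneg by (simp add: k3_def)
  have skAE: "AE \<omega> in P. \<bar>skew \<omega>\<bar> \<le> k3" using skew_bounded by (simp add: k3_def)
  have Wsk: "AE \<omega> in P. \<bar>W a (\<theta> \<omega>) * skew \<omega>\<bar> \<le> w * k3" for a
    using WAE[of a] skAE by eventually_elim (rule abs_mult_bound)
  have i3: "integrable P (\<lambda>\<omega>. W a (\<theta> \<omega>) * skew \<omega> * smooth \<sigma> (U a 3) (\<theta> \<omega>))" for a
    using integrable_weighted_growth(1)[OF _ C s3m s3b _ Wsk, of 0 a] w k3 by simp
  define T where "T t = (\<Sum>a<m. W a t * smooth \<sigma> (U a 3) t)" for t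
  have Tm [measurable]: "T \<in> borel_measurable borel" unfolding T_def by measurable
  have e3: "(\<Sum>a<m. \<integral>\<omega>. W a (\<theta> \<omega>) * skew \<omega> * smooth \<sigma> (U a 3) (\<theta> \<omega>) \<partial>P) = (\<integral>\<omega>. skew \<omega> * T (\<theta> \<omega>) \<partial>P)"
    unfolding T_def using i3 by (subst Bochner_Integration.integral_sum[symmetric]) (auto simp: sum_distrib_left mult_ac intro!: Bochner_Integration.integral_cong)
  have Ti: "integrable P (\<lambda>\<omega>. W a (\<theta> \<omega>) * smooth \<sigma> (U a 3) (\<theta> \<omega>))" for a
    using integrable_weighted_growth(1)[OF _ C s3m s3b WP WAE w, of 0 a] by simp
  have TiP: "integrable P (\<lambda>\<omega>. T (\<theta> \<omega>))" unfolding T_def using Ti by simp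
  have uq: "integrable (gaussm \<sigma>) (\<lambda>z. u a (t + z) * q z)" for a t
  proof (rule integral_abs_mult_le(1))
    show "integrable (gaussm \<sigma>) (\<lambda>z. (u a (t + z))\<^sup>2)"
    proof (rule gaussm_integrable_exp_dominated[OF sg])
      show "\<bar>(u a (t + z))\<^sup>2\<bar> \<le> (B * cosh (C * t))\<^sup>2 * exp ((2 * C) * \<bar>z\<bar>)" for z
      proof -
        have "\<bar>u a (t + z)\<bar> \<le> B * cosh (C * t) * exp (C * \<bar>z\<bar>)"
          using order_trans[OF ub[of a "t + z"] mult_left_mono[OF cosh_mult_add_le[OF C] B]] by (simp add: mult.assoc)
        then have "\<bar>u a (t + z)\<bar>\<^sup>2 \<le> (B * cosh (C * t) * exp (C * \<bar>z\<bar>))\<^sup>2" by (intro power_mono) auto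
        also have "... = (B * cosh (C * t))\<^sup>2 * exp ((2 * C) * \<bar>z\<bar>)"
          by (simp add: power_mult_distrib exp_double[symmetric] mult.assoc)
        finally show ?thesis by simp
      qed
    qed measurable
    show "integrable (gaussm \<sigma>) (\<lambda>z. (q z)\<^sup>2)" unfolding q_def by (rule gaussm_hermite_sq(1)[OF sg])
  qed measurable
  have Th: "T t = (\<integral>y. h (t, t + y) * q y \<partial>gaussm \<sigma>)" for t
    unfolding T_def s3 h_def using uq by (simp add: sum_distrib_right mult.assoc)
  have Qq: "(\<lambda>p. q (snd p - fst p)) \<in> borel_measurable (borel \<Otimes>\<^sub>M borel)" by measurable
  have qq: "(\<integral>\<^sup>+p. ennreal ((q (snd p - fst p))\<^sup>2) \<partial>prior.Q) = ennreal (6 / \<sigma> ^ 6)"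
  proof -
    have "(\<integral>\<^sup>+y. ennreal ((q y)\<^sup>2) \<partial>gaussm \<sigma>) = ennreal (6 / \<sigma> ^ 6)"
      using nn_integral_eq_integral[OF gaussm_hermite_sq(1)[OF sg]] gaussm_hermite_sq(2)[OF sg] by (simp add: q_def)
    then show ?thesis
      by (subst prior.Q_nn_integral) (simp_all add: prior.emeasure_space_1[simplified])
  qed
  have Qq2: "integrable prior.Q (\<lambda>p. (q (snd p - fst p))\<^sup>2)"
    by (rule integrableI_nonneg) (use qq Qq in auto)
  have Qq2v: "(\<integral>p. (q (snd p - fst p))\<^sup>2 \<partial>prior.Q) = 6 / \<sigma> ^ 6"
  proof -
    have "ennreal (\<integral>p. (q (snd p - fst p))\<^sup>2 \<partial>prior.Q) = ennreal (6 / \<sigma> ^ 6)"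
      using nn_integral_eq_integral[OF Qq2] qq by simp
    then show ?thesis using sg by (subst (asm) ennreal_inj) auto
  qed
  have hq: "integrable prior.Q (\<lambda>p. h p * q (snd p - fst p))"
    by (rule integral_abs_mult_le(1)[OF _ _ Qh2 Qq2]) measurable
  have Tint: "integrable \<pi> T" using theta_integral(2)[OF Tm] TiP by simp
  have "\<bar>\<integral>\<omega>. skew \<omega> * T (\<theta> \<omega>) \<partial>P\<bar> \<le> (\<integral>\<omega>. \<bar>skew \<omega> * T (\<theta> \<omega>)\<bar> \<partial>P)" by (rule integral_abs_bound)
  also have "... \<le> (\<integral>\<omega>. k3 * \<bar>T (\<theta> \<omega>)\<bar> \<partial>P)"
  proof (rule integral_mono_AE')
    show "integrable P (\<lambda>\<omega>. k3 * \<bar>T (\<theta> \<omega>)\<bar>)" using TiP by simp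
    show "AE \<omega> in P. \<bar>skew \<omega> * T (\<theta> \<omega>)\<bar> \<le> k3 * \<bar>T (\<theta> \<omega>)\<bar>"
      using skAE by eventually_elim (simp add: abs_mult mult_right_mono)
  qed (use k3 in simp)
  also have "... = k3 * (\<integral>t. \<bar>T t\<bar> \<partial>\<pi>)" using theta_integral(1)[of "\<lambda>t. \<bar>T t\<bar>"] by simp
  also have "... \<le> k3 * (\<integral>p. \<bar>h p * q (snd p - fst p)\<bar> \<partial>prior.Q)"
  proof (rule mult_left_mono[OF _ k3])
    have ha: "integrable prior.Q (\<lambda>p. \<bar>h p * q (snd p - fst p)\<bar>)" using hq by simp
    have hm': "(\<lambda>p. \<bar>h p * q (snd p - fst p)\<bar>) \<in> borel_measurable (borel \<Otimes>\<^sub>M borel)" by measurable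
    note it = prior.Q_integral_iterated[OF hm' ha]
    have "(\<integral>t. \<bar>T t\<bar> \<partial>\<pi>) \<le> (\<integral>t. (\<integral>y. \<bar>h (t, t + y) * q y\<bar> \<partial>gaussm \<sigma>) \<partial>\<pi>)"
    proof (rule integral_mono)
      show "integrable \<pi> (\<lambda>t. \<bar>T t\<bar>)" using Tint by simp
      show "integrable \<pi> (\<lambda>t. \<integral>y. \<bar>h (t, t + y) * q y\<bar> \<partial>gaussm \<sigma>)" using it(2) by simp
      show "\<bar>T t\<bar> \<le> (\<integral>y. \<bar>h (t, t + y) * q y\<bar> \<partial>gaussm \<sigma>)" for t unfolding Th by (rule integral_abs_bound)
    qed
    also have "... = (\<integral>p. \<bar>h p * q (snd p - fst p)\<bar> \<partial>prior.Q)" using it(1) by simp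
    finally show "(\<integral>t. \<bar>T t\<bar> \<partial>\<pi>) \<le> (\<integral>p. \<bar>h p * q (snd p - fst p)\<bar> \<partial>prior.Q)" .
  qed
  also have "... \<le> k3 * (sqrt ?N * sqrt (6 / \<sigma> ^ 6))"
    unfolding Qq2v[symmetric]
    by (intro mult_left_mono integral_abs_mult_le(2) Qh2 Qq2 k3) measurable
  also have "... \<le> k3 * (sqrt ?N * (sqrt 6 / k ^ 3))"
  proof (intro mult_left_mono k3)
    have "k ^ 3 \<le> \<sigma> ^ 3" using k_pos k_le by (intro power_mono) auto
    moreover have "sqrt (6 / \<sigma> ^ 6) = sqrt 6 / \<sigma> ^ 3"
    proof -
      have "sqrt (\<sigma> ^ 6) = \<sigma> ^ 3" by (rule real_sqrt_unique) (use sg in \<open>auto simp: power_mult[symmetric]\<close>)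
      then show ?thesis by (simp add: real_sqrt_divide)
    qed
    ultimately show "sqrt (6 / \<sigma> ^ 6) \<le> sqrt 6 / k ^ 3" using k_pos sg by (simp add: frac_le)
  qed auto
  also have "... = skew_const s k / sqrt (real J) * sqrt ?N"
    by (simp add: k3_def skew_const_def mult_ac)
  finally have third: "\<bar>\<integral>\<omega>. skew \<omega> * T (\<theta> \<omega>) \<partial>P\<bar> \<le> skew_const s k / sqrt (real J) * sqrt ?N" .
  define X1 X2 X3 where "X1 a = (\<integral>\<omega>. W a (\<theta> \<omega>) * u a (obsv \<omega>) \<partial>P)"
    and "X2 a = (\<integral>\<omega>. W a (\<theta> \<omega>) * smooth \<sigma> (u a) (\<theta> \<omega>) \<partial>P)"
    and "X3 a = (\<integral>\<omega>. W a (\<theta> \<omega>) * skew \<omega> * smooth \<sigma> (U a 3) (\<theta> \<omega>) \<partial>P)" for a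
  have "\<bar>\<Sum>a<m. X1 a - X2 a - X3 a\<bar> \<le> (\<Sum>a<m. \<bar>X1 a - X2 a - X3 a\<bar>)" by (rule sum_abs)
  also have "... \<le> (\<Sum>a<m. w * B * lind C / real J)"
    unfolding X1_def X2_def X3_def by (intro sum_mono L)
  also have "... = real m * w * B * lind C / real J" by simp
  finally have "\<bar>(\<Sum>a<m. X1 a) - (\<Sum>a<m. X2 a) - (\<Sum>a<m. X3 a)\<bar> \<le> real m * w * B * lind C / real J"
    by (simp add: sum_subtractf)
  with third show "\<bar>(\<integral>\<omega>. h (\<theta> \<omega>, obsv \<omega>) \<partial>P) - (\<integral>p. h p \<partial>prior.Q)\<bar>
     \<le> skew_const s k / sqrt (real J) * sqrt ?N + real m * w * B * lind C / real J"
    unfolding e1 e2 e3[symmetric] X1_def[symmetric] X2_def[symmetric] X3_def[symmetric] by linarith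
qed

end

section \<open>Likelihood ratios and posterior means under non-Gaussian noise\<close>

lemma integral_square_le:
  fixes h :: "'a \<Rightarrow> real"
  assumes "integrable N h" "integrable N (\<lambda>p. (h p)\<^sup>2)" "AE p in N. 0 \<le> h p \<and> h p \<le> b"
  shows "(\<integral>p. (h p)\<^sup>2 \<partial>N) \<le> b * (\<integral>p. h p \<partial>N)"
proof -
  have "(\<integral>p. (h p)\<^sup>2 \<partial>N) \<le> (\<integral>p. b * h p \<partial>N)"
  proof (rule integral_mono_AE)
    show "AE p in N. (h p)\<^sup>2 \<le> b * h p"
      using assms(3) by eventually_elim (simp add: power2_eq_square mult_right_mono)
  qed (use assms in auto)
  then show ?thesis by simp
qed

lemma two_mult_le_squares: "2 * (a * b) \<le> a\<^sup>2 + b\<^sup>2" for a b :: real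
  using zero_le_power2[of "a - b"] by (simp add: power2_diff)

context noisy_prior
begin

text \<open>The norm of \<open>root_ratio - 1\<close> is \<open>sqrt (2 * H)\<close>. Half of the deficit \<open>H\<close> absorbs its product with
  \<open>1 / sqrt J\<close> at the price of \<open>1 / J\<close>.\<close>

theorem root_ratio_expectation:
  assumes \<rho>: "\<rho> \<in> priors M" and C: "0 \<le> C" and B: "0 \<le> B"
    and u: "smooth8 C B (\<lambda>x. root_ratio \<rho> \<pi> \<sigma> x + (- 1))"
  defines "H \<equiv> hel_sq \<sigma> \<rho> \<pi>"
  shows "integrable P (\<lambda>\<omega>. root_ratio \<rho> \<pi> \<sigma> (obsv \<omega>))"
    and "(\<integral>\<omega>. root_ratio \<rho> \<pi> \<sigma> (obsv \<omega>) \<partial>P)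
      \<le> exp (- (H / 2) + ((skew_const s k)\<^sup>2 + B * lind C) / real J)"
proof -
  have mixr: "mixture M \<sigma> \<rho>" by (rule mixtureI[OF prior.M_pos prior.sg \<rho>])
  note hel = hellinger_mixture[OF mixr prior.mixture_axioms, folded H_def]
  define h where "h = (\<lambda>p::real \<times> real. \<Sum>a<1::nat. (\<lambda>_ _. 1) a (fst p) * (\<lambda>_ x. root_ratio \<rho> \<pi> \<sigma> x + (- 1)) a (snd p))"
  note eb = edgeworth_bound[of C "\<lambda>_ _. 1" 1 B "\<lambda>_ x. root_ratio \<rho> \<pi> \<sigma> x + (- 1)" 1, OF C _ _ _ B u, simplified]
  have he: "h p = root_ratio \<rho> \<pi> \<sigma> (snd p) - 1" for p by (simp add: h_def)
  have hm: "(\<lambda>x. root_ratio \<rho> \<pi> \<sigma> x - 1) \<in> borel_measurable borel"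
  proof -
    interpret R: mixture M \<sigma> \<rho> by (rule mixr)
    show ?thesis unfolding root_ratio_def by measurable
  qed
  have i1: "integrable P (\<lambda>\<omega>. root_ratio \<rho> \<pi> \<sigma> (obsv \<omega>) - 1)" using eb(2) by simp
  have "integrable P (\<lambda>\<omega>. (root_ratio \<rho> \<pi> \<sigma> (obsv \<omega>) - 1) + 1)" using i1 by (intro Bochner_Integration.integrable_add) auto
  then show I: "integrable P (\<lambda>\<omega>. root_ratio \<rho> \<pi> \<sigma> (obsv \<omega>))" by simp
  have e1: "(\<integral>p. root_ratio \<rho> \<pi> \<sigma> (snd p) - 1 \<partial>prior.Q) = - H"
    using prior.Q_integral_snd[OF hm] eb(3) hel(4) by simp
  have hm2: "(\<lambda>x. (root_ratio \<rho> \<pi> \<sigma> x - 1)\<^sup>2) \<in> borel_measurable borel" using hm by measurable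
  have e2: "(\<integral>p. (root_ratio \<rho> \<pi> \<sigma> (snd p) - 1)\<^sup>2 \<partial>prior.Q) = 2 * H"
    using prior.Q_integral_snd[OF hm2] eb(4) hel(5) by simp
  let ?k = "skew_const s k / sqrt (real J)"
  have "(\<integral>\<omega>. root_ratio \<rho> \<pi> \<sigma> (obsv \<omega>) - 1 \<partial>P) \<le> - H + ?k * sqrt (2 * H) + B * lind C / real J"
    using eb(1) unfolding e2 e1[symmetric] by simp
  moreover have "?k * sqrt (2 * H) \<le> H / 2 + (skew_const s k)\<^sup>2 / real J"
  proof -
    have "2 * (sqrt (H / 2) * ?k) \<le> (sqrt (H / 2))\<^sup>2 + ?k\<^sup>2" by (rule two_mult_le_squares)
    also have "... = H / 2 + (skew_const s k)\<^sup>2 / real J" using hel(1) by (simp add: power_divide)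
    also have "2 * (sqrt (H / 2) * ?k) = ?k * sqrt (2 * H)"
    proof -
      have "sqrt (2 * H) = sqrt (4 * (H / 2))" by simp
      also have "... = 2 * sqrt (H / 2)" by (simp only: real_sqrt_mult real_sqrt_four)
      finally show ?thesis by simp
    qed
    finally show ?thesis .
  qed
  moreover have "(\<integral>\<omega>. root_ratio \<rho> \<pi> \<sigma> (obsv \<omega>) - 1 \<partial>P) = (\<integral>\<omega>. root_ratio \<rho> \<pi> \<sigma> (obsv \<omega>) \<partial>P) - 1"
    using I by (simp add: prob_space)
  ultimately have "(\<integral>\<omega>. root_ratio \<rho> \<pi> \<sigma> (obsv \<omega>) \<partial>P)
     \<le> 1 + (- (H / 2) + ((skew_const s k)\<^sup>2 + B * lind C) / real J)"
    by (simp add: add_divide_distrib)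
  also have "... \<le> exp (- (H / 2) + ((skew_const s k)\<^sup>2 + B * lind C) / real J)"
    by (rule exp_ge_add_one_self)
  finally show "(\<integral>\<omega>. root_ratio \<rho> \<pi> \<sigma> (obsv \<omega>) \<partial>P)
      \<le> exp (- (H / 2) + ((skew_const s k)\<^sup>2 + B * lind C) / real J)" .
qed

text \<open>The function is bounded by \<open>4 * M\<^sup>2\<close>, so its norm is at most \<open>2 * M\<close> times the root of its mean, and the
  correction is absorbed by doubling the mean.\<close>

theorem post_diff_expectation:
  assumes \<rho>: "\<rho> \<in> priors M" and C: "0 \<le> C" and B: "0 \<le> B"
    and u: "smooth8 C B (\<lambda>x. (post \<rho> \<sigma> 1 x - post \<pi> \<sigma> 1 x)\<^sup>2)"
  shows "(\<integral>\<omega>. (post \<rho> \<sigma> 1 (obsv \<omega>) - post \<pi> \<sigma> 1 (obsv \<omega>))\<^sup>2 \<partial>P)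
      \<le> 2 * (\<integral>z. (post \<rho> \<sigma> 1 z - post \<pi> \<sigma> 1 z)\<^sup>2 * mom \<pi> \<sigma> 0 z \<partial>lborel)
         + ((skew_const s k)\<^sup>2 * M\<^sup>2 + B * lind C) / real J"
proof -
  have mixr: "mixture M \<sigma> \<rho>" by (rule mixtureI[OF prior.M_pos prior.sg \<rho>])
  interpret R: mixture M \<sigma> \<rho> by (rule mixr)
  let ?b = "\<lambda>x. (post \<rho> \<sigma> 1 x - post \<pi> \<sigma> 1 x)\<^sup>2"
  note eb = edgeworth_bound[of C "\<lambda>_ _. 1" 1 B "\<lambda>_. ?b" 1, OF C _ _ _ B u, simplified]
  have bm: "?b \<in> borel_measurable borel" by measurable
  have bb: "0 \<le> ?b x \<and> ?b x \<le> 4 * M\<^sup>2" for x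
  proof -
    have "\<bar>post \<rho> \<sigma> 1 x - post \<pi> \<sigma> 1 x\<bar> \<le> 2 * M" using R.post_bound[of 1 x] prior.post_bound[of 1 x] by simp
    then have "\<bar>post \<rho> \<sigma> 1 x - post \<pi> \<sigma> 1 x\<bar>\<^sup>2 \<le> (2 * M)\<^sup>2" by (intro power_mono) auto
    then show ?thesis by (simp add: power_mult_distrib)
  qed
  define D where "D = (\<integral>p. ?b (snd p) \<partial>prior.Q)"
  have De: "D = (\<integral>z. ?b z * mom \<pi> \<sigma> 0 z \<partial>lborel)"
    unfolding D_def using prior.Q_integral_snd[OF bm] eb(3) by simp
  have D0: "0 \<le> D" unfolding D_def by (rule integral_nonneg_AE) simp
  have sq: "(\<integral>p. (?b (snd p))\<^sup>2 \<partial>prior.Q) \<le> 4 * M\<^sup>2 * D"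
    unfolding D_def using bb eb(3,4) by (intro integral_square_le) auto
  let ?k = "skew_const s k / sqrt (real J)"
  have k0: "0 \<le> ?k" using skew_const_nonneg[OF k_pos] by simp
  have "(\<integral>\<omega>. ?b (obsv \<omega>) \<partial>P) \<le> D + ?k * sqrt (\<integral>p. (?b (snd p))\<^sup>2 \<partial>prior.Q) + B * lind C / real J"
    using eb(1) unfolding D_def by simp
  moreover have "?k * sqrt (\<integral>p. (?b (snd p))\<^sup>2 \<partial>prior.Q) \<le> ?k * (2 * M * sqrt D)"
  proof (rule mult_left_mono[OF _ k0])
    have "sqrt (\<integral>p. (?b (snd p))\<^sup>2 \<partial>prior.Q) \<le> sqrt ((2 * M)\<^sup>2 * D)"
      using sq by (intro real_sqrt_le_mono) (simp add: power_mult_distrib)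
    also have "... = 2 * M * sqrt D" using prior.M_pos by (simp add: real_sqrt_mult)
    finally show "sqrt (\<integral>p. (?b (snd p))\<^sup>2 \<partial>prior.Q) \<le> 2 * M * sqrt D" .
  qed
  moreover have "?k * (2 * M * sqrt D) \<le> D + (skew_const s k)\<^sup>2 * M\<^sup>2 / real J"
  proof -
    have "2 * (sqrt D * (?k * M)) \<le> (sqrt D)\<^sup>2 + (?k * M)\<^sup>2" by (rule two_mult_le_squares)
    then show ?thesis using D0 by (simp add: power_divide power_mult_distrib mult_ac)
  qed
  ultimately show ?thesis unfolding De[symmetric] by (simp add: add_divide_distrib)
qed

text \<open>The same absorption for the squared error of the oracle. The bound is a square so that Minkowski's
  inequality over the units turns the error into an additive term of the root risk.\<close>

theorem oracle_risk:
  assumes C: "0 \<le> C" and B: "1 \<le> B"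
    and u1: "smooth8 C B (post \<pi> \<sigma> 1)"
    and u2: "smooth8 C B (\<lambda>x. (post \<pi> \<sigma> 1 x)\<^sup>2)"
  defines "c \<equiv> skew_const s k * M + sqrt (3 * (M + 1)\<^sup>2 * B * lind C)"
  shows "(\<integral>\<omega>. (\<theta> \<omega> - post \<pi> \<sigma> 1 (obsv \<omega>))\<^sup>2 \<partial>P) \<le> (sqrt (bayes_risk \<pi> \<sigma>) + c / sqrt (real J))\<^sup>2"
proof -
  let ?R = "post \<pi> \<sigma> 1"
  note M_pos = prior.M_pos
  \<comment> \<open>The square is expanded into three products of a function of \<open>\<theta>\<close> and a function of the observation.\<close>
  define W where "W a = (\<lambda>t::real. if a = (0::nat) then t\<^sup>2 else if a = 1 then - 2 * t else 1)" for a
  define u where "u a = (if a = (0::nat) then (\<lambda>_. 1) else if a = 1 then ?R else (\<lambda>x. (?R x)\<^sup>2))" for a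
  define w where "w = (M + 1)\<^sup>2"
  define L where "L = real 3 * w * B * lind C"
  have weq: "w = M\<^sup>2 + 2 * M + 1" by (simp add: w_def power2_sum)
  have w0: "0 \<le> w" by (simp add: w_def)
  have Wm: "W a \<in> borel_measurable borel" for a by (simp add: W_def)
  have Wb: "\<bar>W a t\<bar> \<le> w" if "\<bar>t\<bar> \<le> M" for a t
  proof -
    have "t\<^sup>2 \<le> M\<^sup>2" using that by (metis abs_ge_zero power2_abs power_mono)
    then have "\<bar>t\<^sup>2\<bar> \<le> w" using M_pos by (simp add: weq)
    moreover have "\<bar>- 2 * t\<bar> \<le> w"
    proof -
      have "\<bar>- 2 * t\<bar> = 2 * \<bar>t\<bar>" by simp
      then show ?thesis using that zero_le_power2[of M] unfolding weq by linarith
    qed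
    moreover have "\<bar>1\<bar> \<le> w" using M_pos by (simp add: weq)
    ultimately show ?thesis by (simp add: W_def)
  qed
  have ub: "smooth8 C B (u a)" for a
  proof -
    have "smooth8 C B (\<lambda>_. 1)"
    proof (rule deriv_bounded_mono[OF deriv_bounded_const[of 1 1]])
      fix x show "1 * 1 \<le> B * cosh (C * x)"
        using B by (intro mult_mono) (auto simp: cosh_real_ge_1)
    qed simp
    then show ?thesis using u1 u2 by (simp add: u_def)
  qed
  define h where "h = (\<lambda>p::real \<times> real. \<Sum>a<3. W a (fst p) * u a (snd p))"
  let ?N = "\<integral>p. (h p)\<^sup>2 \<partial>prior.Q" and ?E = "\<integral>\<omega>. h (\<theta> \<omega>, obsv \<omega>) \<partial>P"
  have B0: "0 \<le> B" using B by simp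
  have eb1: "\<bar>?E - (\<integral>p. h p \<partial>prior.Q)\<bar>
     \<le> skew_const s k / sqrt (real J) * sqrt ?N + L / real J"
    unfolding h_def L_def by (rule edgeworth_bound(1)[OF C Wm Wb w0 B0 ub])
  have eb3: "integrable prior.Q h"
    unfolding h_def by (rule edgeworth_bound(3)[OF C Wm Wb w0 B0 ub])
  have eb4: "integrable prior.Q (\<lambda>p. (h p)\<^sup>2)"
    unfolding h_def by (rule edgeworth_bound(4)[OF C Wm Wb w0 B0 ub])
  have he: "h p = (fst p - ?R (snd p))\<^sup>2" for p
    by (simp add: h_def W_def u_def eval_nat_numeral algebra_simps)
  define D where "D = bayes_risk \<pi> \<sigma>"
  have De: "D = (\<integral>p. h p \<partial>prior.Q)" unfolding D_def prior.bayes_risk_post he ..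
  have D0: "0 \<le> D" unfolding De he by (rule integral_nonneg_AE) simp
  have hb: "AE p in prior.Q. 0 \<le> h p \<and> h p \<le> 4 * M\<^sup>2"
    using prior.Q_fst_bounded
  proof eventually_elim
    case (elim p)
    have "\<bar>fst p - ?R (snd p)\<bar> \<le> 2 * M" using elim prior.post_bound[of 1 "snd p"] by simp
    then have "\<bar>fst p - ?R (snd p)\<bar>\<^sup>2 \<le> (2 * M)\<^sup>2" by (intro power_mono) auto
    then show ?case by (simp add: he power_mult_distrib)
  qed
  have sq: "?N \<le> 4 * M\<^sup>2 * D"
    unfolding De by (rule integral_square_le[OF eb3 eb4 hb])
  let ?k = "skew_const s k / sqrt (real J)"
  have k0: "0 \<le> ?k" using skew_const_nonneg[OF k_pos] by simp
  have L0: "0 \<le> L"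
  proof -
    have "0 \<le> lind C"
      unfolding lindeberg_const_def using consts_nonneg step_const_nonneg by (intro mult_nonneg_nonneg add_nonneg_nonneg) auto
    then show ?thesis unfolding L_def using w0 B0 by simp
  qed
  have "?E \<le> D + ?k * sqrt ?N + L / real J"
    using eb1 unfolding De by linarith
  also have "?k * sqrt ?N \<le> ?k * (2 * M * sqrt D)"
  proof (rule mult_left_mono[OF _ k0])
    have "sqrt ?N \<le> sqrt ((2 * M)\<^sup>2 * D)"
      using sq by (intro real_sqrt_le_mono) (simp add: power_mult_distrib)
    also have "... = 2 * M * sqrt D" using M_pos by (simp add: real_sqrt_mult)
    finally show "sqrt ?N \<le> 2 * M * sqrt D" .
  qed
  finally have 1: "?E \<le> D + ?k * (2 * M * sqrt D) + L / real J" by simp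
  have "(sqrt D + c / sqrt (real J))\<^sup>2 = D + 2 * (c / sqrt (real J)) * sqrt D + c\<^sup>2 / real J"
    using D0 by (simp add: power2_sum power_divide)
  moreover have "?k * (2 * M * sqrt D) \<le> 2 * (c / sqrt (real J)) * sqrt D"
  proof -
    have "skew_const s k * M \<le> c" unfolding c_def using L0 by (simp add: L_def w_def)
    then have "skew_const s k * M / sqrt (real J) \<le> c / sqrt (real J)" by (rule divide_right_mono) simp
    then have "2 * (skew_const s k * M / sqrt (real J)) * sqrt D \<le> 2 * (c / sqrt (real J)) * sqrt D"
      using D0 by (intro mult_right_mono) auto
    then show ?thesis by (simp add: mult_ac)
  qed
  moreover have "L / real J \<le> c\<^sup>2 / real J"
  proof (rule divide_right_mono)
    have "sqrt L \<le> c" unfolding c_def L_def w_def using skew_const_nonneg[OF k_pos] M_pos by simp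
    then have "(sqrt L)\<^sup>2 \<le> c\<^sup>2" using L0 by (intro power_mono) auto
    then show "L \<le> c\<^sup>2" using L0 by simp
  qed simp
  ultimately have "?E \<le> (sqrt D + c / sqrt (real J))\<^sup>2" using 1 by linarith
  then show ?thesis by (simp add: he D_def)
qed

end

section \<open>A finite net of mixing measures\<close>

text \<open>The moments are rounded to multiples of \<open>\<delta>\<close>, and one measure is kept from each nonempty cell.\<close>

lemma moment_net:
  fixes M \<delta> :: real and D :: nat
  assumes M: "0 < M" and d: "0 < \<delta>"
  defines "b \<equiv> nat (2 * (\<lceil>max M 1 ^ D / \<delta>\<rceil> + 1) + 1)"
  shows "\<exists>N. finite N \<and> N \<subseteq> priors M \<and> card N \<le> b ^ Suc D \<and>
    (\<forall>\<pi>\<in>priors M. \<exists>\<rho>\<in>N. \<forall>j\<le>D. \<bar>(\<integral>t. t ^ j \<partial>\<pi>) - (\<integral>t. t ^ j \<partial>\<rho>)\<bar> \<le> \<delta>)"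
proof -
  define q where "q = \<lceil>max M 1 ^ D / \<delta>\<rceil> + 1"
  \<comment> \<open>The grid of cells has \<open>2 * q + 1\<close> values per moment, since moments of order at most \<open>D\<close> are below \<open>max M 1 ^ D\<close>.\<close>
  define cell where "cell \<pi> = (\<lambda>j\<in>{..D}. \<lfloor>(\<integral>t. t ^ j \<partial>\<pi>) / \<delta>\<rfloor>)" for \<pi> :: "real measure"
  have m: "\<bar>\<integral>t. t ^ j \<partial>\<pi>\<bar> \<le> max M 1 ^ D" if p: "\<pi> \<in> priors M" and j: "j \<le> D" for \<pi> j
  proof -
    interpret prob_space \<pi> by (rule prob_measures_onD(1)[OF p])
    have [measurable_cong]: "sets \<pi> = sets borel" by (rule prob_measures_onD(2)[OF p])
    have pw: "AE t in \<pi>. \<bar>t ^ j\<bar> \<le> max M 1 ^ D"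
      using prob_measures_onD(3)[OF p]
    proof eventually_elim
      case (elim t)
      have "\<bar>t ^ j\<bar> \<le> max M 1 ^ j" unfolding power_abs using elim by (intro power_mono) auto
      also have "... \<le> max M 1 ^ D" using j by (intro power_increasing) auto
      finally show ?case .
    qed
    have i: "integrable \<pi> (\<lambda>t. t ^ j)" by (rule integrable_const_bound) (use pw in auto)
    have "\<bar>\<integral>t. t ^ j \<partial>\<pi>\<bar> \<le> (\<integral>t. \<bar>t ^ j\<bar> \<partial>\<pi>)" by (rule integral_abs_bound)
    also have "... \<le> (\<integral>t. max M 1 ^ D \<partial>\<pi>)" by (rule integral_mono_AE) (use i pw in auto)
    also have "... = max M 1 ^ D" by (simp add: prob_space)
    finally show ?thesis .
  qed
  have range: "cell \<pi> \<in> {..D} \<rightarrow>\<^sub>E {-q..q}" if p: "\<pi> \<in> priors M" for \<pi>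
  proof (unfold cell_def, rule restrict_PiE_iff[THEN iffD2], intro ballI)
    fix j assume j: "j \<in> {..D}"
    have "\<bar>(\<integral>t. t ^ j \<partial>\<pi>) / \<delta>\<bar> \<le> max M 1 ^ D / \<delta>"
      unfolding abs_divide using m[OF p, of j] j d by (simp add: divide_right_mono)
    then show "\<lfloor>(\<integral>t. t ^ j \<partial>\<pi>) / \<delta>\<rfloor> \<in> {-q..q}" unfolding q_def atLeastAtMost_iff by linarith
  qed
  define S where "S = cell ` priors M"
  have S: "S \<subseteq> {..D} \<rightarrow>\<^sub>E {-q..q}" using range by (auto simp: S_def)
  have fS: "finite S" by (rule finite_subset[OF S]) (auto intro: finite_PiE)
  have "card S \<le> card ({..D} \<rightarrow>\<^sub>E {-q..q})" by (rule card_mono[OF _ S]) (auto intro: finite_PiE)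
  also have "... = (card {-q..q}) ^ Suc D" by (subst card_PiE) auto
  also have "card {-q..q} = b" by (simp add: b_def q_def)
  finally have cS: "card S \<le> b ^ Suc D" .
  define N where "N = inv_into (priors M) cell ` S"
  show ?thesis
  proof (intro exI[of _ N] conjI ballI)
    show "finite N" using fS by (simp add: N_def)
    show "N \<subseteq> priors M" by (auto simp: N_def S_def intro: inv_into_into)
    show "card N \<le> b ^ Suc D" using card_image_le[OF fS] cS unfolding N_def by (rule order_trans)
    fix \<pi> assume p: "\<pi> \<in> priors M"
    define \<rho> where "\<rho> = inv_into (priors M) cell (cell \<pi>)"
    have r: "cell \<rho> = cell \<pi>" unfolding \<rho>_def using p by (intro f_inv_into_f) auto
    have "\<bar>(\<integral>t. t ^ j \<partial>\<pi>) - (\<integral>t. t ^ j \<partial>\<rho>)\<bar> \<le> \<delta>" if j: "j \<le> D" for j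
    proof -
      have "\<lfloor>(\<integral>t. t ^ j \<partial>\<pi>) / \<delta>\<rfloor> = \<lfloor>(\<integral>t. t ^ j \<partial>\<rho>) / \<delta>\<rfloor>"
        using fun_cong[OF r, of j] j by (simp add: cell_def)
      then have "\<bar>(\<integral>t. t ^ j \<partial>\<pi>) / \<delta> - (\<integral>t. t ^ j \<partial>\<rho>) / \<delta>\<bar> \<le> 1" by linarith
      then have "\<bar>(\<integral>t. t ^ j \<partial>\<pi>) - (\<integral>t. t ^ j \<partial>\<rho>)\<bar> / \<delta> \<le> 1"
        using d by (simp add: diff_divide_distrib[symmetric] abs_divide del: abs_divide) (simp add: abs_divide)?
      then show ?thesis using d by (simp add: pos_divide_le_eq)
    qed
    then show "\<exists>\<rho>\<in>N. \<forall>j\<le>D. \<bar>(\<integral>t. t ^ j \<partial>\<pi>) - (\<integral>t. t ^ j \<partial>\<rho>)\<bar> \<le> \<delta>"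
      using p by (intro bexI[of _ \<rho>]) (auto simp: N_def S_def \<rho>_def)
  qed
qed

lemma normal_density_factor:
  assumes "0 < \<sigma>"
  shows "gpdf \<sigma> (x - t) = gpdf \<sigma> x * exp (t * (x - t / 2) / \<sigma>\<^sup>2)"
proof -
  have "- (x - t - 0)\<^sup>2 / (2 * \<sigma>\<^sup>2) = - (x - 0)\<^sup>2 / (2 * \<sigma>\<^sup>2) + t * (x - t / 2) / \<sigma>\<^sup>2"
    using assms by (simp add: field_simps power2_eq_square)
  then have "exp (- (x - t - 0)\<^sup>2 / (2 * \<sigma>\<^sup>2)) = exp (- (x - 0)\<^sup>2 / (2 * \<sigma>\<^sup>2)) * exp (t * (x - t / 2) / \<sigma>\<^sup>2)"
    by (simp only: exp_add)
  then show ?thesis unfolding normal_density_def by simp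
qed

lemma exp_taylor_bound: "\<bar>exp v - (\<Sum>r<L. v ^ r / fact r)\<bar> \<le> \<bar>v\<bar> ^ L / fact L * exp \<bar>v\<bar>" for v :: real
proof -
  obtain t where t: "\<bar>t\<bar> \<le> \<bar>v\<bar>" "exp v = (\<Sum>r<L. v ^ r / fact r) + exp t / fact L * v ^ L"
    using Maclaurin_exp_le[of v L] by blast
  have "\<bar>exp v - (\<Sum>r<L. v ^ r / fact r)\<bar> = exp t * (\<bar>v\<bar> ^ L / fact L)"
    unfolding t(2) by (simp add: abs_mult power_abs)
  also have "... \<le> exp \<bar>v\<bar> * (\<bar>v\<bar> ^ L / fact L)" using t(1) by (intro mult_right_mono) auto
  finally show ?thesis by (simp add: mult.commute)
qed

text \<open>With the factor \<open>gpdf \<sigma> x\<close> removed, the kernel is the exponential of \<open>t * (x - t / 2) / \<sigma>\<^sup>2\<close>.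
  Its Taylor polynomial is a polynomial in \<open>t\<close> whose coefficients sum in absolute value to at most \<open>exp U'\<close>; the moments
  determine its integral, and \<open>exp U\<close> makes the error relative to the mixture density.\<close>

lemma moments_determine_mixture:
  assumes M: "0 < M" and k: "0 < k" "k < \<sigma>" and p: "\<pi> \<in> priors M" "\<rho> \<in> priors M"
    and d: "\<And>j. j \<le> 2 * L \<Longrightarrow> \<bar>(\<integral>t. t ^ j \<partial>\<pi>) - (\<integral>t. t ^ j \<partial>\<rho>)\<bar> \<le> \<delta>" and i: "i \<le> 1"
    and U: "M * (\<bar>x\<bar> + M / 2) / k\<^sup>2 \<le> U" and U': "(\<bar>x\<bar> + 1 / 2) / k\<^sup>2 \<le> U'"
  shows "\<bar>mom \<pi> \<sigma> i x - mom \<rho> \<sigma> i x\<bar> \<le> exp U * (\<delta> * exp U' + 2 * (1 + M) * (U ^ L / fact L * exp U)) * mom \<rho> \<sigma> 0 x"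
proof -
  have sg: "0 < \<sigma>" using k by simp
  interpret A: mixture M \<sigma> \<pi> by (rule mixtureI[OF M sg p(1)])
  interpret B: mixture M \<sigma> \<rho> by (rule mixtureI[OF M sg p(2)])
  have k2: "k\<^sup>2 \<le> \<sigma>\<^sup>2" "0 < k\<^sup>2" "0 < \<sigma>\<^sup>2" using k by (auto intro: power_mono)
  define nx where "nx = gpdf \<sigma> x"
  have nx: "0 < nx" unfolding nx_def by (rule normal_density_pos[OF sg])
  define v where "v t = t * (x - t / 2) / \<sigma>\<^sup>2" for t
  have nd: "gpdf \<sigma> (x - t) = nx * exp (v t)" for t
    unfolding nx_def v_def by (rule normal_density_factor[OF sg])
  have U0: "0 \<le> U" using order_trans[OF _ U] M by simp
  have vb: "\<bar>v t\<bar> \<le> U" if "\<bar>t\<bar> \<le> M" for t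
  proof -
    have "\<bar>v t\<bar> = \<bar>t\<bar> * \<bar>x - t / 2\<bar> / \<sigma>\<^sup>2" by (simp add: v_def abs_mult)
    also have "... \<le> M * (\<bar>x\<bar> + M / 2) / k\<^sup>2"
      using that M k2 by (intro frac_le mult_mono mult_nonneg_nonneg) auto
    finally show ?thesis using U by simp
  qed
  define pl where "pl t = (\<Sum>r<L. v t ^ r / fact r)" for t
  have [measurable]: "v \<in> borel_measurable borel" "pl \<in> borel_measurable borel" unfolding v_def[abs_def] pl_def[abs_def] by measurable
  define e where "e = U ^ L / fact L * exp U"
  have eb: "\<bar>exp (v t) - pl t\<bar> \<le> e" if "\<bar>t\<bar> \<le> M" for t
  proof -
    have "\<bar>exp (v t) - pl t\<bar> \<le> \<bar>v t\<bar> ^ L / fact L * exp \<bar>v t\<bar>" unfolding pl_def by (rule exp_taylor_bound)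
    also have "... \<le> e" unfolding e_def using vb[OF that] by (intro mult_mono divide_right_mono power_mono) auto
    finally show ?thesis .
  qed
  have e0: "0 \<le> e" unfolding e_def using U0 by simp
  have Mi: "\<bar>t ^ i\<bar> \<le> 1 + M" if "\<bar>t\<bar> \<le> M" for t
  proof -
    from i consider "i = 0" | "i = 1" by linarith
    then show ?thesis using that M by cases auto
  qed
  have approx: "\<bar>mom \<mu> \<sigma> i x - nx * (\<integral>t. t ^ i * pl t \<partial>\<mu>)\<bar> \<le> nx * ((1 + M) * e)"
    and plint: "\<And>c::nat. integrable \<mu> (\<lambda>t. t ^ c)" if "mixture M \<sigma> \<mu>" for \<mu>
  proof -
    interpret C: mixture M \<sigma> \<mu> by fact
    show pw: "integrable \<mu> (\<lambda>t. t ^ c)" for c :: nat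
    proof (rule C.integrable_const_bound[of _ "M ^ c"])
      show "AE t in \<mu>. norm (t ^ c) \<le> M ^ c"
        using C.AE_bound by eventually_elim (auto simp: power_abs intro: power_mono)
    qed measurable
    have i1: "integrable \<mu> (\<lambda>t. t ^ i * exp (v t))"
    proof -
      have "integrable \<mu> (\<lambda>t. (1 / nx) * (t ^ i * gpdf \<sigma> (x - t)))" using C.mom_integrable by simp
      then show ?thesis unfolding nd using nx by simp
    qed
    have plb: "AE t in \<mu>. \<bar>t ^ i * (exp (v t) - pl t)\<bar> \<le> (1 + M) * e"
      using C.AE_bound by eventually_elim (intro abs_mult_bound Mi eb)
    have i2: "integrable \<mu> (\<lambda>t. t ^ i * (exp (v t) - pl t))"
      by (rule C.integrable_const_bound) (use plb in auto)
    have i3: "integrable \<mu> (\<lambda>t. t ^ i * pl t)"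
    proof -
      have "integrable \<mu> (\<lambda>t. t ^ i * exp (v t) - t ^ i * (exp (v t) - pl t))" using i1 i2 by auto
      then show ?thesis by (simp add: right_diff_distrib)
    qed
    have "mom \<mu> \<sigma> i x = nx * (\<integral>t. t ^ i * exp (v t) \<partial>\<mu>)"
      unfolding mom_def nd by (subst integral_mult_right_zero[symmetric]) (simp add: mult_ac)
    also have "(\<integral>t. t ^ i * exp (v t) \<partial>\<mu>) = (\<integral>t. t ^ i * (exp (v t) - pl t) \<partial>\<mu>) + (\<integral>t. t ^ i * pl t \<partial>\<mu>)"
      using i2 i3 by (subst Bochner_Integration.integral_add[symmetric]) (auto simp: right_diff_distrib)
    finally have "mom \<mu> \<sigma> i x - nx * (\<integral>t. t ^ i * pl t \<partial>\<mu>) = nx * (\<integral>t. t ^ i * (exp (v t) - pl t) \<partial>\<mu>)"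
      by (simp add: distrib_left)
    moreover have "\<bar>\<integral>t. t ^ i * (exp (v t) - pl t) \<partial>\<mu>\<bar> \<le> (1 + M) * e"
    proof -
      have "\<bar>\<integral>t. t ^ i * (exp (v t) - pl t) \<partial>\<mu>\<bar> \<le> (\<integral>t. \<bar>t ^ i * (exp (v t) - pl t)\<bar> \<partial>\<mu>)" by (rule integral_abs_bound)
      also have "... \<le> (\<integral>t. (1 + M) * e \<partial>\<mu>)" by (rule integral_mono_AE[OF _ _ plb]) (use i2 in auto)
      also have "... = (1 + M) * e" using C.prob_space by simp
      finally show ?thesis .
    qed
    ultimately show "\<bar>mom \<mu> \<sigma> i x - nx * (\<integral>t. t ^ i * pl t \<partial>\<mu>)\<bar> \<le> nx * ((1 + M) * e)"
      using nx by (simp add: abs_mult)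
  qed
  define co where "co r a = of_nat (r choose a) * (- 1 / 2) ^ a * x ^ (r - a) / (\<sigma>\<^sup>2) ^ r / fact r" for r a :: nat
  have pl: "t ^ i * pl t = (\<Sum>r<L. \<Sum>a\<le>r. co r a * t ^ (i + r + a))" for t
  proof -
    have "v t ^ r / fact r = (\<Sum>a\<le>r. co r a * t ^ (r + a))" for r
    proof -
      have "v t ^ r = t ^ r * (- t / 2 + x) ^ r / (\<sigma>\<^sup>2) ^ r"
        by (simp add: v_def power_divide power_mult_distrib)
      also have "(- t / 2 + x) ^ r = (\<Sum>a\<le>r. of_nat (r choose a) * (- t / 2) ^ a * x ^ (r - a))"
        by (rule binomial_ring)
      finally have "v t ^ r / fact r = (\<Sum>a\<le>r. t ^ r * (of_nat (r choose a) * (- t / 2) ^ a * x ^ (r - a)) / (\<sigma>\<^sup>2) ^ r / fact r)"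
        by (simp add: sum_distrib_left sum_divide_distrib)
      also have "... = (\<Sum>a\<le>r. co r a * t ^ (r + a))"
      proof (rule sum.cong[OF refl])
        fix a
        have "(- t / 2) ^ a = (- 1 / 2) ^ a * t ^ a" by (simp add: power_mult_distrib[symmetric])
        then show "t ^ r * (of_nat (r choose a) * (- t / 2) ^ a * x ^ (r - a)) / (\<sigma>\<^sup>2) ^ r / fact r = co r a * t ^ (r + a)"
          by (simp add: co_def power_add mult_ac)
      qed
      finally show ?thesis .
    qed
    then show ?thesis by (simp add: pl_def sum_distrib_left power_add mult_ac)
  qed
  have plm: "(\<integral>t. t ^ i * pl t \<partial>\<mu>) = (\<Sum>r<L. \<Sum>a\<le>r. co r a * (\<integral>t. t ^ (i + r + a) \<partial>\<mu>))" if "mixture M \<sigma> \<mu>" for \<mu>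
    unfolding pl using plint[OF that] by (subst Bochner_Integration.integral_sum, simp)+ simp
  have coabs: "(\<Sum>a\<le>r. \<bar>co r a\<bar>) = ((\<bar>x\<bar> + 1 / 2) / \<sigma>\<^sup>2) ^ r / fact r" for r
  proof -
    have "(\<Sum>a\<le>r. \<bar>co r a\<bar>) = (\<Sum>a\<le>r. of_nat (r choose a) * (1 / 2) ^ a * \<bar>x\<bar> ^ (r - a)) / (\<sigma>\<^sup>2) ^ r / fact r"
      unfolding sum_divide_distrib by (rule sum.cong) (auto simp: co_def abs_mult power_abs)
    also have "(\<Sum>a\<le>r. of_nat (r choose a) * (1 / 2) ^ a * \<bar>x\<bar> ^ (r - a)) = (1 / 2 + \<bar>x\<bar>) ^ r"
      by (rule binomial_ring[symmetric])
    finally show ?thesis by (simp add: power_divide add.commute)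
  qed
  have d0: "0 \<le> \<delta>" using d[of 0] by (meson abs_ge_zero le0 order_trans)
  have "\<bar>(\<integral>t. t ^ i * pl t \<partial>\<pi>) - (\<integral>t. t ^ i * pl t \<partial>\<rho>)\<bar>
     = \<bar>\<Sum>r<L. \<Sum>a\<le>r. co r a * ((\<integral>t. t ^ (i + r + a) \<partial>\<pi>) - (\<integral>t. t ^ (i + r + a) \<partial>\<rho>))\<bar>"
    unfolding plm[OF A.mixture_axioms] plm[OF B.mixture_axioms] by (simp add: sum_subtractf right_diff_distrib)
  also have "... \<le> (\<Sum>r<L. \<Sum>a\<le>r. \<bar>co r a\<bar> * \<delta>)"
  proof (intro order_trans[OF sum_abs] sum_mono order_trans[OF sum_abs])
    fix r a assume "r \<in> {..<L}" "a \<in> {..r}"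
    then have "i + r + a \<le> 2 * L" using i by auto
    then show "\<bar>co r a * ((\<integral>t. t ^ (i + r + a) \<partial>\<pi>) - (\<integral>t. t ^ (i + r + a) \<partial>\<rho>))\<bar> \<le> \<bar>co r a\<bar> * \<delta>"
      unfolding abs_mult by (intro mult_left_mono d) auto
  qed
  also have "... = \<delta> * (\<Sum>r<L. ((\<bar>x\<bar> + 1 / 2) / \<sigma>\<^sup>2) ^ r / fact r)"
    unfolding sum_distrib_right[symmetric] coabs by (simp add: mult.commute)
  also have "... \<le> \<delta> * exp U'"
  proof (rule mult_left_mono[OF _ d0])
    define y where "y = (\<bar>x\<bar> + 1 / 2) / \<sigma>\<^sup>2"
    have y: "0 \<le> y" by (simp add: y_def)
    have "y \<le> (\<bar>x\<bar> + 1 / 2) / k\<^sup>2" unfolding y_def using k2 by (intro divide_left_mono) auto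
    then have yU: "y \<le> U'" using U' by simp
    obtain t where "exp y = (\<Sum>r<L. y ^ r / fact r) + exp t / fact L * y ^ L"
      using Maclaurin_exp_le[of y L] by blast
    moreover have "0 \<le> exp t / fact L * y ^ L" using y by simp
    ultimately have "(\<Sum>r<L. y ^ r / fact r) \<le> exp y" by linarith
    also have "... \<le> exp U'" using yU by simp
    finally show "(\<Sum>r<L. ((\<bar>x\<bar> + 1 / 2) / \<sigma>\<^sup>2) ^ r / fact r) \<le> exp U'" by (simp add: y_def)
  qed
  finally have pd: "\<bar>(\<integral>t. t ^ i * pl t \<partial>\<pi>) - (\<integral>t. t ^ i * pl t \<partial>\<rho>)\<bar> \<le> \<delta> * exp U'" .
  have "\<bar>nx * (\<integral>t. t ^ i * pl t \<partial>\<pi>) - nx * (\<integral>t. t ^ i * pl t \<partial>\<rho>)\<bar> \<le> nx * (\<delta> * exp U')"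
    unfolding right_diff_distrib[symmetric] abs_mult using pd nx by (auto intro: mult_left_mono)
  then have "\<bar>mom \<pi> \<sigma> i x - mom \<rho> \<sigma> i x\<bar> \<le> nx * (\<delta> * exp U') + nx * ((1 + M) * e) + nx * ((1 + M) * e)"
    using approx[OF A.mixture_axioms] approx[OF B.mixture_axioms] by linarith
  also have "... = nx * (\<delta> * exp U' + 2 * (1 + M) * e)" by (simp add: algebra_simps)
  also have "... \<le> (exp U * mom \<rho> \<sigma> 0 x) * (\<delta> * exp U' + 2 * (1 + M) * e)"
  proof (rule mult_right_mono)
    have "(\<integral>t. nx * exp (- U) \<partial>\<rho>) \<le> (\<integral>t. gpdf \<sigma> (x - t) \<partial>\<rho>)"
    proof (rule integral_mono_AE)
      show "AE t in \<rho>. nx * exp (- U) \<le> gpdf \<sigma> (x - t)"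
        using B.AE_bound
      proof eventually_elim
        case (elim t)
        have "- U \<le> v t" using vb[OF elim] by linarith
        then show ?case unfolding nd using nx by (intro mult_left_mono) auto
      qed
    qed (use B.nd_integrable in auto)
    then have "nx * exp (- U) \<le> mom \<rho> \<sigma> 0 x" using B.prob_space by (simp add: B.mom0)
    then have "exp U * (nx * exp (- U)) \<le> exp U * mom \<rho> \<sigma> 0 x" by (intro mult_left_mono) auto
    moreover have "exp U * (nx * exp (- U)) = nx" by (simp add: exp_minus)
    ultimately show "nx \<le> exp U * mom \<rho> \<sigma> 0 x" by (simp only:)
    show "0 \<le> \<delta> * exp U' + 2 * (1 + M) * e" using d0 e0 M by simp
  qed
  finally show ?thesis by (simp add: e_def mult_ac)
qed

lemma ln_ge_half: "2 \<le> n \<Longrightarrow> 1 / 2 \<le> ln (real n)"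
proof -
  assume "2 \<le> n"
  then have "ln 2 \<le> ln (real n)" by simp
  then show ?thesis using ln2_ge_two_thirds by linarith
qed

text \<open>\<open>U\<close> and \<open>U'\<close> are of order \<open>ln n\<close> for \<open>\<bar>x\<bar> \<le> a * ln n\<close>. Hence a Taylor degree of order \<open>ln n\<close> and moments
  known up to a fixed negative power of \<open>n\<close> suffice; order \<open>ln n\<close> moments with polynomially many values each
  give the square of the logarithm.\<close>

theorem mixture_net:
  assumes M: "0 < M" and k: "0 < k" and a: "0 \<le> a"
  shows "\<exists>c\<ge>0. \<forall>n\<ge>2::nat. \<exists>N. finite N \<and> N \<subseteq> priors M \<and> ln (real (card N)) \<le> c * (ln (real n))\<^sup>2 \<and>
    (\<forall>\<pi>\<in>priors M. \<exists>\<rho>\<in>N. \<forall>\<sigma> x i. k < \<sigma> \<longrightarrow> \<bar>x\<bar> \<le> a * ln (real n) \<longrightarrow> i \<le> 1 \<longrightarrow>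
       \<bar>mom \<pi> \<sigma> i x - mom \<rho> \<sigma> i x\<bar> \<le> mom \<rho> \<sigma> 0 x / real n)"
proof -
  define u0 where "u0 = M * (a + M) / k\<^sup>2"
  define u1 where "u1 = (a + 1) / k\<^sup>2"
  define L0 where "L0 = 5 * u0 + 2 * ln (4 * (1 + M)) + 3"
  define c0 where "c0 = 2 * ln 7 + 2 * L0 * ln (max M 1) + (u0 + u1) + 2 * ln 2 + 1"
  have u: "0 \<le> u0" "0 \<le> u1" using M a k by (auto simp: u0_def u1_def)
  have lM: "0 \<le> ln (4 * (1 + M))" using M by (intro ln_ge_zero) auto
  have lM1: "0 \<le> ln (max M 1)" by (intro ln_ge_zero) auto
  have L0: "0 \<le> L0" unfolding L0_def using u lM by simp
  have c0: "0 \<le> c0" unfolding c0_def using u L0 lM1 by simp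
  show ?thesis
  proof (intro exI[of _ "(2 * L0 + 2) * c0"] conjI allI impI)
    show "0 \<le> (2 * L0 + 2) * c0" using L0 c0 by simp
    fix n :: nat assume n: "2 \<le> n"
    define l where "l = ln (real n)"
    have l: "1 / 2 \<le> l" unfolding l_def by (rule ln_ge_half[OF n])
    have n0: "0 < real n" "exp l = real n" using n by (auto simp: l_def)
    define U U' where "U = u0 * l" and "U' = u1 * l"
    have UU: "0 \<le> U" "0 \<le> U'" using u l by (auto simp: U_def U'_def)
    define \<delta> where "\<delta> = exp (- (U + U')) / (2 * real n)"
    have d: "0 < \<delta>" using n0 by (simp add: \<delta>_def)
    \<comment> \<open>\<open>U ^ L / fact L\<close> is at most \<open>exp (3 * U - L)\<close>; the two further factors \<open>exp U\<close> make it \<open>5 * U\<close>.\<close>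
    define L where "L = nat \<lceil>5 * U + ln (4 * (1 + M)) + l\<rceil>"
    have L1: "5 * U + ln (4 * (1 + M)) + l \<le> real L" unfolding L_def by linarith
    have L2: "real L \<le> L0 * l"
    proof -
      have "real L \<le> 5 * U + ln (4 * (1 + M)) + l + 1" unfolding L_def using UU lM l by linarith
      also have "... \<le> 5 * U + ln (4 * (1 + M)) * (2 * l) + l + 2 * l"
      proof -
        have "ln (4 * (1 + M)) * 1 \<le> ln (4 * (1 + M)) * (2 * l)" using l lM by (intro mult_left_mono) auto
        then show ?thesis using l by simp
      qed
      also have "... = L0 * l" by (simp add: L0_def U_def algebra_simps)
      finally show ?thesis .
    qed
    define D where "D = 2 * L"
    define b where "b = nat (2 * (\<lceil>max M 1 ^ D / \<delta>\<rceil> + 1) + 1)"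
    obtain N where N: "finite N" "N \<subseteq> priors M" "card N \<le> b ^ Suc D"
      "\<forall>\<pi>\<in>priors M. \<exists>\<rho>\<in>N. \<forall>j\<le>D. \<bar>(\<integral>t. t ^ j \<partial>\<pi>) - (\<integral>t. t ^ j \<partial>\<rho>)\<bar> \<le> \<delta>"
      using moment_net[OF M d, of D] unfolding b_def by blast
    have Md: "1 \<le> max M 1 ^ D / \<delta>"
    proof -
      have "exp (- (U + U')) \<le> 1" using UU by simp
      moreover have "2 \<le> real n" using n by simp
      ultimately have "exp (- (U + U')) \<le> 2 * real n" by linarith
      then have "\<delta> \<le> 1" unfolding \<delta>_def using n0 by (simp add: pos_divide_le_eq)
      also have "1 \<le> max M 1 ^ D" by (rule one_le_power) simp
      finally show ?thesis using d by (simp add: pos_le_divide_eq)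
    qed
    define y where "y = max M 1 ^ D / \<delta>"
    have y: "1 \<le> y" using Md by (simp add: y_def)
    have cy: "real_of_int \<lceil>y\<rceil> \<le> y + 1" "1 \<le> \<lceil>y\<rceil>" using y by linarith+
    have "real b = real_of_int (2 * (\<lceil>y\<rceil> + 1) + 1)" unfolding b_def y_def[symmetric] using cy(2) by simp
    then have rb: "real b = 2 * real_of_int \<lceil>y\<rceil> + 3" by simp
    then have b7: "real b \<le> 7 * (max M 1 ^ D / \<delta>)" using cy(1) y unfolding y_def[symmetric] by linarith
    have b1: "1 \<le> real b" using rb cy(2) by simp
    have "ln (real b) \<le> ln (7 * (max M 1 ^ D / \<delta>))" using b7 b1 by (subst ln_le_cancel_iff) auto
    also have "... = ln 7 + (real D * ln (max M 1) - ln \<delta>)"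
    proof -
      have M1: "0 < max M 1" by simp
      then have "0 < max M 1 ^ D" by simp
      then show ?thesis using d M1 by (simp add: ln_mult ln_div ln_realpow)
    qed
    also have "ln \<delta> = - (U + U') - (ln 2 + l)"
      unfolding \<delta>_def l_def using n0 by (subst ln_div, simp_all add: ln_mult)
    finally have lb: "ln (real b) \<le> ln 7 + real D * ln (max M 1) + (U + U') + ln 2 + l" by simp
    also have "... \<le> ln 7 * (2 * l) + (2 * L0 * l) * ln (max M 1) + (U + U') + ln 2 * (2 * l) + l"
    proof -
      have "ln 7 * 1 \<le> ln 7 * (2 * l)" "ln 2 * 1 \<le> ln 2 * (2 * l)" using l by (intro mult_left_mono; simp)+
      moreover have "real D * ln (max M 1) \<le> (2 * L0 * l) * ln (max M 1)"
        using L2 lM1 by (intro mult_right_mono) (auto simp: D_def)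
      ultimately show ?thesis by linarith
    qed
    also have "... = c0 * l" by (simp add: c0_def U_def U'_def algebra_simps)
    finally have lb': "ln (real b) \<le> c0 * l" .
    have card: "ln (real (card N)) \<le> (2 * L0 + 2) * c0 * l\<^sup>2"
    proof (cases "card N = 0")
      case True
      then show ?thesis using L0 c0 by simp
    next
      case False
      have "ln (real (card N)) \<le> ln (real b ^ Suc D)"
        using N(3) False b1 by (subst ln_le_cancel_iff) (auto simp del: power_Suc simp flip: of_nat_power)
      also have "... = real (Suc D) * ln (real b)" using b1 by (subst ln_realpow) auto
      also have "... \<le> ((2 * L0 + 2) * l) * (c0 * l)"
        using lb' b1 L0 L2 l by (intro mult_mono) (auto simp: D_def algebra_simps)
      finally show ?thesis by (simp add: power2_eq_square mult_ac)
    qed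
    have close: "\<bar>mom \<pi> \<sigma> i x - mom \<rho> \<sigma> i x\<bar> \<le> mom \<rho> \<sigma> 0 x / real n"
      if p: "\<pi> \<in> priors M" "\<rho> \<in> priors M" and dd: "\<forall>j\<le>D. \<bar>(\<integral>t. t ^ j \<partial>\<pi>) - (\<integral>t. t ^ j \<partial>\<rho>)\<bar> \<le> \<delta>"
        and \<sigma>: "k < \<sigma>" and x: "\<bar>x\<bar> \<le> a * l" and i: "i \<le> 1" for \<pi> \<rho> \<sigma> x i
    proof -
      have 1: "M * (\<bar>x\<bar> + M / 2) / k\<^sup>2 \<le> U"
      proof -
        have "M * (1 / 2) \<le> M * l" using M l by (intro mult_left_mono) auto
        then have "\<bar>x\<bar> + M / 2 \<le> (a + M) * l" using x by (simp add: distrib_right)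
        then have "M * (\<bar>x\<bar> + M / 2) \<le> M * ((a + M) * l)" using M by (intro mult_left_mono) auto
        then have "M * (\<bar>x\<bar> + M / 2) / k\<^sup>2 \<le> M * ((a + M) * l) / k\<^sup>2" by (rule divide_right_mono) simp
        then show ?thesis by (simp add: U_def u0_def mult_ac)
      qed
      have 2: "(\<bar>x\<bar> + 1 / 2) / k\<^sup>2 \<le> U'"
      proof -
        have "\<bar>x\<bar> + 1 / 2 \<le> (a + 1) * l" using x l by (simp add: distrib_right)
        then have "(\<bar>x\<bar> + 1 / 2) / k\<^sup>2 \<le> (a + 1) * l / k\<^sup>2" by (rule divide_right_mono) simp
        then show ?thesis by (simp add: U'_def u1_def)
      qed
      have "mixture M \<sigma> \<rho>" using mixtureI[OF M _ p(2)] k \<sigma> by auto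
      then have m0: "0 < mom \<rho> \<sigma> 0 x" by (rule mixture.mom0_pos)
      have "\<bar>mom \<pi> \<sigma> i x - mom \<rho> \<sigma> i x\<bar> \<le> exp U * (\<delta> * exp U' + 2 * (1 + M) * (U ^ L / fact L * exp U)) * mom \<rho> \<sigma> 0 x"
        by (rule moments_determine_mixture[OF M k \<sigma> p _ i 1 2]) (use dd in \<open>auto simp: D_def\<close>)
      also have "... \<le> (1 / real n) * mom \<rho> \<sigma> 0 x"
      proof (rule mult_right_mono)
        have e1: "exp U * (\<delta> * exp U') = 1 / (2 * real n)"
        proof -
          have "exp U * (\<delta> * exp U') = (exp U * exp U' * exp (- (U + U'))) / (2 * real n)" by (simp add: \<delta>_def)
          also have "exp U * exp U' * exp (- (U + U')) = 1" by (simp only: exp_add[symmetric]) simp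
          finally show ?thesis .
        qed
        have "U ^ L * exp 1 ^ L = (exp 1 * U) ^ L" by (simp add: power_mult_distrib)
        also have "... \<le> fact L * exp (exp 1 * U)" using UU by (intro power_le_fact_exp) auto
        also have "... \<le> fact L * exp (3 * U)"
          using UU exp_le by (intro mult_left_mono) (auto intro: mult_right_mono)
        finally have "U ^ L * exp (real L) \<le> fact L * exp (3 * U)" by (simp add: exp_of_nat_mult[symmetric])
        then have uf: "U ^ L / fact L \<le> exp (3 * U) / exp (real L)" by (simp add: field_simps)
        have "exp U * (2 * (1 + M) * (U ^ L / fact L * exp U)) \<le> exp U * (2 * (1 + M) * (exp (3 * U) / exp (real L) * exp U))"
          using uf M by (intro mult_left_mono mult_right_mono) auto
        also have "... = 2 * (1 + M) * (exp (5 * U) / exp (real L))"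
        proof -
          have "exp U * exp (3 * U) * exp U = exp (5 * U)" by (simp add: exp_add[symmetric])
          then show ?thesis by (simp add: mult_ac)
        qed
        also have "exp (5 * U) / exp (real L) \<le> exp (5 * U) / exp (5 * U + ln (4 * (1 + M)) + l)"
          using L1 by (intro divide_left_mono) auto
        also have "... = 1 / (4 * (1 + M) * real n)"
          using M n0 by (simp add: exp_add)
        also have "2 * (1 + M) * (1 / (4 * (1 + M) * real n)) = 1 / (2 * real n)"
        proof -
          have cc: "2 * m * (1 / (4 * m * r)) = 1 / (2 * r)" if "0 < m" "0 < r" for m r :: real
            using that by (simp add: field_simps)
          show ?thesis by (rule cc) (use M n0(1) in auto)
        qed
        finally have e2: "exp U * (2 * (1 + M) * (U ^ L / fact L * exp U)) \<le> 1 / (2 * real n)" using M by simp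
        show "exp U * (\<delta> * exp U' + 2 * (1 + M) * (U ^ L / fact L * exp U)) \<le> 1 / real n"
          unfolding distrib_left e1 using e2 by simp
      qed (use m0 in simp)
      finally show ?thesis by simp
    qed
    show "\<exists>N. finite N \<and> N \<subseteq> priors M \<and> ln (real (card N)) \<le> (2 * L0 + 2) * c0 * (ln (real n))\<^sup>2 \<and>
      (\<forall>\<pi>\<in>priors M. \<exists>\<rho>\<in>N. \<forall>\<sigma> x i. k < \<sigma> \<longrightarrow> \<bar>x\<bar> \<le> a * ln (real n) \<longrightarrow> i \<le> 1 \<longrightarrow>
         \<bar>mom \<pi> \<sigma> i x - mom \<rho> \<sigma> i x\<bar> \<le> mom \<rho> \<sigma> 0 x / real n)"
    proof (intro exI[of _ N] conjI ballI)
      show "ln (real (card N)) \<le> (2 * L0 + 2) * c0 * (ln (real n))\<^sup>2" using card by (simp add: l_def)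
      fix \<pi> assume p: "\<pi> \<in> priors M"
      then obtain \<rho> where r: "\<rho> \<in> N" "\<forall>j\<le>D. \<bar>(\<integral>t. t ^ j \<partial>\<pi>) - (\<integral>t. t ^ j \<partial>\<rho>)\<bar> \<le> \<delta>" using N(4) by blast
      then show "\<exists>\<rho>\<in>N. \<forall>\<sigma> x i. k < \<sigma> \<longrightarrow> \<bar>x\<bar> \<le> a * ln (real n) \<longrightarrow> i \<le> 1 \<longrightarrow>
         \<bar>mom \<pi> \<sigma> i x - mom \<rho> \<sigma> i x\<bar> \<le> mom \<rho> \<sigma> 0 x / real n"
        using close[OF p _ r(2)] N(2) unfolding l_def by (intro bexI[of _ \<rho>]) auto
    qed (use N in auto)
  qed
qed

section \<open>Posterior means and the Hellinger distance\<close>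

text \<open>If the first ratio of consecutive terms exceeded \<open>S * m + exp 1\<close>, then each of the first \<open>m\<close> ratios would
  exceed \<open>exp 1\<close>, because the recursion lowers a ratio by at most \<open>S\<close>; the \<open>m\<close>-th term would be too large.\<close>

lemma log_convex_ratio:
  fixes b :: "nat \<Rightarrow> real"
  assumes pos: "\<And>j. 0 < b j" and S: "0 \<le> S"
    and rec: "\<And>j. (b (Suc j))\<^sup>2 \<le> b j * b (Suc (Suc j)) + S * b j * b (Suc j)"
    and top: "b m \<le> exp (real m) * b 0" and m: "0 < m"
  shows "b 1 \<le> (S * real m + exp 1) * b 0"
proof (rule ccontr)
  assume "\<not> ?thesis"
  then have start: "(S * real m + exp 1) * b 0 < b 1" by simp
  have ratio: "j < m \<Longrightarrow> (S * real (m - j) + exp 1) * b j < b (Suc j)" for j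
  proof (induction j)
    case 0
    then show ?case using start by simp
  next
    case (Suc j)
    then have IH: "(S * real (m - j) + exp 1) * b j < b (Suc j)" by simp
    have mj: "real (m - j) = real (m - Suc j) + 1" using Suc.prems by simp
    have "b (Suc j) * ((S * real (m - j) + exp 1) * b j) < b (Suc j) * b (Suc j)"
      using IH pos by (rule mult_strict_left_mono)
    also have "... \<le> b j * b (Suc (Suc j)) + S * b j * b (Suc j)"
      using rec[of j] by (simp add: power2_eq_square)
    finally have "b j * ((S * real (m - Suc j) + exp 1) * b (Suc j)) < b j * b (Suc (Suc j))"
      unfolding mj by (simp add: algebra_simps)
    then show ?case using pos[of j] by (rule mult_left_less_imp_less[OF _ less_imp_le])
  qed
  have "0 < j \<Longrightarrow> j \<le> m \<Longrightarrow> exp (real j) * b 0 < b j" for j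
  proof (induction j)
    case (Suc j)
    have lt: "exp 1 * b j < b (Suc j)"
    proof -
      have "exp 1 * b j \<le> (S * real (m - j) + exp 1) * b j"
        using S pos[of j] by (intro mult_right_mono) auto
      also have "... < b (Suc j)" using ratio[of j] Suc.prems by simp
      finally show ?thesis .
    qed
    have le: "exp (real j) * b 0 \<le> b j"
      using Suc by (cases "j = 0") auto
    have "exp (real (Suc j)) * b 0 = exp 1 * (exp (real j) * b 0)" by (simp add: exp_add)
    also have "... \<le> exp 1 * b j" using le by (intro mult_left_mono) auto
    finally show ?case using lt by linarith
  qed simp
  from this[of m] m top show False by simp
qed

lemma (in mixture) cosh_mom0_integrable: "integrable lborel (\<lambda>z. cosh (C * z) * mom \<pi> \<sigma> 0 z)"
  and cosh_mom0_integral_le: "(\<integral>z. cosh (C * z) * mom \<pi> \<sigma> 0 z \<partial>lborel) \<le> exp (C\<^sup>2 * \<sigma>\<^sup>2 / 2) * cosh (C * M)"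
proof -
  have [measurable]: "(\<lambda>z. cosh (C * z)) \<in> borel_measurable borel" by (simp add: cosh_field_def)
  have cm [measurable]: "(\<lambda>p. cosh (C * snd p)) \<in> borel_measurable (borel \<Otimes>\<^sub>M borel :: (real \<times> real) measure)"
    by (simp add: cosh_field_def)
  have e: "(\<integral>\<^sup>+z. ennreal (cosh (C * z) * mom \<pi> \<sigma> 0 z) \<partial>lborel) = (\<integral>\<^sup>+p. ennreal (cosh (C * snd p)) \<partial>Q)"
    using mom0_pos by (subst Q_nn_integral_snd) (auto simp: ennreal_mult less_imp_le)
  also have "... < \<infinity>" using integrableD(2)[OF Q_cosh_integrable[of C]] by (simp add: less_top)
  finally show I: "integrable lborel (\<lambda>z. cosh (C * z) * mom \<pi> \<sigma> 0 z)"
    by (intro integrableI_nonneg) (use mom0_pos in \<open>auto simp: less_imp_le\<close>)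
  have "(\<integral>z. cosh (C * z) * mom \<pi> \<sigma> 0 z \<partial>lborel) = (\<integral>p. cosh (C * snd p) \<partial>Q)"
    using Q_integral_snd[of "\<lambda>z. cosh (C * z)"] Q_cosh_integrable by simp
  also have "... = (\<integral>\<theta>. exp (C\<^sup>2 * \<sigma>\<^sup>2 / 2) * cosh (C * \<theta>) \<partial>\<pi>)"
    using Q_integral_iterated(1)[OF cm Q_cosh_integrable] gaussm_cosh(2)[OF sg] by simp
  also have "... \<le> (\<integral>\<theta>. exp (C\<^sup>2 * \<sigma>\<^sup>2 / 2) * cosh (C * M) \<partial>\<pi>)"
  proof (rule integral_mono_AE')
    show "AE \<theta> in \<pi>. exp (C\<^sup>2 * \<sigma>\<^sup>2 / 2) * cosh (C * \<theta>) \<le> exp (C\<^sup>2 * \<sigma>\<^sup>2 / 2) * cosh (C * M)"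
      using AE_bound
    proof eventually_elim
      case (elim \<theta>)
      have "\<bar>C * \<theta>\<bar> \<le> \<bar>C * M\<bar>" unfolding abs_mult using elim M_pos by (intro mult_left_mono) auto
      then have "cosh \<bar>C * \<theta>\<bar> \<le> cosh \<bar>C * M\<bar>" by (subst cosh_real_nonneg_le_iff) auto
      then show ?case by (simp add: cosh_real_abs)
    qed
  qed auto
  finally show "(\<integral>z. cosh (C * z) * mom \<pi> \<sigma> 0 z \<partial>lborel) \<le> exp (C\<^sup>2 * \<sigma>\<^sup>2 / 2) * cosh (C * M)"
    by (simp add: prob_space[simplified])
qed

lemma (in mixture) mom0_gauss_dominated:
  "mom \<pi> \<sigma> 0 x \<le> exp (2 * M\<^sup>2 / \<sigma>\<^sup>2) * exp (2 * M / \<sigma>\<^sup>2 * \<bar>x\<bar>) * gpdf \<sigma> x"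
proof -
  let ?c = "exp (2 * M * (\<bar>x\<bar> + M) / \<sigma>\<^sup>2) * gpdf \<sigma> (x - 0)"
  have "(\<integral>\<theta>. gpdf \<sigma> (x - \<theta>) \<partial>\<pi>) \<le> (\<integral>\<theta>. ?c \<partial>\<pi>)"
  proof (rule integral_mono_AE)
    show "AE \<theta> in \<pi>. gpdf \<sigma> (x - \<theta>) \<le> ?c"
      using AE_bound by eventually_elim (rule normal_density_ratio[OF sg], use M_pos in auto)
  qed (use nd_integrable in auto)
  then have "mom \<pi> \<sigma> 0 x \<le> ?c" using prob_space by (simp add: mom0)
  also have "exp (2 * M * (\<bar>x\<bar> + M) / \<sigma>\<^sup>2) = exp (2 * M\<^sup>2 / \<sigma>\<^sup>2) * exp (2 * M / \<sigma>\<^sup>2 * \<bar>x\<bar>)"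
    by (simp add: exp_add[symmetric] power2_eq_square distrib_left add_divide_distrib add.commute mult_ac)
  finally show ?thesis by simp
qed

locale two_mixtures = A: mixture M \<sigma> \<pi> + B: mixture M \<sigma> \<rho> for M \<sigma> \<pi> \<rho>
begin

text \<open>Dividing by the sum of the densities keeps the energies finite and bounded by powers of \<open>M\<close>. The energy of
  order 0 is comparable to the squared Hellinger distance, that of order 1 controls the difference of the
  posterior means.\<close>

definition d :: "nat \<Rightarrow> real \<Rightarrow> real" where "d j x = mom \<pi> \<sigma> j x - mom \<rho> \<sigma> j x"
definition tot :: "nat \<Rightarrow> real \<Rightarrow> real" where "tot j x = mom \<pi> \<sigma> j x + mom \<rho> \<sigma> j x"
abbreviation "f \<equiv> tot 0"
definition energy :: "nat \<Rightarrow> real" where "energy j = (\<integral>x. (d j x)\<^sup>2 / f x \<partial>lborel)"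

lemma f_pos: "0 < f x" using A.mom0_pos[of x] B.mom0_pos[of x] by (simp add: tot_def)

lemma d_bound: "\<bar>d j x\<bar> \<le> M ^ j * f x"
  using A.mom_bound[of j x] B.mom_bound[of j x] by (simp add: d_def tot_def distrib_left)

lemma tot_bound: "\<bar>tot j x\<bar> \<le> M ^ j * f x"
  using A.mom_bound[of j x] B.mom_bound[of j x] by (simp add: tot_def distrib_left)

lemma d_measurable [measurable]: "d j \<in> borel_measurable borel" unfolding d_def[abs_def] by measurable
lemma tot_measurable [measurable]: "tot j \<in> borel_measurable borel" unfolding tot_def[abs_def] by measurable

lemma d_deriv: "(d j has_real_derivative (d (Suc j) x - x * d j x) / \<sigma>\<^sup>2) (at x)"
proof -
  have "(d j has_real_derivative (mom \<pi> \<sigma> (Suc j) x - x * mom \<pi> \<sigma> j x) / \<sigma>\<^sup>2 - (mom \<rho> \<sigma> (Suc j) x - x * mom \<rho> \<sigma> j x) / \<sigma>\<^sup>2) (at x)"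
    unfolding d_def[abs_def] by (rule DERIV_diff[OF A.mom_deriv B.mom_deriv])
  also have "(mom \<pi> \<sigma> (Suc j) x - x * mom \<pi> \<sigma> j x) / \<sigma>\<^sup>2 - (mom \<rho> \<sigma> (Suc j) x - x * mom \<rho> \<sigma> j x) / \<sigma>\<^sup>2 = (d (Suc j) x - x * d j x) / \<sigma>\<^sup>2"
    by (simp add: d_def diff_divide_distrib[symmetric] algebra_simps)
  finally show ?thesis .
qed

lemma tot_deriv: "(tot j has_real_derivative (tot (Suc j) x - x * tot j x) / \<sigma>\<^sup>2) (at x)"
proof -
  have "(tot j has_real_derivative (mom \<pi> \<sigma> (Suc j) x - x * mom \<pi> \<sigma> j x) / \<sigma>\<^sup>2 + (mom \<rho> \<sigma> (Suc j) x - x * mom \<rho> \<sigma> j x) / \<sigma>\<^sup>2) (at x)"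
    unfolding tot_def[abs_def] by (rule DERIV_add[OF A.mom_deriv B.mom_deriv])
  also have "(mom \<pi> \<sigma> (Suc j) x - x * mom \<pi> \<sigma> j x) / \<sigma>\<^sup>2 + (mom \<rho> \<sigma> (Suc j) x - x * mom \<rho> \<sigma> j x) / \<sigma>\<^sup>2 = (tot (Suc j) x - x * tot j x) / \<sigma>\<^sup>2"
    by (simp add: tot_def add_divide_distrib[symmetric] algebra_simps)
  finally show ?thesis .
qed

lemma cosh_f_integrable: "integrable lborel (\<lambda>x. cosh (C * x) * f x)"
  using Bochner_Integration.integrable_add[OF A.cosh_mom0_integrable[of C] B.cosh_mom0_integrable[of C]]
  by (simp add: tot_def distrib_left)

lemma cosh_f_integral_le: "(\<integral>x. cosh (C * x) * f x \<partial>lborel) \<le> 2 * (exp (C\<^sup>2 * \<sigma>\<^sup>2 / 2) * cosh (C * M))"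
proof -
  have "(\<integral>x. cosh (C * x) * f x \<partial>lborel) = (\<integral>x. cosh (C * x) * mom \<pi> \<sigma> 0 x \<partial>lborel) + (\<integral>x. cosh (C * x) * mom \<rho> \<sigma> 0 x \<partial>lborel)"
    unfolding tot_def distrib_left
    by (rule Bochner_Integration.integral_add[OF A.cosh_mom0_integrable B.cosh_mom0_integrable])
  then show ?thesis using A.cosh_mom0_integral_le[of C] B.cosh_mom0_integral_le[of C] by linarith
qed

lemma f_integrable: "integrable lborel f" and f_integral: "(\<integral>x. f x \<partial>lborel) = 2"
proof -
  have e: "tot 0 = (\<lambda>x. mom \<pi> \<sigma> 0 x + mom \<rho> \<sigma> 0 x)" by (auto simp: tot_def)
  show "integrable lborel f" "(\<integral>x. f x \<partial>lborel) = 2"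
    unfolding e using A.mom0_integrable B.mom0_integrable by (auto simp: A.mom0_integral B.mom0_integral)
qed

lemma weighted_cauchy:
  fixes g h :: "real \<Rightarrow> real"
  assumes [measurable]: "g \<in> borel_measurable borel" "h \<in> borel_measurable borel"
    and "integrable lborel (\<lambda>x. (g x)\<^sup>2 / f x)" "integrable lborel (\<lambda>x. (h x)\<^sup>2 / f x)"
  shows "integrable lborel (\<lambda>x. g x * h x / f x)"
    and "(\<integral>x. \<bar>g x * h x / f x\<bar> \<partial>lborel) \<le> sqrt (\<integral>x. (g x)\<^sup>2 / f x \<partial>lborel) * sqrt (\<integral>x. (h x)\<^sup>2 / f x \<partial>lborel)"
proof -
  have s: "(g x / sqrt (f x))\<^sup>2 = (g x)\<^sup>2 / f x" "(h x / sqrt (f x))\<^sup>2 = (h x)\<^sup>2 / f x"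
     "g x / sqrt (f x) * (h x / sqrt (f x)) = g x * h x / f x" for x
    using f_pos[of x] by (simp_all add: power_divide)
  have fa: "\<bar>f x\<bar> = f x" for x using f_pos[of x] by simp
  show "integrable lborel (\<lambda>x. g x * h x / f x)"
    using integral_abs_mult_le(1)[of "\<lambda>x. g x / sqrt (f x)" lborel "\<lambda>x. h x / sqrt (f x)"] assms(3,4) by (simp add: s fa)
  show "(\<integral>x. \<bar>g x * h x / f x\<bar> \<partial>lborel) \<le> sqrt (\<integral>x. (g x)\<^sup>2 / f x \<partial>lborel) * sqrt (\<integral>x. (h x)\<^sup>2 / f x \<partial>lborel)"
    using integral_abs_mult_le(2)[of "\<lambda>x. g x / sqrt (f x)" lborel "\<lambda>x. h x / sqrt (f x)"] assms(3,4) by (simp add: s fa)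
qed

lemma d_sq_le: "(d j x)\<^sup>2 / f x \<le> M ^ (2 * j) * f x"
proof -
  have "(d j x)\<^sup>2 = \<bar>d j x\<bar>\<^sup>2" by simp
  also have "... \<le> (M ^ j * f x)\<^sup>2" by (intro power_mono d_bound) auto
  finally have "(d j x)\<^sup>2 \<le> (M ^ (2 * j) * f x) * f x"
    unfolding power_even_eq by (simp add: power_mult_distrib power2_eq_square mult_ac)
  then show ?thesis using f_pos[of x] by (simp add: pos_divide_le_eq)
qed

lemma energy_integrable: "integrable lborel (\<lambda>x. (d j x)\<^sup>2 / f x)"
proof (rule Bochner_Integration.integrable_bound)
  show "integrable lborel (\<lambda>x. M ^ (2 * j) * f x)" using f_integrable by simp
  show "AE x in lborel. norm ((d j x)\<^sup>2 / f x) \<le> norm (M ^ (2 * j) * f x)"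
    using d_sq_le f_pos by (auto simp: abs_mult less_imp_le intro: order_trans)
qed measurable

lemma energy_nonneg: "0 \<le> energy j"
  unfolding energy_def by (rule integral_nonneg_AE) (use f_pos in \<open>auto simp: less_imp_le\<close>)

lemma energy_le: "energy j \<le> 2 * M ^ (2 * j)"
proof -
  have "energy j \<le> (\<integral>x. M ^ (2 * j) * f x \<partial>lborel)"
    unfolding energy_def by (rule integral_mono[OF energy_integrable]) (use f_integrable d_sq_le in auto)
  then show ?thesis by (simp add: f_integral)
qed

text \<open>On \<open>\<bar>x\<bar> \<le> T\<close> the factor \<open>x\<^sup>2\<close> is at most \<open>T\<^sup>2\<close>; beyond, it is at most \<open>4 * exp (- (2 * T)) * cosh (3 * x)\<close>.\<close>

lemma tail_weight:
  assumes T: "0 \<le> T"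
  defines "\<tau>2 \<equiv> 8 * (exp (3\<^sup>2 * \<sigma>\<^sup>2 / 2) * cosh (3 * M)) * exp (- (2 * T))"
  shows "integrable lborel (\<lambda>x. (x * d j x)\<^sup>2 / f x)"
    and "(\<integral>x. (x * d j x)\<^sup>2 / f x \<partial>lborel) \<le> T\<^sup>2 * energy j + M ^ (2 * j) * \<tau>2"
proof -
  have pw: "(x * d j x)\<^sup>2 / f x \<le> T\<^sup>2 * ((d j x)\<^sup>2 / f x) + M ^ (2 * j) * (4 * exp (- (2 * T)) * (cosh (3 * x) * f x))" for x
  proof (cases "\<bar>x\<bar> \<le> T")
    case True
    have "x\<^sup>2 \<le> T\<^sup>2" using True by (metis abs_ge_zero power2_abs power_mono)
    then have "x\<^sup>2 * ((d j x)\<^sup>2 / f x) \<le> T\<^sup>2 * ((d j x)\<^sup>2 / f x)"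
      using f_pos[of x] by (intro mult_right_mono) (auto simp: less_imp_le)
    moreover have "0 \<le> M ^ (2 * j) * (4 * exp (- (2 * T)) * (cosh (3 * x) * f x))"
      using f_pos[of x] A.M_pos by (simp add: less_imp_le)
    moreover have "(x * d j x)\<^sup>2 / f x = x\<^sup>2 * ((d j x)\<^sup>2 / f x)" by (simp add: power_mult_distrib)
    ultimately show ?thesis by linarith
  next
    case False
    have x2: "x\<^sup>2 \<le> 4 * exp (- (2 * T)) * cosh (3 * x)"
    proof -
      have "x\<^sup>2 \<le> 2 * exp \<bar>x\<bar>" using power_le_fact_exp[of "\<bar>x\<bar>" 2] by simp
      also have "exp \<bar>x\<bar> \<le> exp (- (2 * T) + 3 * \<bar>x\<bar>)" using False by simp
      also have "... = exp (- (2 * T)) * exp (3 * \<bar>x\<bar>)" by (simp only: exp_add)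
      also have "exp (3 * \<bar>x\<bar>) \<le> 2 * cosh (3 * x)" by (cases "0 \<le> x") (simp_all add: cosh_field_def)
      finally show ?thesis by simp
    qed
    have "(x * d j x)\<^sup>2 / f x = x\<^sup>2 * ((d j x)\<^sup>2 / f x)" by (simp add: power_mult_distrib)
    also have "... \<le> (4 * exp (- (2 * T)) * cosh (3 * x)) * (M ^ (2 * j) * f x)"
      using x2 d_sq_le[of j x] f_pos[of x] by (intro mult_mono) (auto simp: less_imp_le)
    finally have "(x * d j x)\<^sup>2 / f x \<le> M ^ (2 * j) * (4 * exp (- (2 * T)) * (cosh (3 * x) * f x))" by (simp add: mult_ac)
    moreover have "0 \<le> T\<^sup>2 * ((d j x)\<^sup>2 / f x)" using f_pos[of x] by (simp add: less_imp_le)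
    ultimately show ?thesis by linarith
  qed
  have I: "integrable lborel (\<lambda>x. T\<^sup>2 * ((d j x)\<^sup>2 / f x) + M ^ (2 * j) * (4 * exp (- (2 * T)) * (cosh (3 * x) * f x)))"
    by (intro Bochner_Integration.integrable_add integrable_mult_right energy_integrable cosh_f_integrable)
  show J: "integrable lborel (\<lambda>x. (x * d j x)\<^sup>2 / f x)"
    by (rule Bochner_Integration.integrable_bound[OF I])
      (use pw f_pos in \<open>auto simp: less_imp_le intro: order_trans[OF _ abs_ge_self]\<close>)
  have "(\<integral>x. (x * d j x)\<^sup>2 / f x \<partial>lborel) \<le> (\<integral>x. T\<^sup>2 * ((d j x)\<^sup>2 / f x) + M ^ (2 * j) * (4 * exp (- (2 * T)) * (cosh (3 * x) * f x)) \<partial>lborel)"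
    by (rule integral_mono[OF J I pw])
  also have "... = T\<^sup>2 * energy j + M ^ (2 * j) * (4 * exp (- (2 * T)) * (\<integral>x. cosh (3 * x) * f x \<partial>lborel))"
    unfolding energy_def
    by (subst Bochner_Integration.integral_add)
      (simp_all only: integral_mult_right_zero integrable_mult_right energy_integrable cosh_f_integrable)
  also have "... \<le> T\<^sup>2 * energy j + M ^ (2 * j) * (4 * exp (- (2 * T)) * (2 * (exp (3\<^sup>2 * \<sigma>\<^sup>2 / 2) * cosh (3 * M))))"
    using A.M_pos by (intro add_left_mono mult_left_mono cosh_f_integral_le) auto
  finally show "(\<integral>x. (x * d j x)\<^sup>2 / f x \<partial>lborel) \<le> T\<^sup>2 * energy j + M ^ (2 * j) * \<tau>2"
    by (simp add: \<tau>2_def mult_ac)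
qed

lemma energy_by_parts:
  "energy (Suc j) = - (\<integral>x. d j x * d (Suc (Suc j)) x / f x \<partial>lborel) + (\<integral>x. (x * d j x) * d (Suc j) x / f x \<partial>lborel)
     + (\<integral>x. d j x * d (Suc j) x * tot 1 x / (f x)\<^sup>2 \<partial>lborel)"
  and energy_parts_integrable: "integrable lborel (\<lambda>x. d j x * d (Suc j) x * tot 1 x / (f x)\<^sup>2)"
proof -
  \<comment> \<open>\<open>G\<close> vanishes at infinity, and the derivative of its factor \<open>d j\<close> produces \<open>d (Suc j)\<close>, hence the energy.\<close>
  define G where "G x = d j x * d (Suc j) x / f x" for x
  define g1 g2 g3 g4 where "g1 x = (d (Suc j) x)\<^sup>2 / f x" and "g2 x = d j x * d (Suc (Suc j)) x / f x"
    and "g3 x = (x * d j x) * d (Suc j) x / f x" and "g4 x = d j x * d (Suc j) x * tot 1 x / (f x)\<^sup>2" for x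
  have sg2: "0 < \<sigma>\<^sup>2" using A.sg by simp
  have fn: "f x \<noteq> 0" for x using f_pos[of x] by simp
  have dG: "(G has_real_derivative (g1 x + g2 x - g3 x - g4 x) / \<sigma>\<^sup>2) (at x)" for x
  proof -
    have "(G has_real_derivative
      ((d j x * ((d (Suc (Suc j)) x - x * d (Suc j) x) / \<sigma>\<^sup>2) + (d (Suc j) x - x * d j x) / \<sigma>\<^sup>2 * d (Suc j) x) * f x
        - d j x * d (Suc j) x * ((tot (Suc 0) x - x * f x) / \<sigma>\<^sup>2)) / (f x * f x)) (at x)"
      unfolding G_def[abs_def] by (rule DERIV_divide[OF DERIV_mult'[OF d_deriv d_deriv] tot_deriv fn])
    moreover have "((d j x * ((d (Suc (Suc j)) x - x * d (Suc j) x) / \<sigma>\<^sup>2) + (d (Suc j) x - x * d j x) / \<sigma>\<^sup>2 * d (Suc j) x) * f x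
        - d j x * d (Suc j) x * ((tot (Suc 0) x - x * f x) / \<sigma>\<^sup>2)) / (f x * f x) = (g1 x + g2 x - g3 x - g4 x) / \<sigma>\<^sup>2"
    proof -
      have alg: "((d0 * ((d2 - x * d1) / t) + (d1 - x * d0) / t * d1) * w - d0 * d1 * ((u - x * w) / t)) / (w * w)
         = (d1\<^sup>2 / w + d0 * d2 / w - (x * d0) * d1 / w - d0 * d1 * u / w\<^sup>2) / t"
        if "w \<noteq> 0" "t \<noteq> 0" for d0 d1 d2 u w t :: real
      proof -
        define P q where "P = d1\<^sup>2 + d0 * d2 - (x * d0) * d1" and "q = d0 * d1 * u"
        have "(d0 * ((d2 - x * d1) / t) + (d1 - x * d0) / t * d1) * w - d0 * d1 * ((u - x * w) / t) = (P * w - q) / t"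
          by (simp add: P_def q_def power2_eq_square algebra_simps add_divide_distrib diff_divide_distrib)
        also have "... / (w * w) = (P / w - q / w\<^sup>2) / t" using that by (simp add: field_simps power2_eq_square)
        finally show ?thesis by (simp add: P_def q_def add_divide_distrib diff_divide_distrib)
      qed
      show ?thesis unfolding g1_def g2_def g3_def g4_def One_nat_def by (rule alg) (use fn[of x] sg2 in auto)
    qed
    ultimately show ?thesis by simp
  qed
  have i1: "integrable lborel g1" unfolding g1_def by (rule energy_integrable)
  have i2: "integrable lborel g2" unfolding g2_def by (rule weighted_cauchy(1)) (auto intro: energy_integrable)
  have i3: "integrable lborel g3" unfolding g3_def
    by (rule weighted_cauchy(1)) (auto intro: energy_integrable tail_weight(1)[of 0])
  show i4: "integrable lborel (\<lambda>x. d j x * d (Suc j) x * tot 1 x / (f x)\<^sup>2)"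
  proof (rule Bochner_Integration.integrable_bound)
    show "integrable lborel (\<lambda>x. M * (d j x * d (Suc j) x / f x))"
      by (intro integrable_mult_right weighted_cauchy(1)) (auto intro: energy_integrable)
    have "\<bar>d j x * d (Suc j) x * tot 1 x / (f x)\<^sup>2\<bar> \<le> \<bar>M * (d j x * d (Suc j) x / f x)\<bar>" for x
    proof -
      have "\<bar>d j x * d (Suc j) x * tot 1 x / (f x)\<^sup>2\<bar> = \<bar>d j x * d (Suc j) x / f x\<bar> * (\<bar>tot 1 x\<bar> / f x)"
        using f_pos[of x] by (simp add: abs_mult power2_eq_square)
      also have "... \<le> \<bar>d j x * d (Suc j) x / f x\<bar> * M"
        using tot_bound[of 1 x] f_pos[of x] by (intro mult_left_mono) (auto simp: pos_divide_le_eq)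
      finally show ?thesis using A.M_pos by (simp add: abs_mult mult_ac)
    qed
    then show "AE x in lborel. norm (d j x * d (Suc j) x * tot 1 x / (f x)\<^sup>2) \<le> norm (M * (d j x * d (Suc j) x / f x))" by simp
  qed measurable
  have i4': "integrable lborel g4" using i4 unfolding g4_def .
  have cd: "isCont (d i) x" "isCont (tot i) x" for i x
    by (rule DERIV_isCont[OF d_deriv], rule DERIV_isCont[OF tot_deriv])
  have Gb: "\<bar>G x\<bar> \<le> (2 * M ^ j * M ^ Suc j * exp (2 * M\<^sup>2 / \<sigma>\<^sup>2)) * exp (2 * M / \<sigma>\<^sup>2 * \<bar>x\<bar>) * gpdf \<sigma> x" for x
  proof -
    have "\<bar>G x\<bar> = \<bar>d j x\<bar> * \<bar>d (Suc j) x\<bar> / f x" unfolding G_def using f_pos[of x] by (simp add: abs_mult)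
    also have "... \<le> (M ^ j * f x) * (M ^ Suc j * f x) / f x"
      using d_bound[of j x] d_bound[of "Suc j" x] f_pos[of x] A.M_pos by (intro divide_right_mono mult_mono) (auto simp: less_imp_le)
    also have "... = M ^ j * M ^ Suc j * f x" using fn[of x] by simp
    also have "... \<le> M ^ j * M ^ Suc j * (2 * (exp (2 * M\<^sup>2 / \<sigma>\<^sup>2) * exp (2 * M / \<sigma>\<^sup>2 * \<bar>x\<bar>) * gpdf \<sigma> x))"
      using A.mom0_gauss_dominated[of x] B.mom0_gauss_dominated[of x] A.M_pos
      by (intro mult_left_mono) (auto simp: tot_def)
    finally show ?thesis by (simp add: mult_ac)
  qed
  have "(\<integral>x. (g1 x + g2 x - g3 x - g4 x) / \<sigma>\<^sup>2 \<partial>lborel) = 0"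
  proof (rule integral_deriv_real_line[OF dG])
    show "isCont (\<lambda>x. (g1 x + g2 x - g3 x - g4 x) / \<sigma>\<^sup>2) x" for x
      unfolding g1_def g2_def g3_def g4_def using fn sg2 by (intro continuous_intros cd) auto
    show "integrable lborel (\<lambda>x. (g1 x + g2 x - g3 x - g4 x) / \<sigma>\<^sup>2)" using i1 i2 i3 i4' by simp
  qed (rule gauss_dominated_tendsto[OF A.sg Gb])+
  then have "(\<integral>x. g1 x + g2 x - g3 x - g4 x \<partial>lborel) = 0" using sg2 by simp
  then have "(\<integral>x. g1 x \<partial>lborel) + (\<integral>x. g2 x \<partial>lborel) - (\<integral>x. g3 x \<partial>lborel) - (\<integral>x. g4 x \<partial>lborel) = 0"
    using i1 i2 i3 i4' by simp
  then show "energy (Suc j) = - (\<integral>x. d j x * d (Suc (Suc j)) x / f x \<partial>lborel) + (\<integral>x. (x * d j x) * d (Suc j) x / f x \<partial>lborel)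
     + (\<integral>x. d j x * d (Suc j) x * tot 1 x / (f x)\<^sup>2 \<partial>lborel)"
    unfolding energy_def g1_def[symmetric] g2_def[symmetric] g3_def[symmetric] g4_def[symmetric] by linarith
qed

end

context two_mixtures
begin

text \<open>The three integrals of the integration by parts are bounded by the Cauchy-Schwarz inequality. Division
  by \<open>M ^ j\<close> makes the sequence bounded, and the shift by \<open>\<tau>\<close> absorbs the tail term.\<close>

lemma energy_recursion:
  assumes T: "0 \<le> T" and t: "0 < \<tau>"
    and \<tau>: "8 * (exp (3\<^sup>2 * \<sigma>\<^sup>2 / 2) * cosh (3 * M)) * exp (- (2 * T)) \<le> \<tau>\<^sup>2"
  defines "b \<equiv> (\<lambda>j. sqrt (energy j) / M ^ j + \<tau>)"
  shows "(b (Suc j))\<^sup>2 \<le> b j * b (Suc (Suc j)) + ((T + 1) / M + 3) * b j * b (Suc j)"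
proof -
  have M: "0 < M" by (rule A.M_pos)
  define E where "E i = sqrt (energy i)" for i
  have E0: "0 \<le> E i" for i by (simp add: E_def energy_nonneg)
  have E2: "(E i)\<^sup>2 = energy i" for i by (simp add: E_def energy_nonneg)
  note di = energy_integrable
  have w1: "\<bar>\<integral>x. d j x * d (Suc (Suc j)) x / f x \<partial>lborel\<bar> \<le> E j * E (Suc (Suc j))"
    using weighted_cauchy(2)[OF _ _ di[of j] di[of "Suc (Suc j)"]]
      integral_abs_bound[of lborel "\<lambda>x. d j x * d (Suc (Suc j)) x / f x"]
    by (simp add: E_def energy_def)
  have w2: "\<bar>\<integral>x. (x * d j x) * d (Suc j) x / f x \<partial>lborel\<bar> \<le> (T * E j + M ^ j * \<tau>) * E (Suc j)"
  proof -
    have "\<bar>\<integral>x. (x * d j x) * d (Suc j) x / f x \<partial>lborel\<bar> \<le> (\<integral>x. \<bar>(x * d j x) * d (Suc j) x / f x\<bar> \<partial>lborel)"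
      by (rule integral_abs_bound)
    also have "... \<le> sqrt (\<integral>x. (x * d j x)\<^sup>2 / f x \<partial>lborel) * sqrt (\<integral>x. (d (Suc j) x)\<^sup>2 / f x \<partial>lborel)"
      by (rule weighted_cauchy(2)) (auto intro: di tail_weight(1)[OF T])
    also have "... \<le> (T * E j + M ^ j * \<tau>) * E (Suc j)"
    proof (rule mult_mono)
      have "(\<integral>x. (x * d j x)\<^sup>2 / f x \<partial>lborel) \<le> T\<^sup>2 * energy j + M ^ (2 * j) * \<tau>\<^sup>2"
      proof -
        have "M ^ (2 * j) * (8 * (exp (3\<^sup>2 * \<sigma>\<^sup>2 / 2) * cosh (3 * M)) * exp (- (2 * T))) \<le> M ^ (2 * j) * \<tau>\<^sup>2"
          using M by (intro mult_left_mono \<tau>) simp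
        then show ?thesis using tail_weight(2)[OF T, of j] by linarith
      qed
      also have "... = (T * E j)\<^sup>2 + (M ^ j * \<tau>)\<^sup>2"
        by (simp add: power_mult_distrib E2 power_even_eq)
      also have "... \<le> (T * E j + M ^ j * \<tau>)\<^sup>2"
        using T E0[of j] t M by (simp add: power2_sum)
      finally have "sqrt (\<integral>x. (x * d j x)\<^sup>2 / f x \<partial>lborel) \<le> sqrt ((T * E j + M ^ j * \<tau>)\<^sup>2)" by (rule real_sqrt_le_mono)
      also have "... = T * E j + M ^ j * \<tau>" using T E0[of j] t M by simp
      finally show "sqrt (\<integral>x. (x * d j x)\<^sup>2 / f x \<partial>lborel) \<le> T * E j + M ^ j * \<tau>" .
      show "0 \<le> T * E j + M ^ j * \<tau>" using T E0[of j] t M by simp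
      show "0 \<le> sqrt (\<integral>x. (d (Suc j) x)\<^sup>2 / f x \<partial>lborel)" using energy_nonneg[of "Suc j"] by (simp add: energy_def)
    qed (simp add: E_def energy_def)
    finally show ?thesis .
  qed
  have w3: "\<bar>\<integral>x. d j x * d (Suc j) x * tot 1 x / (f x)\<^sup>2 \<partial>lborel\<bar> \<le> M * (E j * E (Suc j))"
  proof -
    have "\<bar>\<integral>x. d j x * d (Suc j) x * tot 1 x / (f x)\<^sup>2 \<partial>lborel\<bar> \<le> (\<integral>x. \<bar>d j x * d (Suc j) x * tot 1 x / (f x)\<^sup>2\<bar> \<partial>lborel)"
      by (rule integral_abs_bound)
    also have "... \<le> (\<integral>x. M * \<bar>d j x * d (Suc j) x / f x\<bar> \<partial>lborel)"
    proof (rule integral_mono)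
      show "integrable lborel (\<lambda>x. \<bar>d j x * d (Suc j) x * tot 1 x / (f x)\<^sup>2\<bar>)"
        using energy_parts_integrable[of j] by (rule integrable_abs)
      show "integrable lborel (\<lambda>x. M * \<bar>d j x * d (Suc j) x / f x\<bar>)"
        using weighted_cauchy(1)[OF _ _ di[of j] di[of "Suc j"]] by (intro integrable_mult_right integrable_abs) auto
      fix x
      have "\<bar>d j x * d (Suc j) x * tot 1 x / (f x)\<^sup>2\<bar> = \<bar>d j x * d (Suc j) x / f x\<bar> * (\<bar>tot 1 x\<bar> / f x)"
        using f_pos[of x] by (simp add: abs_mult power2_eq_square)
      also have "... \<le> \<bar>d j x * d (Suc j) x / f x\<bar> * M"
        using tot_bound[of 1 x] f_pos[of x] by (intro mult_left_mono) (auto simp: pos_divide_le_eq)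
      finally show "\<bar>d j x * d (Suc j) x * tot 1 x / (f x)\<^sup>2\<bar> \<le> M * \<bar>d j x * d (Suc j) x / f x\<bar>" by (simp add: mult_ac)
    qed
    also have "... = M * (\<integral>x. \<bar>d j x * d (Suc j) x / f x\<bar> \<partial>lborel)" by (simp only: integral_mult_right_zero)
    also have "... \<le> M * (E j * E (Suc j))"
      using weighted_cauchy(2)[OF _ _ di[of j] di[of "Suc j"]] M
      by (intro mult_left_mono) (auto simp: E_def energy_def)
    finally show ?thesis .
  qed
  have main: "(E (Suc j))\<^sup>2 \<le> E j * E (Suc (Suc j)) + (T * E j + M ^ j * \<tau>) * E (Suc j) + M * (E j * E (Suc j))"
    unfolding E2 energy_by_parts[of j] using w1 w2 w3 by linarith
  define a where "a i = E i / M ^ i" for i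
  have a0: "0 \<le> a i" for i using E0 M by (simp add: a_def)
  have Ea: "E i = M ^ i * a i" for i using M by (simp add: a_def)
  have "(M ^ Suc j * a (Suc j))\<^sup>2 \<le> (M ^ j * a j) * (M ^ Suc (Suc j) * a (Suc (Suc j)))
     + (T * (M ^ j * a j) + M ^ j * \<tau>) * (M ^ Suc j * a (Suc j)) + M * ((M ^ j * a j) * (M ^ Suc j * a (Suc j)))"
    using main unfolding Ea .
  also have "... = (M ^ Suc j)\<^sup>2 * (a j * a (Suc (Suc j)) + (T * a j + \<tau>) / M * a (Suc j) + a j * a (Suc j))"
    using M by (simp add: field_simps power2_eq_square)
  finally have "(M ^ Suc j)\<^sup>2 * (a (Suc j))\<^sup>2 \<le> (M ^ Suc j)\<^sup>2 * (a j * a (Suc (Suc j)) + (T * a j + \<tau>) / M * a (Suc j) + a j * a (Suc j))"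
    by (simp only: power_mult_distrib)
  then have ra: "(a (Suc j))\<^sup>2 \<le> a j * a (Suc (Suc j)) + (T * a j + \<tau>) / M * a (Suc j) + a j * a (Suc j)"
    using M by (subst (asm) mult_le_cancel_left_pos) auto
  have ba: "b i = a i + \<tau>" for i by (simp add: b_def a_def E_def)
  have bp: "0 < b i" "\<tau> \<le> b i" "a i \<le> b i" for i using a0[of i] t by (auto simp: ba)
  have p1: "a j * a (Suc (Suc j)) \<le> b j * b (Suc (Suc j))" using a0 bp by (intro mult_mono) (auto simp: less_imp_le)
  have p2: "(T * a j + \<tau>) / M * a (Suc j) \<le> (T + 1) / M * b j * b (Suc j)"
  proof -
    have "T * a j + \<tau> \<le> (T + 1) * b j" using bp[of j] T mult_left_mono[of "a j" "b j" T] by (simp add: distrib_right)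
    then have "(T * a j + \<tau>) / M \<le> (T + 1) * b j / M" using M by (intro divide_right_mono) auto
    then have "(T * a j + \<tau>) / M * a (Suc j) \<le> (T + 1) * b j / M * b (Suc j)"
      using bp a0 T M by (intro mult_mono) (auto simp: less_imp_le)
    then show ?thesis by simp
  qed
  have p3: "a j * a (Suc j) \<le> b j * b (Suc j)" using a0 bp by (intro mult_mono) (auto simp: less_imp_le)
  have p4: "2 * a (Suc j) * \<tau> + \<tau>\<^sup>2 \<le> 2 * (b j * b (Suc j))"
  proof -
    have "2 * a (Suc j) * \<tau> + \<tau>\<^sup>2 \<le> 2 * (\<tau> * b (Suc j))" using t by (simp add: ba algebra_simps power2_eq_square)
    also have "... \<le> 2 * (b j * b (Suc j))" using bp t by (intro mult_left_mono mult_right_mono) (auto simp: less_imp_le)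
    finally show ?thesis .
  qed
  have "(b (Suc j))\<^sup>2 = (a (Suc j))\<^sup>2 + (2 * a (Suc j) * \<tau> + \<tau>\<^sup>2)" by (simp add: ba power2_sum)
  also have "... \<le> b j * b (Suc (Suc j)) + (T + 1) / M * b j * b (Suc j) + b j * b (Suc j) + 2 * (b j * b (Suc j))"
    using ra p1 p2 p3 p4 by linarith
  also have "... = b j * b (Suc (Suc j)) + ((T + 1) / M + 3) * b j * b (Suc j)"
    by (simp add: algebra_simps)
  finally show ?thesis .
qed

lemma energy0_hellinger:
  "energy 0 \<le> 4 * hel_sq \<sigma> \<pi> \<rho>"
proof -
  note hel = hellinger_mixture(3)[OF A.mixture_axioms B.mixture_axioms]
  let ?s = "\<lambda>x. (sqrt (mom \<pi> \<sigma> 0 x) - sqrt (mom \<rho> \<sigma> 0 x))\<^sup>2"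
  have pw: "(d 0 x)\<^sup>2 / f x \<le> 2 * ?s x" for x
  proof -
    define p q where "p = sqrt (mom \<pi> \<sigma> 0 x)" and "q = sqrt (mom \<rho> \<sigma> 0 x)"
    have pq: "mom \<pi> \<sigma> 0 x = p\<^sup>2" "mom \<rho> \<sigma> 0 x = q\<^sup>2" using A.mom0_pos[of x] B.mom0_pos[of x] by (auto simp: p_def q_def)
    have "(d 0 x)\<^sup>2 = (p - q)\<^sup>2 * (p + q)\<^sup>2" unfolding d_def pq by (simp add: power2_eq_square algebra_simps)
    also have "... \<le> (p - q)\<^sup>2 * (2 * (p\<^sup>2 + q\<^sup>2))"
      using two_mult_le_squares[of p q] by (intro mult_left_mono) (auto simp: power2_sum)
    finally have "(d 0 x)\<^sup>2 \<le> (2 * (p - q)\<^sup>2) * f x" by (simp add: tot_def pq distrib_left mult_ac)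
    then show ?thesis using f_pos[of x] by (simp add: pos_divide_le_eq p_def q_def)
  qed
  have "energy 0 \<le> (\<integral>x. 2 * ?s x \<partial>lborel)"
    unfolding energy_def by (rule integral_mono[OF energy_integrable _ pw]) (use hel in simp)
  then show ?thesis by (simp add: hellinger_sq_def gauss_mixture_mom)
qed

text \<open>With densities \<open>p\<close>, \<open>q\<close> and posterior means \<open>r\<close>, \<open>s\<close> one has \<open>(r - s) * (p + q) = 2 * d 1 - d 0 * (r + s)\<close>.\<close>

lemma post_diff_le_energy:
  "(\<integral>x. (post \<pi> \<sigma> 1 x - post \<rho> \<sigma> 1 x)\<^sup>2 * mom \<rho> \<sigma> 0 x \<partial>lborel) \<le> 8 * energy 1 + 8 * M\<^sup>2 * energy 0"
proof -
  have pw: "(post \<pi> \<sigma> 1 x - post \<rho> \<sigma> 1 x)\<^sup>2 * mom \<rho> \<sigma> 0 x \<le> 8 * ((d 1 x)\<^sup>2 / f x) + 8 * M\<^sup>2 * ((d 0 x)\<^sup>2 / f x)" for x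
  proof -
    define p q where "p = mom \<pi> \<sigma> 0 x" and "q = mom \<rho> \<sigma> 0 x"
    have pq: "0 < p" "0 < q" using A.mom0_pos[of x] B.mom0_pos[of x] by (auto simp: p_def q_def)
    define r s where "r = post \<pi> \<sigma> 1 x" and "s = post \<rho> \<sigma> 1 x"
    have rs: "mom \<pi> \<sigma> 1 x = r * p" "mom \<rho> \<sigma> 1 x = s * q" using pq by (auto simp: r_def s_def post_def p_def q_def)
    have bd: "\<bar>r + s\<bar> \<le> 2 * M" using A.post_bound[of 1 x] B.post_bound[of 1 x] by (simp add: r_def s_def)
    have fe: "f x = p + q" by (simp add: tot_def p_def q_def)
    have "(r - s) * (p + q) = 2 * d 1 x - d 0 x * (r + s)"
      unfolding d_def rs p_def[symmetric] q_def[symmetric] by (simp add: algebra_simps)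
    then have e: "(r - s)\<^sup>2 * (f x)\<^sup>2 = (2 * d 1 x - d 0 x * (r + s))\<^sup>2" unfolding fe by (metis power_mult_distrib)
    have "(2 * d 1 x - d 0 x * (r + s))\<^sup>2 \<le> 2 * (2 * d 1 x)\<^sup>2 + 2 * (d 0 x * (r + s))\<^sup>2"
      using two_mult_le_squares[of "2 * d 1 x" "- (d 0 x * (r + s))"] by (simp add: power2_diff)
    also have "(d 0 x * (r + s))\<^sup>2 \<le> (d 0 x)\<^sup>2 * (2 * M)\<^sup>2"
    proof -
      have "\<bar>r + s\<bar>\<^sup>2 \<le> (2 * M)\<^sup>2" using bd by (intro power_mono) auto
      then show ?thesis unfolding power_mult_distrib[of "d 0 x"] by (intro mult_left_mono) auto
    qed
    finally have ub: "(r - s)\<^sup>2 * (f x)\<^sup>2 \<le> 8 * (d 1 x)\<^sup>2 + 8 * M\<^sup>2 * (d 0 x)\<^sup>2"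
      unfolding e by (simp add: power_mult_distrib mult_ac)
    have "(r - s)\<^sup>2 * q \<le> (r - s)\<^sup>2 * f x" using pq by (intro mult_left_mono) (auto simp: fe)
    also have "... = (r - s)\<^sup>2 * (f x)\<^sup>2 / f x" using f_pos[of x] by (simp add: power2_eq_square)
    also have "... \<le> (8 * (d 1 x)\<^sup>2 + 8 * M\<^sup>2 * (d 0 x)\<^sup>2) / f x" using f_pos[of x] by (intro divide_right_mono ub) auto
    finally show ?thesis by (simp add: add_divide_distrib r_def s_def q_def)
  qed
  have "(\<integral>x. (post \<pi> \<sigma> 1 x - post \<rho> \<sigma> 1 x)\<^sup>2 * mom \<rho> \<sigma> 0 x \<partial>lborel)
     \<le> (\<integral>x. 8 * ((d 1 x)\<^sup>2 / f x) + 8 * M\<^sup>2 * ((d 0 x)\<^sup>2 / f x) \<partial>lborel)"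
  proof (rule integral_mono')
    show "integrable lborel (\<lambda>x. 8 * ((d 1 x)\<^sup>2 / f x) + 8 * M\<^sup>2 * ((d 0 x)\<^sup>2 / f x))"
      by (intro Bochner_Integration.integrable_add integrable_mult_right energy_integrable)
  qed (use pw f_pos in \<open>auto simp: less_imp_le\<close>)
  also have "... = 8 * energy 1 + 8 * M\<^sup>2 * energy 0"
    unfolding energy_def
    by (subst Bochner_Integration.integral_add) (auto intro: energy_integrable integrable_mult_right simp del: times_divide_eq_right)
  finally show ?thesis .
qed

end

text \<open>The roots of the energies, divided by \<open>M ^ j\<close>, are bounded and nearly log-convex, and the shift by \<open>\<tau>\<close> keeps
  the first of them at least of order \<open>1 / n\<close>. Over order \<open>ln n\<close> indices this leaves no room for a first ratio above order \<open>(ln n)\<^sup>2\<close>: one factor is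
  the number of indices, the other the truncation level \<open>T = ln n\<close>. Squaring gives the fourth power.\<close>

theorem post_diff_hellinger:
  assumes M: "0 < M" and K: "0 < K"
  shows "\<exists>c\<ge>0. \<forall>n\<ge>2::nat. \<forall>\<pi> \<rho> \<sigma>. \<pi> \<in> priors M \<longrightarrow> \<rho> \<in> priors M \<longrightarrow> 0 < \<sigma> \<longrightarrow> \<sigma> \<le> K \<longrightarrow>
     (\<integral>x. (post \<pi> \<sigma> 1 x - post \<rho> \<sigma> 1 x)\<^sup>2 * mom \<rho> \<sigma> 0 x \<partial>lborel)
       \<le> c * (ln (real n)) ^ 4 * (hel_sq \<sigma> \<pi> \<rho> + 1 / real n)"
proof -
  define cT where "cT = sqrt (8 * (exp (3\<^sup>2 * K\<^sup>2 / 2) * cosh (3 * M)))"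
  have cT1: "1 \<le> cT"
  proof -
    have "1 * 1 \<le> exp (3\<^sup>2 * K\<^sup>2 / 2) * cosh (3 * M)"
      by (intro mult_mono) (auto simp: cosh_real_ge_1)
    then show ?thesis unfolding cT_def by simp
  qed
  define s0 where "s0 = 5 * (3 / M + 6) + 12"
  have s0: "0 \<le> s0" using M by (simp add: s0_def)
  define c where "c = 64 * M\<^sup>2 * s0\<^sup>2 * (1 + cT\<^sup>2) + 512 * M\<^sup>2"
  show ?thesis
  proof (intro exI[of _ c] conjI allI impI)
    show "0 \<le> c" by (simp add: c_def)
    fix n :: nat and \<pi> \<rho> \<sigma> assume n: "2 \<le> n" and p: "\<pi> \<in> priors M" "\<rho> \<in> priors M" and \<sigma>: "0 < \<sigma>" "\<sigma> \<le> K"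
    interpret A: mixture M \<sigma> \<pi> by (rule mixtureI[OF M \<sigma>(1) p(1)])
    interpret B: mixture M \<sigma> \<rho> by (rule mixtureI[OF M \<sigma>(1) p(2)])
    interpret two_mixtures M \<sigma> \<pi> \<rho> ..
    define H where "H = hel_sq \<sigma> \<pi> \<rho>"
    have H0: "0 \<le> H" unfolding H_def by (rule hellinger_mixture(1)[OF A.mixture_axioms B.mixture_axioms])
    define l where "l = ln (real n)"
    have l: "1 / 2 \<le> l" unfolding l_def by (rule ln_ge_half[OF n])
    have n0: "2 \<le> real n" "exp l = real n" using n by (auto simp: l_def)
    define \<tau> where "\<tau> = cT / real n"
    have t0: "0 < \<tau>" using cT1 n0 by (simp add: \<tau>_def)
    have tb: "8 * (exp (3\<^sup>2 * \<sigma>\<^sup>2 / 2) * cosh (3 * M)) * exp (- (2 * l)) \<le> \<tau>\<^sup>2"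
    proof -
      have "\<sigma>\<^sup>2 \<le> K\<^sup>2" using \<sigma> by (intro power_mono) auto
      then have "8 * (exp (3\<^sup>2 * \<sigma>\<^sup>2 / 2) * cosh (3 * M)) \<le> cT\<^sup>2" unfolding cT_def by simp
      then have "8 * (exp (3\<^sup>2 * \<sigma>\<^sup>2 / 2) * cosh (3 * M)) * exp (- (2 * l)) \<le> cT\<^sup>2 * exp (- (2 * l))" by (intro mult_right_mono) auto
      also have "... = \<tau>\<^sup>2"
      proof -
        have "exp (2 * l) = (real n)\<^sup>2" by (simp only: exp_double n0(2))
        then show ?thesis by (simp add: exp_minus divide_inverse \<tau>_def power_mult_distrib power_inverse)
      qed
      finally show ?thesis .
    qed
    have l0: "0 \<le> l" using l by simp
    define b where "b j = sqrt (energy j) / M ^ j + \<tau>" for j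
    define S where "S = (l + 1) / M + 3"
    \<comment> \<open>\<open>b m\<close> is bounded by \<open>\<tau> * (2 * n + 1)\<close>, which is below \<open>n ^ 3\<close> times \<open>b 0\<close>.\<close>
    define m where "m = nat \<lceil>3 * l\<rceil>"
    have m0: "0 < m" unfolding m_def using l by simp
    have m1: "3 * l \<le> real m" "real m \<le> 3 * l + 1" unfolding m_def using l by linarith+
    have bt: "\<tau> \<le> b j" for j using M by (simp add: b_def energy_nonneg)
    have top: "b m \<le> exp (real m) * b 0"
    proof -
      have "sqrt (energy m) \<le> sqrt (4 * (M ^ m)\<^sup>2)"
        using energy_le[of m] zero_le_power2[of "M ^ m"] unfolding power_even_eq by (intro real_sqrt_le_mono) linarith
      also have "... = 2 * M ^ m" using M by (simp add: real_sqrt_mult)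
      finally have "sqrt (energy m) / M ^ m \<le> 2" using M by (simp add: pos_divide_le_eq)
      then have "b m \<le> 2 + \<tau>" by (simp add: b_def)
      also have "2 \<le> \<tau> * (2 * real n)"
        using cT1 n0 by (simp add: \<tau>_def)
      finally have "b m \<le> \<tau> * (2 * real n + 1)" by (simp add: distrib_left)
      also have "... \<le> \<tau> * exp (real m)"
      proof (rule mult_left_mono)
        have "2 * real n + 1 \<le> 4 * real n" using n0 by simp
        also have "... \<le> real n ^ 3"
        proof -
          have "2 * 2 \<le> real n * real n" using n0 by (intro mult_mono) auto
          then have "4 * real n \<le> (real n * real n) * real n" using n0 by (intro mult_right_mono) auto
          then show ?thesis by (simp add: power3_eq_cube)
        qed
        also have "... = exp (3 * l)" using n0(2) by (metis exp_of_nat_mult of_nat_numeral)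
        also have "... \<le> exp (real m)" using m1 by simp
        finally show "2 * real n + 1 \<le> exp (real m)" .
      qed (use t0 in simp)
      also have "... \<le> exp (real m) * b 0" using bt[of 0] by (simp add: mult.commute)
      finally show ?thesis .
    qed
    have S0: "0 \<le> S" using l M by (simp add: S_def)
    have "b 1 \<le> (S * real m + exp 1) * b 0"
    proof (rule log_convex_ratio[OF _ S0 _ top m0])
      show "0 < b j" for j using bt[of j] t0 by linarith
      show "(b (Suc j))\<^sup>2 \<le> b j * b (Suc (Suc j)) + S * b j * b (Suc j)" for j
        unfolding b_def S_def by (rule energy_recursion[OF l0 t0 tb])
    qed
    also have "... \<le> (s0 * l\<^sup>2) * b 0"
    proof (rule mult_right_mono)
      have "1 / 2 * (1 / 2) \<le> l * l" using l by (intro mult_mono) auto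
      then have l2: "3 \<le> 12 * l\<^sup>2" by (simp add: power2_eq_square)
      have "S \<le> (3 * l) / M + 6 * l" unfolding S_def using l M by (intro add_mono divide_right_mono) auto
      also have "... = (3 / M + 6) * l" by (simp add: algebra_simps)
      finally have "S * real m \<le> ((3 / M + 6) * l) * (5 * l)" using m1 l S0 M by (intro mult_mono) auto
      then have "S * real m + exp 1 \<le> ((3 / M + 6) * l) * (5 * l) + 3" using exp_le by linarith
      also have "... \<le> ((3 / M + 6) * l) * (5 * l) + 12 * l\<^sup>2" using l2 by linarith
      also have "... = s0 * l\<^sup>2" by (simp add: s0_def power2_eq_square algebra_simps)
      finally show "S * real m + exp 1 \<le> s0 * l\<^sup>2" .
      show "0 \<le> b 0" using bt[of 0] t0 by linarith
    qed
    finally have b1: "b 1 \<le> s0 * l\<^sup>2 * b 0" .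
    have "sqrt (energy 1) \<le> M * b 1" using M t0 by (simp add: b_def distrib_left)
    also have "... \<le> M * (s0 * l\<^sup>2 * b 0)" using M b1 by (intro mult_left_mono) auto
    finally have "(sqrt (energy 1))\<^sup>2 \<le> (M * (s0 * l\<^sup>2 * b 0))\<^sup>2" using energy_nonneg[of 1] by (intro power_mono) auto
    then have e1: "energy 1 \<le> M\<^sup>2 * s0\<^sup>2 * l ^ 4 * (b 0)\<^sup>2" by (simp add: energy_nonneg power_mult_distrib mult_ac)
    have b0: "(b 0)\<^sup>2 \<le> 8 * (1 + cT\<^sup>2) * (H + 1 / real n)"
    proof -
      have "(b 0)\<^sup>2 \<le> 2 * (sqrt (energy 0))\<^sup>2 + 2 * \<tau>\<^sup>2"
        using two_mult_le_squares[of "sqrt (energy 0)" \<tau>] by (simp add: b_def power2_sum)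
      also have "... \<le> 8 * H + 2 * \<tau>\<^sup>2" using energy0_hellinger by (simp add: energy_nonneg H_def)
      also have "\<tau>\<^sup>2 \<le> cT\<^sup>2 * (1 / real n)"
      proof -
        have "real n \<le> (real n)\<^sup>2" using n0 by (simp add: power2_eq_square)
        then have "cT\<^sup>2 / (real n)\<^sup>2 \<le> cT\<^sup>2 / real n" using n0 by (intro divide_left_mono) auto
        then show ?thesis by (simp add: \<tau>_def power_divide)
      qed
      finally have "(b 0)\<^sup>2 \<le> 8 * H + 2 * (cT\<^sup>2 * (1 / real n))" by simp
      moreover have "0 \<le> cT\<^sup>2 * H" "0 \<le> cT\<^sup>2 * (1 / real n)" "0 \<le> 1 / real n" using H0 by auto
      moreover have "8 * (1 + cT\<^sup>2) * (H + 1 / real n) = 8 * H + 8 * (cT\<^sup>2 * H) + 8 * (1 / real n) + 8 * (cT\<^sup>2 * (1 / real n))"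
        by (simp add: algebra_simps)
      ultimately show ?thesis by linarith
    qed
    have l4: "1 \<le> 16 * l ^ 4"
    proof -
      have "(1 / 2) ^ 4 \<le> l ^ 4" using l by (intro power_mono) auto
      then show ?thesis by (simp add: power_divide)
    qed
    have Hn: "0 \<le> H + 1 / real n" using H0 by simp
    have "(\<integral>x. (post \<pi> \<sigma> 1 x - post \<rho> \<sigma> 1 x)\<^sup>2 * mom \<rho> \<sigma> 0 x \<partial>lborel) \<le> 8 * energy 1 + 8 * M\<^sup>2 * energy 0"
      by (rule post_diff_le_energy)
    also have "... \<le> 8 * (M\<^sup>2 * s0\<^sup>2 * l ^ 4 * (8 * (1 + cT\<^sup>2) * (H + 1 / real n))) + 8 * M\<^sup>2 * (4 * (H + 1 / real n) * (16 * l ^ 4))"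
    proof (intro add_mono mult_left_mono)
      have "M\<^sup>2 * s0\<^sup>2 * l ^ 4 * (b 0)\<^sup>2 \<le> M\<^sup>2 * s0\<^sup>2 * l ^ 4 * (8 * (1 + cT\<^sup>2) * (H + 1 / real n))"
        using b0 by (intro mult_left_mono) auto
      then show "energy 1 \<le> M\<^sup>2 * s0\<^sup>2 * l ^ 4 * (8 * (1 + cT\<^sup>2) * (H + 1 / real n))" using e1 by linarith
      have "energy 0 \<le> 4 * (H + 1 / real n) * 1" using energy0_hellinger by (simp add: H_def) (smt (verit) divide_nonneg_nonneg of_nat_0_le_iff)
      also have "... \<le> 4 * (H + 1 / real n) * (16 * l ^ 4)" using Hn l4 by (intro mult_left_mono) auto
      finally show "energy 0 \<le> 4 * (H + 1 / real n) * (16 * l ^ 4)" .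
    qed auto
    also have "... = c * l ^ 4 * (H + 1 / real n)" by (simp add: c_def algebra_simps)
    finally show "(\<integral>x. (post \<pi> \<sigma> 1 x - post \<rho> \<sigma> 1 x)\<^sup>2 * mom \<rho> \<sigma> 0 x \<partial>lborel)
       \<le> c * (ln (real n)) ^ 4 * (hel_sq \<sigma> \<pi> \<rho> + 1 / real n)"
      unfolding H_def l_def .
  qed
qed

section \<open>Products over independent units\<close>

lemma (in eb_model) unit_noisy_prior:
  assumes M: "0 < M" and k: "0 < k" and i: "i \<in> {1..n}"
  shows "noisy_prior P (\<theta> i) (\<epsilon> i) (J i) (\<sigma> i) s M K pi_star k"
proof -
  note th [measurable] = theta_measurable[OF i]
  have sg: "k < \<sigma> i" "\<sigma> i < K" using sigma_bounds[OF i] by auto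
  let ?F = "vimage_algebra (space P) (\<theta> i) borel"
  have sub: "subalgebra P ?F"
    using measurable_sets[OF th] by (auto simp: subalgebra_def sets_vimage_algebra2)
  interpret F: finite_measure_subalgebra P ?F by unfold_locales (rule sub)
  have bd: "AE \<omega> in P. \<bar>\<theta> i \<omega>\<bar> \<le> M"
  proof -
    have "AE t in distr P borel (\<theta> i). \<bar>t\<bar> \<le> M"
      unfolding theta_law[OF i] by (rule prob_measures_onD(3)[OF prior])
    then show ?thesis by (subst (asm) AE_distr_iff) auto
  qed
  have sq: "AE \<omega> in P. real_cond_exp P ?F (\<lambda>\<omega>. (\<epsilon> i j \<omega>)\<^sup>2) \<omega> = (\<sigma> i)\<^sup>2 * real (J i)" if j: "j \<in> {1..J i}" for j
  proof -
    note [measurable] = noise_measurable[OF i j]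
    have m: "real_cond_exp P ?F (\<epsilon> i j) \<in> borel_measurable P" by simp
    have "AE \<omega> in P. (\<epsilon> i j \<omega> - real_cond_exp P ?F (\<epsilon> i j) \<omega>)\<^sup>2 = (\<epsilon> i j \<omega>)\<^sup>2"
      using noise_cond_mean[OF i j] by eventually_elim simp
    then have "AE \<omega> in P. real_cond_exp P ?F (\<lambda>\<omega>. (\<epsilon> i j \<omega> - real_cond_exp P ?F (\<epsilon> i j) \<omega>)\<^sup>2) \<omega>
        = real_cond_exp P ?F (\<lambda>\<omega>. (\<epsilon> i j \<omega>)\<^sup>2) \<omega>"
      by (rule F.real_cond_exp_cong) (use m in measurable)
    then show ?thesis using noise_cond_variance[OF i j] unfolding cond_variance_def by eventually_elim simp
  qed
  show ?thesis
    by (intro noisy_prior.intro noisy_unit.intro noisy_unit_axioms.intro noisy_prior_axioms.intro mixtureI)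
      (use bd sq sg M k J_pos[OF i] prior theta_law[OF i] noise_measurable[OF i] noise_cond_indep[OF i]
        noise_cond_mean[OF i] noise_cond_subgaussian[OF i] prob_space_axioms th in auto)
qed

lemma (in eb_model) obs_independent:
  fixes g :: "nat \<Rightarrow> real \<Rightarrow> real"
  assumes g: "\<And>i. i \<in> {1..n} \<Longrightarrow> g i \<in> borel_measurable borel"
  shows "indep_vars (\<lambda>_. borel) (\<lambda>i \<omega>. g i (obs J \<theta> \<epsilon> i \<omega>)) {1..n}"
proof -
  define f where "f i p = g i (fst p + 1 / real (J i) * (\<Sum>j = 1..J i. snd p j))" for i and p :: "real \<times> (nat \<Rightarrow> real)"
  have "indep_vars (\<lambda>_. borel) (\<lambda>i \<omega>. f i (\<theta> i \<omega>, \<lambda>j\<in>{1..J i}. \<epsilon> i j \<omega>)) {1..n}"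
  proof (rule indep_vars_compose2[OF units_independent])
    fix i assume i: "i \<in> {1..n}"
    note [measurable] = g[OF i]
    have "(\<lambda>p. snd p j) \<in> borel_measurable (borel \<Otimes>\<^sub>M (\<Pi>\<^sub>M j\<in>{1..J i}. borel) :: (real \<times> (nat \<Rightarrow> real)) measure)" if "j \<in> {1..J i}" for j
      by (rule measurable_compose[OF measurable_snd measurable_component_singleton[OF that]])
    then have [measurable]: "(\<lambda>p. \<Sum>j = 1..J i. snd p j) \<in> borel_measurable (borel \<Otimes>\<^sub>M (\<Pi>\<^sub>M j\<in>{1..J i}. borel) :: (real \<times> (nat \<Rightarrow> real)) measure)"
      by (intro borel_measurable_sum)
    show "f i \<in> borel \<Otimes>\<^sub>M (\<Pi>\<^sub>M j\<in>{1..J i}. borel) \<rightarrow>\<^sub>M borel"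
      unfolding f_def[abs_def] by measurable
  qed
  also have "(\<lambda>i \<omega>. f i (\<theta> i \<omega>, \<lambda>j\<in>{1..J i}. \<epsilon> i j \<omega>)) = (\<lambda>i \<omega>. g i (obs J \<theta> \<epsilon> i \<omega>))"
    by (simp add: f_def obs_def fun_eq_iff)
  finally show ?thesis .
qed

lemma (in eb_model) prod_obs_expectation:
  fixes g :: "nat \<Rightarrow> real \<Rightarrow> real"
  assumes g: "\<And>i. i \<in> {1..n} \<Longrightarrow> g i \<in> borel_measurable borel"
    and nn: "\<And>i x. i \<in> {1..n} \<Longrightarrow> 0 \<le> g i x"
    and int: "\<And>i. i \<in> {1..n} \<Longrightarrow> integrable P (\<lambda>\<omega>. g i (obs J \<theta> \<epsilon> i \<omega>))"
    and le: "\<And>i. i \<in> {1..n} \<Longrightarrow> (\<integral>\<omega>. g i (obs J \<theta> \<epsilon> i \<omega>) \<partial>P) \<le> exp (a i)"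
  shows "integrable P (\<lambda>\<omega>. \<Prod>i\<in>{1..n}. g i (obs J \<theta> \<epsilon> i \<omega>))"
    and "(\<integral>\<omega>. (\<Prod>i\<in>{1..n}. g i (obs J \<theta> \<epsilon> i \<omega>)) \<partial>P) \<le> exp (\<Sum>i\<in>{1..n}. a i)"
proof -
  note ind = obs_independent[OF g]
  show "integrable P (\<lambda>\<omega>. \<Prod>i\<in>{1..n}. g i (obs J \<theta> \<epsilon> i \<omega>))"
    by (rule indep_vars_integrable[OF _ ind int]) auto
  have "(\<integral>\<omega>. (\<Prod>i\<in>{1..n}. g i (obs J \<theta> \<epsilon> i \<omega>)) \<partial>P) = (\<Prod>i\<in>{1..n}. \<integral>\<omega>. g i (obs J \<theta> \<epsilon> i \<omega>) \<partial>P)"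
    by (rule indep_vars_lebesgue_integral[OF _ ind int]) auto
  also have "... \<le> (\<Prod>i\<in>{1..n}. exp (a i))"
    using le nn by (intro prod_mono) (auto intro!: integral_nonneg_AE)
  also have "... = exp (\<Sum>i\<in>{1..n}. a i)" by (rule exp_sum[symmetric]) simp
  finally show "(\<integral>\<omega>. (\<Prod>i\<in>{1..n}. g i (obs J \<theta> \<epsilon> i \<omega>)) \<partial>P) \<le> exp (\<Sum>i\<in>{1..n}. a i)" .
qed

lemma (in two_mixtures) hellinger_close:
  assumes N: "0 < N" and close: "\<And>x. \<bar>x\<bar> \<le> T \<Longrightarrow> \<bar>d 0 x\<bar> \<le> mom \<rho> \<sigma> 0 x / N"
  shows "hel_sq \<sigma> \<pi> \<rho> \<le> 1 / 2 * (1 / N + 4 * (exp (\<sigma>\<^sup>2 / 2) * cosh M) * exp (- T))"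
proof -
  let ?p = "mom \<pi> \<sigma> 0" and ?q = "mom \<rho> \<sigma> 0"
  have pw: "(sqrt (?p x) - sqrt (?q x))\<^sup>2 \<le> ?q x / N + 2 * exp (- T) * (cosh (1 * x) * f x)" for x
  proof -
    have pos: "0 < ?p x" "0 < ?q x" using A.mom0_pos[of x] B.mom0_pos[of x] by auto
    have n1: "0 \<le> ?q x / N" using pos N by simp
    have n2: "0 \<le> 2 * exp (- T) * (cosh (1 * x) * f x)" using f_pos[of x] by (simp add: less_imp_le)
    show ?thesis
    proof (cases "\<bar>x\<bar> \<le> T")
      case True
      define a b where "a = sqrt (?p x)" and "b = sqrt (?q x)"
      have ab: "0 \<le> a" "0 \<le> b" "?p x = a\<^sup>2" "?q x = b\<^sup>2" using pos by (auto simp: a_def b_def)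
      have "(a - b)\<^sup>2 = \<bar>a - b\<bar> * \<bar>a - b\<bar>" by (simp add: power2_eq_square)
      also have "... \<le> \<bar>a - b\<bar> * (a + b)" using ab by (intro mult_left_mono) auto
      also have "... = \<bar>(a - b) * (a + b)\<bar>" using ab by (simp add: abs_mult)
      also have "(a - b) * (a + b) = d 0 x" by (simp add: d_def ab power2_eq_square algebra_simps)
      finally have "(a - b)\<^sup>2 \<le> ?q x / N" using close[OF True] by linarith
      then show ?thesis using n2 unfolding a_def b_def by linarith
    next
      case False
      have "(sqrt (?p x) - sqrt (?q x))\<^sup>2 = ?p x + ?q x - 2 * sqrt (?p x * ?q x)"
        by (rule sqrt_diff_sq) (use pos in auto)
      also have "... \<le> 1 * f x" using pos by (simp add: tot_def)
      also have "... \<le> (2 * exp (- T) * cosh (1 * x)) * f x"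
      proof (rule mult_right_mono)
        have "1 \<le> exp (- T + \<bar>x\<bar>)" using False by simp
        also have "... = exp (- T) * exp \<bar>x\<bar>" by (simp only: exp_add)
        also have "exp \<bar>x\<bar> \<le> 2 * cosh (1 * x)" by (cases "0 \<le> x") (simp_all add: cosh_field_def)
        finally show "1 \<le> 2 * exp (- T) * cosh (1 * x)" by simp
      qed (use f_pos[of x] in simp)
      finally show ?thesis using n1 by (simp add: mult.assoc)
    qed
  qed
  have iq: "integrable lborel (\<lambda>x. ?q x / N)" using B.mom0_integrable by simp
  have ic: "integrable lborel (\<lambda>x. 2 * exp (- T) * (cosh (1 * x) * f x))"
    by (intro integrable_mult_right cosh_f_integrable)
  have "(\<integral>x. (sqrt (?p x) - sqrt (?q x))\<^sup>2 \<partial>lborel) \<le> (\<integral>x. ?q x / N + 2 * exp (- T) * (cosh (1 * x) * f x) \<partial>lborel)"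
    by (rule integral_mono[OF hellinger_mixture(3)[OF A.mixture_axioms B.mixture_axioms] Bochner_Integration.integrable_add[OF iq ic] pw])
  also have "... = 1 / N + 2 * exp (- T) * (\<integral>x. cosh (1 * x) * f x \<partial>lborel)"
    unfolding Bochner_Integration.integral_add[OF iq ic] integral_mult_right_zero by (simp add: B.mom0_integral)
  also have "... \<le> 1 / N + 2 * exp (- T) * (2 * (exp (1\<^sup>2 * \<sigma>\<^sup>2 / 2) * cosh (1 * M)))"
    by (intro add_left_mono mult_left_mono cosh_f_integral_le) auto
  finally show ?thesis by (simp add: hellinger_sq_def gauss_mixture_mom mult_ac)
qed

lemma square_add_le: "(a + b)\<^sup>2 \<le> 2 * a\<^sup>2 + 2 * b\<^sup>2" for a b :: real
  using two_mult_le_squares[of a b] by (simp add: power2_sum)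

lemma hellinger_triangle:
  assumes "mixture M \<sigma> \<pi>" "mixture M \<sigma> \<rho>" "mixture M \<sigma> \<mu>"
  shows "hel_sq \<sigma> \<pi> \<mu>
     \<le> 2 * hel_sq \<sigma> \<pi> \<rho> + 2 * hel_sq \<sigma> \<rho> \<mu>"
proof -
  let ?a = "\<lambda>x. sqrt (mom \<pi> \<sigma> 0 x)" and ?b = "\<lambda>x. sqrt (mom \<rho> \<sigma> 0 x)" and ?c = "\<lambda>x. sqrt (mom \<mu> \<sigma> 0 x)"
  have pw: "(?a x - ?c x)\<^sup>2 \<le> 2 * (?a x - ?b x)\<^sup>2 + 2 * (?b x - ?c x)\<^sup>2" for x
    using square_add_le[of "?a x - ?b x" "?b x - ?c x"] by simp
  note i = hellinger_mixture(3)[OF assms(1,2)] hellinger_mixture(3)[OF assms(2,3)] hellinger_mixture(3)[OF assms(1,3)]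
  have "(\<integral>x. (?a x - ?c x)\<^sup>2 \<partial>lborel) \<le> (\<integral>x. 2 * (?a x - ?b x)\<^sup>2 + 2 * (?b x - ?c x)\<^sup>2 \<partial>lborel)"
    by (rule integral_mono[OF i(3) _ pw]) (use i in auto)
  also have "... = 2 * (\<integral>x. (?a x - ?b x)\<^sup>2 \<partial>lborel) + 2 * (\<integral>x. (?b x - ?c x)\<^sup>2 \<partial>lborel)" using i by simp
  finally show ?thesis by (simp add: hellinger_sq_def gauss_mixture_mom)
qed

text \<open>A union bound without exceptional events: if all \<open>Y \<mu>\<close> have mean at most 1, then so does the last term,
  whichever \<open>\<rho>\<close> the data select.\<close>

lemma ln_le_ln_card_plus_mean:
  fixes Y :: "'b \<Rightarrow> real"
  assumes "finite N" "\<rho> \<in> N" "\<And>\<mu>. \<mu> \<in> N \<Longrightarrow> 0 < Y \<mu>"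
  shows "ln (Y \<rho>) \<le> ln (real (card N)) + (\<Sum>\<mu>\<in>N. Y \<mu>) / real (card N)"
proof -
  have c: "0 < real (card N)" using assms by (auto simp: card_gt_0_iff)
  have Y: "0 < Y \<rho>" using assms by auto
  have "ln (Y \<rho> / real (card N)) \<le> Y \<rho> / real (card N) - 1" by (rule ln_le_minus_one) (use c Y in simp)
  also have "... \<le> (\<Sum>\<mu>\<in>N. Y \<mu>) / real (card N)"
  proof -
    have "Y \<rho> \<le> (\<Sum>\<mu>\<in>N. Y \<mu>)" by (rule member_le_sum) (use assms in \<open>auto simp: less_imp_le\<close>)
    then have "Y \<rho> / real (card N) \<le> (\<Sum>\<mu>\<in>N. Y \<mu>) / real (card N)" using c by (intro divide_right_mono) auto
    then show ?thesis by simp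
  qed
  finally show ?thesis using c Y by (simp add: ln_div)
qed

text \<open>The optimal weight is \<open>sqrt (v / a)\<close>; a small shift of both roots keeps it positive and finite.\<close>

lemma sqrt_le_of_weighted:
  assumes a: "0 \<le> a" and v: "0 \<le> v" and r: "\<And>t. 0 < t \<Longrightarrow> r \<le> (1 + t) * a + (1 + 1 / t) * v"
  shows "sqrt r \<le> sqrt a + sqrt v"
proof (rule field_le_epsilon)
  fix e :: real assume e: "0 < e"
  \<comment> \<open>With \<open>t = B / A\<close> the right-hand side becomes \<open>(A + B)\<^sup>2\<close>.\<close>
  define A B where "A = sqrt a + e / 2" and "B = sqrt v + e / 2"
  have AB: "0 < A" "0 < B" using a v e by (auto simp: A_def B_def add_nonneg_pos)
  have aA: "a \<le> A\<^sup>2"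
  proof -
    have "(sqrt a)\<^sup>2 \<le> A\<^sup>2" by (rule power_mono) (use a e in \<open>auto simp: A_def\<close>)
    then show ?thesis using a by simp
  qed
  have vB: "v \<le> B\<^sup>2"
  proof -
    have "(sqrt v)\<^sup>2 \<le> B\<^sup>2" by (rule power_mono) (use v e in \<open>auto simp: B_def\<close>)
    then show ?thesis using v by simp
  qed
  have "r \<le> (1 + B / A) * a + (1 + 1 / (B / A)) * v" by (rule r) (use AB in simp)
  also have "... \<le> (1 + B / A) * A\<^sup>2 + (1 + 1 / (B / A)) * B\<^sup>2"
    using AB aA vB by (intro add_mono mult_left_mono) (auto intro: add_nonneg_nonneg)
  also have "... = (A + B)\<^sup>2" using AB by (simp add: field_simps power2_eq_square)
  finally have "sqrt r \<le> sqrt ((A + B)\<^sup>2)" by (rule real_sqrt_le_mono)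
  then show "sqrt r \<le> sqrt a + sqrt v + e" using AB by (simp add: A_def B_def)
qed

section \<open>Hellinger risk\<close>

text \<open>The constants and the net provided so far enter as parameters. The final constants
  are then functions of these parameters and visibly do not involve \<open>n\<close>, the \<open>J i\<close> or the law of the data.\<close>

locale eb_bounds = eb_model P M k K s pi_star n \<sigma> J \<theta> \<epsilon>
  for P :: "'a measure" and M k K s pi_star n \<sigma> J \<theta> \<epsilon> +
  fixes q C B cN cP :: real and N :: "real measure set" and pihat :: "(nat \<Rightarrow> real) \<Rightarrow> real measure"
  assumes M_pos: "0 < M" and k_pos: "0 < k" and q_nonneg: "0 \<le> q" and n_ge: "2 \<le> n"
    and C_nonneg: "0 \<le> C" and B_ge: "1 \<le> B" and cN_nonneg: "0 \<le> cN" and cP_nonneg: "0 \<le> cP"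
    and root_smooth: "\<And>\<rho> \<tau>. \<rho> \<in> priors M \<Longrightarrow> k < \<tau> \<Longrightarrow>
      smooth8 C B (\<lambda>x. root_ratio \<rho> pi_star \<tau> x + (- 1))"
    and diff_smooth: "\<And>\<rho> \<tau>. \<rho> \<in> priors M \<Longrightarrow> k < \<tau> \<Longrightarrow>
      smooth8 C B (\<lambda>x. (post \<rho> \<tau> 1 x - post pi_star \<tau> 1 x)\<^sup>2)"
    and post_smooth: "\<And>\<tau>. k < \<tau> \<Longrightarrow> smooth8 C B (post pi_star \<tau> 1)"
      "\<And>\<tau>. k < \<tau> \<Longrightarrow> smooth8 C B (\<lambda>x. (post pi_star \<tau> 1 x)\<^sup>2)"
    and N_finite: "finite N" and N_sub: "N \<subseteq> priors M" and N_card: "ln (real (card N)) \<le> cN * (ln (real n))\<^sup>2"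
    and N_net: "\<And>\<pi>. \<pi> \<in> priors M \<Longrightarrow> \<exists>\<rho>\<in>N. \<forall>\<tau> x i. k < \<tau> \<longrightarrow> \<bar>x\<bar> \<le> 2 * ln (real n) \<longrightarrow> i \<le> 1 \<longrightarrow>
       \<bar>mom \<pi> \<tau> i x - mom \<rho> \<tau> i x\<bar> \<le> mom \<rho> \<tau> 0 x / real n"
    and post_hel: "\<And>\<rho> \<tau>. \<rho> \<in> priors M \<Longrightarrow> 0 < \<tau> \<Longrightarrow> \<tau> \<le> K \<Longrightarrow>
      (\<integral>x. (post \<rho> \<tau> 1 x - post pi_star \<tau> 1 x)\<^sup>2 * mom pi_star \<tau> 0 x \<partial>lborel)
       \<le> cP * (ln (real n)) ^ 4 * (hel_sq \<tau> \<rho> pi_star + 1 / real n)"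
    and estimator: "prior_estimator M n pihat"
    and likelihood: "approx_npmle P q pi_star n \<sigma> (sample n J \<theta> \<epsilon>) pihat"
begin

abbreviation "X \<equiv> obs J \<theta> \<epsilon>"
abbreviation "ph \<omega> \<equiv> pihat (sample n J \<theta> \<epsilon> \<omega>)"
abbreviation "I \<equiv> {1..n}"
abbreviation "V \<equiv> (\<Sum>i\<in>I. 1 / real (J i))"
abbreviation "H i \<rho> \<equiv> hel_sq (\<sigma> i) \<rho> pi_star"
abbreviation "l \<equiv> ln (real n)"

definition "cHel = (skew_const s k)\<^sup>2 + B * lindeberg_const s M K C"
definition "cDiff = (skew_const s k)\<^sup>2 * M\<^sup>2 + B * lindeberg_const s M K C"
definition "cRisk = skew_const s k * M + sqrt (3 * (M + 1)\<^sup>2 * B * lindeberg_const s M K C)"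
definition "cTail = 2 * growth_const s M 1"
definition "cClose = 1 / 2 * (1 + 4 * (exp (K\<^sup>2 / 2) * cosh M))"

lemma n_pos: "0 < real n" "1 \<le> real n" "2 \<le> real n" using n_ge by auto

lemma l_ge: "1 / 2 \<le> l" by (rule ln_ge_half[OF n_ge])

lemma V_nonneg: "0 \<le> V" by (rule sum_nonneg) auto

lemma unit: "i \<in> I \<Longrightarrow> noisy_prior P (\<theta> i) (\<epsilon> i) (J i) (\<sigma> i) s M K pi_star k"
  by (rule unit_noisy_prior[OF M_pos k_pos])

lemma X_partial: "X i = (\<lambda>\<omega>. noisy_unit.partial (\<theta> i) (\<epsilon> i) (J i) (J i) \<omega>)" if i: "i \<in> I"
proof -
  interpret U: noisy_prior P "\<theta> i" "\<epsilon> i" "J i" "\<sigma> i" s M K pi_star k by (rule unit[OF i])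
  show ?thesis by (simp add: fun_eq_iff obs_def U.partial_def sum_divide_distrib)
qed

lemma X_measurable: "i \<in> I \<Longrightarrow> X i \<in> borel_measurable P"
proof -
  assume i: "i \<in> I"
  interpret U: noisy_prior P "\<theta> i" "\<epsilon> i" "J i" "\<sigma> i" s M K pi_star k by (rule unit[OF i])
  show "X i \<in> borel_measurable P" unfolding X_partial[OF i] using U.obsv_measurable by simp
qed

lemma sigma_facts: "i \<in> I \<Longrightarrow> k < \<sigma> i" "i \<in> I \<Longrightarrow> 0 < \<sigma> i" "i \<in> I \<Longrightarrow> \<sigma> i \<le> K"
  using sigma_bounds k_pos by force+

lemma mix: "i \<in> I \<Longrightarrow> \<rho> \<in> priors M \<Longrightarrow> mixture M (\<sigma> i) \<rho>"
  by (rule mixtureI[OF M_pos sigma_facts(2)])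

lemma ph_prior: "ph \<omega> \<in> priors M"
proof -
  have "sample n J \<theta> \<epsilon> \<omega> \<in> space (\<Pi>\<^sub>M i\<in>{1..n}. (borel :: real measure))"
    by (simp add: sample_def space_PiM)
  then show ?thesis using estimator by (simp add: prior_estimator_def)
qed

lemma consts_nonneg: "0 \<le> lindeberg_const s M K C" "0 \<le> cHel" "0 \<le> cDiff" "0 \<le> cRisk" "0 \<le> cTail" "0 \<le> cClose"
proof -
  have g: "0 \<le> growth_const s M C" "0 \<le> gauss_rem_const K C" "0 \<le> third_const s"
    by (auto simp: growth_const_def gauss_rem_const_def third_const_def)
  then have "0 \<le> step_const s M K C" unfolding step_const_def by (intro mult_nonneg_nonneg add_nonneg_nonneg) auto
  then show L: "0 \<le> lindeberg_const s M K C"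
    unfolding lindeberg_const_def using g by (intro mult_nonneg_nonneg add_nonneg_nonneg) auto
  then show "0 \<le> cHel" "0 \<le> cDiff" using B_ge by (auto simp: cHel_def cDiff_def)
  show "0 \<le> cRisk" unfolding cRisk_def using L B_ge M_pos skew_const_nonneg[OF k_pos, of s] by simp
  show "0 \<le> cTail" by (simp add: cTail_def growth_const_def)
  show "0 \<le> cClose" by (simp add: cClose_def)
qed

lemma H_bounds: "i \<in> I \<Longrightarrow> \<rho> \<in> priors M \<Longrightarrow> 0 \<le> H i \<rho> \<and> H i \<rho> \<le> 1"
  using hellinger_mixture(1,2)[OF mix mix[OF _ prior]] by blast

text \<open>When an observation exceeds \<open>2 * ln n\<close>, where the net gives no control, the trivial bound of order \<open>n\<close> is
  used. \<open>bad_weight\<close> dominates \<open>n\<close> on that event and has bounded mean.\<close>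

definition good :: "'a \<Rightarrow> bool" where "good \<omega> \<longleftrightarrow> (\<forall>i\<in>I. \<bar>X i \<omega>\<bar> \<le> 2 * l)"
definition bad_weight :: "'a \<Rightarrow> real" where "bad_weight \<omega> = 2 / real n * (\<Sum>i\<in>I. cosh (1 * X i \<omega>))"

lemma bad_weight_nonneg: "0 \<le> bad_weight \<omega>"
  unfolding bad_weight_def by (intro mult_nonneg_nonneg sum_nonneg) auto

lemma bad_weight_ge:
  assumes "\<not> good \<omega>"
  shows "real n \<le> bad_weight \<omega>"
proof -
  obtain i where i: "i \<in> I" "2 * l < \<bar>X i \<omega>\<bar>" using assms unfolding good_def by (auto simp: not_le)
  have "(real n)\<^sup>2 = exp (2 * l)" using n_pos by (simp add: exp_double)
  also have "... \<le> exp \<bar>X i \<omega>\<bar>" using i by simp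
  also have "... \<le> 2 * cosh (1 * X i \<omega>)" by (cases "0 \<le> X i \<omega>") (simp_all add: cosh_field_def)
  also have "... \<le> 2 * (\<Sum>i\<in>I. cosh (1 * X i \<omega>))"
    by (intro mult_left_mono member_le_sum i) auto
  finally have "(real n)\<^sup>2 / real n \<le> 2 * (\<Sum>i\<in>I. cosh (1 * X i \<omega>)) / real n" by (rule divide_right_mono) simp
  then show ?thesis using n_pos by (simp add: bad_weight_def power2_eq_square)
qed

lemma bad_weight_integral: "integrable P bad_weight" "(\<integral>\<omega>. bad_weight \<omega> \<partial>P) \<le> cTail"
proof -
  have one: "integrable P (\<lambda>\<omega>. cosh (1 * X i \<omega>))" "(\<integral>\<omega>. cosh (1 * X i \<omega>) \<partial>P) \<le> growth_const s M 1" if i: "i \<in> I" for i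
  proof -
    interpret U: noisy_prior P "\<theta> i" "\<epsilon> i" "J i" "\<sigma> i" s M K pi_star k by (rule unit[OF i])
    show "integrable P (\<lambda>\<omega>. cosh (1 * X i \<omega>))" "(\<integral>\<omega>. cosh (1 * X i \<omega>) \<partial>P) \<le> growth_const s M 1"
      unfolding X_partial[OF i] using U.cosh_partial_integrable[of "J i" 1] by simp_all
  qed
  show "integrable P bad_weight" unfolding bad_weight_def using one by (intro integrable_mult_right Bochner_Integration.integrable_sum) auto
  have "(\<integral>\<omega>. bad_weight \<omega> \<partial>P) = 2 / real n * (\<Sum>i\<in>I. \<integral>\<omega>. cosh (1 * X i \<omega>) \<partial>P)"
    unfolding bad_weight_def integral_mult_right_zero using one by (subst Bochner_Integration.integral_sum) auto
  also have "... \<le> 2 / real n * (\<Sum>i\<in>I. growth_const s M 1)"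
    using one n_pos by (intro mult_left_mono sum_mono) auto
  also have "... = cTail" using n_pos by (simp add: cTail_def)
  finally show "(\<integral>\<omega>. bad_weight \<omega> \<partial>P) \<le> cTail" .
qed

text \<open>Any choice serves, since the representative enters pointwise inequalities only.\<close>

definition rep :: "real measure \<Rightarrow> real measure" where
  "rep \<pi> = (SOME \<rho>. \<rho> \<in> N \<and> (\<forall>\<tau> x i. k < \<tau> \<longrightarrow> \<bar>x\<bar> \<le> 2 * l \<longrightarrow> i \<le> 1 \<longrightarrow>
       \<bar>mom \<pi> \<tau> i x - mom \<rho> \<tau> i x\<bar> \<le> mom \<rho> \<tau> 0 x / real n))"

lemma rep:
  assumes "\<pi> \<in> priors M"
  shows "rep \<pi> \<in> N" "rep \<pi> \<in> priors M"
    "k < \<tau> \<Longrightarrow> \<bar>x\<bar> \<le> 2 * l \<Longrightarrow> i \<le> 1 \<Longrightarrow> \<bar>mom \<pi> \<tau> i x - mom (rep \<pi>) \<tau> i x\<bar> \<le> mom (rep \<pi>) \<tau> 0 x / real n"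
proof -
  have "rep \<pi> \<in> N \<and> (\<forall>\<tau> x i. k < \<tau> \<longrightarrow> \<bar>x\<bar> \<le> 2 * l \<longrightarrow> i \<le> 1 \<longrightarrow>
       \<bar>mom \<pi> \<tau> i x - mom (rep \<pi>) \<tau> i x\<bar> \<le> mom (rep \<pi>) \<tau> 0 x / real n)"
    unfolding rep_def by (rule someI_ex) (use N_net[OF assms] in blast)
  then show "rep \<pi> \<in> N" "rep \<pi> \<in> priors M"
    "k < \<tau> \<Longrightarrow> \<bar>x\<bar> \<le> 2 * l \<Longrightarrow> i \<le> 1 \<Longrightarrow> \<bar>mom \<pi> \<tau> i x - mom (rep \<pi>) \<tau> i x\<bar> \<le> mom (rep \<pi>) \<tau> 0 x / real n"
    using N_sub by auto
qed

lemma hel_rep: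
  assumes i: "i \<in> I" and p: "\<pi> \<in> priors M"
  shows "H i \<pi> \<le> 2 * (cClose / real n) + 2 * H i (rep \<pi>)"
proof -
  interpret two_mixtures M "\<sigma> i" \<pi> "rep \<pi>"
    unfolding two_mixtures_def using mix[OF i p] mix[OF i rep(2)[OF p]] by simp
  have "hel_sq (\<sigma> i) \<pi> (rep \<pi>)
     \<le> 1 / 2 * (1 / real n + 4 * (exp ((\<sigma> i)\<^sup>2 / 2) * cosh M) * exp (- (2 * l)))"
    by (rule hellinger_close) (use n_pos rep(3)[OF p sigma_facts(1)[OF i], of _ 0] in \<open>auto simp: d_def\<close>)
  also have "... \<le> 1 / 2 * (1 / real n + 4 * (exp (K\<^sup>2 / 2) * cosh M) * (1 / real n))"
  proof (intro mult_left_mono add_left_mono mult_mono)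
    show "exp ((\<sigma> i)\<^sup>2 / 2) \<le> exp (K\<^sup>2 / 2)" using sigma_facts(2,3)[OF i] by (auto intro!: power_mono)
    have "exp (- (2 * l)) = 1 / (real n)\<^sup>2" using n_pos by (simp add: exp_minus exp_double divide_inverse)
    also have "... \<le> 1 / real n" using n_pos by (intro divide_left_mono) (auto simp: power2_eq_square)
    finally show "exp (- (2 * l)) \<le> 1 / real n" .
  qed auto
  also have "... = cClose / real n" by (simp add: cClose_def algebra_simps add_divide_distrib)
  finally have "hel_sq (\<sigma> i) \<pi> (rep \<pi>) \<le> cClose / real n" .
  then show ?thesis
    using hellinger_triangle[OF mix[OF i p] mix[OF i rep(2)[OF p]] mix[OF i prior]] by linarith
qed

text \<open>The product of the root likelihood ratios divided by the bound on its mean, so that its mean is at most 1.\<close>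

definition lr_weight :: "real measure \<Rightarrow> 'a \<Rightarrow> real" where
  "lr_weight \<rho> \<omega> = (\<Prod>i\<in>I. root_ratio \<rho> pi_star (\<sigma> i) (X i \<omega>)) * exp ((\<Sum>i\<in>I. H i \<rho>) / 2 - cHel * V)"

lemma root_ratio_pos: "i \<in> I \<Longrightarrow> \<rho> \<in> priors M \<Longrightarrow> 0 < root_ratio \<rho> pi_star (\<sigma> i) x"
  unfolding root_ratio_def using mixture.mom0_pos[OF mix] prior by (auto intro!: divide_pos_pos)

lemma root_ratio_measurable: "i \<in> I \<Longrightarrow> \<rho> \<in> priors M \<Longrightarrow> root_ratio \<rho> pi_star (\<sigma> i) \<in> borel_measurable borel"
proof -
  assume i: "i \<in> I" and r: "\<rho> \<in> priors M"
  note [measurable] = mixture.mom_measurable[OF mix[OF i r]] mixture.mom_measurable[OF mix[OF i prior]]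
  show "root_ratio \<rho> pi_star (\<sigma> i) \<in> borel_measurable borel" unfolding root_ratio_def[abs_def] by measurable
qed

lemma lr_weight_integral:
  assumes r: "\<rho> \<in> priors M"
  shows "integrable P (lr_weight \<rho>)" "(\<integral>\<omega>. lr_weight \<rho> \<omega> \<partial>P) \<le> 1"
proof -
  have one: "integrable P (\<lambda>\<omega>. root_ratio \<rho> pi_star (\<sigma> i) (X i \<omega>))"
    "(\<integral>\<omega>. root_ratio \<rho> pi_star (\<sigma> i) (X i \<omega>) \<partial>P) \<le> exp (- (H i \<rho> / 2) + cHel / real (J i))" if i: "i \<in> I" for i
  proof -
    interpret U: noisy_prior P "\<theta> i" "\<epsilon> i" "J i" "\<sigma> i" s M K pi_star k by (rule unit[OF i])
    have B0: "0 \<le> B" using B_ge by simp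
    show "integrable P (\<lambda>\<omega>. root_ratio \<rho> pi_star (\<sigma> i) (X i \<omega>))"
      "(\<integral>\<omega>. root_ratio \<rho> pi_star (\<sigma> i) (X i \<omega>) \<partial>P) \<le> exp (- (H i \<rho> / 2) + cHel / real (J i))"
      unfolding X_partial[OF i] cHel_def
      using U.root_ratio_expectation[OF r C_nonneg B0 root_smooth[OF r sigma_facts(1)[OF i]]] by simp_all
  qed
  note pr = prod_obs_expectation[OF root_ratio_measurable[OF _ r] less_imp_le[OF root_ratio_pos[OF _ r]] one]
  show "integrable P (lr_weight \<rho>)" unfolding lr_weight_def using pr(1) by simp
  have "(\<integral>\<omega>. lr_weight \<rho> \<omega> \<partial>P) = (\<integral>\<omega>. (\<Prod>i\<in>I. root_ratio \<rho> pi_star (\<sigma> i) (X i \<omega>)) \<partial>P) * exp ((\<Sum>i\<in>I. H i \<rho>) / 2 - cHel * V)"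
    unfolding lr_weight_def by simp
  also have "... \<le> exp (\<Sum>i\<in>I. - (H i \<rho> / 2) + cHel / real (J i)) * exp ((\<Sum>i\<in>I. H i \<rho>) / 2 - cHel * V)"
    by (intro mult_right_mono pr(2)) auto
  also have "... = 1"
  proof -
    have "(\<Sum>i\<in>I. - (H i \<rho> / 2) + cHel / real (J i)) = - (\<Sum>i\<in>I. H i \<rho>) / 2 + cHel * V"
      by (simp add: sum_subtractf sum_divide_distrib sum_distrib_left)
    then show ?thesis by (simp add: exp_add[symmetric])
  qed
  finally show "(\<integral>\<omega>. lr_weight \<rho> \<omega> \<partial>P) \<le> 1" .
qed

lemma lr_weight_pos: "\<rho> \<in> priors M \<Longrightarrow> 0 < lr_weight \<rho> \<omega>"
  unfolding lr_weight_def by (intro mult_pos_pos prod_pos) (auto intro: root_ratio_pos)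

definition mean_over_net :: "(real measure \<Rightarrow> 'a \<Rightarrow> real) \<Rightarrow> 'a \<Rightarrow> real" where
  "mean_over_net Y \<omega> = (\<Sum>\<rho>\<in>N. Y \<rho> \<omega>) / real (card N)"

lemma mean_over_net:
  assumes "\<And>\<rho>. \<rho> \<in> N \<Longrightarrow> integrable P (Y \<rho>)" "\<And>\<rho>. \<rho> \<in> N \<Longrightarrow> (\<integral>\<omega>. Y \<rho> \<omega> \<partial>P) \<le> 1"
    and pos: "\<And>\<rho> \<omega>. \<rho> \<in> N \<Longrightarrow> 0 < Y \<rho> \<omega>"
  shows "integrable P (mean_over_net Y)" "(\<integral>\<omega>. mean_over_net Y \<omega> \<partial>P) \<le> 1" "0 \<le> mean_over_net Y \<omega>"
    "\<rho> \<in> N \<Longrightarrow> ln (Y \<rho> \<omega>) \<le> cN * l\<^sup>2 + mean_over_net Y \<omega>"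
proof -
  show "integrable P (mean_over_net Y)" unfolding mean_over_net_def[abs_def] using assms by simp
  have "(\<integral>\<omega>. mean_over_net Y \<omega> \<partial>P) = (\<Sum>\<rho>\<in>N. \<integral>\<omega>. Y \<rho> \<omega> \<partial>P) / real (card N)"
    unfolding mean_over_net_def using assms by simp
  also have "... \<le> (\<Sum>\<rho>\<in>N. 1) / real (card N)" using assms by (intro divide_right_mono sum_mono) auto
  also have "... \<le> 1" by simp
  finally show "(\<integral>\<omega>. mean_over_net Y \<omega> \<partial>P) \<le> 1" .
  show "0 \<le> mean_over_net Y \<omega>" unfolding mean_over_net_def using pos by (intro divide_nonneg_nonneg sum_nonneg) (auto simp: less_imp_le)
  show "ln (Y \<rho> \<omega>) \<le> cN * l\<^sup>2 + mean_over_net Y \<omega>" if "\<rho> \<in> N"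
    using ln_le_ln_card_plus_mean[OF N_finite that, of "\<lambda>\<rho>. Y \<rho> \<omega>"] pos N_card unfolding mean_over_net_def by (meson add_right_mono order_trans)
qed

abbreviation "lr_mean \<equiv> mean_over_net lr_weight"

lemmas lr_mean = mean_over_net[of lr_weight, OF lr_weight_integral(1)[OF subsetD[OF N_sub]] lr_weight_integral(2)[OF subsetD[OF N_sub]] lr_weight_pos[OF subsetD[OF N_sub]]]

lemma likelihood_gain:
  "AE \<omega> in P. (\<Sum>i\<in>I. ln (mom (ph \<omega>) (\<sigma> i) 0 (X i \<omega>))) \<ge> (\<Sum>i\<in>I. ln (mom pi_star (\<sigma> i) 0 (X i \<omega>))) - q * l"
  using likelihood unfolding approx_npmle_def
proof eventually_elim
  case (elim \<omega>)
  have e: "avg_loglik n \<sigma> (sample n J \<theta> \<epsilon> \<omega>) \<pi> = (\<Sum>i\<in>I. ln (mom \<pi> (\<sigma> i) 0 (X i \<omega>))) / real n" for \<pi>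
  proof -
    have "(\<Sum>i = 1..n. ln (mom \<pi> (\<sigma> i) 0 (sample n J \<theta> \<epsilon> \<omega> i))) = (\<Sum>i\<in>I. ln (mom \<pi> (\<sigma> i) 0 (X i \<omega>)))"
      by (rule sum.cong) (auto simp: sample_def)
    then show ?thesis unfolding avg_loglik_def gauss_mixture_mom by simp
  qed
  have "((\<Sum>i\<in>I. ln (mom pi_star (\<sigma> i) 0 (X i \<omega>))) - q * l) / real n \<le> (\<Sum>i\<in>I. ln (mom (ph \<omega>) (\<sigma> i) 0 (X i \<omega>))) / real n"
    using elim unfolding e by (simp add: diff_divide_distrib)
  then show ?case using n_pos by (simp add: divide_le_cancel)
qed

text \<open>The likelihood inequality, passed on to the representative, bounds the product in its weight from below;
  the logarithm of the weight is at most the log-cardinality of the net plus a term of bounded mean.\<close>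

lemma sum_hel_rep:
  "AE \<omega> in P. good \<omega> \<longrightarrow> (\<Sum>i\<in>I. H i (rep (ph \<omega>))) \<le> q * l + 1 + 2 * cHel * V + 2 * (cN * l\<^sup>2 + lr_mean \<omega>)"
  using likelihood_gain
proof eventually_elim
  case (elim \<omega>)
  show ?case
  proof
    assume g: "good \<omega>"
    define \<rho> where "\<rho> = rep (ph \<omega>)"
    have r: "\<rho> \<in> N" "\<rho> \<in> priors M" using rep[OF ph_prior] by (auto simp: \<rho>_def)
    let ?x = "\<lambda>i. X i \<omega>"
    have cl: "ln (mom (ph \<omega>) (\<sigma> i) 0 (?x i)) \<le> ln (mom \<rho> (\<sigma> i) 0 (?x i)) + 1 / real n" if i: "i \<in> I" for i
    proof -
      have p: "0 < mom (ph \<omega>) (\<sigma> i) 0 (?x i)" "0 < mom \<rho> (\<sigma> i) 0 (?x i)"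
        using mixture.mom0_pos[OF mix[OF i ph_prior]] mixture.mom0_pos[OF mix[OF i r(2)]] by auto
      have "\<bar>mom (ph \<omega>) (\<sigma> i) 0 (?x i) - mom \<rho> (\<sigma> i) 0 (?x i)\<bar> \<le> mom \<rho> (\<sigma> i) 0 (?x i) / real n"
        unfolding \<rho>_def using g i by (intro rep(3)[OF ph_prior sigma_facts(1)[OF i]]) (auto simp: good_def)
      then have "mom (ph \<omega>) (\<sigma> i) 0 (?x i) \<le> mom \<rho> (\<sigma> i) 0 (?x i) * (1 + 1 / real n)" by (simp add: distrib_left)
      then have "ln (mom (ph \<omega>) (\<sigma> i) 0 (?x i)) \<le> ln (mom \<rho> (\<sigma> i) 0 (?x i) * (1 + 1 / real n))"
        using p by (subst ln_le_cancel_iff) (auto intro!: mult_pos_pos add_pos_nonneg)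
      also have "... = ln (mom \<rho> (\<sigma> i) 0 (?x i)) + ln (1 + 1 / real n)"
      proof -
        have "0 < 1 + 1 / real n" by (intro add_pos_nonneg) auto
        then show ?thesis using p by (simp add: ln_mult)
      qed
      also have "ln (1 + 1 / real n) \<le> 1 / real n" by (rule ln_add_one_self_le_self) simp
      finally show ?thesis by simp
    qed
    have "(\<Sum>i\<in>I. ln (mom (ph \<omega>) (\<sigma> i) 0 (?x i))) \<le> (\<Sum>i\<in>I. ln (mom \<rho> (\<sigma> i) 0 (?x i)) + 1 / real n)"
      by (rule sum_mono) (rule cl)
    also have "... = (\<Sum>i\<in>I. ln (mom \<rho> (\<sigma> i) 0 (?x i))) + 1" using n_pos by (simp add: sum.distrib)
    finally have gain: "- q * l - 1 \<le> (\<Sum>i\<in>I. ln (mom \<rho> (\<sigma> i) 0 (?x i))) - (\<Sum>i\<in>I. ln (mom pi_star (\<sigma> i) 0 (?x i)))"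
      using elim by simp
    have rr: "ln (root_ratio \<rho> pi_star (\<sigma> i) (?x i)) = (ln (mom \<rho> (\<sigma> i) 0 (?x i)) - ln (mom pi_star (\<sigma> i) 0 (?x i))) / 2" if i: "i \<in> I" for i
    proof -
      have "0 < mom \<rho> (\<sigma> i) 0 (?x i)" "0 < mom pi_star (\<sigma> i) 0 (?x i)"
        using mixture.mom0_pos[OF mix[OF i r(2)]] mixture.mom0_pos[OF mix[OF i prior]] by auto
      then show ?thesis unfolding root_ratio_def by (subst ln_sqrt) (auto simp: ln_div)
    qed
    have "ln (lr_weight \<rho> \<omega>) = (\<Sum>i\<in>I. ln (root_ratio \<rho> pi_star (\<sigma> i) (?x i))) + ((\<Sum>i\<in>I. H i \<rho>) / 2 - cHel * V)"
    proof -
      define R where "R = (\<Prod>i\<in>I. root_ratio \<rho> pi_star (\<sigma> i) (?x i))"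
      have R: "0 < R" unfolding R_def by (intro prod_pos root_ratio_pos r) auto
      have lR: "ln R = (\<Sum>i\<in>I. ln (root_ratio \<rho> pi_star (\<sigma> i) (?x i)))"
        unfolding R_def by (rule ln_prod) (use root_ratio_pos[OF _ r(2)] in \<open>auto simp: less_imp_neq[symmetric]\<close>)
      show ?thesis unfolding lr_weight_def R_def[symmetric] lR[symmetric] using R by (simp add: ln_mult)
    qed
    also have "(\<Sum>i\<in>I. ln (root_ratio \<rho> pi_star (\<sigma> i) (?x i))) = ((\<Sum>i\<in>I. ln (mom \<rho> (\<sigma> i) 0 (?x i))) - (\<Sum>i\<in>I. ln (mom pi_star (\<sigma> i) 0 (?x i)))) / 2"
    proof -
      have "(\<Sum>i\<in>I. ln (root_ratio \<rho> pi_star (\<sigma> i) (?x i))) = (\<Sum>i\<in>I. (ln (mom \<rho> (\<sigma> i) 0 (?x i)) - ln (mom pi_star (\<sigma> i) 0 (?x i))) / 2)"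
        by (rule sum.cong[OF refl rr])
      then show ?thesis unfolding sum_divide_distrib[symmetric] sum_subtractf .
    qed
    finally have "(- q * l - 1) / 2 + (\<Sum>i\<in>I. H i \<rho>) / 2 - cHel * V \<le> ln (lr_weight \<rho> \<omega>)" using gain by simp
    also have "... \<le> cN * l\<^sup>2 + lr_mean \<omega>" by (rule lr_mean(4)[OF _ _ _ r(1)])
    finally have fin: "(- q * l - 1) / 2 + (\<Sum>i\<in>I. H i \<rho>) / 2 - cHel * V \<le> cN * l\<^sup>2 + lr_mean \<omega>" .
    have "S \<le> a * b + 1 + 2 * c * d + 2 * m" if "(- a * b - 1) / 2 + S / 2 - c * d \<le> m" for a b c d S m :: real
      using that by (simp add: field_simps)
    from this[OF fin] show "(\<Sum>i\<in>I. H i (rep (ph \<omega>))) \<le> q * l + 1 + 2 * cHel * V + 2 * (cN * l\<^sup>2 + lr_mean \<omega>)"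
      unfolding \<rho>_def[symmetric] .
  qed
qed

theorem hellinger_risk:
  "(\<integral>\<omega>. 1 / real n * (\<Sum>i\<in>I. H i (ph \<omega>)) \<partial>P)
    \<le> 1 / real n * (2 * cClose + 2 * (q * l + 1 + 2 * cHel * V + 2 * (cN * l\<^sup>2 + 1)) + cTail)"
proof -
  define R where "R \<omega> = 1 / real n * (2 * cClose + 2 * (q * l + 1 + 2 * cHel * V + 2 * (cN * l\<^sup>2 + lr_mean \<omega>)) + bad_weight \<omega>)" for \<omega>
  have base: "0 \<le> q * l + 1 + 2 * cHel * V + 2 * (cN * l\<^sup>2 + lr_mean \<omega>)" for \<omega>
    using q_nonneg l_ge consts_nonneg V_nonneg cN_nonneg lr_mean(3)[of \<omega>] by (intro add_nonneg_nonneg mult_nonneg_nonneg) auto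
  have Ri: "integrable P R" unfolding R_def using lr_mean(1) bad_weight_integral(1) by simp
  have le: "AE \<omega> in P. 1 / real n * (\<Sum>i\<in>I. H i (ph \<omega>)) \<le> R \<omega>"
    using sum_hel_rep
  proof eventually_elim
    case (elim \<omega>)
    have "(\<Sum>i\<in>I. H i (ph \<omega>)) \<le> 2 * cClose + 2 * (q * l + 1 + 2 * cHel * V + 2 * (cN * l\<^sup>2 + lr_mean \<omega>)) + bad_weight \<omega>"
    proof (cases "good \<omega>")
      case True
      have "(\<Sum>i\<in>I. H i (ph \<omega>)) \<le> (\<Sum>i\<in>I. 2 * (cClose / real n) + 2 * H i (rep (ph \<omega>)))"
        by (rule sum_mono) (rule hel_rep[OF _ ph_prior])
      also have "... = 2 * cClose + 2 * (\<Sum>i\<in>I. H i (rep (ph \<omega>)))"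
        using n_pos by (simp add: sum.distrib sum_distrib_left)
      finally have "(\<Sum>i\<in>I. H i (ph \<omega>)) \<le> 2 * cClose + 2 * (\<Sum>i\<in>I. H i (rep (ph \<omega>)))" .
      moreover have "(\<Sum>i\<in>I. H i (rep (ph \<omega>))) \<le> q * l + 1 + 2 * cHel * V + 2 * (cN * l\<^sup>2 + lr_mean \<omega>)"
        using elim True by blast
      moreover have "a \<le> b + 2 * z + w" if "a \<le> b + 2 * h" "h \<le> z" "0 \<le> w" for a b h z w :: real using that by linarith
      ultimately show ?thesis using bad_weight_nonneg[of \<omega>] by blast
    next
      case False
      have "(\<Sum>i\<in>I. H i (ph \<omega>)) \<le> (\<Sum>i\<in>I. 1)" by (rule sum_mono) (use H_bounds[OF _ ph_prior] in auto)
      also have "... = real n" by simp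
      also have "... \<le> bad_weight \<omega>" by (rule bad_weight_ge[OF False])
      finally have "(\<Sum>i\<in>I. H i (ph \<omega>)) \<le> bad_weight \<omega>" .
      moreover have "a \<le> 2 * b + 2 * z + w" if "a \<le> w" "0 \<le> b" "0 \<le> z" for a b z w :: real using that by linarith
      ultimately show ?thesis using base[of \<omega>] consts_nonneg by blast
    qed
    then show ?case unfolding R_def using n_pos by (intro mult_left_mono) auto
  qed
  have "(\<integral>\<omega>. 1 / real n * (\<Sum>i\<in>I. H i (ph \<omega>)) \<partial>P) \<le> (\<integral>\<omega>. R \<omega> \<partial>P)"
  proof (rule integral_mono_AE'[OF Ri le])
    show "AE \<omega> in P. 0 \<le> R \<omega>"
      unfolding R_def
      by (intro AE_I2 mult_nonneg_nonneg[OF _ add_nonneg_nonneg[OF add_nonneg_nonneg[OF _ mult_nonneg_nonneg[OF _ base]] bad_weight_nonneg]])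
        (use consts_nonneg in auto)
  qed
  also have "... = 1 / real n * (2 * cClose + 2 * (q * l + 1 + 2 * cHel * V + 2 * (cN * l\<^sup>2 + (\<integral>\<omega>. lr_mean \<omega> \<partial>P))) + (\<integral>\<omega>. bad_weight \<omega> \<partial>P))"
    unfolding R_def using lr_mean(1) bad_weight_integral(1) by (simp add: prob_space)
  also have "... \<le> 1 / real n * (2 * cClose + 2 * (q * l + 1 + 2 * cHel * V + 2 * (cN * l\<^sup>2 + 1)) + cTail)"
    using lr_mean(2) bad_weight_integral(2) by (intro mult_left_mono) auto
  finally show ?thesis .
qed

end

section \<open>Regret\<close>

context eb_bounds
begin

abbreviation "gap i \<rho> x \<equiv> (post \<rho> (\<sigma> i) 1 x - post pi_star (\<sigma> i) 1 x)\<^sup>2"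

definition "lam = 1 / (4 * M\<^sup>2)"

lemma lam_pos: "0 < lam" using M_pos by (simp add: lam_def)

lemma post_meas: "i \<in> I \<Longrightarrow> \<rho> \<in> priors M \<Longrightarrow> post \<rho> (\<sigma> i) 1 \<in> borel_measurable borel"
  by (rule mixture.post_measurable[OF mix])

lemma post_le: "i \<in> I \<Longrightarrow> \<rho> \<in> priors M \<Longrightarrow> \<bar>post \<rho> (\<sigma> i) 1 x\<bar> \<le> M"
  using mixture.post_bound[OF mix, of i \<rho> 1 x] by simp

lemma square_diff_le: "\<bar>a\<bar> \<le> M \<Longrightarrow> \<bar>b\<bar> \<le> M \<Longrightarrow> (a - b)\<^sup>2 \<le> 4 * M\<^sup>2"
proof -
  assume "\<bar>a\<bar> \<le> M" "\<bar>b\<bar> \<le> M"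
  then have "\<bar>a - b\<bar>\<^sup>2 \<le> (2 * M)\<^sup>2" by (intro power_mono) auto
  then show ?thesis by (simp add: power_mult_distrib)
qed

lemma gap_bounds: "i \<in> I \<Longrightarrow> \<rho> \<in> priors M \<Longrightarrow> 0 \<le> gap i \<rho> x \<and> gap i \<rho> x \<le> 4 * M\<^sup>2"
  using square_diff_le[OF post_le post_le[OF _ prior]] by auto

lemma gap_integrable: "i \<in> I \<Longrightarrow> \<rho> \<in> priors M \<Longrightarrow> integrable P (\<lambda>\<omega>. gap i \<rho> (X i \<omega>))"
proof -
  assume i: "i \<in> I" and r: "\<rho> \<in> priors M"
  note [measurable] = X_measurable[OF i] post_meas[OF i r] post_meas[OF i prior]
  have "(\<lambda>\<omega>. gap i \<rho> (X i \<omega>)) \<in> borel_measurable P" by measurable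
  then show "integrable P (\<lambda>\<omega>. gap i \<rho> (X i \<omega>))"
    by (intro integrable_const_bound[of _ "4 * M\<^sup>2"]) (use gap_bounds[OF i r] in auto)
qed

definition mean_gap :: "nat \<Rightarrow> real measure \<Rightarrow> real" where
  "mean_gap i \<rho> = (\<integral>\<omega>. gap i \<rho> (X i \<omega>) \<partial>P)"

lemma mean_gap_le:
  assumes i: "i \<in> I" and r: "\<rho> \<in> priors M"
  shows "mean_gap i \<rho> \<le> 2 * (cP * l ^ 4 * (H i \<rho> + 1 / real n)) + cDiff / real (J i)"
proof -
  interpret U: noisy_prior P "\<theta> i" "\<epsilon> i" "J i" "\<sigma> i" s M K pi_star k by (rule unit[OF i])
  have B0: "0 \<le> B" using B_ge by simp
  have "mean_gap i \<rho> \<le> 2 * (\<integral>z. gap i \<rho> z * mom pi_star (\<sigma> i) 0 z \<partial>lborel) + cDiff / real (J i)"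
    unfolding mean_gap_def X_partial[OF i] cDiff_def
    by (rule U.post_diff_expectation[OF r C_nonneg B0 diff_smooth[OF r sigma_facts(1)[OF i]]])
  also have "... \<le> 2 * (cP * l ^ 4 * (H i \<rho> + 1 / real n)) + cDiff / real (J i)"
    using post_hel[OF r sigma_facts(2)[OF i] sigma_facts(3)[OF i]] by simp
  finally show ?thesis .
qed

text \<open>The exponential weights of the squared differences of posterior means, again normalised to have mean at
  most 1. With the factor \<open>lam\<close> these differences lie in \<open>[0, 1]\<close>, where \<open>exp y \<le> 1 + 2 * y\<close>.\<close>

definition gap_weight :: "real measure \<Rightarrow> 'a \<Rightarrow> real" where
  "gap_weight \<rho> \<omega> = (\<Prod>i\<in>I. exp (lam * gap i \<rho> (X i \<omega>))) * exp (- (2 * lam * (\<Sum>i\<in>I. mean_gap i \<rho>)))"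

lemma gap_weight_integral:
  assumes r: "\<rho> \<in> priors M"
  shows "integrable P (gap_weight \<rho>)" "(\<integral>\<omega>. gap_weight \<rho> \<omega> \<partial>P) \<le> 1"
proof -
  have meas: "(\<lambda>x. exp (lam * gap i \<rho> x)) \<in> borel_measurable borel" if i: "i \<in> I" for i
    using post_meas[OF i r] post_meas[OF i prior] by measurable
  have one: "integrable P (\<lambda>\<omega>. exp (lam * gap i \<rho> (X i \<omega>)))"
    "(\<integral>\<omega>. exp (lam * gap i \<rho> (X i \<omega>)) \<partial>P) \<le> exp (2 * lam * mean_gap i \<rho>)" if i: "i \<in> I" for i
  proof -
    note [measurable] = X_measurable[OF i] post_meas[OF i r] post_meas[OF i prior]
    have ub: "exp (lam * gap i \<rho> x) \<le> 1 + 2 * (lam * gap i \<rho> x)" for x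
    proof -
      define y where "y = lam * gap i \<rho> x"
      have "lam * gap i \<rho> x \<le> lam * (4 * M\<^sup>2)" using gap_bounds[OF i r] lam_pos by (intro mult_left_mono) auto
      then have y: "0 \<le> y" "y \<le> 1" using lam_pos M_pos by (auto simp: y_def lam_def)
      have "exp y \<le> 1 + y + y\<^sup>2" by (rule exp_bound[OF y])
      also have "y\<^sup>2 \<le> y" using y by (simp add: power2_eq_square mult_left_le)
      finally show ?thesis by (simp add: y_def)
    qed
    have gi: "integrable P (\<lambda>\<omega>. 1 + 2 * (lam * gap i \<rho> (X i \<omega>)))"
      by (intro Bochner_Integration.integrable_add integrable_const integrable_mult_right gap_integrable[OF i r])
    have "(\<lambda>\<omega>. exp (lam * gap i \<rho> (X i \<omega>))) \<in> borel_measurable P" by measurable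
    then show ei: "integrable P (\<lambda>\<omega>. exp (lam * gap i \<rho> (X i \<omega>)))"
      by (rule Bochner_Integration.integrable_bound[OF gi]) (use ub in \<open>auto intro: order_trans[OF _ abs_ge_self]\<close>)
    have "(\<integral>\<omega>. exp (lam * gap i \<rho> (X i \<omega>)) \<partial>P) \<le> (\<integral>\<omega>. 1 + 2 * (lam * gap i \<rho> (X i \<omega>)) \<partial>P)"
      by (rule integral_mono[OF ei gi ub])
    also have "... = 1 + 2 * lam * mean_gap i \<rho>"
      unfolding mean_gap_def using gap_integrable[OF i r] by (simp add: prob_space)
    also have "... \<le> exp (2 * lam * mean_gap i \<rho>)" by (rule exp_ge_add_one_self)
    finally show "(\<integral>\<omega>. exp (lam * gap i \<rho> (X i \<omega>)) \<partial>P) \<le> exp (2 * lam * mean_gap i \<rho>)" .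
  qed
  note pr = prod_obs_expectation[OF meas _ one]
  show "integrable P (gap_weight \<rho>)" unfolding gap_weight_def using pr(1) by simp
  have "(\<integral>\<omega>. gap_weight \<rho> \<omega> \<partial>P) = (\<integral>\<omega>. (\<Prod>i\<in>I. exp (lam * gap i \<rho> (X i \<omega>))) \<partial>P) * exp (- (2 * lam * (\<Sum>i\<in>I. mean_gap i \<rho>)))"
    unfolding gap_weight_def by simp
  also have "... \<le> exp (\<Sum>i\<in>I. 2 * lam * mean_gap i \<rho>) * exp (- (2 * lam * (\<Sum>i\<in>I. mean_gap i \<rho>)))"
    by (intro mult_right_mono pr(2)) auto
  also have "... = 1" by (simp add: exp_add[symmetric] sum_distrib_left)
  finally show "(\<integral>\<omega>. gap_weight \<rho> \<omega> \<partial>P) \<le> 1" .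
qed

lemma gap_weight_pos: "0 < gap_weight \<rho> \<omega>"
  unfolding gap_weight_def by (intro mult_pos_pos prod_pos) auto

abbreviation "gap_mean \<equiv> mean_over_net gap_weight"

lemmas gap_mean = mean_over_net[of gap_weight, OF gap_weight_integral(1)[OF subsetD[OF N_sub]] gap_weight_integral(2)[OF subsetD[OF N_sub]] gap_weight_pos]

lemma sum_gap_le:
  assumes r: "\<rho> \<in> N"
  shows "(\<Sum>i\<in>I. gap i \<rho> (X i \<omega>)) \<le> 2 * (\<Sum>i\<in>I. mean_gap i \<rho>) + 4 * M\<^sup>2 * (cN * l\<^sup>2 + gap_mean \<omega>)"
proof -
  have "(\<Prod>i\<in>I. exp (lam * gap i \<rho> (X i \<omega>))) = exp (lam * (\<Sum>i\<in>I. gap i \<rho> (X i \<omega>)))"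
    by (simp add: exp_sum sum_distrib_left)
  then have "gap_weight \<rho> \<omega> = exp (lam * (\<Sum>i\<in>I. gap i \<rho> (X i \<omega>)) - 2 * lam * (\<Sum>i\<in>I. mean_gap i \<rho>))"
    unfolding gap_weight_def by (simp add: exp_diff exp_minus divide_inverse)
  then have "lam * (\<Sum>i\<in>I. gap i \<rho> (X i \<omega>)) - 2 * lam * (\<Sum>i\<in>I. mean_gap i \<rho>) = ln (gap_weight \<rho> \<omega>)" by simp
  also have "... \<le> cN * l\<^sup>2 + gap_mean \<omega>" by (rule gap_mean(4)[OF _ _ r])
  finally have "4 * M\<^sup>2 * (lam * (\<Sum>i\<in>I. gap i \<rho> (X i \<omega>)) - 2 * lam * (\<Sum>i\<in>I. mean_gap i \<rho>)) \<le> 4 * M\<^sup>2 * (cN * l\<^sup>2 + gap_mean \<omega>)"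
    by (intro mult_left_mono) auto
  moreover have "4 * M\<^sup>2 * (lam * x - 2 * lam * y) = x - 2 * y" for x y using M_pos by (simp add: lam_def field_simps)
  ultimately show ?thesis by simp
qed

lemma post_close:
  assumes i: "i \<in> I" and p: "\<pi> \<in> priors M" and x: "\<bar>x\<bar> \<le> 2 * l"
  shows "\<bar>post \<pi> (\<sigma> i) 1 x - post (rep \<pi>) (\<sigma> i) 1 x\<bar> \<le> (1 + M) / real n"
proof -
  interpret A: mixture M "\<sigma> i" \<pi> by (rule mix[OF i p])
  interpret R: mixture M "\<sigma> i" "rep \<pi>" by (rule mix[OF i rep(2)[OF p]])
  define a b a1 b1 where "a = mom \<pi> (\<sigma> i) 0 x" and "b = mom (rep \<pi>) (\<sigma> i) 0 x" and "a1 = mom \<pi> (\<sigma> i) 1 x" and "b1 = mom (rep \<pi>) (\<sigma> i) 1 x"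
  have pos: "0 < a" "0 < b" using A.mom0_pos R.mom0_pos by (auto simp: a_def b_def)
  have c: "\<bar>a - b\<bar> \<le> b / real n" "\<bar>a1 - b1\<bar> \<le> b / real n"
    unfolding a_def b_def a1_def b1_def using rep(3)[OF p sigma_facts(1)[OF i] x] by auto
  have pa: "\<bar>a1 / a\<bar> \<le> M" using A.post_bound[of 1 x] by (simp add: post_def a_def a1_def)
  have "a1 / a - b1 / b = (a1 - b1) / b + (a1 / a) * ((b - a) / b)" using pos by (simp add: field_simps)
  also have "\<bar>...\<bar> \<le> \<bar>(a1 - b1) / b\<bar> + \<bar>(a1 / a) * ((b - a) / b)\<bar>" by (rule abs_triangle_ineq)
  also have "... \<le> 1 / real n + M * (1 / real n)"
  proof (rule add_mono)
    show "\<bar>(a1 - b1) / b\<bar> \<le> 1 / real n" using c(2) pos by (simp add: abs_divide pos_divide_le_eq)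
    have "\<bar>(b - a) / b\<bar> \<le> 1 / real n" using c(1) pos by (simp add: abs_divide pos_divide_le_eq abs_minus_commute)
    with pa show "\<bar>(a1 / a) * ((b - a) / b)\<bar> \<le> M * (1 / real n)" by (rule abs_mult_bound)
  qed
  finally show ?thesis by (simp add: post_def a_def b_def a1_def b1_def add_divide_distrib)
qed

text \<open>Collected from \<open>sum_gap_le\<close>, \<open>mean_gap_le\<close>, \<open>sum_hel_rep\<close> and, on the bad event, the bound \<open>4 * M\<^sup>2\<close>.\<close>

definition plug_bound :: "'a \<Rightarrow> real" where
  "plug_bound \<omega> = 2 * (1 + M)\<^sup>2 + 2 * (4 * (cP * l ^ 4) * (q * l + 2 + 2 * cHel * V + 2 * (cN * l\<^sup>2 + lr_mean \<omega>)) + 2 * (cDiff * V)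
      + 4 * M\<^sup>2 * (cN * l\<^sup>2 + gap_mean \<omega>)) + 4 * M\<^sup>2 * bad_weight \<omega>"

lemma plug_bound_parts:
  "0 \<le> 2 * (4 * (cP * l ^ 4) * (q * l + 2 + 2 * cHel * V + 2 * (cN * l\<^sup>2 + lr_mean \<omega>)) + 2 * (cDiff * V)
      + 4 * M\<^sup>2 * (cN * l\<^sup>2 + gap_mean \<omega>))"
  using q_nonneg l_ge consts_nonneg V_nonneg cN_nonneg cP_nonneg lr_mean(3)[of \<omega>] gap_mean(3)[of \<omega>]
  by (intro add_nonneg_nonneg mult_nonneg_nonneg) auto

lemma plug_bound_nonneg: "0 \<le> plug_bound \<omega>"
  unfolding plug_bound_def using plug_bound_parts[of \<omega>] bad_weight_nonneg[of \<omega>]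
  by (intro add_nonneg_nonneg) auto

lemma sum_plug_le: "AE \<omega> in P. (\<Sum>i\<in>I. gap i (ph \<omega>) (X i \<omega>)) \<le> plug_bound \<omega>"
  using sum_hel_rep
proof eventually_elim
  case (elim \<omega>)
  show ?case
  proof (cases "good \<omega>")
    case True
    define \<rho> where "\<rho> = rep (ph \<omega>)"
    have r: "\<rho> \<in> N" "\<rho> \<in> priors M" using rep[OF ph_prior] by (auto simp: \<rho>_def)
    have hs: "(\<Sum>i\<in>I. H i \<rho>) \<le> q * l + 1 + 2 * cHel * V + 2 * (cN * l\<^sup>2 + lr_mean \<omega>)"
      using elim True unfolding \<rho>_def by blast
    have "(\<Sum>i\<in>I. gap i (ph \<omega>) (X i \<omega>)) \<le> (\<Sum>i\<in>I. 2 * ((1 + M) / real n)\<^sup>2 + 2 * gap i \<rho> (X i \<omega>))"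
    proof (rule sum_mono)
      fix i assume i: "i \<in> I"
      have xb: "\<bar>X i \<omega>\<bar> \<le> 2 * l" using True i by (simp add: good_def)
      let ?a = "post (ph \<omega>) (\<sigma> i) 1 (X i \<omega>) - post \<rho> (\<sigma> i) 1 (X i \<omega>)" and ?b = "post \<rho> (\<sigma> i) 1 (X i \<omega>) - post pi_star (\<sigma> i) 1 (X i \<omega>)"
      have "gap i (ph \<omega>) (X i \<omega>) = (?a + ?b)\<^sup>2" by simp
      also have "... \<le> 2 * ?a\<^sup>2 + 2 * ?b\<^sup>2" by (rule square_add_le)
      also have "?a\<^sup>2 \<le> ((1 + M) / real n)\<^sup>2"
        using power_mono[OF post_close[OF i ph_prior xb], where n = 2] by (simp add: \<rho>_def)
      finally show "gap i (ph \<omega>) (X i \<omega>) \<le> 2 * ((1 + M) / real n)\<^sup>2 + 2 * gap i \<rho> (X i \<omega>)" by simp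
    qed
    also have "... = 2 * (real n * ((1 + M) / real n)\<^sup>2) + 2 * (\<Sum>i\<in>I. gap i \<rho> (X i \<omega>))"
      by (simp add: sum.distrib sum_distrib_left)
    also have "real n * ((1 + M) / real n)\<^sup>2 \<le> (1 + M)\<^sup>2"
    proof -
      have "real n * ((1 + M) / real n)\<^sup>2 = (1 + M)\<^sup>2 / real n" using n_pos by (simp add: power_divide power2_eq_square)
      also have "... \<le> (1 + M)\<^sup>2 / 1" using n_pos by (intro divide_left_mono) auto
      finally show ?thesis by simp
    qed
    finally have 1: "(\<Sum>i\<in>I. gap i (ph \<omega>) (X i \<omega>)) \<le> 2 * (1 + M)\<^sup>2 + 2 * (\<Sum>i\<in>I. gap i \<rho> (X i \<omega>))" by simp
    have 2: "(\<Sum>i\<in>I. gap i \<rho> (X i \<omega>)) \<le> 2 * (\<Sum>i\<in>I. mean_gap i \<rho>) + 4 * M\<^sup>2 * (cN * l\<^sup>2 + gap_mean \<omega>)"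
      by (rule sum_gap_le[OF r(1)])
    have "(\<Sum>i\<in>I. mean_gap i \<rho>) \<le> (\<Sum>i\<in>I. 2 * (cP * l ^ 4 * (H i \<rho> + 1 / real n)) + cDiff / real (J i))"
      by (rule sum_mono) (rule mean_gap_le[OF _ r(2)])
    also have "... = 2 * (cP * l ^ 4) * ((\<Sum>i\<in>I. H i \<rho>) + 1) + cDiff * V"
    proof -
      have "(\<Sum>i\<in>I. 2 * (cP * l ^ 4 * (H i \<rho> + 1 / real n)) + cDiff / real (J i))
         = 2 * (cP * l ^ 4) * (\<Sum>i\<in>I. H i \<rho> + 1 / real n) + cDiff * (\<Sum>i\<in>I. 1 / real (J i))"
        unfolding sum.distrib[of "\<lambda>i. 2 * (cP * l ^ 4 * (H i \<rho> + 1 / real n))"] sum_distrib_left by (simp add: mult.assoc)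
      also have "(\<Sum>i\<in>I. H i \<rho> + 1 / real n) = (\<Sum>i\<in>I. H i \<rho>) + 1" using n_pos by (simp add: sum.distrib)
      finally show ?thesis .
    qed
    also have "... \<le> 2 * (cP * l ^ 4) * (q * l + 2 + 2 * cHel * V + 2 * (cN * l\<^sup>2 + lr_mean \<omega>)) + cDiff * V"
      using hs cP_nonneg l_ge by (intro add_right_mono mult_left_mono) auto
    finally have 3: "(\<Sum>i\<in>I. mean_gap i \<rho>) \<le> 2 * (cP * l ^ 4) * (q * l + 2 + 2 * cHel * V + 2 * (cN * l\<^sup>2 + lr_mean \<omega>)) + cDiff * V" .
    have 4: "0 \<le> 4 * M\<^sup>2 * bad_weight \<omega>" using bad_weight_nonneg by simp
    define Z where "Z = 2 * (cP * l ^ 4) * (q * l + 2 + 2 * cHel * V + 2 * (cN * l\<^sup>2 + lr_mean \<omega>))"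
    have "4 * (cP * l ^ 4) * (q * l + 2 + 2 * cHel * V + 2 * (cN * l\<^sup>2 + lr_mean \<omega>)) = 2 * Z" by (simp add: Z_def)
    moreover have "g \<le> 2 * A + 2 * (y + 2 * v + u) + w"
      if "y = 2 * Z" "g \<le> 2 * A + 2 * h" "h \<le> 2 * m + u" "m \<le> Z + v" "0 \<le> w" for A g h m u v w y :: real
      using that by argo
    ultimately show ?thesis using 1 2 3[folded Z_def] 4 unfolding plug_bound_def by blast
  next
    case False
    have "(\<Sum>i\<in>I. gap i (ph \<omega>) (X i \<omega>)) \<le> (\<Sum>i\<in>I. 4 * M\<^sup>2)" by (rule sum_mono) (use gap_bounds[OF _ ph_prior] in auto)
    also have "... = 4 * M\<^sup>2 * real n" by simp
    also have "... \<le> 4 * M\<^sup>2 * bad_weight \<omega>" using bad_weight_ge[OF False] by (intro mult_left_mono) auto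
    also have "... \<le> plug_bound \<omega>" unfolding plug_bound_def using plug_bound_parts[of \<omega>] by simp
    finally show ?thesis .
  qed
qed

definition "plug_const = 2 * (1 + M)\<^sup>2 + 2 * (4 * (cP * l ^ 4) * (q * l + 2 + 2 * cHel * V + 2 * (cN * l\<^sup>2 + 1)) + 2 * (cDiff * V)
      + 4 * M\<^sup>2 * (cN * l\<^sup>2 + 1)) + 4 * M\<^sup>2 * cTail"

lemma plug_bound_integral: "integrable P plug_bound" "(\<integral>\<omega>. plug_bound \<omega> \<partial>P) \<le> plug_const"
proof -
  note i = lr_mean(1) gap_mean(1) bad_weight_integral(1)
  show "integrable P plug_bound" unfolding plug_bound_def[abs_def] using i by simp
  have "(\<integral>\<omega>. plug_bound \<omega> \<partial>P) = 2 * (1 + M)\<^sup>2 + 2 * (4 * (cP * l ^ 4) * (q * l + 2 + 2 * cHel * V + 2 * (cN * l\<^sup>2 + (\<integral>\<omega>. lr_mean \<omega> \<partial>P))) + 2 * (cDiff * V)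
      + 4 * M\<^sup>2 * (cN * l\<^sup>2 + (\<integral>\<omega>. gap_mean \<omega> \<partial>P))) + 4 * M\<^sup>2 * (\<integral>\<omega>. bad_weight \<omega> \<partial>P)"
    unfolding plug_bound_def using i by (simp add: prob_space)
  also have "... \<le> plug_const"
  proof -
    have mono: "2 * (1 + M)\<^sup>2 + 2 * (a * (b + 2 * (c + x)) + d + 4 * M\<^sup>2 * (c + y)) + 4 * M\<^sup>2 * z
        \<le> 2 * (1 + M)\<^sup>2 + 2 * (a * (b + 2 * (c + 1)) + d + 4 * M\<^sup>2 * (c + 1)) + 4 * M\<^sup>2 * cTail"
      if "0 \<le> a" "x \<le> 1" "y \<le> 1" "z \<le> cTail" for a b c d x y z
    proof -
      have "a * (b + 2 * (c + x)) \<le> a * (b + 2 * (c + 1))" "4 * M\<^sup>2 * (c + y) \<le> 4 * M\<^sup>2 * (c + 1)" "4 * M\<^sup>2 * z \<le> 4 * M\<^sup>2 * cTail"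
        using that by (auto intro!: mult_left_mono)
      moreover have "A + 2 * (p + d + p2) + p3 \<le> A + 2 * (r + d + r2) + r3" if "p \<le> r" "p2 \<le> r2" "p3 \<le> r3" for A p p2 p3 r r2 r3 :: real
        using that by (intro add_mono mult_left_mono) auto
      ultimately show ?thesis by blast
    qed
    show ?thesis
      unfolding plug_const_def by (rule mono) (use lr_mean(2) gap_mean(2) bad_weight_integral(2) cP_nonneg in auto)
  qed
  finally show "(\<integral>\<omega>. plug_bound \<omega> \<partial>P) \<le> plug_const" .
qed

lemma ph_measurable: "(\<lambda>\<omega>. ph \<omega>) \<in> P \<rightarrow>\<^sub>M subprob_algebra borel"
proof -
  have "sample n J \<theta> \<epsilon> \<in> P \<rightarrow>\<^sub>M (\<Pi>\<^sub>M i\<in>{1..n}. (borel :: real measure))"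
    unfolding sample_def[abs_def] by (rule measurable_restrict) (rule X_measurable)
  then show ?thesis
    using estimator unfolding prior_estimator_def by (intro measurable_prob_algebraD) (auto intro: measurable_compose)
qed

lemma plug_measurable: "i \<in> I \<Longrightarrow> (\<lambda>\<omega>. post (ph \<omega>) (\<sigma> i) 1 (X i \<omega>)) \<in> borel_measurable P"
proof -
  assume i: "i \<in> I"
  note [measurable] = X_measurable[OF i] ph_measurable
  have m: "(\<lambda>\<omega>. mom (ph \<omega>) (\<sigma> i) j (X i \<omega>)) \<in> borel_measurable P" for j
  proof -
    let ?f = "\<lambda>\<omega> t. t ^ j * gpdf (\<sigma> i) (X i \<omega> - t)"
    have "mom (ph \<omega>) (\<sigma> i) j (X i \<omega>) = enn2real (\<integral>\<^sup>+t. ennreal (?f \<omega> t) \<partial>ph \<omega>) - enn2real (\<integral>\<^sup>+t. ennreal (- ?f \<omega> t) \<partial>ph \<omega>)" for \<omega>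
      unfolding mom_def by (rule real_lebesgue_integral_def[OF mixture.mom_integrable[OF mix[OF i ph_prior]]])
    moreover have "(\<lambda>\<omega>. \<integral>\<^sup>+t. ennreal (?f \<omega> t) \<partial>ph \<omega>) \<in> borel_measurable P"
      by (rule nn_integral_measurable_subprob_algebra2[OF _ ph_measurable]) measurable
    moreover have "(\<lambda>\<omega>. \<integral>\<^sup>+t. ennreal (- ?f \<omega> t) \<partial>ph \<omega>) \<in> borel_measurable P"
      by (rule nn_integral_measurable_subprob_algebra2[OF _ ph_measurable]) measurable
    ultimately show ?thesis by simp
  qed
  show "(\<lambda>\<omega>. post (ph \<omega>) (\<sigma> i) 1 (X i \<omega>)) \<in> borel_measurable P"
    unfolding post_def using m by measurable
qed

lemma theta_AE: "i \<in> I \<Longrightarrow> AE \<omega> in P. \<bar>\<theta> i \<omega>\<bar> \<le> M"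
proof -
  assume i: "i \<in> I"
  interpret U: noisy_prior P "\<theta> i" "\<epsilon> i" "J i" "\<sigma> i" s M K pi_star k by (rule unit[OF i])
  show ?thesis by (rule U.theta_bounded)
qed

text \<open>The plug-in error is split at the posterior mean under the true prior. Averages over units and
  expectations are handled together by the weighted inequality for squares, and the weight is optimised at
  the end.\<close>

theorem regret_bound:
  "regret P pi_star n \<sigma> \<theta> (sample n J \<theta> \<epsilon>) pihat \<le> sqrt (cRisk\<^sup>2 * V / real n) + sqrt (plug_const / real n)"
proof -
  define r where "r i = (\<integral>\<omega>. (\<theta> i \<omega> - post (ph \<omega>) (\<sigma> i) 1 (X i \<omega>))\<^sup>2 \<partial>P)" for i
  define orc where "orc i = (\<integral>\<omega>. (\<theta> i \<omega> - post pi_star (\<sigma> i) 1 (X i \<omega>))\<^sup>2 \<partial>P)" for i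
  have int: "integrable P (\<lambda>\<omega>. (\<theta> i \<omega> - post (ph \<omega>) (\<sigma> i) 1 (X i \<omega>))\<^sup>2)"
    "integrable P (\<lambda>\<omega>. (\<theta> i \<omega> - post pi_star (\<sigma> i) 1 (X i \<omega>))\<^sup>2)"
    "integrable P (\<lambda>\<omega>. gap i (ph \<omega>) (X i \<omega>))" if i: "i \<in> I" for i
  proof -
    note [measurable] = X_measurable[OF i] plug_measurable[OF i] post_meas[OF i prior] theta_measurable[OF i]
    have b: "AE \<omega> in P. (\<theta> i \<omega> - post (ph \<omega>) (\<sigma> i) 1 (X i \<omega>))\<^sup>2 \<le> 4 * M\<^sup>2"
      "AE \<omega> in P. (\<theta> i \<omega> - post pi_star (\<sigma> i) 1 (X i \<omega>))\<^sup>2 \<le> 4 * M\<^sup>2"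
      using theta_AE[OF i] by (eventually_elim, intro square_diff_le post_le[OF i ph_prior] post_le[OF i prior], simp)+
    have "(\<lambda>\<omega>. (\<theta> i \<omega> - post (ph \<omega>) (\<sigma> i) 1 (X i \<omega>))\<^sup>2) \<in> borel_measurable P" by measurable
    then show "integrable P (\<lambda>\<omega>. (\<theta> i \<omega> - post (ph \<omega>) (\<sigma> i) 1 (X i \<omega>))\<^sup>2)"
      by (intro integrable_const_bound[of _ "4 * M\<^sup>2"]) (use b in auto)
    have "(\<lambda>\<omega>. (\<theta> i \<omega> - post pi_star (\<sigma> i) 1 (X i \<omega>))\<^sup>2) \<in> borel_measurable P" by measurable
    then show "integrable P (\<lambda>\<omega>. (\<theta> i \<omega> - post pi_star (\<sigma> i) 1 (X i \<omega>))\<^sup>2)"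
      by (intro integrable_const_bound[of _ "4 * M\<^sup>2"]) (use b in auto)
    have "(\<lambda>\<omega>. gap i (ph \<omega>) (X i \<omega>)) \<in> borel_measurable P" by measurable
    then show "integrable P (\<lambda>\<omega>. gap i (ph \<omega>) (X i \<omega>))"
      by (intro integrable_const_bound[of _ "4 * M\<^sup>2"]) (use gap_bounds[OF i ph_prior] in auto)
  qed
  define a where "a = 1 / real n * (\<Sum>i\<in>I. (sqrt (bayes_risk pi_star (\<sigma> i)) + cRisk / sqrt (real (J i)))\<^sup>2)"
  have oa: "1 / real n * (\<Sum>i\<in>I. orc i) \<le> a"
    unfolding a_def
  proof (intro mult_left_mono sum_mono)
    fix i assume i: "i \<in> I"
    interpret U: noisy_prior P "\<theta> i" "\<epsilon> i" "J i" "\<sigma> i" s M K pi_star k by (rule unit[OF i])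
    show "orc i \<le> (sqrt (bayes_risk pi_star (\<sigma> i)) + cRisk / sqrt (real (J i)))\<^sup>2"
      unfolding orc_def X_partial[OF i] cRisk_def
      by (rule U.oracle_risk[OF C_nonneg B_ge post_smooth[OF sigma_facts(1)[OF i]]])
  qed simp
  have a0: "0 \<le> a" unfolding a_def by (intro mult_nonneg_nonneg sum_nonneg) auto
  have "0 \<le> (\<integral>\<omega>. plug_bound \<omega> \<partial>P)" using plug_bound_nonneg by simp
  then have pc0: "0 \<le> plug_const" using plug_bound_integral(2) by linarith
  have weighted: "1 / real n * (\<Sum>i\<in>I. r i) \<le> (1 + t) * a + (1 + 1 / t) * (plug_const / real n)" if t: "0 < t" for t
  proof -
    have yg: "(x + y)\<^sup>2 \<le> (1 + t) * x\<^sup>2 + (1 + 1 / t) * y\<^sup>2" for x y :: real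
    proof -
      have "0 \<le> (t * x - y)\<^sup>2 / t" using t by simp
      also have "... = t * x\<^sup>2 - 2 * x * y + y\<^sup>2 / t" using t by (simp add: power2_diff field_simps power2_eq_square)
      finally show ?thesis by (simp add: power2_sum algebra_simps)
    qed
    have ri: "r i \<le> (1 + t) * orc i + (1 + 1 / t) * (\<integral>\<omega>. gap i (ph \<omega>) (X i \<omega>) \<partial>P)" if i: "i \<in> I" for i
    proof -
      have "r i \<le> (\<integral>\<omega>. (1 + t) * (\<theta> i \<omega> - post pi_star (\<sigma> i) 1 (X i \<omega>))\<^sup>2 + (1 + 1 / t) * gap i (ph \<omega>) (X i \<omega>) \<partial>P)"
        unfolding r_def
      proof (rule integral_mono)
        fix \<omega>
        have "(\<theta> i \<omega> - post (ph \<omega>) (\<sigma> i) 1 (X i \<omega>))\<^sup>2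
          = ((\<theta> i \<omega> - post pi_star (\<sigma> i) 1 (X i \<omega>)) + (post pi_star (\<sigma> i) 1 (X i \<omega>) - post (ph \<omega>) (\<sigma> i) 1 (X i \<omega>)))\<^sup>2" by simp
        also have "... \<le> (1 + t) * (\<theta> i \<omega> - post pi_star (\<sigma> i) 1 (X i \<omega>))\<^sup>2 + (1 + 1 / t) * (post pi_star (\<sigma> i) 1 (X i \<omega>) - post (ph \<omega>) (\<sigma> i) 1 (X i \<omega>))\<^sup>2"
          by (rule yg)
        finally show "(\<theta> i \<omega> - post (ph \<omega>) (\<sigma> i) 1 (X i \<omega>))\<^sup>2 \<le> (1 + t) * (\<theta> i \<omega> - post pi_star (\<sigma> i) 1 (X i \<omega>))\<^sup>2 + (1 + 1 / t) * gap i (ph \<omega>) (X i \<omega>)"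
          by (simp add: power2_commute)
      qed (use int[OF i] in auto)
      also have "... = (1 + t) * orc i + (1 + 1 / t) * (\<integral>\<omega>. gap i (ph \<omega>) (X i \<omega>) \<partial>P)"
        unfolding orc_def using int[OF i] by simp
      finally show ?thesis .
    qed
    have gsum: "(\<Sum>i\<in>I. \<integral>\<omega>. gap i (ph \<omega>) (X i \<omega>) \<partial>P) \<le> plug_const"
    proof -
      have "(\<Sum>i\<in>I. \<integral>\<omega>. gap i (ph \<omega>) (X i \<omega>) \<partial>P) = (\<integral>\<omega>. (\<Sum>i\<in>I. gap i (ph \<omega>) (X i \<omega>)) \<partial>P)"
        using int(3) by (rule Bochner_Integration.integral_sum[symmetric])
      also have "... \<le> (\<integral>\<omega>. plug_bound \<omega> \<partial>P)"
        by (rule integral_mono_AE'[OF plug_bound_integral(1) sum_plug_le]) (use plug_bound_nonneg in auto)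
      finally show ?thesis using plug_bound_integral(2) by simp
    qed
    have "(\<Sum>i\<in>I. r i) \<le> (\<Sum>i\<in>I. (1 + t) * orc i + (1 + 1 / t) * (\<integral>\<omega>. gap i (ph \<omega>) (X i \<omega>) \<partial>P))"
      by (rule sum_mono) (rule ri)
    also have "... = (1 + t) * (\<Sum>i\<in>I. orc i) + (1 + 1 / t) * (\<Sum>i\<in>I. \<integral>\<omega>. gap i (ph \<omega>) (X i \<omega>) \<partial>P)"
      by (simp add: sum.distrib sum_distrib_left)
    also have "... \<le> (1 + t) * (\<Sum>i\<in>I. orc i) + (1 + 1 / t) * plug_const"
      using t gsum by (intro add_left_mono mult_left_mono) auto
    finally have "1 / real n * (\<Sum>i\<in>I. r i) \<le> 1 / real n * ((1 + t) * (\<Sum>i\<in>I. orc i) + (1 + 1 / t) * plug_const)"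
      by (intro mult_left_mono) auto
    also have "... = (1 + t) * (1 / real n * (\<Sum>i\<in>I. orc i)) + (1 + 1 / t) * (plug_const / real n)"
      by (simp add: add_divide_distrib)
    also have "... \<le> (1 + t) * a + (1 + 1 / t) * (plug_const / real n)"
      using oa t by (intro add_right_mono mult_left_mono) auto
    finally show ?thesis .
  qed
  have "sqrt (1 / real n * (\<Sum>i\<in>I. r i)) \<le> sqrt a + sqrt (plug_const / real n)"
    by (rule sqrt_le_of_weighted[OF a0 _ weighted]) (use pc0 in simp)
  also have "sqrt a \<le> sqrt (1 / real n * (\<Sum>i\<in>I. bayes_risk pi_star (\<sigma> i))) + sqrt (cRisk\<^sup>2 * V / real n)"
  proof -
    have br: "0 \<le> bayes_risk pi_star (\<sigma> i)" if "i \<in> I" for i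
      unfolding mixture.bayes_risk_post[OF mix[OF that prior]] by (rule integral_nonneg_AE) simp
    have "sqrt (\<Sum>i\<in>I. (sqrt (bayes_risk pi_star (\<sigma> i)) + cRisk / sqrt (real (J i)))\<^sup>2)
       \<le> sqrt (\<Sum>i\<in>I. (sqrt (bayes_risk pi_star (\<sigma> i)))\<^sup>2) + sqrt (\<Sum>i\<in>I. (cRisk / sqrt (real (J i)))\<^sup>2)"
      using L2_set_triangle_ineq[of "\<lambda>i. sqrt (bayes_risk pi_star (\<sigma> i))" "\<lambda>i. cRisk / sqrt (real (J i))" I]
      by (simp add: L2_set_def)
    also have "(\<Sum>i\<in>I. (sqrt (bayes_risk pi_star (\<sigma> i)))\<^sup>2) = (\<Sum>i\<in>I. bayes_risk pi_star (\<sigma> i))"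
      by (rule sum.cong) (use br in auto)
    also have "(\<Sum>i\<in>I. (cRisk / sqrt (real (J i)))\<^sup>2) = cRisk\<^sup>2 * V"
      by (simp add: power_divide sum_distrib_left)
    finally have "sqrt (1 / real n) * sqrt (\<Sum>i\<in>I. (sqrt (bayes_risk pi_star (\<sigma> i)) + cRisk / sqrt (real (J i)))\<^sup>2)
      \<le> sqrt (1 / real n) * (sqrt (\<Sum>i\<in>I. bayes_risk pi_star (\<sigma> i)) + sqrt (cRisk\<^sup>2 * V))"
      by (intro mult_left_mono) auto
    then show ?thesis unfolding a_def by (simp add: real_sqrt_mult[symmetric] distrib_left)
  qed
  finally have "sqrt (1 / real n * (\<Sum>i\<in>I. r i)) - sqrt (1 / real n * (\<Sum>i\<in>I. bayes_risk pi_star (\<sigma> i)))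
     \<le> sqrt (cRisk\<^sup>2 * V / real n) + sqrt (plug_const / real n)" by simp
  moreover have "(\<Sum>i = 1..n. \<integral>\<omega>. \<bar>\<theta> i \<omega> - plug_in_mean (ph \<omega>) (\<sigma> i) (sample n J \<theta> \<epsilon> \<omega> i)\<bar>\<^sup>2 \<partial>P) = (\<Sum>i\<in>I. r i)"
    by (rule sum.cong) (auto simp: r_def plug_in_mean_post sample_def)
  ultimately show ?thesis unfolding regret_def by simp
qed

end

section \<open>Rates\<close>

lemma power_le_higher_power:
  fixes l :: real
  assumes "1 / 2 \<le> l" "i \<le> j"
  shows "l ^ i \<le> 2 ^ (j - i) * l ^ j"
proof -
  have "l ^ i * 1 \<le> l ^ i * (2 * l) ^ (j - i)" using assms by (intro mult_left_mono one_le_power) auto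
  also have "... = 2 ^ (j - i) * (l ^ i * l ^ (j - i))" by (simp add: power_mult_distrib)
  also have "l ^ i * l ^ (j - i) = l ^ j" using assms(2) by (simp flip: power_add)
  finally show ?thesis by simp
qed

context eb_bounds
begin

definition "rate_hel = (32 * cClose + 16 * q + 96 + 16 * cN + 16 * cTail) + 64 * cHel"
definition "rate_regret = 2 * (256 * cRisk\<^sup>2 + (256 * (1 + M)\<^sup>2 + 8 * cP * (4 * q + 32 + 4 * cN) + 8 * M\<^sup>2 * (32 * cN + 128) + 512 * M\<^sup>2 * cTail)
   + (128 * cP * cHel + 512 * cDiff))"

lemma combine_rate:
  assumes "0 \<le> a" "0 \<le> b" "0 \<le> W"
  shows "1 / real n * (a * W + b * (V * W)) \<le> (a + b) * (W * (1 / real n + 1 / real n * V))"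
proof -
  have "a * W + b * (V * W) \<le> (a + b) * (W * (1 + V))"
  proof -
    have "0 \<le> a * (V * W)" "0 \<le> b * W" using assms V_nonneg by (auto intro!: mult_nonneg_nonneg)
    then show ?thesis by (simp add: algebra_simps)
  qed
  then have "1 / real n * (a * W + b * (V * W)) \<le> 1 / real n * ((a + b) * (W * (1 + V)))" by (rule mult_left_mono) simp
  also have "... = (a + b) * (W * (1 / real n + 1 / real n * V))" by (simp add: algebra_simps add_divide_distrib)
  finally show ?thesis .
qed

theorem hellinger_rate:
  "(\<integral>\<omega>. 1 / real n * (\<Sum>i\<in>I. H i (ph \<omega>)) \<partial>P) \<le> rate_hel * (l ^ 4 * (1 / real n + 1 / real n * V))"
proof -
  define W where "W = l ^ 4"
  have W: "1 \<le> 16 * W" "l \<le> 8 * W" "l\<^sup>2 \<le> 4 * W" "0 \<le> W"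
    using power_le_higher_power[OF l_ge, of 0 4] power_le_higher_power[OF l_ge, of 1 4] power_le_higher_power[OF l_ge, of 2 4] l_ge by (auto simp: W_def)
  have b: "2 * cClose * 1 \<le> 2 * cClose * (16 * W)" "q * l \<le> q * (8 * W)" "cHel * V * 1 \<le> cHel * V * (16 * W)"
    "cN * l\<^sup>2 \<le> cN * (4 * W)" "cTail * 1 \<le> cTail * (16 * W)"
    using W consts_nonneg q_nonneg cN_nonneg V_nonneg by (intro mult_left_mono; (intro mult_nonneg_nonneg)?; simp)+
  have "(\<integral>\<omega>. 1 / real n * (\<Sum>i\<in>I. H i (ph \<omega>)) \<partial>P) \<le> 1 / real n * (2 * cClose + 2 * (q * l + 1 + 2 * cHel * V + 2 * (cN * l\<^sup>2 + 1)) + cTail)"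
    by (rule hellinger_risk)
  also have "... \<le> 1 / real n * ((32 * cClose + 16 * q + 96 + 16 * cN + 16 * cTail) * W + 64 * cHel * (V * W))"
  proof (rule mult_left_mono)
    have r: "2 * c + 2 * (x1 + 1 + 2 * h + 2 * (x2 + 1)) + t \<le> c' + 2 * x1' + 96 * W + 4 * h' + 4 * x2' + t'"
      if "2 * c \<le> c'" "x1 \<le> x1'" "h \<le> h'" "x2 \<le> x2'" "t \<le> t'" for c c' x1 x1' h h' x2 x2' t t' :: real
      using that W(1) by argo
    have "2 * cClose + 2 * (q * l + 1 + 2 * (cHel * V) + 2 * (cN * l\<^sup>2 + 1)) + cTail
      \<le> 2 * cClose * (16 * W) + 2 * (q * (8 * W)) + 96 * W + 4 * (cHel * V * (16 * W)) + 4 * (cN * (4 * W)) + cTail * (16 * W)"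
      by (rule r) (use b in simp_all)
    then show "2 * cClose + 2 * (q * l + 1 + 2 * cHel * V + 2 * (cN * l\<^sup>2 + 1)) + cTail
      \<le> (32 * cClose + 16 * q + 96 + 16 * cN + 16 * cTail) * W + 64 * cHel * (V * W)"
      by (simp add: algebra_simps)
  qed simp
  also have "... \<le> rate_hel * (W * (1 / real n + 1 / real n * V))"
    unfolding rate_hel_def using W(4) consts_nonneg q_nonneg cN_nonneg
    by (intro combine_rate add_nonneg_nonneg mult_nonneg_nonneg) auto
  finally show ?thesis by (simp add: W_def)
qed

lemma plug_const_le:
  "plug_const \<le> (256 * (1 + M)\<^sup>2 + 8 * cP * (4 * q + 32 + 4 * cN) + 8 * M\<^sup>2 * (32 * cN + 128) + 512 * M\<^sup>2 * cTail) * l ^ 7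
     + (128 * cP * cHel + 512 * cDiff) * (V * l ^ 7)"
proof -
  define W where "W = l ^ 7"
  have W: "1 \<le> 128 * W" "l\<^sup>2 \<le> 32 * W" "l ^ 4 \<le> 8 * W" "l ^ 5 \<le> 4 * W" "l ^ 6 \<le> 2 * W" "0 \<le> W"
    using power_le_higher_power[OF l_ge, of 0 7] power_le_higher_power[OF l_ge, of 2 7] power_le_higher_power[OF l_ge, of 4 7]
      power_le_higher_power[OF l_ge, of 5 7] power_le_higher_power[OF l_ge, of 6 7] l_ge by (auto simp: W_def)
  have pw: "l ^ 4 * l = l ^ 5" "l ^ 4 * l\<^sup>2 = l ^ 6" by (simp_all flip: power_Suc2 power_add)
  have "plug_const = 2 * (1 + M)\<^sup>2 * 1 + (8 * cP * q) * (l ^ 4 * l) + (32 * cP) * l ^ 4 + (16 * cP * cHel * V) * l ^ 4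
      + (16 * cP * cN) * (l ^ 4 * l\<^sup>2) + (4 * cDiff * V) * 1 + (8 * M\<^sup>2 * cN) * l\<^sup>2 + (8 * M\<^sup>2) * 1 + (4 * M\<^sup>2 * cTail) * 1"
    unfolding plug_const_def by (simp add: algebra_simps)
  also have "... \<le> 2 * (1 + M)\<^sup>2 * (128 * W) + (8 * cP * q) * (4 * W) + (32 * cP) * (8 * W) + (16 * cP * cHel * V) * (8 * W)
      + (16 * cP * cN) * (2 * W) + (4 * cDiff * V) * (128 * W) + (8 * M\<^sup>2 * cN) * (32 * W) + (8 * M\<^sup>2) * (128 * W) + (4 * M\<^sup>2 * cTail) * (128 * W)"
    unfolding pw using W consts_nonneg q_nonneg cN_nonneg cP_nonneg V_nonneg
    by (intro add_mono mult_left_mono mult_nonneg_nonneg) auto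
  also have "... = (256 * (1 + M)\<^sup>2 + 8 * cP * (4 * q + 32 + 4 * cN) + 8 * M\<^sup>2 * (32 * cN + 128) + 512 * M\<^sup>2 * cTail) * W
     + (128 * cP * cHel + 512 * cDiff) * (V * W)"
    by (simp add: algebra_simps)
  finally show ?thesis by (simp add: W_def)
qed

theorem regret_rate:
  "(max (regret P pi_star n \<sigma> \<theta> (sample n J \<theta> \<epsilon>) pihat) 0)\<^sup>2 \<le> rate_regret * (l ^ 7 * (1 / real n + 1 / real n * V))"
proof -
  define W a b where "W = l ^ 7"
    and "a = 256 * (1 + M)\<^sup>2 + 8 * cP * (4 * q + 32 + 4 * cN) + 8 * M\<^sup>2 * (32 * cN + 128) + 512 * M\<^sup>2 * cTail"
    and "b = 128 * cP * cHel + 512 * cDiff"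
  have W: "1 \<le> 128 * W" "0 \<le> W"
    using power_le_higher_power[OF l_ge, of 0 7] l_ge by (auto simp: W_def)
  have ab: "0 \<le> a" "0 \<le> b" unfolding a_def b_def using consts_nonneg q_nonneg cN_nonneg cP_nonneg
    by (intro add_nonneg_nonneg mult_nonneg_nonneg; simp)+
  define x y where "x = cRisk\<^sup>2 * V / real n" and "y = plug_const / real n"
  have x0: "0 \<le> x" using V_nonneg by (simp add: x_def)
  have "0 \<le> (\<integral>\<omega>. plug_bound \<omega> \<partial>P)" using plug_bound_nonneg by simp
  then have "0 \<le> plug_const" using plug_bound_integral(2) by linarith
  then have y0: "0 \<le> y" by (simp add: y_def)
  have "max (regret P pi_star n \<sigma> \<theta> (sample n J \<theta> \<epsilon>) pihat) 0 \<le> sqrt x + sqrt y"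
    using regret_bound x0 y0 by (simp add: x_def y_def)
  then have "(max (regret P pi_star n \<sigma> \<theta> (sample n J \<theta> \<epsilon>) pihat) 0)\<^sup>2 \<le> (sqrt x + sqrt y)\<^sup>2" by (rule power_mono) simp
  also have "... \<le> 2 * (sqrt x)\<^sup>2 + 2 * (sqrt y)\<^sup>2" by (rule square_add_le)
  also have "... = 1 / real n * (2 * (cRisk\<^sup>2 * V) + 2 * plug_const)" using x0 y0 by (simp add: x_def y_def add_divide_distrib)
  also have "... \<le> 1 / real n * ((2 * a) * W + (256 * cRisk\<^sup>2 + 2 * b) * (V * W))"
  proof (rule mult_left_mono)
    have "cRisk\<^sup>2 * V * 1 \<le> cRisk\<^sup>2 * V * (128 * W)" using W V_nonneg by (intro mult_left_mono) auto
    moreover have "plug_const \<le> a * W + b * (V * W)" using plug_const_le by (simp add: a_def b_def W_def)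
    ultimately show "2 * (cRisk\<^sup>2 * V) + 2 * plug_const \<le> (2 * a) * W + (256 * cRisk\<^sup>2 + 2 * b) * (V * W)"
      by (simp add: algebra_simps)
  qed simp
  also have "... \<le> (2 * a + (256 * cRisk\<^sup>2 + 2 * b)) * (W * (1 / real n + 1 / real n * V))"
    using ab W by (intro combine_rate) auto
  also have "... \<le> rate_regret * (W * (1 / real n + 1 / real n * V))"
  proof (rule mult_right_mono)
    show "2 * a + (256 * cRisk\<^sup>2 + 2 * b) \<le> rate_regret"
      unfolding rate_regret_def a_def[symmetric] b_def[symmetric] by simp
    show "0 \<le> W * (1 / real n + 1 / real n * V)" using W V_nonneg by (intro mult_nonneg_nonneg add_nonneg_nonneg) auto
  qed
  finally show ?thesis by (simp add: W_def)
qed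

end

lemma smoothness_constants:
  assumes M: "0 < M" and k: "0 < k"
  obtains B where "1 \<le> B"
    "\<And>\<rho> \<pi> \<tau>. \<rho> \<in> priors M \<Longrightarrow> \<pi> \<in> priors M \<Longrightarrow> k < \<tau> \<Longrightarrow>
      smooth8 (M / k\<^sup>2) B (\<lambda>x. root_ratio \<rho> \<pi> \<tau> x + (- 1))"
    "\<And>\<rho> \<pi> \<tau>. \<rho> \<in> priors M \<Longrightarrow> \<pi> \<in> priors M \<Longrightarrow> k < \<tau> \<Longrightarrow>
      smooth8 (M / k\<^sup>2) B (\<lambda>x. (post \<rho> \<tau> 1 x - post \<pi> \<tau> 1 x)\<^sup>2)"
    "\<And>\<pi> \<tau>. \<pi> \<in> priors M \<Longrightarrow> k < \<tau> \<Longrightarrow> smooth8 (M / k\<^sup>2) B (post \<pi> \<tau> 1)"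
    "\<And>\<pi> \<tau>. \<pi> \<in> priors M \<Longrightarrow> k < \<tau> \<Longrightarrow> smooth8 (M / k\<^sup>2) B (\<lambda>x. (post \<pi> \<tau> 1 x)\<^sup>2)"
proof -
  obtain G where G: "0 \<le> G" "\<And>\<rho> \<pi> \<tau>. \<rho> \<in> priors M \<Longrightarrow> \<pi> \<in> priors M \<Longrightarrow> k < \<tau> \<Longrightarrow>
      smooth8 (M / k\<^sup>2) G (root_ratio \<rho> \<pi> \<tau>)"
    using root_ratio_deriv_bounded[OF M k, of 8] by blast
  obtain D where D: "0 \<le> D" "\<And>\<pi> \<tau>. \<pi> \<in> priors M \<Longrightarrow> k < \<tau> \<Longrightarrow> deriv_bounded 8 (\<lambda>_. 1) D (post \<pi> \<tau> 1)"
    using post_deriv_bounded[OF M k, of 8 1] by blast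
  define E where "E = D + \<bar>- 1\<bar> * D"
  define B where "B = G + 1 + D + 2 ^ 8 * (D * D) + 2 ^ 8 * (E * E)"
  have E: "0 \<le> E" using D by (simp add: E_def)
  have DD: "0 \<le> 2 ^ 8 * (D * D)" "0 \<le> 2 ^ 8 * (E * E)" by auto
  have B: "1 \<le> B" "G + 1 \<le> B" "D \<le> B" "2 ^ 8 * (D * D) \<le> B" "2 ^ 8 * (E * E) \<le> B"
    unfolding B_def using G(1) D(1) DD by linarith+
  have weight: "smooth8 (M / k\<^sup>2) B f" if "deriv_bounded 8 (\<lambda>_. 1) b f" "b \<le> B" for b f
  proof (rule deriv_bounded_mono[OF that(1)])
    fix x :: real
    have "b * 1 \<le> B * 1" using that(2) by simp
    also have "... \<le> B * cosh (M / k\<^sup>2 * x)" using B(1) by (intro mult_left_mono) (auto simp: cosh_real_ge_1)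
    finally show "b * 1 \<le> B * cosh (M / k\<^sup>2 * x)" .
  qed
  show ?thesis
  proof (rule that[OF B(1)])
    fix \<rho> \<pi> \<tau> assume p: "\<rho> \<in> priors M" "\<pi> \<in> priors M" "k < \<tau>"
    have "smooth8 (M / k\<^sup>2) 1 (\<lambda>_. - 1)"
      by (rule deriv_bounded_mono[OF deriv_bounded_const[of "- 1" 1]]) (auto simp: cosh_real_ge_1)
    from deriv_bounded_add[OF G(2)[OF p] this]
    show "smooth8 (M / k\<^sup>2) B (\<lambda>x. root_ratio \<rho> \<pi> \<tau> x + (- 1))"
      by (rule deriv_bounded_mono) (use B(2) in \<open>auto intro!: mult_right_mono\<close>)
    have d: "deriv_bounded 8 (\<lambda>_. 1) E (\<lambda>x. post \<rho> \<tau> 1 x + (- 1) * post \<pi> \<tau> 1 x)"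
      unfolding E_def by (intro deriv_bounded_add deriv_bounded_cmult D(2) p)
    from weight[OF deriv_bounded_mult[OF d d _ E E] B(5)]
    show "smooth8 (M / k\<^sup>2) B (\<lambda>x. (post \<rho> \<tau> 1 x - post \<pi> \<tau> 1 x)\<^sup>2)"
      by (simp add: power2_eq_square)
  next
    fix \<pi> \<tau> assume p: "\<pi> \<in> priors M" "k < \<tau>"
    show "smooth8 (M / k\<^sup>2) B (post \<pi> \<tau> 1)" by (rule weight[OF D(2)[OF p] B(3)])
    from weight[OF deriv_bounded_mult[OF D(2)[OF p] D(2)[OF p] _ D(1) D(1)] B(4)]
    show "smooth8 (M / k\<^sup>2) B (\<lambda>x. (post \<pi> \<tau> 1 x)\<^sup>2)"
      by (simp add: power2_eq_square)
  qed
qed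

theorem theorem4p1:
  fixes M k K s q :: real and pi_star :: "real measure"
  assumes "0 < M" and "pi_star \<in> prob_measures_on M"
    and "0 < k" and "k < K" and "0 < s" and "0 \<le> q"
  shows "\<exists>C. \<forall>(P :: 'a measure) (n :: nat) (\<sigma> :: nat \<Rightarrow> real) (J :: nat \<Rightarrow> nat)
            (\<theta> :: nat \<Rightarrow> 'a \<Rightarrow> real) (\<epsilon> :: nat \<Rightarrow> nat \<Rightarrow> 'a \<Rightarrow> real)
            (pihat :: (nat \<Rightarrow> real) \<Rightarrow> real measure).
           2 \<le> n \<longrightarrow>
           eb_model P M k K s pi_star n \<sigma> J \<theta> \<epsilon> \<longrightarrow>
           prior_estimator M n pihat \<longrightarrow>
           approx_npmle P q pi_star n \<sigma> (sample n J \<theta> \<epsilon>) pihat \<longrightarrow>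
             (\<integral>\<omega>. 1 / real n * (\<Sum>i = 1..n.
                  hellinger_sq (gauss_mixture (pihat (sample n J \<theta> \<epsilon> \<omega>)) (\<sigma> i))
                               (gauss_mixture pi_star (\<sigma> i))) \<partial>P)
               \<le> C * ((ln (real n)) ^ 4 * (1 / real n + 1 / real n * (\<Sum>i = 1..n. 1 / real (J i))))
             \<and> (max (regret P pi_star n \<sigma> \<theta> (sample n J \<theta> \<epsilon>) pihat) 0)\<^sup>2
               \<le> C * ((ln (real n)) ^ 7 * (1 / real n + 1 / real n * (\<Sum>i = 1..n. 1 / real (J i))))"
proof -
  note M = \<open>0 < M\<close> and k = \<open>0 < k\<close>
  have K: "0 < K" using \<open>0 < k\<close> \<open>k < K\<close> by linarith
  obtain B where B: "1 \<le> B"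
    "\<And>\<rho> \<pi> \<tau>. \<rho> \<in> priors M \<Longrightarrow> \<pi> \<in> priors M \<Longrightarrow> k < \<tau> \<Longrightarrow>
      smooth8 (M / k\<^sup>2) B (\<lambda>x. root_ratio \<rho> \<pi> \<tau> x + (- 1))"
    "\<And>\<rho> \<pi> \<tau>. \<rho> \<in> priors M \<Longrightarrow> \<pi> \<in> priors M \<Longrightarrow> k < \<tau> \<Longrightarrow>
      smooth8 (M / k\<^sup>2) B (\<lambda>x. (post \<rho> \<tau> 1 x - post \<pi> \<tau> 1 x)\<^sup>2)"
    "\<And>\<pi> \<tau>. \<pi> \<in> priors M \<Longrightarrow> k < \<tau> \<Longrightarrow> smooth8 (M / k\<^sup>2) B (post \<pi> \<tau> 1)"
    "\<And>\<pi> \<tau>. \<pi> \<in> priors M \<Longrightarrow> k < \<tau> \<Longrightarrow> smooth8 (M / k\<^sup>2) B (\<lambda>x. (post \<pi> \<tau> 1 x)\<^sup>2)"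
    using smoothness_constants[OF M k] by blast
  obtain cN where cN: "0 \<le> cN" "\<And>n::nat. 2 \<le> n \<Longrightarrow> \<exists>N. finite N \<and> N \<subseteq> priors M \<and> ln (real (card N)) \<le> cN * (ln (real n))\<^sup>2 \<and>
    (\<forall>\<pi>\<in>priors M. \<exists>\<rho>\<in>N. \<forall>\<sigma> x i. k < \<sigma> \<longrightarrow> \<bar>x\<bar> \<le> 2 * ln (real n) \<longrightarrow> i \<le> 1 \<longrightarrow>
       \<bar>mom \<pi> \<sigma> i x - mom \<rho> \<sigma> i x\<bar> \<le> mom \<rho> \<sigma> 0 x / real n)"
    using mixture_net[OF M k, of 2] by auto
  obtain cP where cP: "0 \<le> cP" "\<And>(n::nat) \<pi> \<rho> \<sigma>. 2 \<le> n \<Longrightarrow> \<pi> \<in> priors M \<Longrightarrow> \<rho> \<in> priors M \<Longrightarrow> 0 < \<sigma> \<Longrightarrow> \<sigma> \<le> K \<Longrightarrow>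
     (\<integral>x. (post \<pi> \<sigma> 1 x - post \<rho> \<sigma> 1 x)\<^sup>2 * mom \<rho> \<sigma> 0 x \<partial>lborel)
       \<le> cP * (ln (real n)) ^ 4 * (hel_sq \<sigma> \<pi> \<rho> + 1 / real n)"
    using post_diff_hellinger[OF M K] by blast
  define c1 c2 where "c1 = eb_bounds.rate_hel M k K s q (M / k\<^sup>2) B cN"
    and "c2 = eb_bounds.rate_regret M k K s q (M / k\<^sup>2) B cN cP"
  show ?thesis
  proof (intro exI[of _ "max c1 c2"] allI impI)
    fix P :: "'a measure" and n \<sigma> J \<theta> \<epsilon> pihat
    assume n: "2 \<le> n" and model: "eb_model P M k K s pi_star n \<sigma> J \<theta> \<epsilon>"
      and est: "prior_estimator M n pihat" and lik: "approx_npmle P q pi_star n \<sigma> (sample n J \<theta> \<epsilon>) pihat"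
    obtain N where N: "finite N" "N \<subseteq> priors M" "ln (real (card N)) \<le> cN * (ln (real n))\<^sup>2"
      "\<And>\<pi>. \<pi> \<in> priors M \<Longrightarrow> \<exists>\<rho>\<in>N. \<forall>\<sigma> x i. k < \<sigma> \<longrightarrow> \<bar>x\<bar> \<le> 2 * ln (real n) \<longrightarrow> i \<le> 1 \<longrightarrow>
         \<bar>mom \<pi> \<sigma> i x - mom \<rho> \<sigma> i x\<bar> \<le> mom \<rho> \<sigma> 0 x / real n"
      using cN(2)[OF n] by blast
    interpret eb_model P M k K s pi_star n \<sigma> J \<theta> \<epsilon> by (rule model)
    interpret E: eb_bounds P M k K s pi_star n \<sigma> J \<theta> \<epsilon> q "M / k\<^sup>2" B cN cP N pihat
      by unfold_locales
        (fact M k \<open>0 \<le> q\<close> n B(1) cN(1) cP(1) B(2)[OF _ assms(2)] B(3)[OF _ assms(2)] B(4,5)[OF assms(2)] N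
            cP(2)[OF n _ assms(2)] est lik | use M in simp)+
    let ?W = "1 / real n + 1 / real n * (\<Sum>i = 1..n. 1 / real (J i))"
    have W: "0 \<le> ln (real n) ^ j * ?W" for j
      using n by (intro mult_nonneg_nonneg add_nonneg_nonneg sum_nonneg) auto
    have "c1 * (ln (real n) ^ 4 * ?W) \<le> max c1 c2 * (ln (real n) ^ 4 * ?W)"
      "c2 * (ln (real n) ^ 7 * ?W) \<le> max c1 c2 * (ln (real n) ^ 7 * ?W)"
      by (intro mult_right_mono W; simp)+
    with E.hellinger_rate E.regret_rate
    show "(\<integral>\<omega>. 1 / real n * (\<Sum>i = 1..n.
                  hellinger_sq (gauss_mixture (pihat (sample n J \<theta> \<epsilon> \<omega>)) (\<sigma> i))
                               (gauss_mixture pi_star (\<sigma> i))) \<partial>P)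
               \<le> max c1 c2 * ((ln (real n)) ^ 4 * ?W)
             \<and> (max (regret P pi_star n \<sigma> \<theta> (sample n J \<theta> \<epsilon>) pihat) 0)\<^sup>2
               \<le> max c1 c2 * ((ln (real n)) ^ 7 * ?W)"
      unfolding c1_def c2_def by (intro conjI) (erule order_trans, assumption)+
  qed
qed

end
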